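(* Let $k$ be a field, let $\mathbf P=(\widetilde{\mathcal M},g,f)$ be a generic oriented matroid program on a finite set $E\sqcup\{g,f\}$, and let $U\subset k^E$ be a parameter space for $M=\underline{(\widetilde{\mathcal M}\setminus f)/g}$. There is a natural isomorphism $\widetilde A(\mathbf P^\vee)\to\widetilde B(\mathbf P)$ of graded $\operatorname{Sym}(k^E)$-algebras, and it induces an isomorphism $A(\mathbf P^\vee,U^\perp)\simeq B(\mathbf P,U)$ of graded rings.
   Context: Oriented matroids. $E$ is a finite set, $n=|E|$. For $Z:I\to\{0,+,-\}$ put $\underline Z=\{i:Z(i)\neq 0\}$, $z(Z)=I\setminus\underline Z$; $(Z\circ Z')(i)=Z(i)$ if $Z(i)\ne 0$ and $Z'(i)$ otherwise; $Z$ is a face of $Z'$ if $Z\circ Z'=Z'$. The covectors of an oriented matroid are $0$ and all compositions of signed cocircuits; topes are the covectors maximal for the face order. $\underline{\mathcal M}$ is the underlying matroid; $\mathcal M^\vee$ the dual oriented matroid (signed circuits and cocircuits exchanged). Programs. An oriented matroid program $\mathbf P=(\widetilde{\mathcal M},g,f)$ is an oriented matroid $\widetilde{\mathcal M}$ on $E\sqcup\{g,f\}$ with $g$ not a loop and $f$ not a coloop. Put $\mathcal M=(\widetilde{\mathcal M}\setminus f)/g$, $M=\underline{\mathcal M}$, $d=\operatorname{rank}M$, $\mathcal N=\widetilde{\mathcal M}\setminus f$. $\mathbf P$ is generic if (1) every cocircuit $Y$ of $\mathcal N$ with $|z(Y)|>d$ has $Y(g)=0$, and (2) every circuit $X$ of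 $\widetilde{\mathcal M}/g$ with $|z(X)|>n-d$ has $X(f)=0$. The dual program is $\mathbf P^\vee=(\widetilde{\mathcal M}^\vee,f,g)$ (roles of $f$ and $g$ exchanged); it is generic iff $\mathbf P$ is. Feasible and bounded sign vectors. A covector $Y$ of $\mathcal N$ is feasible if $Y(g)=+$. Feasible topes of $\mathcal N$ (which has no loops) are identified with their restrictions to $E$; $\mathcal F\subset\{+,-\}^E$ denotes the set of feasible topes. A sign vector $\alpha\in\{+,-\}^E$ is unbounded if there is a covector $Z$ of $\widetilde{\mathcal M}$ with $Z(g)=0$, $Z(f)=+$ and $Z(i)\in\{0,\alpha(i)\}$ for all $i\in E$; otherwise it is bounded. $\mathcal B$ is the set of bounded sign vectors, $\mathcal P=\mathcal F\cap\mathcal B$. Writing $\mathcal F^\vee,\mathcal B^\vee,\mathcal P^\vee$ for the corresponding sets for $\mathbf P^\vee$, one has $\mathcal F^\vee=\mathcal B$, $\mathcal B^\vee=\mathcal F$, $\mathcal P^\vee=\mathcal P$. Parameter spaces. Let $k^E$ have basis $\{t_i\}_{i\in E}$, so $\operatorname{Sym}(k^E)=k[t_i:i\in E]$. A subspace $U\subset k^E$ is a parameter space for $M$ if for every basis $b$ of $M$ the composition $U\hookrightarrow k^E\twoheadrightarrow\operatorname{Span}\{t_i: i\in b\}$ is an isomorphism. The algebras $\widetilde A(\mathbf P^\vee)$ and $A(\mathbf P^\vee,U^\perp)$. Two sign vectors are adjacent if they differ in exactly one coordinate; $\alpha^i$ denotes $\alpha$ with the $i$-th sign changed. Let $Q^\vee$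 be the quiver with vertex set $\mathcal F^\vee$ and an arrow in each direction between any two adjacent elements, $P(Q^\vee)$ its path algebra over $k$, $e_\alpha$ the trivial paths, $p^\vee(\alpha_1,\dots,\alpha_r)$ the path through $\alpha_1,\dots,\alpha_r$ (paths compose left to right). $\widetilde A(\mathbf P^\vee)$ is the quotient of $P(Q^\vee)\otimes_kk[t_i:i\in E]$ by the two-sided ideal generated by: $e_\alpha=0$ for $\alpha\in\mathcal F^\vee\setminus\mathcal P^\vee$; $p^\vee(\alpha,\gamma,\beta)=p^\vee(\alpha,\delta,\beta)$ for any four distinct $\alpha,\beta,\gamma,\delta\in\mathcal F^\vee$ with $\alpha,\beta$ each adjacent to both $\gamma,\delta$; $p^\vee(\alpha,\alpha^i,\alpha)=e_\alpha t_i$ whenever $\alpha,\alpha^i\in\mathcal F^\vee$. $A(\mathbf P^\vee,U^\perp)$ is the quotient of $\widetilde A(\mathbf P^\vee)$ by the relations $x=0$ for $x\in U\subset\operatorname{Sym}(k^E)$. Grading: $\deg e_\alpha=0$, arrows have degree $1$, $\deg t_i=2$. The algebras $\widetilde B(\mathbf P)$ and $B(\mathbf P,U)$. For $\alpha_1,\dots,\alpha_r\in\mathcal P$ let $\Delta_{\alpha_1\cdots\alpha_r}$ be the set of feasible covectors of $\mathcal N$ that are faces of every one of the feasible topes $\alpha_1,\dots,\alpha_r$, let $z(\Delta_{\alpha_1\cdots\alpha_r})=\{S\subset E: S\subset z(X)\text{ for some }X\in\Delta_{\alpha_1\cdots\alpha_r}\}$, and let $\widetilde R_{\alpha_1\cdots\alpha_r}=k[t_i:i\in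 E]/(t_S: S\subset E,\ S\notin z(\Delta_{\alpha_1\cdots\alpha_r}))$, where $t_S=\prod_{i\in S}t_i$ and $t_\varnothing=1$ (so the ring is zero if $\Delta_{\alpha_1\cdots\alpha_r}=\varnothing$); $\deg t_i=2$. Put $d_{\alpha\beta}=|\{i:\alpha(i)\ne\beta(i)\}|$ and $S^\beta_{\alpha\gamma}=\{i:\alpha(i)=\gamma(i)\neq\beta(i)\}$. For a graded space, $(N\langle m\rangle)_i=N_{i+m}$. As a graded vector space $\widetilde B(\mathbf P)=\bigoplus_{(\alpha,\beta)\in\mathcal P\times\mathcal P}\widetilde R_{\alpha\beta}\langle-d_{\alpha\beta}\rangle$. The product $\star$ is zero on $\widetilde R_{\alpha\beta}\otimes\widetilde R_{\delta\gamma}$ if $\beta\ne\delta$, and on $\widetilde R_{\alpha\beta}\otimes\widetilde R_{\beta\gamma}$ it is the composite of the quotient maps to $\widetilde R_{\alpha\beta\gamma}\otimes\widetilde R_{\alpha\beta\gamma}$, multiplication in $\widetilde R_{\alpha\beta\gamma}$, and the (well-defined) map $\widetilde R_{\alpha\beta\gamma}\to\widetilde R_{\alpha\gamma}$ induced by multiplication by $t_{S^\beta_{\alpha\gamma}}$. $\widetilde B(\mathbf P)$ is a $\operatorname{Sym}(k^E)$-algebra via $\operatorname{Sym}(k^E)\to\bigoplus_\alpha\operatorname{Sym}(k^E)\to\bigoplus_\alpha\widetilde R_{\alpha\alpha}\subset\widetilde B(\mathbf P)$ (diagonal followed by quotients). $B(\mathbf P,U)=\widetilde B(\mathbf P)\otimes_{\operatorname{Sym}U}k$,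 where $\operatorname{Sym}U\subset\operatorname{Sym}(k^E)$ and $U$ acts on $k$ by zero. *)

theory Defs
  imports
    "HOL-Algebra.QuotRing"
    "HOL-Algebra.Generated_Rings"
    "HOL-Algebra.Algebraic_Closure_Type"
    "HOL-Library.Poly_Mapping"
    "HOL-Library.Function_Algebras"
begin

text \<open>Otherwise \<open>X\<close> would not be available as a variable.\<close>

no_notation var ("X\<index>")

section \<open>Oriented matroids\<close>

datatype sign = Zero | Pos | Neg

fun opp :: "sign \<Rightarrow> sign" where
  "opp Zero = Zero"
| "opp Pos = Neg"
| "opp Neg = Pos"

text \<open>A sign vector on a set \<open>I\<close> is a total function that is \<^term>\<open>Zero\<close> outside \<open>I\<close>.\<close>

type_synonym 'e svec = "'e \<Rightarrow> sign"

definition svecs :: "'e set \<Rightarrow> 'e svec set" where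
  "svecs I = {X. \<forall>i. i \<notin> I \<longrightarrow> X i = Zero}"

definition zero_svec :: "'e svec" where
  "zero_svec = (\<lambda>_. Zero)"

definition neg_svec :: "'e svec \<Rightarrow> 'e svec" where
  "neg_svec X = (\<lambda>i. opp (X i))"

definition supp :: "'e svec \<Rightarrow> 'e set" where
  "supp X = {i. X i \<noteq> Zero}"

definition zeros :: "'e set \<Rightarrow> 'e svec \<Rightarrow> 'e set" where
  "zeros I X = I - supp X"

definition restr :: "'e set \<Rightarrow> 'e svec \<Rightarrow> 'e svec" where
  "restr I X = (\<lambda>i. if i \<in> I then X i else Zero)"

definition sv_comp :: "'e svec \<Rightarrow> 'e svec \<Rightarrow> 'e svec" where
  "sv_comp X Y = (\<lambda>i. if X i \<noteq> Zero then X i else Y i)"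

definition is_face :: "'e svec \<Rightarrow> 'e svec \<Rightarrow> bool" where
  "is_face X Y \<longleftrightarrow> sv_comp X Y = Y"

text \<open>On the common support \<open>X i * Y i\<close> is \<open>+\<close> if \<open>X i = Y i\<close> and \<open>-\<close> otherwise; both signs
  have to occur unless the supports are disjoint.\<close>

definition orthogonal :: "'e svec \<Rightarrow> 'e svec \<Rightarrow> bool" where
  "orthogonal X Y \<longleftrightarrow>
     supp X \<inter> supp Y = {} \<or>
     (\<exists>i \<in> supp X \<inter> supp Y. X i = Y i) \<and> (\<exists>i \<in> supp X \<inter> supp Y. X i \<noteq> Y i)"

record 'e om =
  ground :: "'e set"
  circuits :: "'e svec set"

definition oriented_matroid :: "'e om \<Rightarrow> bool" where
  "oriented_matroid M \<longleftrightarrow>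
     finite (ground M) \<and>
     circuits M \<subseteq> svecs (ground M) \<and>
     zero_svec \<notin> circuits M \<and>
     (\<forall>X \<in> circuits M. neg_svec X \<in> circuits M) \<and>
     (\<forall>X \<in> circuits M. \<forall>Y \<in> circuits M. supp X \<subseteq> supp Y \<longrightarrow> X = Y \<or> X = neg_svec Y) \<and>
     (\<forall>X \<in> circuits M. \<forall>Y \<in> circuits M. \<forall>e. X \<noteq> neg_svec Y \<and> X e = Pos \<and> Y e = Neg \<longrightarrow>
        (\<exists>Z \<in> circuits M.
           {i. Z i = Pos} \<subseteq> ({i. X i = Pos} \<union> {i. Y i = Pos}) - {e} \<and>
           {i. Z i = Neg} \<subseteq> ({i. X i = Neg} \<union> {i. Y i = Neg}) - {e}))"

subsection \<open>The underlying matroid\<close>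

definition indep :: "'e om \<Rightarrow> 'e set \<Rightarrow> bool" where
  "indep M S \<longleftrightarrow> S \<subseteq> ground M \<and> \<not> (\<exists>X \<in> circuits M. supp X \<subseteq> S)"

definition basis :: "'e om \<Rightarrow> 'e set \<Rightarrow> bool" where
  "basis M b \<longleftrightarrow> indep M b \<and> (\<forall>S. indep M S \<and> b \<subseteq> S \<longrightarrow> S = b)"

definition rank :: "'e om \<Rightarrow> nat" where
  "rank M = Max (card ` {S. indep M S})"

text \<open>The circuits of the dual matroid, whose bases are the complements of the bases: a set is
  dependent in the dual iff it meets every basis.\<close>

definition matroid_cocircuit :: "'e om \<Rightarrow> 'e set \<Rightarrow> bool" where
  "matroid_cocircuit M D \<longleftrightarrow>
     D \<subseteq> ground M \<and> (\<forall>b. basis M b \<longrightarrow> D \<inter> b \<noteq> {}) \<and>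
     (\<forall>D'. D' \<subset> D \<longrightarrow> (\<exists>b. basis M b \<and> D' \<inter> b = {}))"

subsection \<open>Duality, minors, covectors, topes\<close>

text \<open>The signed cocircuits form the unique signature of the cocircuits of the underlying matroid
  that is orthogonal to the signed circuits.\<close>

definition cocircuits :: "'e om \<Rightarrow> 'e svec set" where
  "cocircuits M = {Y. matroid_cocircuit M (supp Y) \<and> (\<forall>X \<in> circuits M. orthogonal X Y)}"

definition dual :: "'e om \<Rightarrow> 'e om" where
  "dual M = \<lparr>ground = ground M, circuits = cocircuits M\<rparr>"

definition is_loop :: "'e om \<Rightarrow> 'e \<Rightarrow> bool" where
  "is_loop M e \<longleftrightarrow> (\<exists>X \<in> circuits M. supp X = {e})"

definition is_coloop :: "'e om \<Rightarrow> 'e \<Rightarrow> bool" where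
  "is_coloop M e \<longleftrightarrow> is_loop (dual M) e"

definition deletion :: "'e om \<Rightarrow> 'e \<Rightarrow> 'e om" where
  "deletion M e = \<lparr>ground = ground M - {e}, circuits = {X \<in> circuits M. X e = Zero}\<rparr>"

text \<open>The circuits of a contraction are the nonzero restrictions of circuits with minimal
  support.\<close>

definition contraction :: "'e om \<Rightarrow> 'e \<Rightarrow> 'e om" where
  "contraction M e =
     (let R = restr (ground M - {e}) ` circuits M - {zero_svec}
      in \<lparr>ground = ground M - {e}, circuits = {X \<in> R. \<forall>Y \<in> R. \<not> supp Y \<subset> supp X}\<rparr>)"

inductive_set covectors :: "'e om \<Rightarrow> 'e svec set" for M where
  zero: "zero_svec \<in> covectors M"
| comp: "Y \<in> cocircuits M \<Longrightarrow> Z \<in> covectors M \<Longrightarrow> sv_comp Y Z \<in> covectors M"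

definition topes :: "'e om \<Rightarrow> 'e svec set" where
  "topes M = {T \<in> covectors M. \<forall>Z \<in> covectors M. is_face T Z \<longrightarrow> Z = T}"

section \<open>Oriented matroid programs\<close>

text \<open>The set \<open>E\<close> of the program \<open>(M, g, f)\<close> is recovered as \<open>ground M - {g, f}\<close>.\<close>

record 'e program =
  mat :: "'e om"
  gelt :: 'e
  felt :: 'e

definition program :: "'e program \<Rightarrow> bool" where
  "program P \<longleftrightarrow>
     oriented_matroid (mat P) \<and>
     gelt P \<in> ground (mat P) \<and> felt P \<in> ground (mat P) \<and> gelt P \<noteq> felt P \<and>
     \<not> is_loop (mat P) (gelt P) \<and> \<not> is_coloop (mat P) (felt P)"

definition elts :: "'e program \<Rightarrow> 'e set" where
  "elts P = ground (mat P) - {gelt P, felt P}"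

definition dual_program :: "'e program \<Rightarrow> 'e program" where
  "dual_program P = \<lparr>mat = dual (mat P), gelt = felt P, felt = gelt P\<rparr>"

definition N_of :: "'e program \<Rightarrow> 'e om" where
  "N_of P = deletion (mat P) (felt P)"

definition M_of :: "'e program \<Rightarrow> 'e om" where
  "M_of P = contraction (deletion (mat P) (felt P)) (gelt P)"

definition generic :: "'e program \<Rightarrow> bool" where
  "generic P \<longleftrightarrow>
     (\<forall>Y \<in> cocircuits (N_of P).
        card (zeros (ground (N_of P)) Y) > rank (M_of P) \<longrightarrow> Y (gelt P) = Zero) \<and>
     (\<forall>X \<in> circuits (contraction (mat P) (gelt P)).
        int (card (zeros (ground (contraction (mat P) (gelt P))) X))
          > int (card (elts P)) - int (rank (M_of P)) \<longrightarrow> X (felt P) = Zero)"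

definition full_signs :: "'e program \<Rightarrow> 'e svec set" where
  "full_signs P = {\<alpha>. supp \<alpha> = elts P}"

definition feasible_topes :: "'e program \<Rightarrow> 'e svec set" where
  "feasible_topes P = restr (elts P) ` {T \<in> topes (N_of P). T (gelt P) = Pos}"

definition unbounded :: "'e program \<Rightarrow> 'e svec \<Rightarrow> bool" where
  "unbounded P \<alpha> \<longleftrightarrow>
     (\<exists>Z \<in> covectors (mat P). Z (gelt P) = Zero \<and> Z (felt P) = Pos \<and>
        (\<forall>i \<in> elts P. Z i \<in> {Zero, \<alpha> i}))"

definition bounded_signs :: "'e program \<Rightarrow> 'e svec set" where
  "bounded_signs P = {\<alpha> \<in> full_signs P. \<not> unbounded P \<alpha>}"

definition bounded_feasible :: "'e program \<Rightarrow> 'e svec set" where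
  "bounded_feasible P = feasible_topes P \<inter> bounded_signs P"

definition adjacent :: "'e svec \<Rightarrow> 'e svec \<Rightarrow> bool" where
  "adjacent \<alpha> \<beta> \<longleftrightarrow> (\<exists>!i. \<alpha> i \<noteq> \<beta> i)"

definition flip_at :: "'e svec \<Rightarrow> 'e \<Rightarrow> 'e svec" where
  "flip_at \<alpha> i = \<alpha>(i := opp (\<alpha> i))"

section \<open>Tensor products of algebras\<close>

text \<open>Let \<open>B\<close> and \<open>C\<close> be algebras over the commutative ring \<open>S\<close> via \<open>\<sigma>\<close> and \<open>\<tau>\<close>. The tensor
  product is the free abelian group on \<open>B \<times> C\<close>, with the multiplication
  \<open>(b, c) (b', c') = (b b', c c')\<close>, modulo biadditivity and \<open>S\<close>-balancedness.\<close>

definition free_pairs :: "'b ring \<Rightarrow> 'c ring \<Rightarrow> ('b \<times> 'c \<Rightarrow>\<^sub>0 int) ring" where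
  "free_pairs B C =
     \<lparr>carrier = {x. Poly_Mapping.keys x \<subseteq> carrier B \<times> carrier C},
      monoid.mult = (\<lambda>x y. \<Sum>u \<in> Poly_Mapping.keys x. \<Sum>v \<in> Poly_Mapping.keys y.
         Poly_Mapping.single (fst u \<otimes>\<^bsub>B\<^esub> fst v, snd u \<otimes>\<^bsub>C\<^esub> snd v)
           (Poly_Mapping.lookup x u * Poly_Mapping.lookup y v)),
      one = frag_of (\<one>\<^bsub>B\<^esub>, \<one>\<^bsub>C\<^esub>),
      zero = 0,
      add = (+)\<rparr>"

abbreviation pair_gen :: "'b \<Rightarrow> 'c \<Rightarrow> ('b \<times> 'c \<Rightarrow>\<^sub>0 int)" where
  "pair_gen b c \<equiv> frag_of (b, c)"

definition tensor_rels ::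
  "'s ring \<Rightarrow> ('s \<Rightarrow> 'b) \<Rightarrow> ('s \<Rightarrow> 'c) \<Rightarrow> 'b ring \<Rightarrow> 'c ring \<Rightarrow> ('b \<times> 'c \<Rightarrow>\<^sub>0 int) set" where
  "tensor_rels S \<sigma> \<tau> B C =
     {pair_gen (b \<oplus>\<^bsub>B\<^esub> b') c - pair_gen b c - pair_gen b' c | b b' c.
        b \<in> carrier B \<and> b' \<in> carrier B \<and> c \<in> carrier C} \<union>
     {pair_gen b (c \<oplus>\<^bsub>C\<^esub> c') - pair_gen b c - pair_gen b c' | b c c'.
        b \<in> carrier B \<and> c \<in> carrier C \<and> c' \<in> carrier C} \<union>
     {pair_gen (b \<otimes>\<^bsub>B\<^esub> \<sigma> s) c - pair_gen b (\<tau> s \<otimes>\<^bsub>C\<^esub> c) | b s c.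
        b \<in> carrier B \<and> s \<in> carrier S \<and> c \<in> carrier C}"

definition tensor_ideal ::
  "'s ring \<Rightarrow> ('s \<Rightarrow> 'b) \<Rightarrow> ('s \<Rightarrow> 'c) \<Rightarrow> 'b ring \<Rightarrow> 'c ring \<Rightarrow> ('b \<times> 'c \<Rightarrow>\<^sub>0 int) set" where
  "tensor_ideal S \<sigma> \<tau> B C = Idl\<^bsub>free_pairs B C\<^esub> (tensor_rels S \<sigma> \<tau> B C)"

definition tensor ::
  "'s ring \<Rightarrow> ('s \<Rightarrow> 'b) \<Rightarrow> ('s \<Rightarrow> 'c) \<Rightarrow> 'b ring \<Rightarrow> 'c ring \<Rightarrow> ('b \<times> 'c \<Rightarrow>\<^sub>0 int) set ring" where
  "tensor S \<sigma> \<tau> B C = free_pairs B C Quot tensor_ideal S \<sigma> \<tau> B C"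

definition pure_tensor ::
  "'s ring \<Rightarrow> ('s \<Rightarrow> 'b) \<Rightarrow> ('s \<Rightarrow> 'c) \<Rightarrow> 'b ring \<Rightarrow> 'c ring \<Rightarrow> 'b \<Rightarrow> 'c \<Rightarrow> ('b \<times> 'c \<Rightarrow>\<^sub>0 int) set" where
  "pure_tensor S \<sigma> \<tau> B C b c = tensor_ideal S \<sigma> \<tau> B C +>\<^bsub>free_pairs B C\<^esub> pair_gen b c"

text \<open>Gradings are given by their homogeneous components, indexed by the integers.\<close>

definition tensor_deg ::
  "'s ring \<Rightarrow> ('s \<Rightarrow> 'b) \<Rightarrow> ('s \<Rightarrow> 'c) \<Rightarrow> 'b ring \<Rightarrow> 'c ring \<Rightarrow> (int \<Rightarrow> 'b set) \<Rightarrow> (int \<Rightarrow> 'c set) \<Rightarrow>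
     int \<Rightarrow> ('b \<times> 'c \<Rightarrow>\<^sub>0 int) set set" where
  "tensor_deg S \<sigma> \<tau> B C Bdeg Cdeg m =
     (\<lambda>x. tensor_ideal S \<sigma> \<tau> B C +>\<^bsub>free_pairs B C\<^esub> x) `
       {x. Poly_Mapping.keys x \<subseteq> (\<Union>i. Bdeg i \<times> Cdeg (m - i))}"

definition quot_deg :: "'a ring \<Rightarrow> 'a set \<Rightarrow> (int \<Rightarrow> 'a set) \<Rightarrow> int \<Rightarrow> 'a set set" where
  "quot_deg R I Rdeg m = (\<lambda>x. I +>\<^bsub>R\<^esub> x) ` Rdeg m"

definition graded_ring_iso ::
  "'a ring \<Rightarrow> (int \<Rightarrow> 'a set) \<Rightarrow> 'b ring \<Rightarrow> (int \<Rightarrow> 'b set) \<Rightarrow> ('a \<Rightarrow> 'b) \<Rightarrow> bool" where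
  "graded_ring_iso R Rdeg S Sdeg \<phi> \<longleftrightarrow> \<phi> \<in> ring_iso R S \<and> (\<forall>m. \<phi> ` Rdeg m = Sdeg m)"

section \<open>Polynomial rings and parameter spaces\<close>

type_synonym ('e, 'k) mpoly = "('e \<Rightarrow>\<^sub>0 nat) \<Rightarrow>\<^sub>0 'k"

abbreviation base_field :: "'k::field ring" where
  "base_field \<equiv> ring_of_type_algebra"

definition field_deg :: "int \<Rightarrow> 'k::field set" where
  "field_deg m = (if m = 0 then UNIV else {0})"

definition poly_const :: "'k::field \<Rightarrow> ('e, 'k) mpoly" where
  "poly_const c = Poly_Mapping.single 0 c"

definition poly_var :: "'e \<Rightarrow> ('e, 'k::field) mpoly" where
  "poly_var i = Poly_Mapping.single (Poly_Mapping.single i 1) 1"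

definition sym_ring :: "'e set \<Rightarrow> ('e, 'k::field) mpoly ring" where
  "sym_ring E = ring_of_type_algebra
     \<lparr>carrier := {p. \<forall>m \<in> Poly_Mapping.keys p. Poly_Mapping.keys m \<subseteq> E}\<rparr>"

definition sym_deg :: "'e set \<Rightarrow> int \<Rightarrow> ('e, 'k::field) mpoly set" where
  "sym_deg E d =
     {p \<in> carrier (sym_ring E). \<forall>m \<in> Poly_Mapping.keys p.
        2 * int (\<Sum>i \<in> Poly_Mapping.keys m. Poly_Mapping.lookup m i) = d}"

definition squarefree_mon :: "'e set \<Rightarrow> ('e, 'k::field) mpoly" where
  "squarefree_mon S = (\<Prod>i \<in> S. poly_var i)"

text \<open>Vectors of \<open>k\<^sup>E\<close> are functions vanishing outside \<open>E\<close>.\<close>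

definition coord_space :: "'e set \<Rightarrow> ('e \<Rightarrow> 'k::field) set" where
  "coord_space E = {v. \<forall>i. i \<notin> E \<longrightarrow> v i = 0}"

definition linear_form :: "'e set \<Rightarrow> ('e \<Rightarrow> 'k::field) \<Rightarrow> ('e, 'k) mpoly" where
  "linear_form E v = (\<Sum>i \<in> E. poly_const (v i) * poly_var i)"

definition parameter_space :: "'e om \<Rightarrow> ('e \<Rightarrow> 'k::field) set \<Rightarrow> bool" where
  "parameter_space M U \<longleftrightarrow>
     U \<subseteq> coord_space (ground M) \<and> module.subspace (\<lambda>c v i. c * v i) U \<and>
     (\<forall>b. basis M b \<longrightarrow>
        bij_betw (\<lambda>v i. if i \<in> b then v i else 0) U (coord_space b))"

text \<open>\<open>Sym U\<close>, as the subalgebra of \<open>Sym (k\<^sup>E)\<close> generated by \<open>U\<close>. On it, taking constant terms is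
  the ring homomorphism to \<open>k\<close> that kills \<open>U\<close>.\<close>

definition sym_sub :: "'e set \<Rightarrow> ('e \<Rightarrow> 'k::field) set \<Rightarrow> ('e, 'k) mpoly ring" where
  "sym_sub E U =
     (sym_ring E)\<lparr>carrier := generate_ring (sym_ring E) (range poly_const \<union> linear_form E ` U)\<rparr>"

definition const_term :: "('e, 'k::field) mpoly \<Rightarrow> 'k" where
  "const_term p = Poly_Mapping.lookup p 0"

section \<open>The algebras \<open>A\<close>\<close>

text \<open>The quiver with vertex set \<open>V\<close> has exactly one arrow in each direction between adjacent
  vertices, so a path is its sequence of vertices. They sv_comp left to right.\<close>

definition paths :: "'e svec set \<Rightarrow> 'e svec list set" where
  "paths V = {p. p \<noteq> [] \<and> set p \<subseteq> V \<and> successively adjacent p}"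

type_synonym ('e, 'k) pathalg = "'e svec list \<Rightarrow>\<^sub>0 'k"

definition path_algebra :: "'e svec set \<Rightarrow> ('e, 'k::field) pathalg ring" where
  "path_algebra V =
     \<lparr>carrier = {x. Poly_Mapping.keys x \<subseteq> paths V},
      monoid.mult = (\<lambda>x y. \<Sum>p \<in> Poly_Mapping.keys x. \<Sum>q \<in> Poly_Mapping.keys y.
         if last p = hd q
         then Poly_Mapping.single (p @ tl q) (Poly_Mapping.lookup x p * Poly_Mapping.lookup y q)
         else 0),
      one = (\<Sum>\<alpha> \<in> V. Poly_Mapping.single [\<alpha>] 1),
      zero = 0,
      add = (+)\<rparr>"

definition path_algebra_const :: "'e svec set \<Rightarrow> 'k::field \<Rightarrow> ('e, 'k) pathalg" where
  "path_algebra_const V c = (\<Sum>\<alpha> \<in> V. Poly_Mapping.single [\<alpha>] c)"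

definition path_algebra_deg :: "'e svec set \<Rightarrow> int \<Rightarrow> ('e, 'k::field) pathalg set" where
  "path_algebra_deg V m =
     {x \<in> carrier (path_algebra V). \<forall>p \<in> Poly_Mapping.keys x. int (length p) - 1 = m}"

text \<open>\<open>P(Q) \<otimes> k[t\<^sub>i : i \<in> E]\<close> over \<open>k\<close>, for the quiver \<open>Q\<close> on the feasible topes of \<open>P\<close>. The
  definitions below are for an arbitrary program and get applied to the dual program.\<close>

type_synonym ('e, 'k) pathpoly = "(('e, 'k) pathalg \<times> ('e, 'k) mpoly \<Rightarrow>\<^sub>0 int) set"

definition path_poly :: "'e program \<Rightarrow> ('e, 'k::field) pathpoly ring" where
  "path_poly P =
     tensor base_field (path_algebra_const (feasible_topes P)) poly_const
       (path_algebra (feasible_topes P)) (sym_ring (elts P))"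

definition path_poly_deg :: "'e program \<Rightarrow> int \<Rightarrow> ('e, 'k::field) pathpoly set" where
  "path_poly_deg P =
     tensor_deg base_field (path_algebra_const (feasible_topes P)) poly_const
       (path_algebra (feasible_topes P)) (sym_ring (elts P))
       (path_algebra_deg (feasible_topes P)) (sym_deg (elts P))"

definition path_tensor ::
  "'e program \<Rightarrow> ('e, 'k::field) pathalg \<Rightarrow> ('e, 'k) mpoly \<Rightarrow> ('e, 'k) pathpoly" where
  "path_tensor P =
     pure_tensor base_field (path_algebra_const (feasible_topes P)) poly_const
       (path_algebra (feasible_topes P)) (sym_ring (elts P))"

definition path_elt :: "'e program \<Rightarrow> 'e svec list \<Rightarrow> ('e, 'k::field) pathpoly" where
  "path_elt P p = path_tensor P (Poly_Mapping.single p 1) 1"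

definition A_rels :: "'e program \<Rightarrow> ('e, 'k::field) pathpoly set" where
  "A_rels P =
     {path_elt P [\<alpha>] | \<alpha>. \<alpha> \<in> feasible_topes P - bounded_feasible P} \<union>
     {path_elt P [\<alpha>, \<gamma>, \<beta>] \<ominus>\<^bsub>path_poly P\<^esub> path_elt P [\<alpha>, \<delta>, \<beta>] | \<alpha> \<beta> \<gamma> \<delta>.
        {\<alpha>, \<beta>, \<gamma>, \<delta>} \<subseteq> feasible_topes P \<and> distinct [\<alpha>, \<beta>, \<gamma>, \<delta>] \<and>
        adjacent \<alpha> \<gamma> \<and> adjacent \<alpha> \<delta> \<and> adjacent \<beta> \<gamma> \<and> adjacent \<beta> \<delta>} \<union>
     {path_elt P [\<alpha>, flip_at \<alpha> i, \<alpha>] \<ominus>\<^bsub>path_poly P\<^esub>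
        path_tensor P (Poly_Mapping.single [\<alpha>] 1) (poly_var i) | \<alpha> i.
        i \<in> elts P \<and> \<alpha> \<in> feasible_topes P \<and> flip_at \<alpha> i \<in> feasible_topes P}"

definition A_ideal :: "'e program \<Rightarrow> ('e, 'k::field) pathpoly set" where
  "A_ideal P = Idl\<^bsub>path_poly P\<^esub> (A_rels P)"

definition A_tilde :: "'e program \<Rightarrow> ('e, 'k::field) pathpoly set ring" where
  "A_tilde P = path_poly P Quot A_ideal P"

definition A_tilde_deg :: "'e program \<Rightarrow> int \<Rightarrow> ('e, 'k::field) pathpoly set set" where
  "A_tilde_deg P = quot_deg (path_poly P) (A_ideal P) (path_poly_deg P)"

definition A_tilde_path :: "'e program \<Rightarrow> 'e svec list \<Rightarrow> ('e, 'k::field) pathpoly set" where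
  "A_tilde_path P p = A_ideal P +>\<^bsub>path_poly P\<^esub> path_elt P p"

definition A_tilde_sym :: "'e program \<Rightarrow> ('e, 'k::field) mpoly \<Rightarrow> ('e, 'k) pathpoly set" where
  "A_tilde_sym P p =
     A_ideal P +>\<^bsub>path_poly P\<^esub> path_tensor P \<one>\<^bsub>path_algebra (feasible_topes P)\<^esub> p"

text \<open>The quotient of \<open>A_tilde P\<close> by the linear forms in \<open>U\<close>. Thus \<open>A_alg (dual_program P) U\<close> is the
  algebra written \<open>A(P\<^sup>\<or>, U\<^sup>\<bottom>)\<close>, since the linear forms vanishing on \<open>U\<^sup>\<bottom>\<close> are those in \<open>U\<close>.\<close>

definition A_alg_ideal ::
  "'e program \<Rightarrow> ('e \<Rightarrow> 'k::field) set \<Rightarrow> ('e, 'k) pathpoly set set" where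
  "A_alg_ideal P U = Idl\<^bsub>A_tilde P\<^esub> ((\<lambda>u. A_tilde_sym P (linear_form (elts P) u)) ` U)"

definition A_alg ::
  "'e program \<Rightarrow> ('e \<Rightarrow> 'k::field) set \<Rightarrow> ('e, 'k) pathpoly set set ring" where
  "A_alg P U = A_tilde P Quot A_alg_ideal P U"

definition A_alg_deg ::
  "'e program \<Rightarrow> ('e \<Rightarrow> 'k::field) set \<Rightarrow> int \<Rightarrow> ('e, 'k) pathpoly set set set" where
  "A_alg_deg P U = quot_deg (A_tilde P) (A_alg_ideal P U) (A_tilde_deg P)"

definition A_alg_proj ::
  "'e program \<Rightarrow> ('e \<Rightarrow> 'k::field) set \<Rightarrow> ('e, 'k) pathpoly set \<Rightarrow> ('e, 'k) pathpoly set set" where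
  "A_alg_proj P U a = A_alg_ideal P U +>\<^bsub>A_tilde P\<^esub> a"

section \<open>The algebras \<open>B\<close>\<close>

text \<open>A set \<open>\<A>\<close> of sign vectors stands for the indices \<open>\<alpha>\<^sub>1, \<dots>, \<alpha>\<^sub>r\<close>. Since \<open>N\<close> has no loops, the
  feasible tope with restriction \<open>\<alpha>\<close> to \<open>E\<close> is \<open>\<alpha>(g := Pos)\<close>.\<close>

definition common_faces :: "'e program \<Rightarrow> 'e svec set \<Rightarrow> 'e svec set" where
  "common_faces P \<A> =
     {X \<in> covectors (N_of P). X (gelt P) = Pos \<and> (\<forall>\<alpha> \<in> \<A>. is_face X (\<alpha>(gelt P := Pos)))}"

definition z_common_faces :: "'e program \<Rightarrow> 'e svec set \<Rightarrow> 'e set set" where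
  "z_common_faces P \<A> =
     {S. S \<subseteq> elts P \<and> (\<exists>X \<in> common_faces P \<A>. S \<subseteq> zeros (ground (N_of P)) X)}"

definition R_ideal :: "'e program \<Rightarrow> 'e svec set \<Rightarrow> ('e, 'k::field) mpoly set" where
  "R_ideal P \<A> =
     Idl\<^bsub>sym_ring (elts P)\<^esub> {squarefree_mon S | S. S \<subseteq> elts P \<and> S \<notin> z_common_faces P \<A>}"

definition R_tilde :: "'e program \<Rightarrow> 'e svec set \<Rightarrow> ('e, 'k::field) mpoly set ring" where
  "R_tilde P \<A> = sym_ring (elts P) Quot R_ideal P \<A>"

text \<open>The map \<open>R / I \<rightarrow> R / J\<close> induced by \<open>h : R \<rightarrow> R\<close> with \<open>h ` I \<subseteq> J\<close>: all cosets in the union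
  coincide.\<close>

definition coset_map :: "'a ring \<Rightarrow> 'a set \<Rightarrow> ('a \<Rightarrow> 'a) \<Rightarrow> 'a set \<Rightarrow> 'a set" where
  "coset_map R J h C = (\<Union>c \<in> C. J +>\<^bsub>R\<^esub> h c)"

definition sdist :: "'e program \<Rightarrow> 'e svec \<Rightarrow> 'e svec \<Rightarrow> nat" where
  "sdist P \<alpha> \<beta> = card {i \<in> elts P. \<alpha> i \<noteq> \<beta> i}"

definition detour :: "'e program \<Rightarrow> 'e svec \<Rightarrow> 'e svec \<Rightarrow> 'e svec \<Rightarrow> 'e set" where
  "detour P \<alpha> \<beta> \<gamma> = {i \<in> elts P. \<alpha> i = \<gamma> i \<and> \<alpha> i \<noteq> \<beta> i}"

definition star ::
  "'e program \<Rightarrow> 'e svec \<Rightarrow> 'e svec \<Rightarrow> 'e svec \<Rightarrow>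
     ('e, 'k::field) mpoly set \<Rightarrow> ('e, 'k) mpoly set \<Rightarrow> ('e, 'k) mpoly set" where
  "star P \<alpha> \<beta> \<gamma> x y =
     (let S = sym_ring (elts P); J = R_ideal P {\<alpha>, \<beta>, \<gamma>}
      in coset_map S (R_ideal P {\<alpha>, \<gamma>}) (\<lambda>p. squarefree_mon (detour P \<alpha> \<beta> \<gamma>) * p)
           (coset_map S J (\<lambda>p. p) x \<otimes>\<^bsub>R_tilde P {\<alpha>, \<beta>, \<gamma>}\<^esub> coset_map S J (\<lambda>p. p) y))"

text \<open>Elements of the direct sum are families indexed by pairs in the finite set
  \<^term>\<open>bounded_feasible P\<close>.\<close>

type_synonym ('e, 'k) matalg = "'e svec \<times> 'e svec \<Rightarrow> ('e, 'k) mpoly set"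

definition B_family ::
  "'e program \<Rightarrow> ('e svec \<Rightarrow> 'e svec \<Rightarrow> ('e, 'k::field) mpoly set) \<Rightarrow> ('e, 'k) matalg" where
  "B_family P h = restrict (\<lambda>(\<alpha>, \<beta>). h \<alpha> \<beta>) (bounded_feasible P \<times> bounded_feasible P)"

definition B_tilde_sym :: "'e program \<Rightarrow> ('e, 'k::field) mpoly \<Rightarrow> ('e, 'k) matalg" where
  "B_tilde_sym P p = B_family P (\<lambda>\<alpha> \<beta>.
     if \<alpha> = \<beta> then R_ideal P {\<alpha>, \<beta>} +>\<^bsub>sym_ring (elts P)\<^esub> p else \<zero>\<^bsub>R_tilde P {\<alpha>, \<beta>}\<^esub>)"

definition B_tilde :: "'e program \<Rightarrow> ('e, 'k::field) matalg ring" where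
  "B_tilde P =
     \<lparr>carrier = (\<Pi>\<^sub>E (\<alpha>, \<beta>) \<in> bounded_feasible P \<times> bounded_feasible P. carrier (R_tilde P {\<alpha>, \<beta>})),
      monoid.mult = (\<lambda>x y. B_family P (\<lambda>\<alpha> \<gamma>.
         \<Oplus>\<^bsub>R_tilde P {\<alpha>, \<gamma>}\<^esub> \<beta> \<in> bounded_feasible P. star P \<alpha> \<beta> \<gamma> (x (\<alpha>, \<beta>)) (y (\<beta>, \<gamma>)))),
      one = B_tilde_sym P 1,
      zero = B_family P (\<lambda>\<alpha> \<beta>. \<zero>\<^bsub>R_tilde P {\<alpha>, \<beta>}\<^esub>),
      add = (\<lambda>x y. B_family P (\<lambda>\<alpha> \<beta>. x (\<alpha>, \<beta>) \<oplus>\<^bsub>R_tilde P {\<alpha>, \<beta>}\<^esub> y (\<alpha>, \<beta>)))\<rparr>"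

definition B_tilde_deg :: "'e program \<Rightarrow> int \<Rightarrow> ('e, 'k::field) matalg set" where
  "B_tilde_deg P m =
     (\<Pi>\<^sub>E (\<alpha>, \<beta>) \<in> bounded_feasible P \<times> bounded_feasible P.
        quot_deg (sym_ring (elts P)) (R_ideal P {\<alpha>, \<beta>}) (sym_deg (elts P))
          (m - int (sdist P \<alpha> \<beta>)))"

text \<open>The unit of the ring \<open>R_tilde P {\<alpha>, \<beta>}\<close>, placed in the summand \<open>(\<alpha>, \<beta>)\<close>.\<close>

definition B_tilde_unit :: "'e program \<Rightarrow> 'e svec \<Rightarrow> 'e svec \<Rightarrow> ('e, 'k::field) matalg" where
  "B_tilde_unit P \<alpha> \<beta> = B_family P (\<lambda>\<alpha>' \<beta>'.
     if (\<alpha>', \<beta>') = (\<alpha>, \<beta>) then \<one>\<^bsub>R_tilde P {\<alpha>', \<beta>'}\<^esub> else \<zero>\<^bsub>R_tilde P {\<alpha>', \<beta>'}\<^esub>)"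

definition B_alg ::
  "'e program \<Rightarrow> ('e \<Rightarrow> 'k::field) set \<Rightarrow> (('e, 'k) matalg \<times> 'k \<Rightarrow>\<^sub>0 int) set ring" where
  "B_alg P U = tensor (sym_sub (elts P) U) (B_tilde_sym P) const_term (B_tilde P) base_field"

definition B_alg_deg ::
  "'e program \<Rightarrow> ('e \<Rightarrow> 'k::field) set \<Rightarrow> int \<Rightarrow> (('e, 'k) matalg \<times> 'k \<Rightarrow>\<^sub>0 int) set set" where
  "B_alg_deg P U =
     tensor_deg (sym_sub (elts P) U) (B_tilde_sym P) const_term (B_tilde P) base_field
       (B_tilde_deg P) field_deg"

definition B_alg_proj ::
  "'e program \<Rightarrow> ('e \<Rightarrow> 'k::field) set \<Rightarrow> ('e, 'k) matalg \<Rightarrow> (('e, 'k) matalg \<times> 'k \<Rightarrow>\<^sub>0 int) set" where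
  "B_alg_proj P U b =
     pure_tensor (sym_sub (elts P) U) (B_tilde_sym P) const_term (B_tilde P) base_field b 1"

end

theory Submission imports Defs begin

text \<open>By duality (Farkas' lemma) and genericity, the feasible topes of the dual program are the bounded
  sign vectors of the program. To a path through bounded sign vectors assign the monomial in which
  \<open>t\<^sub>i\<close> has half the number of superfluous changes of the \<open>i\<close>-th sign; with entries in the polynomial
  ring this is a homomorphism into matrices with the product twisted by the monomials of the
  detours \<open>S\<^sup>\<beta>\<^sub>\<alpha>\<^sub>\<gamma>\<close>, which descends to a surjection onto \<open>B_tilde\<close>.

  For injectivity, every path equals its monomial times a taut path, one that changes no sign
  twice. Any two taut paths with the same ends agree by the square relations, because elimination
  of covectors connects the possible first steps. Finally, a monomial \<open>t\<^sub>S\<close> with \<open>S\<close> not in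
  \<open>z(\<Delta>\<^sub>\<alpha>\<^sub>\<gamma>)\<close> kills the taut path from \<open>\<alpha>\<close> to \<open>\<gamma>\<close>: by Farkas' lemma there is a bounded infeasible
  sign vector whose detour is contained in \<open>S\<close>, so the product factors through a vanishing idempotent.
  Base change along the constant term identifies both quotients with the quotient by the linear forms in \<open>U\<close>.\<close>

section \<open>Oriented matroids\<close>

text \<open>The definitions start from signed circuits with weak elimination, whereas the argument
  lives on covectors. Farkas' lemma, derived from strong elimination, bridges the gap: it identifies
  covectors with the vectors orthogonal to all circuits. Genericity enters through
  \<open>circuit_through_g\<close> and \<open>covector_through_f\<close>: a certificate that misses
  \<open>g\<close> or \<open>f\<close> can be replaced by one that contains it. So infeasibility and
  unboundedness are each witnessed by a single circuit or covector, and duality exchanges them. On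
  the algebraic side no map out of a quotient is built by hand. \<open>A_tilde\<close> and
  \<open>B_tilde\<close> are both images of one ring \<open>FP\<close> of formal pairs of a path
  element and a polynomial, and the isomorphism is the equality of two kernels; as an image,
  \<open>B_tilde\<close> is also seen to be a ring. Matrices are indexed by all bounded sign
  vectors, and the ideals of \<open>R_tilde\<close> remove the infeasible ones. The kernels are
  compared through the section \<open>theta\<close>: modulo the relations every element is a
  combination of chosen taut paths with polynomial coefficients, so only coefficients remain to be
  compared.\<close>

lemma opp_simps [simp]: "opp (opp s) = s" "opp s = Zero \<longleftrightarrow> s = Zero" "Zero = opp s \<longleftrightarrow> s = Zero"
    "opp s = opp t \<longleftrightarrow> s = t" "s = opp s \<longleftrightarrow> s = Zero" "opp s = s \<longleftrightarrow> s = Zero"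
  by (cases s; cases t; simp)+

lemma sign_cases: "s \<noteq> Zero \<Longrightarrow> t \<noteq> Zero \<Longrightarrow> t = s \<or> t = opp s"
  by (cases s; cases t; simp)

lemma neg_neg [simp]: "neg_svec (neg_svec X) = X" by (simp add: neg_svec_def)

lemma neg_apply: "neg_svec X i = opp (X i)" by (simp add: neg_svec_def)

lemma supp_neg [simp]: "supp (neg_svec X) = supp X" by (simp add: supp_def neg_svec_def)

lemma in_supp: "i \<in> supp X \<longleftrightarrow> X i \<noteq> Zero" by (simp add: supp_def)

text \<open>The signs that an elimination between \<open>X\<close> and \<open>Y\<close> may produce,
  without the demand that the eliminated entry vanish. In this form eliminations can be chained
  (\<open>between_trans1\<close>, \<open>between_trans2\<close>); on \<open>sep X Y\<close> either
  sign is allowed.\<close>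

definition between :: "'e svec \<Rightarrow> 'e svec \<Rightarrow> 'e svec \<Rightarrow> bool" where
  "between X Y Z \<longleftrightarrow> (\<forall>i. Z i = Zero \<or> Z i = X i \<or> Z i = Y i)"

definition sep :: "'e svec \<Rightarrow> 'e svec \<Rightarrow> 'e set" where
  "sep X Y = {i. X i \<noteq> Zero \<and> Y i = opp (X i)}"

lemma sep_commute: "sep X Y = sep Y X" by (auto simp: sep_def)

lemma betweenD: "between X Y Z \<Longrightarrow> Z i = Zero \<or> Z i = X i \<or> Z i = Y i" by (simp add: between_def)

lemma between_supp: "between X Y Z \<Longrightarrow> supp Z \<subseteq> supp X \<union> supp Y"
  unfolding between_def in_supp subset_iff Un_iff by metis

lemma between_trans1: "between X Y X' \<Longrightarrow> between X' Y W \<Longrightarrow> between X Y W"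
  unfolding between_def by metis

lemma between_trans2: "between X Y Y' \<Longrightarrow> between X Y' W \<Longrightarrow> between X Y W"
  unfolding between_def by metis

lemma between_commute: "between X Y Z \<longleftrightarrow> between Y X Z"
  unfolding between_def by metis

text \<open>A sign of \<open>Z\<close> opposed to \<open>X\<close> can only come from
  \<open>Y\<close>. So an elimination never enlarges the separation set, and the eliminated element
  leaves it; this drives the descents below.\<close>

lemma sep_between:
  assumes "between X Y Z"
  shows "sep X Z \<subseteq> {i \<in> sep X Y. Z i \<noteq> Zero}"
proof
  fix i assume "i \<in> sep X Z"
  then have i: "X i \<noteq> Zero" "Z i = opp (X i)" by (auto simp: sep_def)
  then have "Z i \<noteq> Zero" "Z i \<noteq> X i" by auto
  then have "Z i = Y i" using betweenD[OF assms, of i] by auto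
  then show "i \<in> {i \<in> sep X Y. Z i \<noteq> Zero}" using i by (auto simp: sep_def)
qed

lemma sep_between':
  assumes "between X Y Z"
  shows "sep Y Z \<subseteq> {i \<in> sep X Y. Z i \<noteq> Zero}" "sep Z Y \<subseteq> {i \<in> sep X Y. Z i \<noteq> Zero}"
  using sep_between[of Y X Z] assms between_commute sep_commute by metis+

locale om =
  fixes M :: "'e om"
  assumes om: "oriented_matroid M"
begin

lemma finite_ground: "finite (ground M)" using om by (simp add: oriented_matroid_def)

lemma circuit_svec: "X \<in> circuits M \<Longrightarrow> supp X \<subseteq> ground M"
  using om by (auto simp: oriented_matroid_def svecs_def supp_def)

lemma finite_circuit: "X \<in> circuits M \<Longrightarrow> finite (supp X)"
  using circuit_svec finite_ground finite_subset by blast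

lemma circuit_nonzero: "X \<in> circuits M \<Longrightarrow> supp X \<noteq> {}"
proof
  assume "X \<in> circuits M" "supp X = {}"
  then have "X = zero_svec" by (auto simp: supp_def zero_svec_def)
  then show False using om \<open>X \<in> circuits M\<close> by (simp add: oriented_matroid_def)
qed

lemma circuit_neg: "X \<in> circuits M \<Longrightarrow> neg_svec X \<in> circuits M"
  using om by (simp add: oriented_matroid_def)

lemma circuit_incomparable:
  "X \<in> circuits M \<Longrightarrow> Y \<in> circuits M \<Longrightarrow> supp X \<subseteq> supp Y \<Longrightarrow> X = Y \<or> X = neg_svec Y"
  using om by (simp add: oriented_matroid_def)

section \<open>Strong circuit elimination\<close>

lemma weak_elim_pos:
  assumes "X \<in> circuits M" "Y \<in> circuits M" "X \<noteq> neg_svec Y" "X e = Pos" "Y e = Neg"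
  shows "\<exists>Z \<in> circuits M. Z e = Zero \<and> between X Y Z"
proof -
  obtain Z where Z: "Z \<in> circuits M"
    "{i. Z i = Pos} \<subseteq> ({i. X i = Pos} \<union> {i. Y i = Pos}) - {e}"
    "{i. Z i = Neg} \<subseteq> ({i. X i = Neg} \<union> {i. Y i = Neg}) - {e}"
    using assms om unfolding oriented_matroid_def by metis
  have "Z e = Zero" using Z by (cases "Z e") auto
  moreover have "Z i = Zero \<or> Z i = X i \<or> Z i = Y i" for i using Z by (cases "Z i") auto
  ultimately show ?thesis using Z(1) unfolding between_def by blast
qed

lemma weak_elim:
  assumes "X \<in> circuits M" "Y \<in> circuits M" "X \<noteq> neg_svec Y" "e \<in> sep X Y"
  shows "\<exists>Z \<in> circuits M. Z e = Zero \<and> between X Y Z"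
proof (cases "X e")
  case Zero then show ?thesis using assms by (simp add: sep_def)
next
  case Pos then show ?thesis using assms by (intro weak_elim_pos) (auto simp: sep_def)
next
  case Neg
  then have "\<exists>Z \<in> circuits M. Z e = Zero \<and> between Y X Z"
    using assms by (intro weak_elim_pos) (auto simp: sep_def)
  then show ?thesis using between_commute by blast
qed

text \<open>The induction parameter of strong elimination: the size of the union of the supports, then
  the size of the separation set.\<close>

definition elim_measure :: "'e svec \<Rightarrow> 'e svec \<Rightarrow> nat" where
  "elim_measure X Y = card (supp X \<union> supp Y) * Suc (card (ground M)) + card (sep X Y)"

text \<open>The factor \<open>Suc (card (ground M))\<close> exceeds the size of every separation
  set, so the measure is lexicographic: one element less in the union of the supports outweighs any
  growth of the separation.\<close>

lemma elim_measure_supp: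
  assumes "X \<in> circuits M" "Y \<in> circuits M" "X' \<in> circuits M" "Y' \<in> circuits M"
    "supp X' \<union> supp Y' \<subset> supp X \<union> supp Y"
  shows "elim_measure X' Y' < elim_measure X Y"
proof -
  have fin: "finite (supp X \<union> supp Y)"
    using assms finite_circuit by simp
  have "card (supp X' \<union> supp Y') < card (supp X \<union> supp Y)" using psubset_card_mono[OF fin assms(5)] .
  then have "Suc (card (supp X' \<union> supp Y')) * Suc (card (ground M)) \<le> card (supp X \<union> supp Y) * Suc (card (ground M))"
    by (intro mult_le_mono) auto
  moreover have "card (sep X' Y') \<le> card (ground M)"
    using circuit_svec[OF assms(3)] finite_ground by (intro card_mono) (auto simp: sep_def supp_def)
  ultimately show ?thesis by (simp add: elim_measure_def)
qed

lemma elim_measure_sep: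
  assumes "X \<in> circuits M" "Y \<in> circuits M"
    "supp X' \<union> supp Y' \<subseteq> supp X \<union> supp Y" "sep X' Y' \<subset> sep X Y"
  shows "elim_measure X' Y' < elim_measure X Y"
proof -
  have fin: "finite (supp X \<union> supp Y)"
    using assms finite_circuit by simp
  have "sep X Y \<subseteq> supp X \<union> supp Y" by (auto simp: sep_def supp_def)
  then have "card (sep X' Y') < card (sep X Y)"
    using psubset_card_mono[OF finite_subset[OF _ fin] assms(4)] by simp
  moreover have "card (supp X' \<union> supp Y') * Suc (card (ground M)) \<le> card (supp X \<union> supp Y) * Suc (card (ground M))"
    using assms(3) fin by (intro mult_le_mono card_mono) auto
  ultimately show ?thesis by (simp add: elim_measure_def)
qed

text \<open>\<open>W\<close> may carry signs opposite to those of \<open>Z\<close>, because it is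
  obtained with the help of \<open>neg_svec Z\<close>. Eliminating between \<open>W\<close> and
  \<open>Z\<close> at such places keeps the entry at \<open>f\<close>, where \<open>Z\<close>
  vanishes, and shrinks \<open>sep W Z\<close>; once this set is empty, every nonzero sign of
  \<open>W\<close> comes from \<open>X\<close> or \<open>Y\<close>.\<close>

lemma elim_repair:
  assumes Z: "Z \<in> circuits M" "Z e = Zero" "Z f = Zero" "between X Y Z"
    and W: "W \<in> circuits M" "W e = Zero" "W f = s" "s \<noteq> Zero"
      "\<And>i. W i = Zero \<or> W i = X i \<or> W i = Y i \<or> W i = opp (Z i)"
    and elim: "\<And>W j. W \<in> circuits M \<Longrightarrow> supp W \<subseteq> supp X \<union> supp Y - {e} \<Longrightarrow> j \<in> sep W Z \<Longrightarrow> W f \<noteq> Zero \<Longrightarrow>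
      \<exists>W' \<in> circuits M. W' j = Zero \<and> W' f = W f \<and> between W Z W'"
  shows "\<exists>W \<in> circuits M. W e = Zero \<and> W f = s \<and> between X Y W"
proof -
  define Q where "Q W \<longleftrightarrow> W \<in> circuits M \<and> W e = Zero \<and> W f = s \<and>
      (\<forall>i. W i = Zero \<or> W i = X i \<or> W i = Y i \<or> W i = opp (Z i))" for W
  have "Q W" using W unfolding Q_def by blast
  then obtain W where QW: "Q W" and least: "\<And>W'. Q W' \<Longrightarrow> card (sep W Z) \<le> card (sep W' Z)"
    using ex_has_least_nat[of Q W "\<lambda>W. card (sep W Z)"] by blast
  have "sep W Z = {}"
  proof (rule ccontr)
    assume "sep W Z \<noteq> {}"
    then obtain j where j: "j \<in> sep W Z" by blast
    have "supp W \<subseteq> supp X \<union> supp Y - {e}"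
    proof
      fix i assume "i \<in> supp W"
      then have "W i \<noteq> Zero" by (simp add: in_supp)
      then show "i \<in> supp X \<union> supp Y - {e}"
        using QW betweenD[OF Z(4), of i] unfolding Q_def by (auto simp: in_supp)
    qed
    moreover have "W f \<noteq> Zero" using QW W(4) by (simp add: Q_def)
    ultimately obtain W' where W': "W' \<in> circuits M" "W' j = Zero" "W' f = W f" "between W Z W'"
      using elim[of W j] QW j unfolding Q_def by blast
    have "W' e = Zero" using betweenD[OF W'(4), of e] QW Z(2) by (auto simp: Q_def)
    moreover have "\<forall>i. W' i = Zero \<or> W' i = X i \<or> W' i = Y i \<or> W' i = opp (Z i)"
      using betweenD[OF W'(4)] betweenD[OF Z(4)] QW unfolding Q_def by metis
    ultimately have "Q W'" using W' QW by (simp add: Q_def)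
    moreover have "sep W' Z \<subset> sep W Z"
    proof -
      have "sep W' Z \<subseteq> sep W Z"
        using sep_between'[OF W'(4)] by auto
      moreover have "j \<notin> sep W' Z" using W' by (simp add: sep_def)
      ultimately show ?thesis using j by blast
    qed
    moreover have "finite (sep W Z)"
    proof (rule finite_subset[OF _ finite_ground])
      show "sep W Z \<subseteq> ground M"
        using circuit_svec[OF Z(1)] by (auto simp: sep_def supp_def)
    qed
    ultimately show False using least[of W'] psubset_card_mono[of "sep W Z" "sep W' Z"] by linarith
  qed
  then have "between X Y W"
    using QW unfolding Q_def between_def sep_def by (auto) (metis opp_simps(1) opp_simps(2))
  then show ?thesis using QW by (auto simp: Q_def)
qed

text \<open>Weak elimination yields a \<open>Z\<close> that vanishes at \<open>e\<close>, but
  perhaps also at \<open>f\<close>. If \<open>Z\<close> opposes \<open>X\<close> or \<open>Y\<close>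
  somewhere, an elimination against \<open>Z\<close> brings that vector closer to the other one, and
  the induction applies again. If \<open>Z\<close> opposes neither, an element of \<open>Z\<close>
  outside \<open>X\<close> is removed from \<open>Y\<close> by means of \<open>neg_svec Z\<close>;
  the union of the supports gets smaller at the price of wrong signs, which
  \<open>elim_repair\<close> corrects.\<close>

lemma strong_elim_aux:
  "\<forall>X Y e f. X \<in> circuits M \<and> Y \<in> circuits M \<and> e \<in> sep X Y \<and> X f \<noteq> Zero \<and> Y f = Zero \<and>
     elim_measure X Y = n \<longrightarrow> (\<exists>Z \<in> circuits M. Z e = Zero \<and> Z f = X f \<and> between X Y Z)"
proof (induction n rule: less_induct)
  case (less n)
  have IH: "\<exists>Z \<in> circuits M. Z e = Zero \<and> Z f = X f \<and> between X Y Z"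
    if "elim_measure X Y < n" "X \<in> circuits M" "Y \<in> circuits M" "e \<in> sep X Y" "X f \<noteq> Zero" "Y f = Zero" for X Y e f
    using less.IH[OF that(1)] that(2-) by blast
  show ?case
  proof (intro allI impI, elim conjE)
    fix X Y e f
    assume X: "X \<in> circuits M" and Y: "Y \<in> circuits M" and e: "e \<in> sep X Y" and Xf: "X f \<noteq> Zero"
      and Yf: "Y f = Zero" and n: "elim_measure X Y = n"
    have Xe: "X e \<noteq> Zero" "Y e = opp (X e)" "Y e \<noteq> Zero" using e by (auto simp: sep_def)
    have "X \<noteq> neg_svec Y" using Xf Yf by (auto simp: neg_apply)
    then obtain Z where Z: "Z \<in> circuits M" "Z e = Zero" "between X Y Z" using weak_elim X Y e by blast
    note ZB = betweenD[OF Z(3)]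
    show "\<exists>Z \<in> circuits M. Z e = Zero \<and> Z f = X f \<and> between X Y Z"
    proof (cases "Z f = Zero")
      case False
      then have "Z f = X f" using ZB[of f] Yf by auto
      then show ?thesis using Z by blast
    next
      case Zf: True
      consider (A) e' where "e' \<in> sep X Z" | (B) e' where "e' \<in> sep Y Z" | (C) "sep X Z = {}" "sep Y Z = {}"
        by blast
      then show ?thesis
      proof cases
        case A
        have sub: "sep X Z \<subseteq> sep X Y - {e}" 
          using sep_between[OF Z(3)] Z(2) by auto
        have "elim_measure X Z < n" unfolding n[symmetric]
          using between_supp[OF Z(3)] sub e by (intro elim_measure_sep[OF X Y]) auto
        then obtain X' where X': "X' \<in> circuits M" "X' e' = Zero" "X' f = X f" "between X Z X'"
          using IH[of X Z e' f] A X Z Xf Zf by blast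
        note XB = betweenD[OF X'(4)]
        have bX': "between X Y X'" using between_trans2[OF Z(3) X'(4)] .
        show ?thesis
        proof (cases "X' e = Zero")
          case True then show ?thesis using X' bX' by blast
        next
          case False
          then have "e \<in> sep X' Y" using XB[of e] Z(2) Xe by (auto simp: sep_def)
          have sub2: "sep X' Y \<subseteq> sep X Y - {e'}"
            using sep_between'[OF bX'] X'(2) by auto
          have "elim_measure X' Y < n" unfolding n[symmetric]
            using between_supp[OF bX'] sub2 A sub by (intro elim_measure_sep[OF X Y]) auto
          then obtain W where "W \<in> circuits M" "W e = Zero" "W f = X' f" "between X' Y W"
            using IH[of X' Y e f] X' Y \<open>e \<in> sep X' Y\<close> Xf Yf by metis
          then show ?thesis using between_trans1[OF bX'] X'(3) by metis
        qed
      next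
        case B
        have sub: "sep Y Z \<subseteq> sep X Y - {e}" 
          using sep_between'[OF Z(3)] Z(2) by auto
        have "elim_measure Y Z < n" unfolding n[symmetric]
          using between_supp[OF Z(3)] sub e by (intro elim_measure_sep[OF X Y]) auto
        \<comment> \<open>The entry kept here is \<open>e\<close>, not \<open>f\<close>:
          \<open>Y\<close> and \<open>Z\<close> vanish at \<open>f\<close> anyway, and
          \<open>e\<close> must stay in the separation set for the next elimination.\<close>
        then obtain Y' where Y': "Y' \<in> circuits M" "Y' e' = Zero" "Y' e = Y e" "between Y Z Y'"
          using IH[of Y Z e' e] B Y Z Xe by blast
        have bY': "between X Y Y'" using between_trans2[of Y X Z Y'] Z(3) Y'(4) between_commute by metis
        have "e \<in> sep X Y'" using Y'(3) Xe by (auto simp: sep_def)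
        have Y'f: "Y' f = Zero" using betweenD[OF Y'(4), of f] Zf Yf by auto
        have sub2: "sep X Y' \<subseteq> sep X Y - {e'}"
          using sep_between[OF bY'] Y'(2) by auto
        have "elim_measure X Y' < n" unfolding n[symmetric]
          using between_supp[OF bY'] sub2 B sub by (intro elim_measure_sep[OF X Y]) auto
        then obtain W where "W \<in> circuits M" "W e = Zero" "W f = X f" "between X Y' W"
          using IH[of X Y' e f] Y' X \<open>e \<in> sep X Y'\<close> Xf Y'f by metis
        then show ?thesis using between_trans2[OF bY'] by metis
      next
        case C
        \<comment> \<open>Circuits are incomparable: \<open>Z\<close> vanishes at \<open>e\<close>,
          where \<open>X\<close> does not, so \<open>Z\<close> is neither \<open>X\<close> nor its
          negative.\<close>
        have "\<not> supp Z \<subseteq> supp X"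
          using circuit_incomparable[OF Z(1) X] Z(2) Xe by (auto simp: neg_apply)
        then obtain h where h: "Z h \<noteq> Zero" "X h = Zero" by (auto simp: in_supp)
        then have Yh: "Y h = Z h" using ZB[of h] by auto
        have nZ: "neg_svec Z \<in> circuits M" using circuit_neg Z by blast
        \<comment> \<open>Of the three vectors only \<open>X\<close> is nonzero at \<open>f\<close>,
          so the union of the supports has become smaller.\<close>
        have "elim_measure Y (neg_svec Z) < n" unfolding n[symmetric]
        proof (rule elim_measure_supp[OF X Y Y nZ])
          show "supp Y \<union> supp (neg_svec Z) \<subset> supp X \<union> supp Y"
            using between_supp[OF Z(3)] Xf Yf Zf by (auto simp: in_supp)
        qed
        moreover have "h \<in> sep Y (neg_svec Z)" using h Yh by (simp add: sep_def neg_apply)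
        ultimately obtain Y' where Y': "Y' \<in> circuits M" "Y' h = Zero" "Y' e = Y e" "between Y (neg_svec Z) Y'"
          using IH[of Y "neg_svec Z" h e] Y nZ Xe Z(2) by (metis neg_apply opp_simps(2))
        have Y'B: "Y' i = Zero \<or> Y' i = Y i \<or> Y' i = opp (Z i)" for i
          using betweenD[OF Y'(4), of i] by (simp add: neg_apply)
        have Y'f: "Y' f = Zero" using Y'B[of f] Yf Zf by auto
        have "elim_measure X Y' < n" unfolding n[symmetric]
        proof (rule elim_measure_supp[OF X Y X Y'(1)])
          have "supp Y' \<subseteq> supp Y \<union> supp Z" using between_supp[OF Y'(4)] by simp
          then show "supp X \<union> supp Y' \<subset> supp X \<union> supp Y"
            using between_supp[OF Z(3)] h Yh Y'(2) by (auto simp: in_supp)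
        qed
        moreover have "e \<in> sep X Y'" using Y'(3) Xe by (auto simp: sep_def)
        ultimately obtain W where W: "W \<in> circuits M" "W e = Zero" "W f = X f" "between X Y' W"
          using IH[of X Y' e f] X Y' Xf Y'f by blast
        show ?thesis
        proof (rule elim_repair[OF Z(1,2) Zf Z(3) W(1-3) Xf])
          show "W i = Zero \<or> W i = X i \<or> W i = Y i \<or> W i = opp (Z i)" for i
            using betweenD[OF W(4), of i] Y'B[of i] by metis
          fix V j assume V: "V \<in> circuits M" "supp V \<subseteq> supp X \<union> supp Y - {e}" "j \<in> sep V Z" "V f \<noteq> Zero"
          have "elim_measure V Z < n" unfolding n[symmetric]
          proof (rule elim_measure_supp[OF X Y V(1) Z(1)])
            show "supp V \<union> supp Z \<subset> supp X \<union> supp Y"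
              using between_supp[OF Z(3)] V(2) Xe Z(2) by (auto simp: in_supp)
          qed
          then show "\<exists>W' \<in> circuits M. W' j = Zero \<and> W' f = V f \<and> between V Z W'"
            using IH[of V Z j f] V Z Zf by blast
        qed
      qed
    qed
  qed
qed

lemma strong_elim_zero:
  "X \<in> circuits M \<Longrightarrow> Y \<in> circuits M \<Longrightarrow> e \<in> sep X Y \<Longrightarrow> X f \<noteq> Zero \<Longrightarrow> Y f = Zero \<Longrightarrow>
    \<exists>Z \<in> circuits M. Z e = Zero \<and> Z f = X f \<and> between X Y Z"
  using strong_elim_aux by blast

text \<open>An elimination against \<open>Z\<close> is now an instance of
  \<open>strong_elim_zero\<close>, since \<open>Z\<close> vanishes at \<open>f\<close>; the
  induction serves the pairs in which both vectors are nonzero at \<open>f\<close>. In the last case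
  the roles are exchanged: \<open>h\<close> lies outside \<open>Y\<close> and is removed from
  \<open>X\<close>.\<close>

lemma strong_elim_same_aux:
  "\<forall>X Y e. X \<in> circuits M \<and> Y \<in> circuits M \<and> e \<in> sep X Y \<and> X f \<noteq> Zero \<and> Y f = X f \<and>
     elim_measure X Y = n \<longrightarrow> (\<exists>Z \<in> circuits M. Z e = Zero \<and> Z f = X f \<and> between X Y Z)"
proof (induction n rule: less_induct)
  case (less n)
  have IH: "\<exists>Z \<in> circuits M. Z e = Zero \<and> Z f = X f \<and> between X Y Z"
    if "elim_measure X Y < n" "X \<in> circuits M" "Y \<in> circuits M" "e \<in> sep X Y" "X f \<noteq> Zero" "Y f = X f" for X Y e
    using less.IH[OF that(1)] that(2-) by blast
  show ?case
  proof (intro allI impI, elim conjE)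
    fix X Y e
    assume X: "X \<in> circuits M" and Y: "Y \<in> circuits M" and e: "e \<in> sep X Y" and Xf: "X f \<noteq> Zero"
      and Yf: "Y f = X f" and n: "elim_measure X Y = n"
    have Xe: "X e \<noteq> Zero" "Y e = opp (X e)" "Y e \<noteq> Zero" using e by (auto simp: sep_def)
    have "X \<noteq> neg_svec Y" using Xf Yf by (metis neg_apply opp_simps(5))
    then obtain Z where Z: "Z \<in> circuits M" "Z e = Zero" "between X Y Z" using weak_elim X Y e by blast
    note ZB = betweenD[OF Z(3)]
    show "\<exists>Z \<in> circuits M. Z e = Zero \<and> Z f = X f \<and> between X Y Z"
    proof (cases "Z f = Zero")
      case False
      then have "Z f = X f" using ZB[of f] Yf by auto
      then show ?thesis using Z by blast
    next
      case Zf: True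
      consider (A) e' where "e' \<in> sep X Z" | (B) e' where "e' \<in> sep Y Z" | (C) "sep X Z = {}" "sep Y Z = {}"
        by blast
      then show ?thesis
      proof cases
        case A
        have sub: "sep X Z \<subseteq> sep X Y - {e}" 
          using sep_between[OF Z(3)] Z(2) by auto
        obtain X' where X': "X' \<in> circuits M" "X' e' = Zero" "X' f = X f" "between X Z X'"
          using strong_elim_zero[OF X Z(1) A Xf Zf] by blast
        note XB = betweenD[OF X'(4)]
        have bX': "between X Y X'" using between_trans2[OF Z(3) X'(4)] .
        show ?thesis
        proof (cases "X' e = Zero")
          case True then show ?thesis using X' bX' by blast
        next
          case False
          then have "e \<in> sep X' Y" using XB[of e] Z(2) Xe by (auto simp: sep_def)
          have sub2: "sep X' Y \<subseteq> sep X Y - {e'}"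
            using sep_between'[OF bX'] X'(2) by auto
          have "elim_measure X' Y < n" unfolding n[symmetric]
            using between_supp[OF bX'] sub2 A sub by (intro elim_measure_sep[OF X Y]) auto
          then obtain W where "W \<in> circuits M" "W e = Zero" "W f = X' f" "between X' Y W"
            using IH[of X' Y e] X' Y \<open>e \<in> sep X' Y\<close> Xf Yf by metis
          then show ?thesis using between_trans1[OF bX'] X'(3) by metis
        qed
      next
        case B
        have sub: "sep Y Z \<subseteq> sep X Y - {e}" 
          using sep_between'[OF Z(3)] Z(2) by auto
        obtain Y' where Y': "Y' \<in> circuits M" "Y' e' = Zero" "Y' f = Y f" "between Y Z Y'"
          using strong_elim_zero[OF Y Z(1) B _ Zf] Xf Yf by auto
        have bY': "between X Y Y'" using between_trans2[of Y X Z Y'] Z(3) Y'(4) between_commute by metis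
        show ?thesis
        proof (cases "Y' e = Zero")
          case True then show ?thesis using Y' bY' Yf by metis
        next
          case False
          then have "e \<in> sep X Y'" using betweenD[OF Y'(4), of e] Z(2) Xe by (auto simp: sep_def)
          have sub2: "sep X Y' \<subseteq> sep X Y - {e'}"
            using sep_between[OF bY'] Y'(2) by auto
          have "elim_measure X Y' < n" unfolding n[symmetric]
            using between_supp[OF bY'] sub2 B sub by (intro elim_measure_sep[OF X Y]) auto
          then obtain W where "W \<in> circuits M" "W e = Zero" "W f = X f" "between X Y' W"
            using IH[of X Y' e] Y' X \<open>e \<in> sep X Y'\<close> Xf Yf by metis
          then show ?thesis using between_trans2[OF bY'] by metis
        qed
      next
        case C
        have "\<not> supp Z \<subseteq> supp Y"
          using circuit_incomparable[OF Z(1) Y] Z(2) Xe by (auto simp: neg_apply)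
        then obtain h where h: "Z h \<noteq> Zero" "Y h = Zero" by (auto simp: in_supp)
        then have Xh: "X h = Z h" using ZB[of h] by auto
        have nZ: "neg_svec Z \<in> circuits M" using circuit_neg Z by blast
        have "h \<in> sep X (neg_svec Z)" using h Xh by (simp add: sep_def neg_apply)
        then obtain X' where X': "X' \<in> circuits M" "X' h = Zero" "X' f = X f" "between X (neg_svec Z) X'"
          using strong_elim_zero[OF X nZ, of h f] Xf Zf by (auto simp: neg_apply)
        have X'B: "X' i = Zero \<or> X' i = X i \<or> X' i = opp (Z i)" for i
          using betweenD[OF X'(4), of i] by (simp add: neg_apply)
        obtain W where W: "W \<in> circuits M" "W e = Zero" "W f = X f" 
            "\<And>i. W i = Zero \<or> W i = X i \<or> W i = Y i \<or> W i = opp (Z i)"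
        proof (cases "X' e = Zero")
          case True
          show ?thesis by (rule that[OF X'(1) True X'(3)]) (metis X'B)
        next
          case False
          then have "e \<in> sep X' Y" using X'B[of e] Z(2) Xe by (auto simp: sep_def)
          moreover have "elim_measure X' Y < n" unfolding n[symmetric]
          proof (rule elim_measure_supp[OF X Y X'(1) Y])
            have "supp X' \<subseteq> supp X \<union> supp Z" using between_supp[OF X'(4)] by simp
            then show "supp X' \<union> supp Y \<subset> supp X \<union> supp Y"
              using between_supp[OF Z(3)] h Xh X'(2) by (auto simp: in_supp)
          qed
          ultimately obtain W where W: "W \<in> circuits M" "W e = Zero" "W f = X' f" "between X' Y W"
            using IH[of X' Y e] X' Y Xf Yf by metis
          show ?thesis
            by (rule that[OF W(1,2)]) (use W(3) X'(3) betweenD[OF W(4)] X'B in metis)+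
        qed
        show ?thesis
        proof (rule elim_repair[OF Z(1,2) Zf Z(3) W(1-3) Xf W(4)])
          fix V j assume V: "V \<in> circuits M" "j \<in> sep V Z" "V f \<noteq> Zero"
          then show "\<exists>W' \<in> circuits M. W' j = Zero \<and> W' f = V f \<and> between V Z W'"
            using strong_elim_zero Z Zf by blast
        qed
      qed
    qed
  qed
qed

lemma strong_elim:
  assumes "X \<in> circuits M" "Y \<in> circuits M" "e \<in> sep X Y" "X f \<noteq> Zero" "Y f = Zero \<or> Y f = X f"
  shows "\<exists>Z \<in> circuits M. Z e = Zero \<and> Z f = X f \<and> between X Y Z"
  using assms strong_elim_zero strong_elim_same_aux by blast

end

section \<open>Orthogonality of sign vectors\<close>

lemma orthogonal_iff:
  "orthogonal X Y \<longleftrightarrow> (\<forall>i. X i \<noteq> Zero \<and> Y i \<noteq> Zero \<longrightarrow>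
     (\<exists>j. X j \<noteq> Zero \<and> Y j = X j) \<and> (\<exists>j. X j \<noteq> Zero \<and> Y j = opp (X j)))"
proof
  assume o: "orthogonal X Y"
  show "\<forall>i. X i \<noteq> Zero \<and> Y i \<noteq> Zero \<longrightarrow>
     (\<exists>j. X j \<noteq> Zero \<and> Y j = X j) \<and> (\<exists>j. X j \<noteq> Zero \<and> Y j = opp (X j))"
  proof (intro allI impI)
    fix i assume "X i \<noteq> Zero \<and> Y i \<noteq> Zero"
    then have "supp X \<inter> supp Y \<noteq> {}" by (auto simp: in_supp)
    then obtain j k where "j \<in> supp X \<inter> supp Y" "X j = Y j" "k \<in> supp X \<inter> supp Y" "X k \<noteq> Y k"
      using o unfolding orthogonal_def by blast
    then show "(\<exists>j. X j \<noteq> Zero \<and> Y j = X j) \<and> (\<exists>j. X j \<noteq> Zero \<and> Y j = opp (X j))"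
      using sign_cases[of "X k" "Y k"] unfolding in_supp Int_iff by metis
  qed
next
  assume o: "\<forall>i. X i \<noteq> Zero \<and> Y i \<noteq> Zero \<longrightarrow>
     (\<exists>j. X j \<noteq> Zero \<and> Y j = X j) \<and> (\<exists>j. X j \<noteq> Zero \<and> Y j = opp (X j))"
  show "orthogonal X Y"
  proof (cases "supp X \<inter> supp Y = {}")
    case False
    then obtain i where "i \<in> supp X" "i \<in> supp Y" by blast
    then have "X i \<noteq> Zero \<and> Y i \<noteq> Zero" by (simp add: in_supp)
    then obtain j k where j: "X j \<noteq> Zero" "Y j = X j" and k: "X k \<noteq> Zero" "Y k = opp (X k)" using o by blast
    then have "j \<in> supp X \<inter> supp Y" "k \<in> supp X \<inter> supp Y" "X k \<noteq> Y k" by (auto simp: in_supp)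
    then show ?thesis using j unfolding orthogonal_def by metis
  qed (simp add: orthogonal_def)
qed

lemma orthogonal_neg_right [simp]: "orthogonal X (neg_svec Y) \<longleftrightarrow> orthogonal X Y"
  unfolding orthogonal_iff neg_apply opp_simps by (metis opp_simps(1))

lemma orthogonal_commute: "orthogonal X Y \<longleftrightarrow> orthogonal Y X"
  unfolding orthogonal_iff by (metis opp_simps(1,2))

text \<open>Orthogonal vectors that meet must also disagree somewhere. Many contradictions below
  arise in this way, from a circuit and a covector that follow the same sign vector and are both
  nonzero at \<open>g\<close> or \<open>f\<close>.\<close>

lemma orthogonal_agree:
  assumes "orthogonal X Y" "\<And>i. X i \<noteq> Zero \<Longrightarrow> Y i \<noteq> Zero \<Longrightarrow> Y i = X i"
  shows "X i = Zero \<or> Y i = Zero"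
  using assms unfolding orthogonal_iff by (metis opp_simps(2,5))

lemma orthogonal_disagreeD:
  "orthogonal X Y \<Longrightarrow> X i \<noteq> Zero \<Longrightarrow> Y i \<noteq> Zero \<Longrightarrow> \<exists>j. X j \<noteq> Zero \<and> Y j = opp (X j)"
  unfolding orthogonal_iff by blast

lemma orthogonal_sv_comp: "orthogonal X Y \<Longrightarrow> orthogonal X Z \<Longrightarrow> orthogonal X (sv_comp Y Z)"
  unfolding orthogonal_iff sv_comp_def by (smt (verit) opp_simps(2))

text \<open>This is the set of covectors (\<open>covectors_eq\<close>), described without
  cocircuits; Farkas' lemma produces its elements directly.\<close>

definition orth_space :: "'e om \<Rightarrow> 'e svec set" where
  "orth_space M = {Y. supp Y \<subseteq> ground M \<and> (\<forall>X \<in> circuits M. orthogonal X Y)}"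

section \<open>Farkas' lemma and elimination for covectors\<close>

context om
begin

lemma orth_space_neg: "Y \<in> orth_space M \<Longrightarrow> neg_svec Y \<in> orth_space M"
  by (simp add: orth_space_def)

lemma orth_space_comp: "Y \<in> orth_space M \<Longrightarrow> Z \<in> orth_space M \<Longrightarrow> sv_comp Y Z \<in> orth_space M"
  by (auto simp: orth_space_def orthogonal_sv_comp) (auto simp: in_supp sv_comp_def subset_iff split: if_splits)

lemma finite_orth: "Y \<in> orth_space M \<Longrightarrow> finite (supp Y)"
  using finite_ground by (auto simp: orth_space_def dest: finite_subset)

text \<open>One vector serves all elements at once: \<open>Y\<close> is \<open>c\<close> restricted
  to the set \<open>T\<close> of elements through which no circuit of the excluded kind passes. A
  circuit not orthogonal to \<open>Y\<close> would, up to sign, meet \<open>T\<close> and agree with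
  \<open>c\<close> there; \<open>key\<close> turns it into an excluded circuit.\<close>

lemma farkas_contract:
  assumes c: "\<And>i. i \<in> ground M \<Longrightarrow> c i \<noteq> Zero" and e: "e \<in> ground M - R"
    and no: "\<not> (\<exists>X \<in> circuits M. X e = c e \<and> (\<forall>i \<in> ground M - R. X i = Zero \<or> X i = c i))"
  shows "\<exists>Y \<in> orth_space M. Y e = c e \<and> (\<forall>i. Y i = Zero \<or> Y i = c i) \<and> (\<forall>i \<in> R. Y i = Zero)"
proof -
  define T where "T = {t \<in> ground M - R.
      \<not> (\<exists>X \<in> circuits M. X t = c t \<and> (\<forall>i \<in> ground M - R. X i = Zero \<or> X i = c i))}"
  define Y where "Y = (\<lambda>i. if i \<in> T then c i else Zero)"
  have eT: "e \<in> T" using e no by (auto simp: T_def)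
  have cT: "i \<in> T \<Longrightarrow> c i \<noteq> Zero" for i using c by (auto simp: T_def)
  \<comment> \<open>Wrong signs outside \<open>R\<close> lie outside \<open>T\<close>, and through
    each of them runs a conformal circuit \<open>W\<close>, which vanishes on all of
    \<open>T\<close> by the definition of \<open>T\<close>. Eliminating with \<open>W\<close>
    reduces the number of wrong signs, creates none on \<open>T\<close> and keeps the entry at
    \<open>t\<close>.\<close>
  have key: False if X: "X \<in> circuits M" and t: "t \<in> T" "X t = c t" and XT: "\<And>i. i \<in> T \<Longrightarrow> X i = Zero \<or> X i = c i" for X t
  proof -
    define bad where "bad X = {i \<in> ground M - R. X i = opp (c i)}" for X :: "'e svec"
    define Q where "Q X \<longleftrightarrow> X \<in> circuits M \<and> X t = c t \<and> (\<forall>i \<in> T. X i = Zero \<or> X i = c i)" for X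
    have "Q X" using X t XT by (auto simp: Q_def)
    then obtain X where QX: "Q X" and least: "\<And>X'. Q X' \<Longrightarrow> card (bad X) \<le> card (bad X')"
      using ex_has_least_nat[of Q X "\<lambda>X. card (bad X)"] by blast
    have "bad X = {}"
    proof (rule ccontr)
      assume "bad X \<noteq> {}"
      then obtain j where j: "j \<in> ground M - R" "X j = opp (c j)" by (auto simp: bad_def)
      have cj: "c j \<noteq> Zero" using c j by auto
      have "j \<notin> T" using QX j cT[of j] unfolding Q_def by (metis opp_simps(2,6))
      then obtain W where W: "W \<in> circuits M" "W j = c j" "\<And>i. i \<in> ground M - R \<Longrightarrow> W i = Zero \<or> W i = c i"
        using j unfolding T_def by blast
      have WT: "W i = Zero" if "i \<in> T" for i
        using that W unfolding T_def by blast
      have "j \<in> sep X W" using j W cj by (simp add: sep_def)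
      then obtain Z where Z: "Z \<in> circuits M" "Z j = Zero" "Z t = X t" "between X W Z"
        using strong_elim_zero[of X W j t] QX W(1) WT[OF t(1)] cT[OF t(1)] by (auto simp: Q_def)
      have "Q Z" unfolding Q_def using Z QX betweenD[OF Z(4)] WT unfolding Q_def by metis
      moreover have "bad Z \<subset> bad X"
      proof
        show "bad Z \<subseteq> bad X"
        proof
          fix i assume "i \<in> bad Z"
          then have i: "i \<in> ground M - R" "Z i = opp (c i)" by (auto simp: bad_def)
          then have "Z i \<noteq> Zero" "Z i \<noteq> W i" using W(3)[OF i(1)] c[of i] by auto
          then show "i \<in> bad X" using i betweenD[OF Z(4), of i] by (auto simp: bad_def)
        qed
        have "j \<in> bad X" "j \<notin> bad Z" using j Z(2) cj by (auto simp: bad_def)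
        then show "bad Z \<noteq> bad X" by blast
      qed
      then have "card (bad Z) < card (bad X)"
        using psubset_card_mono[of "bad X" "bad Z"] finite_ground by (auto simp: bad_def)
      ultimately show False using least[of Z] by simp
    qed
    then have "X i = Zero \<or> X i = c i" if "i \<in> ground M - R" for i
      using that sign_cases[of "c i" "X i"] c[of i] by (auto simp: bad_def)
    then show False using t QX unfolding T_def Q_def by auto
  qed
  have orth: "orthogonal X Y" if X: "X \<in> circuits M" for X
  proof (rule ccontr)
    assume no: "\<not> orthogonal X Y"
    then obtain t where t: "X t \<noteq> Zero" "Y t \<noteq> Zero"
      and no2: "\<not> ((\<exists>j. X j \<noteq> Zero \<and> Y j = X j) \<and> (\<exists>j. X j \<noteq> Zero \<and> Y j = opp (X j)))"
      unfolding orthogonal_iff by blast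
    have tT: "t \<in> T" using t by (auto simp: Y_def split: if_splits)
    show False
    proof (cases "\<exists>j. X j \<noteq> Zero \<and> Y j = opp (X j)")
      case False
      have X': "X i = Zero \<or> X i = c i" if "i \<in> T" for i
      proof -
        have "Y i = c i" using that by (simp add: Y_def)
        then show ?thesis using False sign_cases[of "X i" "c i"] cT[OF that] by metis
      qed
      then have "X t = c t" using tT t by blast
      then show False using key[OF X tT _ X'] by blast
    next
      case True
      then have nj: "\<not> (\<exists>j. X j \<noteq> Zero \<and> Y j = X j)" using no2 by blast
      have X': "neg_svec X i = Zero \<or> neg_svec X i = c i" if "i \<in> T" for i
      proof -
        have "Y i = c i" using that by (simp add: Y_def)
        then show ?thesis using nj sign_cases[of "X i" "c i"] cT[OF that] by (metis neg_apply opp_simps(1,2))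
      qed
      then have "neg_svec X t = c t" using tT t X'[of t] by (auto simp: neg_apply)
      then show False using key[OF circuit_neg[OF X] tT _ X'] by blast
    qed
  qed
  have "Y \<in> orth_space M"
    using orth by (auto simp: orth_space_def Y_def in_supp T_def split: if_splits)
  moreover have "Y i = Zero" if "i \<in> R" for i using that by (auto simp: Y_def T_def)
  ultimately show ?thesis using eT by (intro bexI[of _ Y]) (auto simp: Y_def)
qed

text \<open>The colouring form of Farkas' lemma: \<open>R\<close> is free for circuits and \<open>G\<close> is free for covectors.\<close>

lemma farkas:
  assumes "finite G"
    and "\<And>i. i \<in> ground M \<Longrightarrow> c i \<noteq> Zero" and "e \<in> ground M - R - G" and "R \<inter> G = {}"
    and "\<not> (\<exists>X \<in> circuits M. X e = c e \<and> (\<forall>i \<in> ground M - R - G. X i = Zero \<or> X i = c i) \<and> (\<forall>i \<in> G. X i = Zero))"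
  shows "\<exists>Y \<in> orth_space M. Y e = c e \<and> (\<forall>i \<in> ground M - R - G. Y i = Zero \<or> Y i = c i) \<and> (\<forall>i \<in> R. Y i = Zero)"
  using assms
proof (induction G arbitrary: c rule: finite_induct)
  case empty
  then show ?case using farkas_contract[of c e R] by auto
next
  case (insert g G)
  note no = insert.prems(4)
  have ge: "e \<noteq> g" using insert.prems by auto
  \<comment> \<open>The element \<open>g\<close> leaves \<open>G\<close> and receives a colour. One
    of the two colours must work: circuits that obstruct both have opposite signs at
    \<open>g\<close>, and eliminating \<open>g\<close> between them gives a circuit excluded by the
    hypothesis.\<close>
  have "\<exists>s. s \<noteq> Zero \<and> \<not> (\<exists>X \<in> circuits M. X e = c e \<and>
     (\<forall>i \<in> ground M - R - G. X i = Zero \<or> X i = (c(g := s)) i) \<and> (\<forall>i \<in> G. X i = Zero))"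
  proof (rule ccontr)
    assume "\<not> ?thesis"
    then have ex: "\<And>s. s \<noteq> Zero \<Longrightarrow> \<exists>X \<in> circuits M. X e = c e \<and>
     (\<forall>i \<in> ground M - R - G. X i = Zero \<or> X i = (c(g := s)) i) \<and> (\<forall>i \<in> G. X i = Zero)" by blast
    obtain X where X: "X \<in> circuits M" "X e = c e"
     "\<forall>i \<in> ground M - R - G. X i = Zero \<or> X i = (c(g := Pos)) i" "\<forall>i \<in> G. X i = Zero" using ex[of Pos] by auto
    obtain Y where Y: "Y \<in> circuits M" "Y e = c e"
     "\<forall>i \<in> ground M - R - G. Y i = Zero \<or> Y i = (c(g := Neg)) i" "\<forall>i \<in> G. Y i = Zero" using ex[of Neg] by auto
    have Xg: "X g \<noteq> Zero"
    proof
      assume "X g = Zero"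
      then have "\<exists>X \<in> circuits M. X e = c e \<and> (\<forall>i \<in> ground M - R - insert g G. X i = Zero \<or> X i = c i) \<and> (\<forall>i \<in> insert g G. X i = Zero)"
        using X by (intro bexI[of _ X]) auto
      then show False using no by blast
    qed
    have Yg: "Y g \<noteq> Zero"
    proof
      assume "Y g = Zero"
      then have "\<exists>X \<in> circuits M. X e = c e \<and> (\<forall>i \<in> ground M - R - insert g G. X i = Zero \<or> X i = c i) \<and> (\<forall>i \<in> insert g G. X i = Zero)"
        using Y by (intro bexI[of _ Y]) auto
      then show False using no by blast
    qed
    have gM: "g \<in> ground M - R - G" 
      using Xg circuit_svec[OF X(1)] insert.prems(3) insert.hyps by (auto simp: in_supp)
    have "X g = Pos" "Y g = Neg" using X(3) Y(3) gM Xg Yg by auto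
    then have "g \<in> sep X Y" by (simp add: sep_def)
    then obtain Z where Z: "Z \<in> circuits M" "Z g = Zero" "Z e = X e" "between X Y Z"
      using strong_elim[of X Y g e] X Y insert.prems(1)[of e] insert.prems(2) by auto
    have "Z i = Zero \<or> Z i = c i" if "i \<in> ground M - R - insert g G" for i
    proof -
      have "X i = Zero \<or> X i = c i" "Y i = Zero \<or> Y i = c i"
        using that X(3) Y(3) by (metis Diff_iff fun_upd_apply insertCI)+
      then show ?thesis using betweenD[OF Z(4), of i] by metis
    qed
    moreover have "Z i = Zero" if "i \<in> insert g G" for i
      using that betweenD[OF Z(4), of i] X(4) Y(4) Z(2) by auto
    moreover have "Z e = c e" using Z X(2) by simp
    ultimately show False using no Z(1) by blast
  qed
  then obtain s where s: "s \<noteq> Zero" "\<not> (\<exists>X \<in> circuits M. X e = (c(g := s)) e \<and>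
     (\<forall>i \<in> ground M - R - G. X i = Zero \<or> X i = (c(g := s)) i) \<and> (\<forall>i \<in> G. X i = Zero))"
    using ge by auto
  have "\<exists>Y \<in> orth_space M. Y e = (c(g := s)) e \<and> (\<forall>i \<in> ground M - R - G. Y i = Zero \<or> Y i = (c(g := s)) i) \<and> (\<forall>i \<in> R. Y i = Zero)"
    using insert.prems s by (intro insert.IH) auto
  then obtain Y where Y: "Y \<in> orth_space M" "Y e = c e" "\<forall>i \<in> ground M - R - G. Y i = Zero \<or> Y i = (c(g := s)) i" "\<forall>i \<in> R. Y i = Zero"
    using ge by auto
  have "Y i = Zero \<or> Y i = c i" if "i \<in> ground M - R - insert g G" for i
    using that Y(3) by (metis Diff_iff fun_upd_apply insertCI)
  then show ?case using Y by blast
qed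

text \<open>Farkas' lemma with \<open>e\<close> and the common zeros in \<open>R\<close>, so that
  the result vanishes there, and the rest of the separation set in \<open>G\<close>, where its sign
  is free. An obstructing circuit can disagree with \<open>Y1\<close> only at \<open>e\<close>;
  there it agrees with \<open>Y2\<close>, and no place remains at which it could disagree with
  \<open>Y2\<close>.\<close>

lemma orth_elim:
  assumes Y1: "Y1 \<in> orth_space M" and Y2: "Y2 \<in> orth_space M" and e: "e \<in> sep Y1 Y2"
    and f: "Y1 f \<noteq> Zero" "Y2 f = Zero \<or> Y2 f = Y1 f"
  shows "\<exists>Y \<in> orth_space M. Y e = Zero \<and> Y f = Y1 f \<and> between Y1 Y2 Y"
proof -
  define c where "c i = (if Y1 i \<noteq> Zero then Y1 i else if Y2 i \<noteq> Zero then Y2 i else Pos)" for i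
  define R where "R = insert e {i \<in> ground M. Y1 i = Zero \<and> Y2 i = Zero}"
  define G where "G = sep Y1 Y2 - {e}"
  have g: "supp Y1 \<subseteq> ground M" "supp Y2 \<subseteq> ground M" using Y1 Y2 by (auto simp: orth_space_def)
  have cn: "c i \<noteq> Zero" for i by (simp add: c_def)
  have fG: "f \<in> ground M - R - G" using f g e by (auto simp: R_def G_def sep_def in_supp)
  have RG: "R \<inter> G = {}" by (auto simp: R_def G_def sep_def)
  have finG: "finite G" using finite_orth[OF Y1] by (rule rev_finite_subset) (auto simp: G_def sep_def in_supp)
  have no: "\<not> (\<exists>X \<in> circuits M. X f = c f \<and> (\<forall>i \<in> ground M - R - G. X i = Zero \<or> X i = c i) \<and> (\<forall>i \<in> G. X i = Zero))"
  proof
    assume "\<exists>X \<in> circuits M. X f = c f \<and> (\<forall>i \<in> ground M - R - G. X i = Zero \<or> X i = c i) \<and> (\<forall>i \<in> G. X i = Zero)"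
    then obtain X where X: "X \<in> circuits M" "X f = c f" "\<And>i. i \<in> ground M - R - G \<Longrightarrow> X i = Zero \<or> X i = c i" "\<And>i. i \<in> G \<Longrightarrow> X i = Zero"
      by blast
    have Xg: "X i \<noteq> Zero \<Longrightarrow> i \<in> ground M" for i using circuit_svec[OF X(1)] by (auto simp: in_supp)
    have "orthogonal X Y1" "orthogonal X Y2" using X(1) Y1 Y2 by (auto simp: orth_space_def)
    have "X f \<noteq> Zero" using X(2) cn by simp
    obtain j where j: "X j \<noteq> Zero" "Y1 j = opp (X j)"
      using orthogonal_disagreeD[OF \<open>orthogonal X Y1\<close> \<open>X f \<noteq> Zero\<close> f(1)] by blast
    have "j = e"
    proof (rule ccontr)
      assume "j \<noteq> e"
      then have "j \<in> ground M - R - G" using j Xg X(4) by (auto simp: R_def)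
      then have "X j = c j" using X(3) j by blast
      then show False using j by (auto simp: c_def split: if_splits)
    qed
    then have Xe: "X e \<noteq> Zero" "Y2 e = X e" using e j by (auto simp: sep_def)
    obtain k where k: "X k \<noteq> Zero" "Y2 k = opp (X k)"
      using orthogonal_disagreeD[OF \<open>orthogonal X Y2\<close>, of e] Xe by auto
    have "k \<noteq> e" using k Xe by auto
    then have kk: "k \<in> ground M - R - G" using k Xg X(4) by (auto simp: R_def)
    then have "X k = c k" using X(3) k by blast
    moreover have "k \<notin> sep Y1 Y2" using kk \<open>k \<noteq> e\<close> by (auto simp: G_def)
    ultimately show False using k sign_cases[of "Y1 k" "Y2 k"] by (auto simp: c_def sep_def split: if_splits)
  qed
  obtain Y where Y: "Y \<in> orth_space M" "Y f = c f" "\<And>i. i \<in> ground M - R - G \<Longrightarrow> Y i = Zero \<or> Y i = c i" "\<And>i. i \<in> R \<Longrightarrow> Y i = Zero"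
    using farkas[OF finG cn fG RG no] by blast
  have "between Y1 Y2 Y" unfolding between_def
  proof
    fix i
    consider "i \<in> R" | "i \<in> G" | "i \<in> ground M - R - G" | "i \<notin> ground M" by blast
    then show "Y i = Zero \<or> Y i = Y1 i \<or> Y i = Y2 i"
    proof cases
      case 1 then show ?thesis using Y by auto
    next
      case 2 then show ?thesis using sign_cases[of "Y1 i" "Y i"] by (auto simp: G_def sep_def)
    next
      case 3 then show ?thesis using Y(3)[OF 3] by (auto simp: c_def R_def split: if_splits)
    next
      case 4 then show ?thesis using Y(1) by (auto simp: orth_space_def in_supp)
    qed
  qed
  then show ?thesis using Y f by (intro bexI[of _ Y]) (auto simp: R_def c_def)
qed

text \<open>These are the signed cocircuits (\<open>cocircuits_eq\<close>); minimality of the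
  support is the form in which they are used.\<close>

definition minimal_orth :: "'e svec \<Rightarrow> bool" where
  "minimal_orth V \<longleftrightarrow> V \<in> orth_space M \<and> supp V \<noteq> {} \<and> (\<forall>W \<in> orth_space M. supp W \<subset> supp V \<longrightarrow> supp W = {})"

text \<open>Among the conformal vectors through \<open>y\<close>, one with smallest support is
  minimal: a nonzero \<open>W\<close> with smaller support could be made to agree with
  \<open>V\<close> at \<open>y\<close> and then, by eliminating opposed signs, on its whole support,
  against the choice of \<open>V\<close>.\<close>

lemma conformal_minimal:
  assumes Y: "Y \<in> orth_space M" and y: "Y y \<noteq> Zero"
  shows "\<exists>V. minimal_orth V \<and> V y = Y y \<and> (\<forall>i. V i = Zero \<or> V i = Y i)"
proof -
  define Q where "Q V \<longleftrightarrow> V \<in> orth_space M \<and> V y = Y y \<and> (\<forall>i. V i = Zero \<or> V i = Y i)" for V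
  have "Q Y" using Y by (auto simp: Q_def)
  then obtain V where V: "Q V" and least: "\<And>V'. Q V' \<Longrightarrow> card (supp V) \<le> card (supp V')"
    using ex_has_least_nat[of Q Y "\<lambda>V. card (supp V)"] by blast
  have VM: "V \<in> orth_space M" and Vy: "V y \<noteq> Zero" using V y by (auto simp: Q_def)
  have "supp W = {}" if W: "W \<in> orth_space M" "supp W \<subset> supp V" for W
  proof (rule ccontr)
    assume ne: "supp W \<noteq> {}"
    define K where "K W \<longleftrightarrow> W \<in> orth_space M \<and> supp W \<subset> supp V \<and> W y = V y" for W
    \<comment> \<open>If \<open>W\<close> misses \<open>y\<close>, eliminating a common element of
      \<open>V\<close> and \<open>W\<close> gives a vector that keeps the entry of \<open>V\<close>
      at \<open>y\<close> and has lost that element from its support.\<close>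
    have "\<exists>W. K W"
    proof (cases "W y = Zero")
      case False
      then have "W y = V y \<or> neg_svec W y = V y" using sign_cases[of "V y" "W y"] Vy by (auto simp: neg_apply)
      then show ?thesis using W orth_space_neg[OF W(1)] unfolding K_def by (metis supp_neg)
    next
      case True
      obtain e where "e \<in> supp W" "e \<in> supp V" using ne W(2) by blast
      then have e: "W e \<noteq> Zero" "V e \<noteq> Zero" by (auto simp: in_supp)
      obtain W' where W': "W' \<in> orth_space M" "supp W' = supp W" "W' y = Zero" "e \<in> sep V W'"
      proof (cases "W e = opp (V e)")
        case True then show ?thesis using that[of W] W \<open>W y = Zero\<close> e by (auto simp: sep_def)
      next
        case False
        then have "W e = V e" using sign_cases[of "V e" "W e"] e by auto
        then show ?thesis using that[of "neg_svec W"] W orth_space_neg \<open>W y = Zero\<close> e by (auto simp: sep_def neg_apply)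
      qed
      obtain Z where Z: "Z \<in> orth_space M" "Z e = Zero" "Z y = V y" "between V W' Z"
        using orth_elim[OF VM W'(1) W'(4) Vy] W'(3) by blast
      have "supp Z \<subset> supp V" using between_supp[OF Z(4)] W'(2) W(2) Z(2) e(2) by (auto simp: in_supp)
      then show ?thesis using Z by (auto simp: K_def)
    qed
    then obtain W0 where "K W0" by blast
    then obtain W where KW: "K W" and lW: "\<And>W'. K W' \<Longrightarrow> card (sep V W) \<le> card (sep V W')"
      using ex_has_least_nat[of K W0 "\<lambda>W. card (sep V W)"] by blast
    have "sep V W = {}"
    proof (rule ccontr)
      assume "sep V W \<noteq> {}"
      then obtain e where e: "e \<in> sep V W" by blast
      obtain Z where Z: "Z \<in> orth_space M" "Z e = Zero" "Z y = V y" "between V W Z"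
        using orth_elim[OF VM _ e Vy, of ] KW unfolding K_def by metis
      have Ve: "V e \<noteq> Zero" using e by (auto simp: sep_def)
      have "K Z" using Z between_supp[OF Z(4)] KW Ve by (auto simp: K_def in_supp)
      moreover have "sep V Z \<subset> sep V W" using sep_between[OF Z(4)] Z(2) e by auto
      then have "card (sep V Z) < card (sep V W)"
      proof (intro psubset_card_mono)
        show "finite (sep V W)" by (rule finite_subset[OF _ finite_orth[OF VM]]) (auto simp: sep_def in_supp)
      qed
      ultimately show False using lW[of Z] by simp
    qed
    have "W i = Zero \<or> W i = V i" for i
    proof (cases "W i = Zero")
      case False
      then have "i \<in> supp V" using KW unfolding K_def by (metis in_supp psubsetD)
      then show ?thesis using \<open>sep V W = {}\<close> False sign_cases[of "V i" "W i"] by (auto simp: sep_def in_supp)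
    qed simp
    then have "Q W" using KW V unfolding Q_def K_def by metis
    moreover have "card (supp W) < card (supp V)" using KW finite_orth[OF VM] psubset_card_mono by (auto simp: K_def)
    ultimately show False using least[of W] by simp
  qed
  then have "minimal_orth V" using VM Vy by (auto simp: minimal_orth_def in_supp)
  then show ?thesis using V unfolding Q_def by blast
qed

section \<open>Bases and cocircuits of the underlying matroid\<close>

lemma indep_empty: "indep M {}"
  using circuit_nonzero by (auto simp: indep_def)

lemma indep_finite: "indep M S \<Longrightarrow> finite S"
  using finite_ground finite_subset by (auto simp: indep_def)

lemma indep_subset: "indep M S \<Longrightarrow> T \<subseteq> S \<Longrightarrow> indep M T"
  unfolding indep_def by blast

lemma indep_extend:
  assumes "indep M S" "S \<subseteq> T" "T \<subseteq> ground M"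
  shows "\<exists>b. S \<subseteq> b \<and> b \<subseteq> T \<and> indep M b \<and> (\<forall>y \<in> T - b. \<not> indep M (insert y b))"
proof -
  have fT: "finite T" using assms(3) finite_ground finite_subset by blast
  define K where "K b \<longleftrightarrow> S \<subseteq> b \<and> b \<subseteq> T \<and> indep M b" for b
  have "K S" using assms by (auto simp: K_def)
  moreover have "\<forall>b. K b \<longrightarrow> card b < Suc (card T)" using fT card_mono unfolding K_def by (metis le_imp_less_Suc)
  ultimately obtain b where b: "K b" "\<And>b'. K b' \<Longrightarrow> card b' \<le> card b"
    using ex_has_greatest_nat[of K S card "Suc (card T)"] by (metis less_imp_le)
  have "\<not> indep M (insert y b)" if "y \<in> T - b" for y
  proof
    assume "indep M (insert y b)"
    then have "K (insert y b)" using b(1) that by (auto simp: K_def)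
    then have "card (insert y b) \<le> card b" by (rule b(2))
    moreover have "finite b" using b(1) fT finite_subset by (auto simp: K_def)
    ultimately show False using that by simp
  qed
  then show ?thesis using b(1) unfolding K_def by blast
qed

lemma basis_iff: "basis M b \<longleftrightarrow> indep M b \<and> (\<forall>y \<in> ground M - b. \<not> indep M (insert y b))"
proof
  show "basis M b \<Longrightarrow> indep M b \<and> (\<forall>y \<in> ground M - b. \<not> indep M (insert y b))"
    unfolding basis_def by blast
  assume b: "indep M b \<and> (\<forall>y \<in> ground M - b. \<not> indep M (insert y b))"
  have "S = b" if S: "indep M S" "b \<subseteq> S" for S
  proof (rule ccontr)
    assume "S \<noteq> b"
    then obtain y where "y \<in> S - b" using S(2) by blast
    then have "indep M (insert y b)" "y \<in> ground M - b"
      using S indep_subset[OF S(1), of "insert y b"] by (auto simp: indep_def)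
    then show False using b by blast
  qed
  then show "basis M b" using b by (auto simp: basis_def)
qed

lemma basis_extend: "indep M S \<Longrightarrow> \<exists>b. S \<subseteq> b \<and> basis M b"
  using indep_extend[of S "ground M"] basis_iff by (auto simp: indep_def)

lemma dependent_insert:
  assumes "indep M b" "\<not> indep M (insert y b)" "y \<in> ground M"
  shows "\<exists>X \<in> circuits M. X y \<noteq> Zero \<and> supp X \<subseteq> insert y b"
proof -
  obtain X where X: "X \<in> circuits M" "supp X \<subseteq> insert y b" using assms by (auto simp: indep_def)
  moreover have "\<not> supp X \<subseteq> b" using X assms(1) by (auto simp: indep_def)
  ultimately have "y \<in> supp X" by blast
  then show ?thesis using X by (auto simp: in_supp)
qed

text \<open>The closure of \<open>b\<close> contains \<open>T\<close>, hence also the closure of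
  \<open>T\<close>: the elements of the circuit in \<open>T\<close> outside \<open>b\<close> are
  eliminated one at a time against their fundamental circuits, which avoid \<open>y\<close>.\<close>

lemma circuit_in_closure:
  assumes b: "indep M b" "\<And>y. y \<in> T - b \<Longrightarrow> \<not> indep M (insert y b)" and T: "T \<subseteq> ground M" "b \<subseteq> T"
    and X: "X \<in> circuits M" "X y \<noteq> Zero" "supp X \<subseteq> insert y T" and y: "y \<notin> T"
  shows "\<exists>X \<in> circuits M. X y \<noteq> Zero \<and> supp X \<subseteq> insert y b"
proof -
  define Q where "Q X \<longleftrightarrow> X \<in> circuits M \<and> X y \<noteq> Zero \<and> supp X \<subseteq> insert y T" for X
  have "Q X" using X by (auto simp: Q_def)
  then obtain X where QX: "Q X" and least: "\<And>X'. Q X' \<Longrightarrow> card (supp X - insert y b) \<le> card (supp X' - insert y b)"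
    using ex_has_least_nat[of Q X "\<lambda>X. card (supp X - insert y b)"] by blast
  have "supp X \<subseteq> insert y b"
  proof (rule ccontr)
    assume "\<not> supp X \<subseteq> insert y b"
    then obtain j where j: "j \<in> supp X" "j \<notin> insert y b" by blast
    then have jT: "j \<in> T - b" using QX by (auto simp: Q_def)
    obtain W where W: "W \<in> circuits M" "W j \<noteq> Zero" "supp W \<subseteq> insert j b"
      using dependent_insert[OF b(1) b(2)[OF jT]] jT T by blast
    have Wy: "W y = Zero" using W(3) y T(2) jT by (auto simp: in_supp)
    obtain W' where W': "W' \<in> circuits M" "j \<in> sep X W'" "supp W' = supp W" "W' y = Zero"
    proof (cases "W j = opp (X j)")
      case True then show ?thesis using that[of W] W j Wy by (auto simp: sep_def in_supp)
    next
      case False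
      then have "W j = X j" using sign_cases[of "X j" "W j"] W j by (auto simp: in_supp)
      then show ?thesis using that[of "neg_svec W"] W circuit_neg Wy j by (auto simp: sep_def neg_apply in_supp)
    qed
    have "X \<in> circuits M" "X y \<noteq> Zero" using QX by (auto simp: Q_def)
    then obtain Z where Z: "Z \<in> circuits M" "Z j = Zero" "Z y = X y" "between X W' Z"
      using strong_elim_zero[OF _ W'(1,2) _ W'(4)] by blast
    have ZS: "supp Z \<subseteq> supp X \<union> supp W" using between_supp[OF Z(4)] W'(3) by simp
    have "supp Z \<subseteq> insert y T" using QX ZS W(3) jT T(2) unfolding Q_def by blast
    then have "Q Z" using Z QX unfolding Q_def by metis
    moreover have "j \<notin> supp Z" using Z(2) by (simp add: in_supp)
    then have "supp Z - insert y b \<subset> supp X - insert y b" using ZS W(3) j by blast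
    then have "card (supp Z - insert y b) < card (supp X - insert y b)"
      using finite_circuit[of X] QX by (intro psubset_card_mono) (auto simp: Q_def)
    ultimately show False using least[of Z] by simp
  qed
  then show ?thesis using QX by (auto simp: Q_def)
qed

text \<open>Otherwise the fundamental circuit of an element of \<open>supp Y\<close> would meet
  \<open>Y\<close> in that element alone, which orthogonality forbids.\<close>

lemma orth_meets_basis:
  assumes "Y \<in> orth_space M" "supp Y \<noteq> {}" "basis M b"
  shows "supp Y \<inter> b \<noteq> {}"
proof
  assume e: "supp Y \<inter> b = {}"
  obtain y where y: "y \<in> supp Y" using assms by blast
  then have "y \<in> ground M - b" using assms(1) e by (auto simp: orth_space_def)
  then obtain X where X: "X \<in> circuits M" "X y \<noteq> Zero" "supp X \<subseteq> insert y b"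
    using assms(3) dependent_insert[of b y] basis_iff by blast
  have o: "orthogonal X Y" using X assms by (auto simp: orth_space_def)
  then obtain j where "X j \<noteq> Zero" "Y j = opp (X j)" "X y \<noteq> Zero" 
    using orthogonal_disagreeD[OF o X(2)] y X(2) by (auto simp: in_supp)
  moreover obtain k where "X k \<noteq> Zero" "Y k = X k"
    using o X(2) y unfolding orthogonal_iff in_supp by blast
  moreover have "i = y" if i: "X i \<noteq> Zero" "Y i \<noteq> Zero" for i
  proof -
    have "i \<in> supp X" "i \<in> supp Y" using i by (auto simp: in_supp)
    then show ?thesis using X(3) e by blast
  qed
  ultimately show False by (metis opp_simps(2,5))
qed

text \<open>If a proper subset \<open>D'\<close> met every basis, a maximal independent set off
  \<open>D'\<close> would not span. For an element \<open>y\<close> of \<open>D'\<close> outside its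
  closure, Farkas' lemma gives an orthogonal vector through \<open>y\<close> supported in
  \<open>D'\<close>, against minimality.\<close>

lemma minimal_orth_matroid_cocircuit:
  assumes V: "minimal_orth V"
  shows "matroid_cocircuit M (supp V)"
proof -
  have VM: "V \<in> orth_space M" "supp V \<noteq> {}" using V by (auto simp: minimal_orth_def)
  have "\<exists>b. basis M b \<and> D' \<inter> b = {}" if D': "D' \<subset> supp V" for D'
  proof (rule ccontr)
    assume no: "\<not> (\<exists>b. basis M b \<and> D' \<inter> b = {})"
    define T where "T = ground M - D'"
    obtain b where b: "b \<subseteq> T" "indep M b" "\<And>y. y \<in> T - b \<Longrightarrow> \<not> indep M (insert y b)"
      using indep_extend[OF indep_empty, of T] T_def by auto
    have "\<not> basis M b" using no b(1) by (auto simp: T_def)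
    then obtain y where y: "y \<in> ground M - b" "indep M (insert y b)" using basis_iff b by blast
    then have yD: "y \<in> D'" using b(3) by (auto simp: T_def)
    have fD: "finite (D' - {y})" using D' finite_orth[OF VM(1)] finite_subset by blast
    have no2: "\<not> (\<exists>X \<in> circuits M. X y = Pos \<and> (\<forall>i \<in> ground M - T - (D' - {y}). X i = Zero \<or> X i = Pos) \<and> (\<forall>i \<in> D' - {y}. X i = Zero))"
    proof
      assume "\<exists>X \<in> circuits M. X y = Pos \<and> (\<forall>i \<in> ground M - T - (D' - {y}). X i = Zero \<or> X i = Pos) \<and> (\<forall>i \<in> D' - {y}. X i = Zero)"
      then obtain X where X: "X \<in> circuits M" "X y = Pos" "\<forall>i \<in> D' - {y}. X i = Zero" by blast
      have "supp X \<subseteq> insert y T" using X(3) circuit_svec[OF X(1)] by (auto simp: T_def in_supp)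
      then have "\<exists>X \<in> circuits M. X y \<noteq> Zero \<and> supp X \<subseteq> insert y b"
        using X yD b by (intro circuit_in_closure[of b T X y]) (auto simp: T_def)
      then show False using y(2) by (auto simp: indep_def)
    qed
    have "y \<in> ground M - T - (D' - {y})" "T \<inter> (D' - {y}) = {}" using yD y by (auto simp: T_def)
    then have "\<exists>Y \<in> orth_space M. Y y = Pos \<and> (\<forall>i \<in> ground M - T - (D' - {y}). Y i = Zero \<or> Y i = Pos) \<and> (\<forall>i \<in> T. Y i = Zero)"
      using farkas[OF fD, where c = "\<lambda>_. Pos" and e = y and R = T] no2 by auto
    then obtain Y where Y: "Y \<in> orth_space M" "Y y = Pos" "\<forall>i \<in> T. Y i = Zero" by blast
    have "supp Y \<subseteq> D'" using Y by (auto simp: orth_space_def T_def in_supp)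
    then have "supp Y \<subset> supp V" using D' by blast
    then have "supp Y = {}" using V Y(1) by (auto simp: minimal_orth_def)
    then show False using Y(2) by (auto simp: supp_def)
  qed
  then show ?thesis
    using VM orth_meets_basis by (auto simp: matroid_cocircuit_def orth_space_def)
qed

text \<open>The matroid condition on the support amounts to minimality because every nonzero element
  of \<open>orth_space\<close> meets every basis.\<close>

lemma cocircuits_eq: "cocircuits M = {V. minimal_orth V}"
proof (rule subset_antisym; rule subsetI)
  fix V assume "V \<in> cocircuits M"
  then have V: "matroid_cocircuit M (supp V)" "\<forall>X \<in> circuits M. orthogonal X V" by (auto simp: cocircuits_def)
  obtain b where b: "basis M b" using basis_extend[OF indep_empty] by blast
  have "supp V \<noteq> {}" using V(1) b by (auto simp: matroid_cocircuit_def)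
  moreover have "V \<in> orth_space M" using V by (auto simp: orth_space_def matroid_cocircuit_def)
  moreover have "supp W = {}" if W: "W \<in> orth_space M" "supp W \<subset> supp V" for W
  proof -
    obtain b' where "basis M b'" "supp W \<inter> b' = {}" using V(1) W(2) unfolding matroid_cocircuit_def by metis
    then show ?thesis using orth_meets_basis[OF W(1)] by blast
  qed
  ultimately show "V \<in> {V. minimal_orth V}" by (simp add: minimal_orth_def)
next
  fix V assume "V \<in> {V. minimal_orth V}"
  then show "V \<in> cocircuits M"
    using minimal_orth_matroid_cocircuit by (auto simp: cocircuits_def minimal_orth_def orth_space_def)
qed

section \<open>Covectors, the dual and deletions\<close>

lemma cocircuit_orth: "V \<in> cocircuits M \<Longrightarrow> V \<in> orth_space M"
  by (simp add: cocircuits_eq minimal_orth_def)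

lemma zero_orth: "zero_svec \<in> orth_space M"
  by (auto simp: orth_space_def zero_svec_def supp_def orthogonal_iff)

lemma orth_conformal:
  "Y \<in> orth_space M \<Longrightarrow> Y y \<noteq> Zero \<Longrightarrow> \<exists>V \<in> cocircuits M. V y = Y y \<and> (\<forall>i. V i = Zero \<or> V i = Y i)"
  using conformal_minimal cocircuits_eq by auto

theorem covectors_eq: "covectors M = orth_space M"
proof
  show "covectors M \<subseteq> orth_space M"
  proof
    fix Y assume "Y \<in> covectors M"
    then show "Y \<in> orth_space M"
      by induction (auto intro: zero_orth orth_space_comp cocircuit_orth)
  qed
  show "orth_space M \<subseteq> covectors M"
  proof
    fix Y assume Y: "Y \<in> orth_space M"
    \<comment> \<open>Conformal cocircuits of \<open>Y\<close> are composed, one for each element of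
      the support; conformity makes the order of composition harmless.\<close>
    have "\<exists>Z \<in> covectors M. (\<forall>i \<in> A. Z i = Y i) \<and> (\<forall>i. Z i = Zero \<or> Z i = Y i)" if "finite A" for A
      using that
    proof (induction A)
      case empty
      then show ?case by (intro bexI[OF _ covectors.zero]) (auto simp: zero_svec_def)
    next
      case (insert y A)
      then obtain Z where Z: "Z \<in> covectors M" "\<forall>i \<in> A. Z i = Y i" "\<forall>i. Z i = Zero \<or> Z i = Y i" by blast
      show ?case
      proof (cases "Y y = Zero")
        case True
        then show ?thesis using Z by (intro bexI[OF _ Z(1)]) auto
      next
        case False
        then obtain V where V: "V \<in> cocircuits M" "V y = Y y" "\<forall>i. V i = Zero \<or> V i = Y i"
          using orth_conformal[OF Y] by blast
        have "sv_comp V Z \<in> covectors M" using covectors.comp V Z by blast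
        moreover have "\<forall>i \<in> insert y A. sv_comp V Z i = Y i" "\<forall>i. sv_comp V Z i = Zero \<or> sv_comp V Z i = Y i"
          using V Z False by (auto simp: sv_comp_def)
        ultimately show ?thesis by blast
      qed
    qed
    then obtain Z where Z: "Z \<in> covectors M" "\<forall>i \<in> supp Y. Z i = Y i" "\<forall>i. Z i = Zero \<or> Z i = Y i"
      using finite_orth[OF Y] by blast
    then have "Z = Y" unfolding in_supp Ball_def fun_eq_iff by metis
    then show "Y \<in> covectors M" using Z by simp
  qed
qed

text \<open>Eliminating between cocircuits gives an element of \<open>orth_space\<close>, and
  conformal decomposition gives a cocircuit below it. The danger is the zero vector, which is
  avoided by keeping an entry \<open>f\<close> at which \<open>X\<close> is not the negative of
  \<open>Y\<close>.\<close>

theorem dual_om: "oriented_matroid (dual M)"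
proof -
  have elim: "\<exists>Z \<in> cocircuits M.
           {i. Z i = Pos} \<subseteq> ({i. X i = Pos} \<union> {i. Y i = Pos}) - {e} \<and>
           {i. Z i = Neg} \<subseteq> ({i. X i = Neg} \<union> {i. Y i = Neg}) - {e}"
    if X: "X \<in> cocircuits M" and Y: "Y \<in> cocircuits M" and XY: "X \<noteq> neg_svec Y" "X e = Pos" "Y e = Neg" for X Y e
  proof -
    obtain f where f: "X f \<noteq> opp (Y f)" using XY(1) by (auto simp: neg_apply fun_eq_iff)
    obtain Z where Z: "Z \<in> orth_space M" "Z e = Zero" "Z f \<noteq> Zero" "between X Y Z"
    proof (cases "X f = Zero")
      case False
      then have "Y f = Zero \<or> Y f = X f" using f sign_cases[of "X f" "Y f"] by (metis opp_simps(1))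
      then show ?thesis
        using orth_elim[OF cocircuit_orth[OF X] cocircuit_orth[OF Y], of e f] XY False that by (auto simp: sep_def)
    next
      case True
      then have "Y f \<noteq> Zero" using f by auto
      then show ?thesis
        using orth_elim[OF cocircuit_orth[OF Y] cocircuit_orth[OF X], of e f] XY True that
        by (auto simp: sep_def between_commute)
    qed
    obtain V where V: "V \<in> cocircuits M" "\<And>i. V i = Zero \<or> V i = Z i" using orth_conformal[OF Z(1,3)] by blast
    have VB: "V i = Zero \<or> V i = X i \<or> V i = Y i" for i using V(2)[of i] betweenD[OF Z(4), of i] by auto
    have "V e = Zero" using V(2)[of e] Z(2) by auto
    then show ?thesis using V(1) VB by (intro bexI[of _ V]) (auto, (metis sign.distinct)+)
  qed
  \<comment> \<open>Vectors with equal supports that are neither equal nor opposite disagree at some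
    \<open>e\<close> and agree at some \<open>f\<close>; eliminating \<open>e\<close> while keeping
    \<open>f\<close> gives a smaller nonempty support.\<close>
  have inc: "X = Y \<or> X = neg_svec Y" if X: "X \<in> cocircuits M" and Y: "Y \<in> cocircuits M" and s: "supp X \<subseteq> supp Y" for X Y
  proof (rule ccontr)
    assume no: "\<not> (X = Y \<or> X = neg_svec Y)"
    have sXY: "supp X = supp Y" using X Y s by (auto simp: cocircuits_eq minimal_orth_def)
    have XM: "X \<in> orth_space M" and YM: "Y \<in> orth_space M" using X Y cocircuit_orth by auto
    obtain e where e: "X e \<noteq> Y e" using no by (auto simp: fun_eq_iff)
    then have "X e \<noteq> Zero" "Y e \<noteq> Zero" using sXY by (metis in_supp)+
    then have e2: "e \<in> sep X Y" using e sign_cases[of "X e" "Y e"] by (auto simp: sep_def)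
    obtain f where f: "X f \<noteq> opp (Y f)" using no by (auto simp: neg_apply fun_eq_iff)
    then have f2: "X f \<noteq> Zero" "Y f = X f"
      using sXY sign_cases[of "X f" "Y f"] by (metis in_supp opp_simps(1,2))+
    obtain Z where Z: "Z \<in> orth_space M" "Z e = Zero" "Z f = X f" "between X Y Z"
      using orth_elim[OF XM YM e2 f2(1)] f2 by auto
    have "supp Z \<subset> supp X" using between_supp[OF Z(4)] sXY e2 Z(2) by (auto simp: in_supp sep_def)
    then have "supp Z = {}" using X Z(1) by (auto simp: cocircuits_eq minimal_orth_def)
    then show False using Z(3) f2 by (auto simp: supp_def)
  qed
  have zero: "zero_svec \<notin> cocircuits M" by (auto simp: cocircuits_eq minimal_orth_def supp_def zero_svec_def)
  have sub: "cocircuits M \<subseteq> svecs (ground M)"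
    by (auto simp: cocircuits_eq minimal_orth_def orth_space_def svecs_def supp_def)
  have neg: "neg_svec X \<in> cocircuits M" if "X \<in> cocircuits M" for X
    using that by (simp add: cocircuits_def)
  show ?thesis unfolding oriented_matroid_def dual_def om.simps
    using finite_ground sub zero neg inc elim by blast
qed

theorem deletion_om: "oriented_matroid (deletion M e)"
proof -
  have elim: "\<exists>Z \<in> circuits M. Z e = Zero \<and>
           {i. Z i = Pos} \<subseteq> ({i. X i = Pos} \<union> {i. Y i = Pos}) - {a} \<and>
           {i. Z i = Neg} \<subseteq> ({i. X i = Neg} \<union> {i. Y i = Neg}) - {a}"
    if X: "X \<in> circuits M" "X e = Zero" and Y: "Y \<in> circuits M" "Y e = Zero" and XY: "X \<noteq> neg_svec Y" "X a = Pos" "Y a = Neg" for X Y a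
  proof -
    obtain Z where Z: "Z \<in> circuits M" 
           "{i. Z i = Pos} \<subseteq> ({i. X i = Pos} \<union> {i. Y i = Pos}) - {a}"
           "{i. Z i = Neg} \<subseteq> ({i. X i = Neg} \<union> {i. Y i = Neg}) - {a}"
      using om X Y XY unfolding oriented_matroid_def by metis
    moreover have "Z e = Zero" using Z(2,3) X Y by (cases "Z e") auto
    ultimately show ?thesis by blast
  qed
  have sub: "{X \<in> circuits M. X e = Zero} \<subseteq> svecs (ground M - {e})"
    using circuit_svec by (fastforce simp: svecs_def supp_def)
  have zero: "zero_svec \<notin> {X \<in> circuits M. X e = Zero}"
    using circuit_nonzero[of zero_svec] by (auto simp: supp_def zero_svec_def)
  have "finite (ground M - {e})" using finite_ground by simp
  then show ?thesis unfolding oriented_matroid_def deletion_def om.simps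
    using sub zero by (intro conjI ballI allI impI) (auto simp: circuit_neg neg_apply circuit_incomparable elim[unfolded Bex_def])
qed

section \<open>Rank, contraction and hyperplanes\<close>

lemma strong_elim_supp:
  assumes X: "X \<in> circuits M" and W: "W \<in> circuits M" and j: "X j \<noteq> Zero" "W j \<noteq> Zero"
    and y: "X y \<noteq> Zero" "W y = Zero"
  shows "\<exists>Z \<in> circuits M. Z j = Zero \<and> Z y \<noteq> Zero \<and> supp Z \<subseteq> supp X \<union> supp W"
proof -
  obtain W' where W': "W' \<in> circuits M" "j \<in> sep X W'" "supp W' = supp W" "W' y = Zero"
  proof (cases "W j = opp (X j)")
    case True then show ?thesis using that[of W] W j y by (auto simp: sep_def)
  next
    case False
    then have "W j = X j" using sign_cases[of "X j" "W j"] j by auto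
    then show ?thesis using that[of "neg_svec W"] W circuit_neg j y by (auto simp: sep_def neg_apply)
  qed
  obtain Z where Z: "Z \<in> circuits M" "Z j = Zero" "Z y = X y" "between X W' Z"
    using strong_elim_zero[OF X W'(1,2) y(1) W'(4)] by blast
  have "supp Z \<subseteq> supp X \<union> supp W" using between_supp[OF Z(4)] W'(3) by simp
  then show ?thesis using Z y by auto
qed

text \<open>Exchange argument: an element \<open>j\<close> of \<open>J\<close> outside
  \<open>I\<close> replaces an element \<open>i\<close> outside \<open>J\<close> of its fundamental
  circuit. The new set is again maximal independent in \<open>T\<close>, has the same size and
  contains one more element of \<open>J\<close>.\<close>

lemma indep_card_le:
  assumes "indep M I" "\<And>y. y \<in> T - I \<Longrightarrow> \<not> indep M (insert y I)" "I \<subseteq> T" "T \<subseteq> ground M" "indep M J" "J \<subseteq> T"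
  shows "card J \<le> card I"
  using assms(1-3)
proof (induction "card (J - I)" arbitrary: I rule: less_induct)
  case less
  have fin: "finite I" "finite J" using less.prems assms(5) indep_finite by auto
  show ?case
  proof (cases "J \<subseteq> I")
    case True then show ?thesis using fin card_mono by blast
  next
    case False
    then obtain j where j: "j \<in> J" "j \<notin> I" by blast
    have jT: "j \<in> T - I" using j assms(6) by blast
    obtain X where X: "X \<in> circuits M" "X j \<noteq> Zero" "supp X \<subseteq> insert j I"
      using dependent_insert[OF less.prems(1) less.prems(2)[OF jT]] jT assms(4) by blast
    have "\<not> supp X \<subseteq> J" using X(1) assms(5) by (auto simp: indep_def)
    then obtain i where i: "i \<in> supp X" "i \<notin> J" by blast
    then have iI: "i \<in> I" "i \<noteq> j" using X(3) j by auto
    have Xi: "X i \<noteq> Zero" using i by (simp add: in_supp)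
    define I' where "I' = insert j (I - {i})"
    have ind: "indep M I'"
    proof (rule ccontr)
      assume "\<not> indep M I'"
      moreover have "I' \<subseteq> ground M" using less.prems(3) assms(4) jT by (auto simp: I'_def)
      ultimately obtain W where W: "W \<in> circuits M" "supp W \<subseteq> I'" by (auto simp: indep_def)
      have "\<not> supp W \<subseteq> I" using W(1) less.prems(1) by (auto simp: indep_def)
      then have "j \<in> supp W" using W(2) by (auto simp: I'_def)
      moreover have "i \<notin> supp W" using W(2) iI by (auto simp: I'_def)
      ultimately obtain Z where Z: "Z \<in> circuits M" "Z j = Zero" "supp Z \<subseteq> supp X \<union> supp W"
        using strong_elim_supp[OF X(1) W(1) X(2) _ Xi] by (auto simp: in_supp)
      have "j \<notin> supp Z" using Z(2) by (simp add: in_supp)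
      then have "supp Z \<subseteq> I" using Z(3) X(3) W(2) by (auto simp: I'_def)
      then show False using Z(1) less.prems(1) by (auto simp: indep_def)
    qed
    have max: "\<not> indep M (insert y I')" if y: "y \<in> T - I'" for y
    proof (cases "y = i")
      case True
      then have "supp X \<subseteq> insert y I'" using X(3) by (auto simp: I'_def)
      then show ?thesis using X(1) by (auto simp: indep_def)
    next
      case False
      then have yI: "y \<in> T - I" "y \<noteq> j" using y by (auto simp: I'_def)
      obtain W where W: "W \<in> circuits M" "W y \<noteq> Zero" "supp W \<subseteq> insert y I"
        using dependent_insert[OF less.prems(1) less.prems(2)[OF yI(1)]] yI assms(4) by blast
      show ?thesis
      proof (cases "W i = Zero")
        case True
        then have "i \<notin> supp W" by (simp add: in_supp)
        then have "supp W \<subseteq> insert y I'" using W(3) by (auto simp: I'_def)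
        then show ?thesis using W(1) by (auto simp: indep_def)
      next
        case False
        have "y \<notin> supp X" using yI X(3) by blast
        then have "X y = Zero" by (simp add: in_supp)
        then obtain Z where Z: "Z \<in> circuits M" "Z i = Zero" "supp Z \<subseteq> supp W \<union> supp X"
          using strong_elim_supp[OF W(1) X(1) False Xi W(2)] by blast
        have "i \<notin> supp Z" using Z(2) by (simp add: in_supp)
        then have "supp Z \<subseteq> insert y I'" using Z(3) X(3) W(3) by (auto simp: I'_def)
        then show ?thesis using Z(1) by (auto simp: indep_def)
      qed
    qed
    have "J - I' \<subset> J - I" using j i by (auto simp: I'_def)
    then have "card (J - I') < card (J - I)" using fin by (intro psubset_card_mono) auto
    then have "card J \<le> card I'" using less.hyps ind max jT less.prems(3) by (auto simp: I'_def)
    also have "card I' = Suc (card (I - {i}))"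
      using j(2) fin by (simp add: I'_def del: card_Diff_singleton)
    also have "\<dots> = card I" using card_Suc_Diff1[OF fin(1) iI(1)] .
    finally show ?thesis .
  qed
qed

lemma basis_card_eq: "basis M b \<Longrightarrow> basis M b' \<Longrightarrow> card b = card b'"
  using indep_card_le[of b "ground M" b'] indep_card_le[of b' "ground M" b] unfolding basis_iff
  by (auto simp: indep_def intro: le_antisym)

lemma indep_card_le_basis: "basis M b \<Longrightarrow> indep M J \<Longrightarrow> card J \<le> card b"
  using indep_card_le[of b "ground M" J] unfolding basis_iff by (auto simp: indep_def)

lemma contraction_circuit_below:
  assumes "Y \<in> restr (ground M - {e}) ` circuits M - {zero_svec}"
  shows "\<exists>X \<in> circuits (contraction M e). supp X \<subseteq> supp Y"
proof -
  define R where "R = restr (ground M - {e}) ` circuits M - {zero_svec}"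
  have "\<exists>Z \<in> R. supp Z \<subseteq> supp Y \<and> (\<forall>Z' \<in> R. supp Z' \<subseteq> supp Y \<longrightarrow> card (supp Z) \<le> card (supp Z'))"
    using ex_has_least_nat[of "\<lambda>Z. Z \<in> R \<and> supp Z \<subseteq> supp Y" Y "\<lambda>Z. card (supp Z)"] assms
    by (auto simp: R_def)
  then obtain Z where Z: "Z \<in> R" "supp Z \<subseteq> supp Y" "\<And>Z'. Z' \<in> R \<Longrightarrow> supp Z' \<subseteq> supp Y \<Longrightarrow> card (supp Z) \<le> card (supp Z')"
    by blast
  have "\<not> supp Z' \<subset> supp Z" if "Z' \<in> R" for Z'
  proof
    assume s: "supp Z' \<subset> supp Z"
    have "finite (supp Z)"
      using Z(1) finite_ground by (auto simp: R_def supp_def restr_def)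
    then have "card (supp Z') < card (supp Z)" using s psubset_card_mono by blast
    moreover have "card (supp Z) \<le> card (supp Z')" using Z(2,3) that s by blast
    ultimately show False by simp
  qed
  then show ?thesis using Z(1,2) by (auto simp: contraction_def Let_def R_def)
qed

lemma supp_restr: "supp (restr A X) = supp X \<inter> A"
  by (auto simp: supp_def restr_def)

lemma restr_nonzero: "\<not> is_loop M e \<Longrightarrow> X \<in> circuits M \<Longrightarrow> restr (ground M - {e}) X \<noteq> zero_svec"
proof
  assume l: "\<not> is_loop M e" and X: "X \<in> circuits M" and z: "restr (ground M - {e}) X = zero_svec"
  have "supp (restr (ground M - {e}) X) = {}" using z by (auto simp: supp_def zero_svec_def)
  then have "supp X \<subseteq> {e}" using circuit_svec[OF X] by (auto simp: supp_restr)
  then have "supp X = {e}" using circuit_nonzero[OF X] by blast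
  then show False using l X by (auto simp: is_loop_def)
qed

lemma indep_contraction:
  assumes "\<not> is_loop M e" "e \<in> ground M"
  shows "indep (contraction M e) S \<longleftrightarrow> S \<subseteq> ground M - {e} \<and> indep M (insert e S)"
proof
  assume i: "indep (contraction M e) S"
  then have S: "S \<subseteq> ground M - {e}" by (auto simp: indep_def contraction_def Let_def)
  have "\<not> supp X \<subseteq> insert e S" if X: "X \<in> circuits M" for X
  proof
    assume s: "supp X \<subseteq> insert e S"
    obtain Y where "Y \<in> circuits (contraction M e)" and "supp Y \<subseteq> supp (restr (ground M - {e}) X)"
      using contraction_circuit_below[of "restr (ground M - {e}) X" e] restr_nonzero[OF assms(1) X] X by auto
    moreover have "supp (restr (ground M - {e}) X) \<subseteq> S" using s by (auto simp: supp_restr)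
    ultimately have "supp Y \<subseteq> S" by blast
    then show False using i \<open>Y \<in> circuits (contraction M e)\<close> by (auto simp: indep_def)
  qed
  then show "S \<subseteq> ground M - {e} \<and> indep M (insert e S)" using S assms(2) by (auto simp: indep_def)
next
  assume i: "S \<subseteq> ground M - {e} \<and> indep M (insert e S)"
  have "\<not> supp Y \<subseteq> S" if Y: "Y \<in> circuits (contraction M e)" for Y
  proof
    assume s: "supp Y \<subseteq> S"
    obtain X where X: "X \<in> circuits M" "Y = restr (ground M - {e}) X" using Y by (auto simp: contraction_def Let_def)
    then have "supp X \<subseteq> insert e S" using s circuit_svec[OF X(1)] by (auto simp: supp_restr)
    then show False using i X(1) by (auto simp: indep_def)
  qed
  then show "indep (contraction M e) S" using i by (auto simp: indep_def contraction_def Let_def)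
qed

text \<open>Contracting an element that is not a loop lowers the rank by one. With \<open>e\<close>
  taken to be \<open>g\<close>, this turns the \<open>d\<close> of the genericity conditions into
  the size of bases.\<close>

lemma basis_card:
  assumes e: "\<not> is_loop M e" "e \<in> ground M" and b: "basis M b"
  shows "card b = Suc (rank (contraction M e))"
proof -
  have "indep M {e}"
    using e circuit_nonzero by (auto simp: indep_def is_loop_def)
  then obtain b0 where b0: "{e} \<subseteq> b0" "basis M b0" using basis_extend by blast
  have fin: "finite b0" using b0 indep_finite by (auto simp: basis_def)
  have "rank (contraction M e) = card (b0 - {e})" unfolding rank_def
  proof (rule Max_eqI)
    show "finite (card ` {S. indep (contraction M e) S})"
    proof (rule finite_imageI, rule finite_subset)
      show "{S. indep (contraction M e) S} \<subseteq> Pow (ground M)" using indep_contraction[OF e] by auto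
    qed (simp add: finite_ground)
    have "insert e (b0 - {e}) = b0" "indep M b0" "b0 \<subseteq> ground M" using b0 by (auto simp: basis_def indep_def)
    then have "indep (contraction M e) (b0 - {e})" using indep_contraction[OF e, of "b0 - {e}"] by auto
    then show "card (b0 - {e}) \<in> card ` {S. indep (contraction M e) S}" by blast
    fix n assume "n \<in> card ` {S. indep (contraction M e) S}"
    then obtain S where S: "n = card S" "indep (contraction M e) S" by auto
    have S2: "e \<notin> S" "indep M (insert e S)" using S(2) unfolding indep_contraction[OF e] by blast+
    then have "card (insert e S) \<le> card b0" using indep_card_le_basis b0 by blast
    moreover have "finite S" using indep_finite[OF S2(2)] by simp
    ultimately show "n \<le> card (b0 - {e})" using S(1) S2(1) b0(1) fin by simp
  qed
  moreover have "card b0 = Suc (card (b0 - {e}))" using card_Suc_Diff1[OF fin, of e, symmetric] b0(1) by blast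
  ultimately show ?thesis using basis_card_eq[OF b b0(2)] by simp
qed

text \<open>The zero set of a cocircuit is a hyperplane. An element off it is not in its closure, by
  orthogonality; and if a further \<open>y\<close> could be added, Farkas' lemma would give a vector
  through \<open>e\<close> that vanishes on the zero set and at \<open>y\<close>, hence has a
  smaller support.\<close>

lemma hyperplane_basis:
  assumes V: "V \<in> cocircuits M" and e: "V e \<noteq> Zero"
    and I: "indep M I" "I \<subseteq> zeros (ground M) V" "\<And>y. y \<in> zeros (ground M) V - I \<Longrightarrow> \<not> indep M (insert y I)"
  shows "basis M (insert e I)" "e \<notin> I"
proof -
  define H where "H = zeros (ground M) V"
  have VM: "V \<in> orth_space M" using V cocircuit_orth by blast
  have eM: "e \<in> ground M" using VM e by (auto simp: orth_space_def in_supp)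
  have eH: "e \<notin> H" using e by (auto simp: H_def zeros_def in_supp)
  show eI: "e \<notin> I" using eH I(2) H_def by blast
  have ind: "indep M (insert e I)"
  proof (rule ccontr)
    assume "\<not> indep M (insert e I)"
    then obtain X where X: "X \<in> circuits M" "X e \<noteq> Zero" "supp X \<subseteq> insert e I"
      using dependent_insert[OF I(1) _ eM] by blast
    have o: "orthogonal X V" using X VM by (auto simp: orth_space_def)
    have only: "i = e" if i: "X i \<noteq> Zero" "V i \<noteq> Zero" for i
    proof -
      have "i \<in> supp X" "i \<notin> H" using i by (auto simp: in_supp H_def zeros_def)
      then show ?thesis using X(3) I(2) H_def by blast
    qed
    obtain j k where "X j \<noteq> Zero" "V j = opp (X j)" "X k \<noteq> Zero" "V k = X k"
      using o X(2) e unfolding orthogonal_iff by metis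
    then show False using only[of j] only[of k] by auto
  qed
  have "\<not> indep M (insert y (insert e I))" if y: "y \<in> ground M - insert e I" for y
  proof
    assume iy: "indep M (insert y (insert e I))"
    have yH: "y \<notin> H"
    proof
      assume "y \<in> H"
      then have "\<not> indep M (insert y I)" using I(3) y by (auto simp: H_def)
      moreover have "indep M (insert y I)" by (rule indep_subset[OF iy]) auto
      ultimately show False by blast
    qed
    define T where "T = insert y H"
    have fG: "finite (ground M - T - {e})" using finite_ground by simp
    have no: "\<not> (\<exists>X \<in> circuits M. X e = Pos \<and> (\<forall>i \<in> ground M - T - (ground M - T - {e}). X i = Zero \<or> X i = Pos) \<and> (\<forall>i \<in> ground M - T - {e}. X i = Zero))"
    proof
      assume "\<exists>X \<in> circuits M. X e = Pos \<and> (\<forall>i \<in> ground M - T - (ground M - T - {e}). X i = Zero \<or> X i = Pos) \<and> (\<forall>i \<in> ground M - T - {e}. X i = Zero)"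
      then obtain X where X: "X \<in> circuits M" "X e = Pos" "\<forall>i \<in> ground M - T - {e}. X i = Zero" by blast
      have "supp X \<subseteq> insert e T"
      proof
        fix i assume "i \<in> supp X"
        then have "i \<in> ground M" "X i \<noteq> Zero" using circuit_svec[OF X(1)] by (auto simp: in_supp)
        then show "i \<in> insert e T" using X(3) by blast
      qed
      moreover have "\<not> indep M (insert z (insert y I))" if z: "z \<in> T - insert y I" for z
      proof
        assume "indep M (insert z (insert y I))"
        then have "indep M (insert z I)" by (rule indep_subset) auto
        then show False using I(3)[of z] z by (auto simp: T_def H_def)
      qed
      moreover have "indep M (insert y I)" by (rule indep_subset[OF iy]) auto
      moreover have "T \<subseteq> ground M" "insert y I \<subseteq> T" "e \<notin> T" using y I(2) eH by (auto simp: T_def H_def zeros_def)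
      ultimately have "\<exists>X \<in> circuits M. X e \<noteq> Zero \<and> supp X \<subseteq> insert e (insert y I)"
        using X by (intro circuit_in_closure[of "insert y I" T X e]) auto
      then show False using iy by (auto simp: indep_def insert_commute)
    qed
    have "e \<in> ground M - T - (ground M - T - {e})" "T \<inter> (ground M - T - {e}) = {}"
      using eM eH y by (auto simp: T_def)
    then have "\<exists>Y \<in> orth_space M. Y e = Pos \<and> (\<forall>i \<in> ground M - T - (ground M - T - {e}). Y i = Zero \<or> Y i = Pos) \<and> (\<forall>i \<in> T. Y i = Zero)"
      using farkas[OF fG, where c = "\<lambda>_. Pos" and e = e and R = T] no by auto
    then obtain Y where Y: "Y \<in> orth_space M" "Y e = Pos" "\<forall>i \<in> T. Y i = Zero" by blast
    have YM: "supp Y \<subseteq> ground M" using Y(1) by (simp add: orth_space_def)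
    have "supp Y \<inter> T = {}" using Y(3) by (auto simp: in_supp)
    then have "supp Y \<subseteq> supp V - {y}" using YM by (auto simp: T_def H_def zeros_def)
    moreover have "y \<in> supp V" using yH y by (auto simp: H_def zeros_def)
    ultimately have "supp Y \<subset> supp V" by blast
    then have "supp Y = {}" using V Y(1) by (auto simp: cocircuits_eq minimal_orth_def)
    then show False using Y(2) by (auto simp: supp_def)
  qed
  then show "basis M (insert e I)" using ind by (auto simp: basis_iff)
qed

text \<open>Stated for an abstract \<open>bad\<close> so that it serves both the program and its
  dual: with \<open>h = g\<close> badness is infeasibility, with \<open>h = f\<close> in the dual it
  is unboundedness. A full sign vector fails to be orthogonal to a circuit exactly if it agrees with
  the circuit or its negative on the support, and this is the situation of
  \<open>bad2\<close>.\<close>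

lemma topes_at:
  assumes h: "h \<in> ground M"
    and bad1: "\<And>\<alpha>. supp \<alpha> = ground M - {h} \<Longrightarrow> bad \<alpha> \<Longrightarrow> \<alpha>(h := Pos) \<notin> orth_space M"
    and bad2: "\<And>\<alpha> Z. supp \<alpha> = ground M - {h} \<Longrightarrow> Z \<in> circuits M \<Longrightarrow> (\<And>i. Z i = Zero \<or> Z i = (\<alpha>(h := Pos)) i) \<Longrightarrow> bad \<alpha>"
    and noloop: "\<And>i. i \<in> ground M - {h} \<Longrightarrow> \<not> is_loop M i"
  shows "restr (ground M - {h}) ` {T \<in> topes M. T h = Pos} = {\<alpha>. supp \<alpha> = ground M - {h} \<and> \<not> bad \<alpha>}"
proof (rule subset_antisym; rule subsetI)
  fix \<alpha> assume "\<alpha> \<in> restr (ground M - {h}) ` {T \<in> topes M. T h = Pos}"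
  then obtain T where T: "T \<in> topes M" "T h = Pos" "\<alpha> = restr (ground M - {h}) T" by blast
  have TM: "T \<in> orth_space M" using T by (simp add: topes_def covectors_eq)
  \<comment> \<open>Since \<open>i\<close> is not a loop, Farkas' lemma gives a covector that is
    nonzero at \<open>i\<close>; composing with it would enlarge the tope.\<close>
  have full: "T i \<noteq> Zero" if i: "i \<in> ground M - {h}" for i
  proof
    assume Ti: "T i = Zero"
    have fG: "finite (ground M - {i})" using finite_ground by simp
    have no: "\<not> (\<exists>X \<in> circuits M. X i = Pos \<and> (\<forall>k \<in> ground M - {} - (ground M - {i}). X k = Zero \<or> X k = Pos) \<and> (\<forall>k \<in> ground M - {i}. X k = Zero))"
    proof
      assume "\<exists>X \<in> circuits M. X i = Pos \<and> (\<forall>k \<in> ground M - {} - (ground M - {i}). X k = Zero \<or> X k = Pos) \<and> (\<forall>k \<in> ground M - {i}. X k = Zero)"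
      then obtain X where X: "X \<in> circuits M" "X i = Pos" "\<forall>k \<in> ground M - {i}. X k = Zero" by blast
      have "supp X = {i}"
      proof
        show "supp X \<subseteq> {i}"
        proof
          fix k assume "k \<in> supp X"
          then have "k \<in> ground M" "X k \<noteq> Zero" using circuit_svec[OF X(1)] by (auto simp: in_supp)
          then show "k \<in> {i}" using X(3) by blast
        qed
      qed (use X(2) in \<open>simp add: in_supp\<close>)
      then show False using noloop[OF i] X(1) by (auto simp: is_loop_def)
    qed
    have "\<exists>Y \<in> orth_space M. Y i = Pos \<and> (\<forall>k \<in> ground M - {} - (ground M - {i}). Y k = Zero \<or> Y k = Pos) \<and> (\<forall>k \<in> {}. Y k = Zero)"
      using farkas[OF fG, where c = "\<lambda>_. Pos" and e = i and R = "{}"] no i by auto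
    then obtain Y where Y: "Y \<in> orth_space M" "Y i = Pos" by blast
    have "sv_comp T Y \<in> covectors M" using orth_space_comp[OF TM Y(1)] covectors_eq by simp
    moreover have "is_face T (sv_comp T Y)" by (auto simp: is_face_def sv_comp_def fun_eq_iff)
    ultimately have "sv_comp T Y = T" using T(1) by (auto simp: topes_def)
    then have "sv_comp T Y i = T i" by simp
    then show False using Ti Y(2) by (simp add: sv_comp_def)
  qed
  have s: "supp \<alpha> = ground M - {h}" unfolding T(3) supp_restr using full by (auto simp: in_supp)
  have "\<alpha>(h := Pos) = T"
  proof
    fix i
    have "T i = Zero" if "i \<notin> ground M" using that TM by (auto simp: orth_space_def in_supp)
    then show "(\<alpha>(h := Pos)) i = T i" using T(2,3) by (auto simp: restr_def)
  qed
  then have "\<not> bad \<alpha>" using bad1[OF s] TM by auto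
  then show "\<alpha> \<in> {\<alpha>. supp \<alpha> = ground M - {h} \<and> \<not> bad \<alpha>}" using s by simp
next
  fix \<alpha> assume "\<alpha> \<in> {\<alpha>. supp \<alpha> = ground M - {h} \<and> \<not> bad \<alpha>}"
  then have s: "supp \<alpha> = ground M - {h}" and nb: "\<not> bad \<alpha>" by auto
  define T where "T = \<alpha>(h := Pos)"
  have sT: "supp T = ground M" using s h by (auto simp: T_def supp_def)
  have "orthogonal Z T" if Z: "Z \<in> circuits M" for Z
  proof (rule ccontr)
    assume "\<not> orthogonal Z T"
    then have no2: "\<not> ((\<exists>j. Z j \<noteq> Zero \<and> T j = Z j) \<and> (\<exists>j. Z j \<noteq> Zero \<and> T j = opp (Z j)))"
      unfolding orthogonal_iff by blast
    have TZ: "T i \<noteq> Zero" if "Z i \<noteq> Zero" for i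
      using that circuit_svec[OF Z] sT by (metis in_supp subsetD)
    have "(\<forall>i. Z i = Zero \<or> Z i = T i) \<or> (\<forall>i. neg_svec Z i = Zero \<or> neg_svec Z i = T i)"
      using no2 TZ sign_cases unfolding neg_apply by (metis opp_simps(1))
    then show False using bad2[OF s Z] bad2[OF s circuit_neg[OF Z]] nb unfolding T_def by blast
  qed
  then have TM: "T \<in> orth_space M" using sT by (auto simp: orth_space_def)
  have "Z = T" if "Z \<in> covectors M" "is_face T Z" for Z
  proof
    fix i
    have "supp Z \<subseteq> ground M" using that(1) by (auto simp: covectors_eq orth_space_def)
    then have "T i = Zero \<Longrightarrow> Z i = Zero" using sT by (auto simp: supp_def)
    moreover have "sv_comp T Z i = Z i" using that(2) by (simp add: is_face_def)
    ultimately show "Z i = T i" by (auto simp: sv_comp_def split: if_splits)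
  qed
  then have "T \<in> topes M" using TM by (auto simp: topes_def covectors_eq)
  moreover have "restr (ground M - {h}) T = \<alpha>"
  proof
    fix i
    have "i \<notin> ground M - {h} \<Longrightarrow> \<alpha> i = Zero" using s in_supp by metis
    then show "restr (ground M - {h}) T i = \<alpha> i" by (auto simp: restr_def T_def)
  qed
  ultimately show "\<alpha> \<in> restr (ground M - {h}) ` {T \<in> topes M. T h = Pos}"
    by (intro image_eqI[of _ _ T]) (auto simp: T_def)
qed

end

section \<open>Generic programs\<close>

lemma is_face_iff: "is_face X Y \<longleftrightarrow> (\<forall>i. X i = Zero \<or> X i = Y i)"
  by (auto simp: is_face_def sv_comp_def fun_eq_iff)

locale generic_program =
  fixes P :: "'e program"
  assumes prog: "program P" and gen: "generic P"
begin

abbreviation "E \<equiv> elts P"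
abbreviation "M \<equiv> mat P"
abbreviation "g \<equiv> gelt P"
abbreviation "f \<equiv> felt P"
abbreviation "d \<equiv> rank (M_of P)"

sublocale om M using prog by unfold_locales (simp add: program_def)
sublocale N: om "N_of P" unfolding N_of_def by unfold_locales (rule deletion_om)
sublocale D: om "dual M" by unfold_locales (rule dual_om)

lemma gf: "g \<in> ground M" "f \<in> ground M" "g \<noteq> f" "f \<noteq> g" "\<not> is_loop M g" "\<not> is_coloop M f"
  using prog by (auto simp: program_def)

lemma ground_N: "ground (N_of P) = ground M - {f}" by (simp add: N_of_def deletion_def)
lemma circuits_N: "circuits (N_of P) = {X \<in> circuits M. X f = Zero}" by (simp add: N_of_def deletion_def)
lemma E_eq: "ground (N_of P) - {g} = E" "ground M = insert g (insert f E)" "g \<notin> E" "f \<notin> E"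
  using gf by (auto simp: ground_N elts_def)

lemma finite_E: "finite E" using finite_ground by (simp add: elts_def)

lemma orth_N: "Y \<in> orth_space (N_of P) \<longleftrightarrow> supp Y \<subseteq> insert g E \<and> (\<forall>X \<in> circuits M. X f = Zero \<longrightarrow> orthogonal X Y)"
proof -
  have "ground (N_of P) = insert g E" using gf by (auto simp: ground_N elts_def)
  then show ?thesis by (auto simp: orth_space_def circuits_N)
qed

lemma g_not_loop_N: "\<not> is_loop (N_of P) g" "g \<in> ground (N_of P)"
  using gf by (auto simp: is_loop_def circuits_N ground_N)

lemma indep_N: "indep (N_of P) S \<longleftrightarrow> indep M S \<and> f \<notin> S"
proof -
  have "X f = Zero" if "supp X \<subseteq> S" "f \<notin> S" for X :: "'e svec" using that by (auto simp: in_supp)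
  then show ?thesis unfolding indep_def ground_N circuits_N by blast
qed

lemma basis_N_card: "basis (N_of P) b \<Longrightarrow> card b = Suc d"
  using N.basis_card[OF g_not_loop_N] by (simp add: M_of_def N_of_def)

text \<open>As \<open>f\<close> is not a coloop, some basis avoids it, and deleting \<open>f\<close>
  keeps the rank.\<close>

lemma basis_M_card:
  assumes "basis M b" shows "card b = Suc d"
proof -
  have "\<exists>b. basis M b \<and> f \<notin> b"
  proof (rule ccontr)
    assume no: "\<not> (\<exists>b. basis M b \<and> f \<notin> b)"
    \<comment> \<open>If \<open>f\<close> lay in every basis, no circuit would contain
      \<open>f\<close>, so the unit vector at \<open>f\<close> would be a cocircuit and
      \<open>f\<close> a coloop.\<close>
    define Y where "Y = (\<lambda>i. if i = f then Pos else Zero)"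
    have sY: "supp Y = {f}" by (auto simp: Y_def supp_def)
    have "X f = Zero" if X: "X \<in> circuits M" for X
    proof (rule ccontr)
      assume Xf: "X f \<noteq> Zero"
      have "indep M (supp X - {f})"
      proof (rule ccontr)
        assume "\<not> indep M (supp X - {f})"
        then obtain W where W: "W \<in> circuits M" "supp W \<subseteq> supp X - {f}"
          using circuit_svec[OF X] by (auto simp: indep_def)
        then have "W = X \<or> W = neg_svec X" using circuit_incomparable[OF W(1) X] by blast
        then have "supp W = supp X" by auto
        then show False using W(2) Xf by (auto simp: in_supp)
      qed
      then obtain b where b: "supp X - {f} \<subseteq> b" "basis M b" using basis_extend by blast
      then have "supp X \<subseteq> b" using no by blast
      then show False using b X by (auto simp: basis_def indep_def)
    qed
    then have "Y \<in> orth_space M" using gf sY by (auto simp: orth_space_def orthogonal_iff Y_def)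
    then have "minimal_orth Y" using sY by (auto simp: minimal_orth_def)
    then have "is_loop (dual M) f" using sY cocircuits_eq by (auto simp: is_loop_def dual_def)
    then show False using gf by (simp add: is_coloop_def)
  qed
  then obtain b' where b': "basis M b'" "f \<notin> b'" by blast
  then have "basis (N_of P) b'"
    unfolding basis_iff N.basis_iff using indep_N by (auto simp: ground_N)
  then show ?thesis using basis_N_card basis_card_eq[OF assms b'(1)] by simp
qed

text \<open>First genericity condition. If no circuit through \<open>g\<close> were supported in
  \<open>insert g (supp Z)\<close>, Farkas' lemma would give a cocircuit \<open>V\<close> of
  \<open>N_of P\<close> with \<open>V g = Pos\<close> that vanishes on \<open>supp Z\<close>. Its
  zero set is a hyperplane, of rank \<open>d\<close>, and contains a dependent set, so it has more
  than \<open>d\<close> elements. The signs of the circuit are corrected by eliminations with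
  \<open>Z\<close>, which keep the entry at \<open>g\<close> because \<open>Z\<close> vanishes
  there.\<close>

lemma circuit_through_g:
  assumes Z: "Z \<in> circuits M" "Z f = Zero" "Z g = Zero"
  shows "\<exists>W \<in> circuits M. W g = Pos \<and> W f = Zero \<and> (\<forall>i. i \<noteq> g \<longrightarrow> W i = Zero \<or> W i = Z i)"
proof -
  have ZN: "Z \<in> circuits (N_of P)" using Z by (simp add: circuits_N)
  have "\<exists>W \<in> circuits M. W g = Pos \<and> W f = Zero \<and> supp W \<subseteq> insert g (supp Z)"
  proof (rule ccontr)
    assume no: "\<not> ?thesis"
    define G where "G = ground (N_of P) - supp Z - {g}"
    have fG: "finite G" using N.finite_ground by (simp add: G_def)
    have no2: "\<not> (\<exists>X \<in> circuits (N_of P). X g = Pos \<and> (\<forall>i \<in> ground (N_of P) - supp Z - G. X i = Zero \<or> X i = Pos) \<and> (\<forall>i \<in> G. X i = Zero))"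
    proof
      assume "\<exists>X \<in> circuits (N_of P). X g = Pos \<and> (\<forall>i \<in> ground (N_of P) - supp Z - G. X i = Zero \<or> X i = Pos) \<and> (\<forall>i \<in> G. X i = Zero)"
      then obtain X where X: "X \<in> circuits (N_of P)" "X g = Pos" "\<forall>i \<in> G. X i = Zero" by blast
      have "supp X \<subseteq> insert g (supp Z)"
      proof
        fix i assume "i \<in> supp X"
        then have "i \<in> ground (N_of P)" "X i \<noteq> Zero" using N.circuit_svec[OF X(1)] by (auto simp: in_supp)
        then show "i \<in> insert g (supp Z)" using X(3) unfolding G_def by blast
      qed
      then show False using no X by (auto simp: circuits_N)
    qed
    have "g \<notin> supp Z" using Z by (simp add: in_supp)
    then have "\<exists>Y \<in> orth_space (N_of P). Y g = Pos \<and> (\<forall>i \<in> ground (N_of P) - supp Z - G. Y i = Zero \<or> Y i = Pos) \<and> (\<forall>i \<in> supp Z. Y i = Zero)"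
      using N.farkas[OF fG, where c = "\<lambda>_. Pos" and e = g and R = "supp Z"] no2 g_not_loop_N(2) by (auto simp: G_def)
    then obtain Y where Y: "Y \<in> orth_space (N_of P)" "Y g = Pos" "\<forall>i \<in> supp Z. Y i = Zero" by blast
    obtain V where V: "V \<in> cocircuits (N_of P)" "V g = Pos" "\<And>i. V i = Zero \<or> V i = Y i"
      using N.orth_conformal[OF Y(1), of g] Y(2) by auto
    define H where "H = zeros (ground (N_of P)) V"
    have "\<not> card H > d" using gen V(1,2) by (auto simp: generic_def H_def)
    moreover have "card H > d"
    proof -
      have HM: "H \<subseteq> ground (N_of P)" "finite H" using N.finite_ground by (auto simp: H_def zeros_def)
      obtain I where I: "I \<subseteq> H" "indep (N_of P) I" "\<forall>y \<in> H - I. \<not> indep (N_of P) (insert y I)"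
        using N.indep_extend[OF N.indep_empty _ HM(1)] by auto
      have b: "basis (N_of P) (insert g I)" "g \<notin> I"
        using N.hyperplane_basis[OF V(1) _ I(2), of g] V(2) I(1,3) by (auto simp: H_def)
      have "card I = d" using basis_N_card[OF b(1)] b(2) N.indep_finite[OF I(2)] by simp
      have "V i = Zero" if "i \<in> supp Z" for i using V(3)[of i] Y(3) that by auto
      then have "supp Z \<subseteq> H" using N.circuit_svec[OF ZN] by (auto simp: H_def zeros_def in_supp)
      moreover have "\<not> supp Z \<subseteq> I" using I(2) ZN by (auto simp: indep_def)
      ultimately have "I \<subset> H" using I(1) by blast
      then show ?thesis using \<open>card I = d\<close> psubset_card_mono[OF HM(2), of I] by simp
    qed
    ultimately show False by blast
  qed
  then obtain W0 where W0: "W0 \<in> circuits M" "W0 g = Pos" "W0 f = Zero" "supp W0 \<subseteq> insert g (supp Z)" by blast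
  define Q where "Q W \<longleftrightarrow> W \<in> circuits M \<and> W g = Pos \<and> W f = Zero \<and> supp W \<subseteq> insert g (supp Z)" for W
  have "Q W0" using W0 by (simp add: Q_def)
  then obtain W where W: "Q W" "\<And>W'. Q W' \<Longrightarrow> card (sep W Z) \<le> card (sep W' Z)"
    using ex_has_least_nat[of Q W0 "\<lambda>W. card (sep W Z)"] by blast
  have "sep W Z = {}"
  proof (rule ccontr)
    assume "sep W Z \<noteq> {}"
    then obtain j where j: "j \<in> sep W Z" by blast
    have "W \<in> circuits M" "W g \<noteq> Zero" using W(1) by (auto simp: Q_def)
    then obtain W' where W': "W' \<in> circuits M" "W' j = Zero" "W' g = W g" "between W Z W'"
      using strong_elim_zero[OF _ Z(1) j _ Z(3)] by blast
    have "W' f = Zero" using betweenD[OF W'(4), of f] W(1) Z(2) by (auto simp: Q_def)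
    moreover have "supp W' \<subseteq> insert g (supp Z)" using between_supp[OF W'(4)] W(1) unfolding Q_def by blast
    ultimately have "Q W'" using W' W(1) by (simp add: Q_def)
    moreover have "sep W' Z \<subset> sep W Z" using sep_between'(2)[OF W'(4)] j W'(2) by blast
    moreover have "finite (sep W Z)"
      by (rule finite_subset[OF _ finite_circuit[OF Z(1)]]) (auto simp: sep_def in_supp)
    ultimately show False using W(2)[of W'] psubset_card_mono[of "sep W Z" "sep W' Z"] by simp
  qed
  have "W i = Zero \<or> W i = Z i" if "i \<noteq> g" for i
  proof (cases "W i = Zero")
    case False
    then have "i \<in> supp Z" using W(1) that unfolding Q_def in_supp by (metis in_supp insertE subsetD)
    then show ?thesis using \<open>sep W Z = {}\<close> False sign_cases[of "W i" "Z i"] by (auto simp: sep_def in_supp)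
  qed simp
  then show ?thesis using W(1) by (auto simp: Q_def)
qed

text \<open>Second genericity condition. Otherwise Farkas' lemma gives a circuit through
  \<open>f\<close> disjoint from \<open>Z\<close>; one that is minimal apart from \<open>g\<close>
  restricts to a circuit \<open>C\<close> of the contraction. Genericity gives \<open>C\<close> at
  least \<open>d + 1\<close> elements. Exchanging \<open>f\<close> for \<open>g\<close> in its
  support yields an independent set of the same size inside the zero set of \<open>Z\<close>, a
  hyperplane of rank \<open>d\<close>.\<close>

lemma covector_through_f:
  assumes Z: "Z \<in> cocircuits M" "Z f = Zero" "Z g = Zero"
  shows "\<exists>W \<in> orth_space M. W f = Pos \<and> W g = Zero \<and> supp W \<subseteq> insert f (supp Z)"
proof (rule ccontr)
  assume no: "\<not> ?thesis"
  have ZM: "Z \<in> orth_space M" using cocircuit_orth Z by blast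
  have ZS: "supp Z \<subseteq> ground M" "supp Z \<noteq> {}" using Z(1) by (auto simp: cocircuits_eq minimal_orth_def orth_space_def)
  define R where "R = ground M - supp Z - {f}"
  have fs: "f \<notin> supp Z" using Z by (simp add: in_supp)
  have "\<exists>X \<in> circuits M. X f \<noteq> Zero \<and> supp X \<inter> supp Z = {}"
  proof (rule ccontr)
    assume no2: "\<not> ?thesis"
    have no3: "\<not> (\<exists>X \<in> circuits M. X f = Pos \<and> (\<forall>i \<in> ground M - R - supp Z. X i = Zero \<or> X i = Pos) \<and> (\<forall>i \<in> supp Z. X i = Zero))"
    proof
      assume "\<exists>X \<in> circuits M. X f = Pos \<and> (\<forall>i \<in> ground M - R - supp Z. X i = Zero \<or> X i = Pos) \<and> (\<forall>i \<in> supp Z. X i = Zero)"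
      then obtain X where X: "X \<in> circuits M" "X f = Pos" "\<forall>i \<in> supp Z. X i = Zero" by blast
      have "supp X \<inter> supp Z = {}" using X(3) by (auto simp: in_supp)
      then show False using no2 X by auto
    qed
    have "\<exists>Y \<in> orth_space M. Y f = Pos \<and> (\<forall>i \<in> ground M - R - supp Z. Y i = Zero \<or> Y i = Pos) \<and> (\<forall>i \<in> R. Y i = Zero)"
      using farkas[OF finite_orth[OF ZM], where c = "\<lambda>_. Pos" and e = f and R = R] no3 gf fs by (auto simp: R_def)
    then obtain Y where Y: "Y \<in> orth_space M" "Y f = Pos" "\<forall>i \<in> R. Y i = Zero" by blast
    have "supp Y \<subseteq> insert f (supp Z)"
    proof
      fix i assume "i \<in> supp Y"
      then have "i \<in> ground M" "Y i \<noteq> Zero" using Y(1) by (auto simp: in_supp orth_space_def)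
      then show "i \<in> insert f (supp Z)" using Y(3) unfolding R_def by blast
    qed
    moreover have "Y g = Zero" using Y(3) gf Z(3) by (auto simp: R_def in_supp)
    ultimately show False using no Y by blast
  qed
  then obtain X0 where X0: "X0 \<in> circuits M \<and> X0 f \<noteq> Zero \<and> supp X0 \<inter> supp Z = {}" by blast
  define Q where "Q X \<longleftrightarrow> X \<in> circuits M \<and> X f \<noteq> Zero \<and> supp X \<inter> supp Z = {}" for X
  have "Q X0" using X0 by (simp add: Q_def)
  then obtain X where X: "Q X" and least: "\<And>X'. Q X' \<Longrightarrow> card (supp X - {g}) \<le> card (supp X' - {g})"
    using ex_has_least_nat[of Q X0 "\<lambda>X. card (supp X - {g})"] by blast
  have XM: "X \<in> circuits M" and Xf: "X f \<noteq> Zero" and XZ: "supp X \<inter> supp Z = {}" using X by (auto simp: Q_def)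
  define C where "C = restr (ground M - {g}) X"
  have supp_r: "supp (restr (ground M - {g}) Y) = supp Y - {g}" if "Y \<in> circuits M" for Y
    using circuit_svec[OF that] by (auto simp: supp_restr)
  have sC: "supp C = supp X - {g}" using supp_r[OF XM] by (simp add: C_def)
  have fC: "f \<in> supp C" using sC Xf gf by (auto simp: in_supp)
  \<comment> \<open>A smaller restriction that contains \<open>f\<close> contradicts the choice of
    \<open>X\<close>; one that misses \<open>f\<close> can be used to eliminate a further element of
    \<open>X\<close> while keeping \<open>f\<close>.\<close>
  have min: "\<not> supp (restr (ground M - {g}) Y) \<subset> supp C" if Y: "Y \<in> circuits M" for Y
  proof
    assume s: "supp (restr (ground M - {g}) Y) \<subset> supp C"
    then have s: "supp Y - {g} \<subset> supp X - {g}" using supp_r[OF Y] sC by simp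
    have fin: "finite (supp X - {g})" using finite_circuit[OF XM] by simp
    have gZ: "g \<notin> supp Z" using Z by (simp add: in_supp)
    have YZ: "supp Y \<inter> supp Z = {}" using s XZ gZ by blast
    show False
    proof (cases "Y f = Zero")
      case False
      then have "Q Y" using Y YZ by (simp add: Q_def)
      then show False using least[of Y] psubset_card_mono[OF fin s] by simp
    next
      case True
      have "supp Y \<noteq> {g}" using gf(5) Y by (auto simp: is_loop_def)
      then obtain y where y: "y \<in> supp Y" "y \<noteq> g" using circuit_nonzero[OF Y] by blast
      then have "X y \<noteq> Zero" "Y y \<noteq> Zero" using s by (auto simp: in_supp)
      then obtain W where W: "W \<in> circuits M" "W y = Zero" "W f \<noteq> Zero" "supp W \<subseteq> supp X \<union> supp Y"
        using strong_elim_supp[OF XM Y _ _ Xf True] by blast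
      have "Q W" using W XZ YZ unfolding Q_def by blast
      moreover have "y \<notin> supp W" using W by (simp add: in_supp)
      then have "supp W - {g} \<subset> supp X - {g}" using W(4) s y by blast
      then have "card (supp W - {g}) < card (supp X - {g})" using psubset_card_mono[OF fin] by blast
      ultimately show False using least[of W] by simp
    qed
  qed
  have CC: "C \<in> circuits (contraction M g)"
    using XM min restr_nonzero[OF gf(5) XM] by (auto simp: contraction_def Let_def C_def)
  \<comment> \<open>The ground set of the contraction has one element more than \<open>E\<close>,
    and at most \<open>card E - d\<close> of its elements are zeros of \<open>C\<close>, because
    \<open>C f\<close> is not zero.\<close>
  have "card (supp C) \<ge> Suc d"
  proof -
    have gr: "ground (contraction M g) = insert f E" using gf by (auto simp: contraction_def Let_def elts_def)
    have "C f \<noteq> Zero" using fC by (simp add: in_supp)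
    then have "int (card (zeros (insert f E) C)) \<le> int (card E) - int d"
      using gen CC unfolding generic_def gr by (metis not_less)
    moreover have "supp C \<subseteq> insert f E" using sC circuit_svec[OF XM] by (auto simp: elts_def)
    then have "card (zeros (insert f E) C) + card (supp C) = card (insert f E)"
      unfolding zeros_def using finite_E by (metis card_Diff_subset card_mono finite.insertI finite_subset le_add_diff_inverse2)
    moreover have "card (insert f E) = Suc (card E)" using finite_E E_eq by simp
    ultimately show ?thesis by linarith
  qed
  define J where "J = insert g (supp C - {f})"
  have "indep M J"
  proof (rule ccontr)
    assume "\<not> indep M J"
    moreover have "J \<subseteq> ground M" using circuit_svec[OF XM] gf by (auto simp: J_def sC)
    ultimately obtain Y where Y: "Y \<in> circuits M" "supp Y \<subseteq> J" by (auto simp: indep_def)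
    have "supp (restr (ground M - {g}) Y) \<subset> supp C" using Y(2) supp_r[OF Y(1)] fC by (auto simp: J_def)
    then show False using min Y(1) by blast
  qed
  moreover have "J \<subseteq> zeros (ground M) Z"
    using XZ circuit_svec[OF XM] gf Z by (auto simp: J_def sC zeros_def in_supp)
  ultimately obtain I where I: "J \<subseteq> I" "I \<subseteq> zeros (ground M) Z" "indep M I" "\<forall>y \<in> zeros (ground M) Z - I. \<not> indep M (insert y I)"
    using indep_extend[of J "zeros (ground M) Z"] by (auto simp: zeros_def)
  have finI: "finite I" using indep_finite[OF I(3)] .
  obtain z where z: "z \<in> supp Z" using ZS by blast
  then have "Z z \<noteq> Zero" by (simp add: in_supp)
  then have b: "basis M (insert z I)" "z \<notin> I" using hyperplane_basis[OF Z(1) _ I(3,2)] I(4) by auto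
  have "card J = card (supp C)"
  proof -
    have fin: "finite (supp C)" using finite_circuit[OF XM] by (simp add: sC)
    have "card J = Suc (card (supp C - {f}))"
      unfolding J_def using fin by (intro card_insert_disjoint) (auto simp: sC)
    then show ?thesis using card_Suc_Diff1[OF fin fC] by simp
  qed
  then have "card I \<ge> Suc d" using \<open>card (supp C) \<ge> Suc d\<close> card_mono[OF finI I(1)] by simp
  then show False using basis_M_card[OF b(1)] b(2) finI by simp
qed

text \<open>A certificate by one circuit through \<open>g\<close>. By genericity this is the only
  way in which a full sign vector can fail to be a feasible tope
  (\<open>feasible_topes_eq\<close>).\<close>

definition infeasible :: "'e svec \<Rightarrow> bool" where
  "infeasible \<alpha> \<longleftrightarrow> (\<exists>X \<in> circuits M. X f = Zero \<and> X g = Pos \<and> (\<forall>i \<in> E. X i = Zero \<or> X i = \<alpha> i))"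

lemma feasible_topes_eq: "feasible_topes P = {\<alpha>. supp \<alpha> = E \<and> \<not> infeasible \<alpha>}"
proof -
  have "restr (ground (N_of P) - {g}) ` {T \<in> topes (N_of P). T g = Pos} =
      {\<alpha>. supp \<alpha> = ground (N_of P) - {g} \<and> \<not> infeasible \<alpha>}"
  proof (rule N.topes_at[OF g_not_loop_N(2)]; unfold E_eq)
    fix \<alpha> assume s: "supp \<alpha> = E" and "infeasible \<alpha>"
    then obtain X where X: "X \<in> circuits M" "X f = Zero" "X g = Pos" "\<forall>i \<in> E. X i = Zero \<or> X i = \<alpha> i"
      by (auto simp: infeasible_def)
    show "\<alpha>(g := Pos) \<notin> orth_space (N_of P)"
    proof
      assume "\<alpha>(g := Pos) \<in> orth_space (N_of P)"
      then have o: "orthogonal X (\<alpha>(g := Pos))" using X orth_N by blast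
      have "(\<alpha>(g := Pos)) i = X i" if "X i \<noteq> Zero" for i
      proof -
        have "i \<in> insert g E" using that circuit_svec[OF X(1)] X(2) E_eq by (auto simp: in_supp)
        then show ?thesis using X that by auto
      qed
      then have "X g = Zero \<or> (\<alpha>(g := Pos)) g = Zero" using orthogonal_agree[OF o] by blast
      then show False using X by auto
    qed
  next
    fix \<alpha> Z assume s: "supp \<alpha> = E" and Z: "Z \<in> circuits (N_of P)" "\<And>i. Z i = Zero \<or> Z i = (\<alpha>(g := Pos)) i"
    have ZM: "Z \<in> circuits M" "Z f = Zero" using Z by (auto simp: circuits_N)
    have Za: "Z i = Zero \<or> Z i = \<alpha> i" if "i \<in> E" for i using Z(2)[of i] that E_eq(3) by auto
    show "infeasible \<alpha>"
    proof (cases "Z g = Zero")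
      case True
      then obtain W where W: "W \<in> circuits M" "W g = Pos" "W f = Zero" "\<forall>i. i \<noteq> g \<longrightarrow> W i = Zero \<or> W i = Z i"
        using circuit_through_g ZM by blast
      have "W i = Zero \<or> W i = \<alpha> i" if "i \<in> E" for i using W(4) Za[OF that] that E_eq(3) by metis
      then show ?thesis using W by (auto simp: infeasible_def)
    next
      case False
      then have "Z g = Pos" using Z(2)[of g] by auto
      then show ?thesis using ZM Za by (auto simp: infeasible_def)
    qed
  next
    \<comment> \<open>A loop \<open>i\<close> of \<open>N_of P\<close> would give a circuit through
      \<open>g\<close> supported in \<open>{g, i}\<close>; incomparability removes \<open>i\<close>
      from it, and \<open>g\<close> would be a loop.\<close>
    fix i assume i: "i \<in> E"
    show "\<not> is_loop (N_of P) i"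
    proof
      assume "is_loop (N_of P) i"
      then obtain Z where Z: "Z \<in> circuits M" "Z f = Zero" "supp Z = {i}" by (auto simp: is_loop_def circuits_N)
      have "Z g = Zero" using Z(3) i E_eq by (auto simp: supp_def)
      then obtain W where W: "W \<in> circuits M" "W g = Pos" "\<forall>j. j \<noteq> g \<longrightarrow> W j = Zero \<or> W j = Z j"
        using circuit_through_g Z by blast
      have "\<not> supp Z \<subseteq> supp W"
        using circuit_incomparable[OF Z(1) W(1)] W(2) \<open>Z g = Zero\<close> by (auto simp: neg_apply)
      then have "W i = Zero" using Z(3) by (auto simp: in_supp)
      then have "supp W = {g}" using W(2,3) Z(3) by (auto simp: supp_def) (metis (mono_tags, lifting) mem_Collect_eq singletonD)
      then show False using gf(5) W(1) by (auto simp: is_loop_def)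
    qed
  qed
  then show ?thesis unfolding E_eq feasible_topes_def .
qed

lemma elts_dual [simp]: "elts (dual_program P) = E"
  by (auto simp: elts_def dual_program_def dual_def)

lemma unbounded_iff: "unbounded P \<alpha> \<longleftrightarrow> (\<exists>Z \<in> orth_space M. Z g = Zero \<and> Z f = Pos \<and> (\<forall>i \<in> E. Z i = Zero \<or> Z i = \<alpha> i))"
  by (simp add: unbounded_def covectors_eq)

lemma bounded_signs_eq: "bounded_signs P = {\<alpha>. supp \<alpha> = E \<and> \<not> unbounded P \<alpha>}"
  by (auto simp: bounded_signs_def full_signs_def)

text \<open>In the dual, the circuits are the cocircuits of \<open>M\<close>, and \<open>f\<close>
  takes the place of \<open>g\<close>. An unbounded direction shrinks to a cocircuit by conformal
  decomposition. A conformal cocircuit that vanishes at \<open>f\<close> is composed with the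
  covector of \<open>covector_through_f\<close>, which adds only \<open>f\<close> to its
  support.\<close>

lemma feasible_topes_dual: "feasible_topes (dual_program P) = bounded_signs P"
proof -
  define K where "K = N_of (dual_program P)"
  have K: "ground K = ground M - {g}" "circuits K = {Z \<in> cocircuits M. Z g = Zero}"
    by (auto simp: K_def N_of_def dual_program_def deletion_def dual_def)
  interpret K: om K unfolding K_def N_of_def dual_program_def by unfold_locales (simp add: D.deletion_om)
  have KE: "ground K - {f} = E" "f \<in> ground K" using gf by (auto simp: K elts_def)
  have "restr (ground K - {f}) ` {T \<in> topes K. T f = Pos} = {\<alpha>. supp \<alpha> = ground K - {f} \<and> \<not> unbounded P \<alpha>}"
  proof (rule K.topes_at[OF KE(2)]; unfold KE(1))
    fix \<alpha> assume s: "supp \<alpha> = E" and "unbounded P \<alpha>"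
    then obtain Z where Z: "Z \<in> orth_space M" "Z g = Zero" "Z f = Pos" "\<forall>i \<in> E. Z i = Zero \<or> Z i = \<alpha> i"
      by (auto simp: unbounded_iff)
    then obtain V where V: "V \<in> cocircuits M" "V f = Pos" "\<And>i. V i = Zero \<or> V i = Z i"
      using orth_conformal[OF Z(1), of f] by auto
    show "\<alpha>(f := Pos) \<notin> orth_space K"
    proof
      have "V g = Zero" using V(3)[of g] Z by auto
      moreover assume "\<alpha>(f := Pos) \<in> orth_space K"
      ultimately have o: "orthogonal V (\<alpha>(f := Pos))" using V K by (auto simp: orth_space_def)
      have "(\<alpha>(f := Pos)) i = V i" if "V i \<noteq> Zero" for i
      proof -
        have "i \<in> insert f E"
          using that cocircuit_orth[OF V(1)] \<open>V g = Zero\<close> E_eq by (auto simp: in_supp orth_space_def)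
        then show ?thesis using V(2) V(3)[of i] bspec[OF Z(4), of i] that by auto
      qed
      then have "V f = Zero \<or> (\<alpha>(f := Pos)) f = Zero" using orthogonal_agree[OF o] by blast
      then show False using V by auto
    qed
  next
    fix \<alpha> Z assume s: "supp \<alpha> = E" and Z: "Z \<in> circuits K" "\<And>i. Z i = Zero \<or> Z i = (\<alpha>(f := Pos)) i"
    have ZM: "Z \<in> cocircuits M" "Z g = Zero" using Z by (auto simp: K)
    have Za: "Z i = Zero \<or> Z i = \<alpha> i" if "i \<in> E" for i using Z(2)[of i] that E_eq(4) by auto
    show "unbounded P \<alpha>"
    proof (cases "Z f = Zero")
      case True
      then obtain W where W: "W \<in> orth_space M" "W f = Pos" "W g = Zero" "supp W \<subseteq> insert f (supp Z)"
        using covector_through_f ZM by blast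
      have "sv_comp Z W \<in> orth_space M" using orth_space_comp[OF cocircuit_orth[OF ZM(1)] W(1)] .
      moreover have "sv_comp Z W g = Zero" "sv_comp Z W f = Pos" using True W ZM by (auto simp: sv_comp_def)
      moreover have "sv_comp Z W i = Zero \<or> sv_comp Z W i = \<alpha> i" if i: "i \<in> E" for i
      proof (cases "Z i = Zero")
        case True
        then have "i \<notin> insert f (supp Z)" using i E_eq by (auto simp: in_supp)
        then have "W i = Zero" using W(4) by (auto simp: in_supp)
        then show ?thesis using True by (simp add: sv_comp_def)
      qed (use Za[OF i] in \<open>simp add: sv_comp_def\<close>)
      ultimately show ?thesis unfolding unbounded_iff by blast
    next
      case False
      then have "Z f = Pos" using Z(2)[of f] by auto
      then show ?thesis using ZM Za cocircuit_orth unfolding unbounded_iff by blast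
    qed
  next
    fix i assume i: "i \<in> E"
    show "\<not> is_loop K i"
    proof
      assume "is_loop K i"
      then obtain Z where Z: "Z \<in> cocircuits M" "Z g = Zero" "supp Z = {i}" by (auto simp: is_loop_def K)
      have "Z f = Zero" using Z(3) i E_eq by (auto simp: supp_def)
      then obtain W where W: "W \<in> orth_space M" "W f = Pos" "W g = Zero" "supp W \<subseteq> insert f (supp Z)"
        using covector_through_f Z by blast
      have Zi: "Z i \<noteq> Zero" using Z(3) by (auto simp: supp_def)
      obtain W' where W': "W' \<in> orth_space M" "W' f = Pos" "supp W' \<subseteq> {f}"
      proof (cases "W i = Zero")
        case True
        then have "supp W \<subseteq> {f}" using W(4) Z(3) by (auto simp: in_supp)
        then show ?thesis using that W by blast
      next
        case False
        obtain Z' where Z': "Z' \<in> orth_space M" "supp Z' = {i}" "i \<in> sep W Z'" "Z' f = Zero"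
        proof (cases "Z i = opp (W i)")
          case True
          then show ?thesis using that[of Z] Z cocircuit_orth False \<open>Z f = Zero\<close> by (auto simp: sep_def)
        next
          case F: False
          then have "Z i = W i" using sign_cases[of "W i" "Z i"] False Zi by auto
          then show ?thesis using that[of "neg_svec Z"] Z cocircuit_orth orth_space_neg False \<open>Z f = Zero\<close>
            by (auto simp: sep_def neg_apply)
        qed
        obtain Y where Y: "Y \<in> orth_space M" "Y i = Zero" "Y f = W f" "between W Z' Y"
          using orth_elim[OF W(1) Z'(1,3), of f] W(2) Z'(4) by auto
        have "i \<notin> supp Y" using Y(2) by (simp add: in_supp)
        then have "supp Y \<subseteq> {f}" using between_supp[OF Y(4)] W(4) unfolding Z(3) Z'(2) by blast
        then show ?thesis using that Y W by auto
      qed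
      obtain V where V: "V \<in> cocircuits M" "V f = Pos" "\<And>i. V i = Zero \<or> V i = W' i"
        using orth_conformal[OF W'(1), of f] W' by auto
      have "supp V = {f}"
      proof
        show "supp V \<subseteq> {f}" 
        proof
          fix j assume "j \<in> supp V"
          then have "j \<in> supp W'" using V(3)[of j] by (auto simp: in_supp)
          then show "j \<in> {f}" using W' by blast
        qed
      qed (use V in \<open>auto simp: in_supp\<close>)
      then show False using gf(6) V(1) by (auto simp: is_coloop_def is_loop_def dual_def)
    qed
  qed
  moreover have "gelt (dual_program P) = f" by (simp add: dual_program_def)
  ultimately show ?thesis using KE(1) unfolding bounded_signs_eq feasible_topes_def elts_dual K_def by simp
qed

text \<open>A circuit is orthogonal to all cocircuits, so it is a covector of the dual. Conversely,
  a vector orthogonal to all cocircuits contains a conformal circuit through \<open>g\<close>;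
  otherwise Farkas' lemma yields a cocircuit that meets it without disagreement.\<close>

lemma unbounded_dual: "unbounded (dual_program P) \<alpha> \<longleftrightarrow> infeasible \<alpha>"
proof
  assume "infeasible \<alpha>"
  then obtain X where X: "X \<in> circuits M" "X f = Zero" "X g = Pos" "\<forall>i \<in> E. X i = Zero \<or> X i = \<alpha> i"
    by (auto simp: infeasible_def)
  have "X \<in> orth_space (dual M)"
    using X circuit_svec[OF X(1)] by (auto simp: orth_space_def dual_def cocircuits_def orthogonal_commute)
  then show "unbounded (dual_program P) \<alpha>"
    using X D.covectors_eq unfolding unbounded_def elts_dual by (auto simp: dual_program_def)
next
  assume "unbounded (dual_program P) \<alpha>"
  then obtain Z where Z: "Z \<in> orth_space (dual M)" "Z f = Zero" "Z g = Pos" "\<forall>i \<in> E. Z i = Zero \<or> Z i = \<alpha> i"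
    unfolding unbounded_def elts_dual by (auto simp: dual_program_def D.covectors_eq)
  have Zo: "orthogonal V Z" if "V \<in> cocircuits M" for V using Z(1) that by (auto simp: orth_space_def dual_def)
  define c where "c i = (if Z i = Zero then Pos else Z i)" for i
  define G where "G = ground M - supp Z"
  have fG: "finite G" using finite_ground by (simp add: G_def)
  have "\<exists>X \<in> circuits M. X g = c g \<and> (\<forall>i \<in> ground M - {} - G. X i = Zero \<or> X i = c i) \<and> (\<forall>i \<in> G. X i = Zero)"
  proof (rule ccontr)
    assume no: "\<not> ?thesis"
    have "\<exists>Y \<in> orth_space M. Y g = c g \<and> (\<forall>i \<in> ground M - {} - G. Y i = Zero \<or> Y i = c i) \<and> (\<forall>i \<in> {}. Y i = Zero)"
      by (rule farkas[OF fG _ _ _ no]) (use gf Z in \<open>auto simp: c_def G_def in_supp\<close>)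
    then obtain Y where Y: "Y \<in> orth_space M" "Y g = c g" "\<forall>i \<in> ground M - G. Y i = Zero \<or> Y i = c i" by auto
    have cg: "c g = Pos" using Z by (simp add: c_def)
    then obtain V where V: "V \<in> cocircuits M" "V g = Pos" "\<And>i. V i = Zero \<or> V i = Y i"
      using orth_conformal[OF Y(1), of g] Y by auto
    have "Z i = V i" if "V i \<noteq> Zero" "Z i \<noteq> Zero" for i
    proof -
      have "i \<in> ground M - G" using that cocircuit_orth[OF V(1)] by (auto simp: G_def orth_space_def in_supp)
      then have "Y i = Zero \<or> Y i = c i" using Y(3) by blast
      then show ?thesis using V(3)[of i] that by (auto simp: c_def split: if_splits)
    qed
    then have "V g = Zero \<or> Z g = Zero" using orthogonal_agree[OF Zo[OF V(1)]] by blast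
    then show False using V Z by auto
  qed
  then obtain X where X: "X \<in> circuits M" "X g = c g" "\<And>i. i \<in> ground M - G \<Longrightarrow> X i = Zero \<or> X i = c i" "\<And>i. i \<in> G \<Longrightarrow> X i = Zero"
    by auto
  have XZ: "X i = Zero \<or> X i = Z i" for i
  proof (cases "Z i = Zero")
    case True
    then show ?thesis using X(4)[of i] circuit_svec[OF X(1)] by (auto simp: G_def in_supp)
  next
    case False
    then show ?thesis using X(3)[of i] circuit_svec[OF X(1)] by (auto simp: G_def in_supp c_def)
  qed
  have "X g = Pos" "X f = Zero" using X(2) Z XZ[of f] by (auto simp: c_def)
  moreover have "X i = Zero \<or> X i = \<alpha> i" if "i \<in> E" for i using XZ[of i] Z(4) that by metis
  ultimately show "infeasible \<alpha>" using X(1) by (auto simp: infeasible_def)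
qed

lemma bounded_feasible_dual: "bounded_feasible (dual_program P) = bounded_feasible P"
proof -
  have "bounded_signs (dual_program P) = feasible_topes P"
    by (auto simp: feasible_topes_eq bounded_signs_def full_signs_def unbounded_dual)
  then show ?thesis by (auto simp: bounded_feasible_def feasible_topes_dual)
qed

end

section \<open>Unbounded sign vectors under single sign changes\<close>

lemma flip_at_apply: "flip_at \<alpha> i j = (if j = i then opp (\<alpha> i) else \<alpha> j)"
  by (simp add: flip_at_def)

lemma flip_flip [simp]: "flip_at (flip_at \<alpha> i) i = \<alpha>"
  by (auto simp: flip_at_def)

lemma supp_flip [simp]: "supp (flip_at \<alpha> i) = supp \<alpha>"
  by (auto simp: supp_def flip_at_apply split: if_splits)

lemma full_signs_cases: "supp \<alpha> = A \<Longrightarrow> supp \<beta> = A \<Longrightarrow> \<beta> i = \<alpha> i \<or> \<beta> i = opp (\<alpha> i)"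
  using sign_cases[of "\<alpha> i" "\<beta> i"] by (metis in_supp opp_simps(2))

lemma full_eq_or_flip:
  assumes "supp \<alpha> = A" "supp \<beta> = A" "\<And>l. l \<noteq> j \<Longrightarrow> \<beta> l = \<alpha> l"
  shows "\<beta> = \<alpha> \<or> \<beta> = flip_at \<alpha> j"
proof (cases "\<beta> j = \<alpha> j")
  case True
  then have "\<beta> i = \<alpha> i" for i using assms(3) by metis
  then show ?thesis by blast
next
  case False
  then have "\<beta> i = flip_at \<alpha> j i" for i
    using full_signs_cases[OF assms(1,2), of j] assms(3) unfolding flip_at_apply by metis
  then show ?thesis by blast
qed

context generic_program
begin

abbreviation "B \<equiv> bounded_signs P"

text \<open>The unbounded direction also vanishes on \<open>K\<close>, so it works for every sign
  vector that agrees with \<beta> off \<open>K\<close> (\<open>unb_cong\<close>). The arguments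
  below enlarge \<open>K\<close> until the direction works for a vector known to be bounded.\<close>

definition unb :: "'e svec \<Rightarrow> 'e set \<Rightarrow> bool" where
  "unb \<beta> K \<longleftrightarrow> (\<exists>Z \<in> orth_space M. Z g = Zero \<and> Z f = Pos \<and> (\<forall>i \<in> E. Z i = Zero \<or> Z i = \<beta> i) \<and> (\<forall>i \<in> K. Z i = Zero))"

lemma B_iff: "\<beta> \<in> B \<longleftrightarrow> supp \<beta> = E \<and> \<not> unb \<beta> {}"
  by (auto simp: bounded_signs_eq unbounded_iff unb_def)

lemma B_supp: "\<beta> \<in> B \<Longrightarrow> supp \<beta> = E" by (simp add: B_iff)

lemma unb_mono: "unb \<beta> K \<Longrightarrow> K' \<subseteq> K \<Longrightarrow> unb \<beta> K'"
  unfolding unb_def by blast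

lemma unb_not_B: "unb \<beta> K \<Longrightarrow> \<beta> \<notin> B"
  using unb_mono[of \<beta> K "{}"] by (auto simp: B_iff)

lemma unb_cong: "unb \<beta> K \<Longrightarrow> (\<And>i. i \<in> E \<Longrightarrow> i \<notin> K \<Longrightarrow> \<beta>' i = \<beta> i) \<Longrightarrow> unb \<beta>' K"
  unfolding unb_def by (smt (verit))

lemma not_B_unb: "supp \<beta> = E \<Longrightarrow> \<beta> \<notin> B \<Longrightarrow> unb \<beta> {}"
  by (auto simp: B_iff)

text \<open>Eliminating \<open>k\<close> between the two directions keeps the entry at
  \<open>f\<close>, which is \<open>Pos\<close> in both. The result vanishes at \<open>k\<close>,
  which is why the sign \<open>s\<close> there can be prescribed.\<close>

lemma unb_elim:
  assumes b: "supp \<beta> = E" "supp \<beta>' = E" and u: "unb \<beta> K" "unb \<beta>' K" and k: "k \<in> E" "\<beta> k \<noteq> \<beta>' k" and s: "s \<noteq> Zero"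
  shows "\<exists>\<beta>''. supp \<beta>'' = E \<and> (\<forall>i. i \<noteq> k \<longrightarrow> \<beta> i = \<beta>' i \<longrightarrow> \<beta>'' i = \<beta> i) \<and> \<beta>'' k = s \<and> unb \<beta>'' (insert k K)"
proof -
  obtain Z where Z: "Z \<in> orth_space M" "Z g = Zero" "Z f = Pos" "\<And>i. i \<in> E \<Longrightarrow> Z i = Zero \<or> Z i = \<beta> i" "\<And>i. i \<in> K \<Longrightarrow> Z i = Zero"
    using u(1) unfolding unb_def by blast
  obtain Z' where Z': "Z' \<in> orth_space M" "Z' g = Zero" "Z' f = Pos" "\<And>i. i \<in> E \<Longrightarrow> Z' i = Zero \<or> Z' i = \<beta>' i" "\<And>i. i \<in> K \<Longrightarrow> Z' i = Zero"
    using u(2) unfolding unb_def by blast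
  obtain Y where Y: "Y \<in> orth_space M" "Y f = Pos" "Y k = Zero" "between Z Z' Y"
  proof -
    consider "Z k = Zero" | "Z' k = Zero" | "Z k \<noteq> Zero" "Z' k \<noteq> Zero" by blast
    then show ?thesis
    proof cases
      case 1 then show ?thesis using that[of Z] Z by (auto simp: between_def)
    next
      case 2 then show ?thesis using that[of Z'] Z' by (auto simp: between_def)
    next
      case 3
      then have "k \<in> sep Z Z'"
        using Z(4)[OF k(1)] Z'(4)[OF k(1)] k(2) sign_cases[of "Z k" "Z' k"] by (auto simp: sep_def)
      then show ?thesis using orth_elim[OF Z(1) Z'(1), of k f] Z(3) Z'(3) that by auto
    qed
  qed
  define \<beta>'' where "\<beta>'' = (\<lambda>i. if i = k then s else if i \<in> E then (if Y i \<noteq> Zero then Y i else \<beta> i) else Zero)"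
  have "supp \<beta>'' = E" using s k(1) b(1) by (auto simp: \<beta>''_def supp_def split: if_splits)
  moreover have "\<beta>'' i = \<beta> i" if "i \<noteq> k" "\<beta> i = \<beta>' i" for i
  proof (cases "i \<in> E")
    case True
    then show ?thesis using betweenD[OF Y(4), of i] Z(4)[OF True] Z'(4)[OF True] that by (auto simp: \<beta>''_def)
  next
    case False
    then have "\<beta> i = Zero" using b(1) in_supp by metis
    then show ?thesis using that False by (simp add: \<beta>''_def)
  qed
  moreover have "unb \<beta>'' (insert k K)" unfolding unb_def
  proof (intro bexI[OF _ Y(1)] conjI ballI)
    show "Y g = Zero" using betweenD[OF Y(4), of g] Z(2) Z'(2) by auto
    show "Y f = Pos" by (rule Y(2))
    show "Y i = Zero \<or> Y i = \<beta>'' i" if "i \<in> E" for i using that Y(3) by (auto simp: \<beta>''_def)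
    show "Y i = Zero" if "i \<in> insert k K" for i
      using that betweenD[OF Y(4), of i] Z(5)[of i] Z'(5)[of i] Y(3) by auto
  qed
  ultimately show ?thesis unfolding \<beta>''_def by (intro exI[of _ \<beta>'']) (simp add: \<beta>''_def)
qed

text \<open>Eliminating \<open>k\<close> between the directions of \<open>flip_at \<beta> j\<close>
  and \<open>flip_at \<beta> k\<close> and restoring the sign at \<open>k\<close> gives a direction
  of \<beta> or of \<open>flip_at \<beta> j\<close>, and \<beta> is bounded.\<close>

lemma unb_flip_zero:
  assumes b: "\<beta> \<in> B" and J: "J \<subseteq> E" "\<And>j. j \<in> J \<Longrightarrow> flip_at \<beta> j \<notin> B" and K: "finite K" "K \<subseteq> J"
  shows "j \<in> J - K \<Longrightarrow> unb (flip_at \<beta> j) K"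
  using K
proof (induction K arbitrary: j rule: finite_induct)
  case empty
  then show ?case using J(2)[of j] B_supp[OF b] by (intro not_B_unb) auto
next
  case (insert k K)
  have kE: "k \<in> E" and jk: "j \<noteq> k" using insert.prems J(1) by auto
  have bs: "supp (flip_at \<beta> j) = E" "supp (flip_at \<beta> k) = E" using B_supp[OF b] by auto
  have bk: "\<beta> k \<noteq> Zero" using B_supp[OF b] kE in_supp by metis
  obtain \<beta>'' where b'': "supp \<beta>'' = E" "\<forall>i. i \<noteq> k \<longrightarrow> flip_at \<beta> j i = flip_at \<beta> k i \<longrightarrow> \<beta>'' i = flip_at \<beta> j i"
      "\<beta>'' k = \<beta> k" "unb \<beta>'' (insert k K)"
  proof -
    have "unb (flip_at \<beta> j) K" "unb (flip_at \<beta> k) K" using insert.IH insert.prems insert.hyps by auto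
    moreover have "flip_at \<beta> j k \<noteq> flip_at \<beta> k k" using jk bk by (simp add: flip_at_apply)
    ultimately show ?thesis using unb_elim[OF bs _ _ kE _ bk] that by blast
  qed
  have "\<beta>'' l = \<beta> l" if "l \<noteq> j" for l using b''(2,3) that jk by (cases "l = k") (auto simp: flip_at_apply)
  then have "\<beta>'' = \<beta> \<or> \<beta>'' = flip_at \<beta> j" using full_eq_or_flip[OF B_supp[OF b] b''(1)] by blast
  then show ?case using b''(4) unb_not_B b by blast
qed

lemma finite_diff: "\<alpha> \<in> B \<Longrightarrow> \<gamma> \<in> B \<Longrightarrow> finite {i. \<alpha> i \<noteq> \<gamma> i} \<and> {i. \<alpha> i \<noteq> \<gamma> i} \<subseteq> E"
proof -
  assume a: "\<alpha> \<in> B" "\<gamma> \<in> B"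
  have "i \<in> E" if "\<alpha> i \<noteq> \<gamma> i" for i
    using that B_supp[OF a(1)] B_supp[OF a(2)] in_supp by metis
  then have "{i. \<alpha> i \<noteq> \<gamma> i} \<subseteq> E" by blast
  then show ?thesis using finite_E finite_subset by blast
qed

text \<open>If every flip of \<alpha> towards \<gamma> were unbounded, \<open>unb_flip_zero\<close>
  would make the direction of one flip vanish at all other differences, and it would show that
  \<gamma> is unbounded.\<close>

lemma bounded_step:
  assumes a: "\<alpha> \<in> B" "\<gamma> \<in> B" "\<alpha> \<noteq> \<gamma>"
  shows "\<exists>i. \<alpha> i \<noteq> \<gamma> i \<and> flip_at \<alpha> i \<in> B"
proof (rule ccontr)
  assume no: "\<not> ?thesis"
  define D where "D = {i. \<alpha> i \<noteq> \<gamma> i}"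
  have D: "finite D" "D \<subseteq> E" using finite_diff a by (auto simp: D_def)
  obtain j where j: "j \<in> D" using a(3) by (auto simp: D_def fun_eq_iff)
  have "unb (flip_at \<alpha> j) (D - {j})"
    by (rule unb_flip_zero[OF a(1) D(2)]) (use no D j in \<open>auto simp: D_def\<close>)
  moreover have "\<gamma> i = flip_at \<alpha> j i" if "i \<notin> D - {j}" for i
  proof (cases "i = j")
    case True
    then show ?thesis
      using full_signs_cases[OF B_supp[OF a(1)] B_supp[OF a(2)], of j] j by (auto simp: flip_at_apply D_def)
  qed (use that in \<open>auto simp: flip_at_apply D_def\<close>)
  ultimately have "unb \<gamma> (D - {j})" using unb_cong by blast
  then show False using unb_not_B a by blast
qed

text \<open>The first steps of the taut paths from \<open>\<alpha>\<close> to \<open>\<gamma>\<close> are connected through squares.\<close>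

lemma bounded_steps_connected:
  assumes a: "\<alpha> \<in> B" "\<gamma> \<in> B"
    and W: "\<And>i. i \<in> W1 \<union> W2 \<longleftrightarrow> \<alpha> i \<noteq> \<gamma> i \<and> flip_at \<alpha> i \<in> B" "W1 \<inter> W2 = {}" "W1 \<noteq> {}" "W2 \<noteq> {}"
    and no: "\<And>i j. i \<in> W1 \<Longrightarrow> j \<in> W2 \<Longrightarrow> flip_at (flip_at \<alpha> i) j \<notin> B"
  shows False
proof -
  define D where "D = {i. \<alpha> i \<noteq> \<gamma> i}"
  have D: "finite D" "D \<subseteq> E" using finite_diff a by (auto simp: D_def)
  define V where "V = D - W1 - W2"
  have sub: "W1 \<subseteq> D" "W2 \<subseteq> D" using W(1) by (auto simp: D_def)
  have fin: "finite W1" "finite W2" "finite V" using sub D finite_subset by (auto simp: V_def)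
  have aS: "supp \<alpha> = E" using a B_supp by blast
  have nz: "k \<in> D \<Longrightarrow> \<alpha> k \<noteq> Zero" for k using aS D(2) in_supp by (metis subsetD)
  have flipB: "flip_at \<alpha> i \<in> B" if "i \<in> W1 \<or> i \<in> W2" for i using W(1)[of i] that by auto
  \<comment> \<open>Of the four sign vectors that agree with \<alpha> away from \<open>i\<close> and
    \<open>j\<close>, three are bounded; so an unbounded direction can only belong to the double
    flip.\<close>
  have cls2: "\<beta> = flip_at (flip_at \<alpha> i) j"
    if ij: "i \<in> W1" "j \<in> W2" and b: "supp \<beta> = E" "unb \<beta> K" and l: "\<And>l. l \<noteq> i \<Longrightarrow> l \<noteq> j \<Longrightarrow> \<beta> l = \<alpha> l" for i j \<beta> K
  proof -
    have nB: "\<beta> \<notin> B" using unb_not_B b by blast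
    have "\<beta> \<noteq> \<alpha>" "\<beta> \<noteq> flip_at \<alpha> i" "\<beta> \<noteq> flip_at \<alpha> j" using nB a flipB ij by auto
    have ine: "i \<noteq> j" using ij W(2) by blast
    define \<alpha>' where "\<alpha>' = \<alpha>(i := \<beta> i)"
    have bi: "\<beta> i = \<alpha> i \<or> \<beta> i = opp (\<alpha> i)" using full_signs_cases[OF aS b(1)] .
    then have a': "\<alpha>' = \<alpha> \<or> \<alpha>' = flip_at \<alpha> i" by (auto simp: \<alpha>'_def flip_at_def)
    then have "supp \<alpha>' = E" using aS by (metis supp_flip)
    then have "\<beta> = \<alpha>' \<or> \<beta> = flip_at \<alpha>' j"
      by (rule full_eq_or_flip[OF _ b(1)]) (auto simp: \<alpha>'_def l)
    then show ?thesis using a' \<open>\<beta> \<noteq> \<alpha>\<close> \<open>\<beta> \<noteq> flip_at \<alpha> i\<close> \<open>\<beta> \<noteq> flip_at \<alpha> j\<close> by blast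
  qed
  have ff: "flip_at (flip_at \<alpha> i) j l = (if l = i then opp (\<alpha> i) else if l = j then opp (\<alpha> j) else \<alpha> l)" if "i \<noteq> j" for i j l
    using that by (auto simp: flip_at_apply)
  have ffS: "supp (flip_at (flip_at \<alpha> i) j) = E" "supp (flip_at \<alpha> i) = E" for i j using aS by auto
  \<comment> \<open>The directions of the double flips are made to vanish on \<open>V\<close>, where
    the single flips are unbounded; \<open>step2\<close> adds the rest of \<open>W2\<close> and
    \<open>step3\<close> the rest of \<open>W1\<close>. Such a direction vanishes at all differences
    other than \<open>i\<close> and \<open>j\<close>, so it witnesses that \<gamma> is
    unbounded.\<close>
  have step1: "unb (flip_at (flip_at \<alpha> i) j) K" if "finite K" "K \<subseteq> V" "i \<in> W1" "j \<in> W2" for K i j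
    using that
  proof (induction K rule: finite_induct)
    case empty
    then show ?case using no aS by (intro not_B_unb) auto
  next
    case (insert k K)
    have kk: "k \<in> D" "k \<noteq> i" "k \<noteq> j" "i \<noteq> j" using insert.prems W(2) by (auto simp: V_def)
    have uk: "unb (flip_at \<alpha> k) K"
      by (rule unb_flip_zero[OF a(1), of V]) (use D W(1) insert.prems insert.hyps in \<open>auto simp: V_def D_def\<close>)
    obtain \<beta> where b: "supp \<beta> = E" "\<forall>l. l \<noteq> k \<longrightarrow> flip_at (flip_at \<alpha> i) j l = flip_at \<alpha> k l \<longrightarrow> \<beta> l = flip_at (flip_at \<alpha> i) j l"
      "\<beta> k = \<alpha> k" "unb \<beta> (insert k K)"
    proof -
      have "unb (flip_at (flip_at \<alpha> i) j) K" using insert.IH insert.prems by auto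
      moreover have "flip_at (flip_at \<alpha> i) j k \<noteq> flip_at \<alpha> k k" using kk nz[of k] by (simp add: flip_at_apply)
      moreover have "k \<in> E" using kk D(2) by blast
      ultimately show ?thesis using unb_elim[OF ffS(1) ffS(2) _ uk _ _ nz[OF kk(1)]] that by blast
    qed
    have "\<beta> l = \<alpha> l" if "l \<noteq> i" "l \<noteq> j" for l using b(2,3) kk that by (cases "l = k") (auto simp: flip_at_apply)
    then show ?case using cls2[OF insert.prems(2,3) b(1,4)] b(4) by auto
  qed
  have step2: "unb (flip_at (flip_at \<alpha> i) j) (V \<union> K)" if "finite K" "K \<subseteq> W2" "i \<in> W1" "j \<in> W2 - K" for K i j
    using that
  proof (induction K arbitrary: j rule: finite_induct)
    case empty
    then show ?case using step1[OF fin(3)] by auto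
  next
    case (insert k K)
    have kk: "k \<in> D" "k \<noteq> i" "k \<noteq> j" "i \<noteq> j" "i \<noteq> k" using insert.prems W(2) sub by auto
    have u: "unb (flip_at (flip_at \<alpha> i) j) (V \<union> K)" "unb (flip_at (flip_at \<alpha> i) k) (V \<union> K)"
      using insert.IH insert.prems insert.hyps by auto
    obtain \<beta> where b: "supp \<beta> = E" "\<forall>l. l \<noteq> k \<longrightarrow> flip_at (flip_at \<alpha> i) j l = flip_at (flip_at \<alpha> i) k l \<longrightarrow> \<beta> l = flip_at (flip_at \<alpha> i) j l"
      "\<beta> k = \<alpha> k" "unb \<beta> (insert k (V \<union> K))"
    proof -
      have "k \<in> E" using kk D(2) by blast
      moreover have "flip_at (flip_at \<alpha> i) j k \<noteq> flip_at (flip_at \<alpha> i) k k" using kk nz[of k] by (simp add: flip_at_apply)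
      ultimately show ?thesis using unb_elim[OF ffS(1) ffS(1) u _ _ nz[OF kk(1)]] that by blast
    qed
    have "\<beta> l = \<alpha> l" if "l \<noteq> i" "l \<noteq> j" for l using b(2,3) kk that by (cases "l = k") (auto simp: ff)
    then show ?case using cls2[OF _ _ b(1,4)] b(4) insert.prems by auto
  qed
  have step3: "unb (flip_at (flip_at \<alpha> i) j) (V \<union> (W2 - {j}) \<union> K)" if "finite K" "K \<subseteq> W1" "j \<in> W2" "i \<in> W1 - K" for K i j
    using that
  proof (induction K arbitrary: i rule: finite_induct)
    case empty
    then show ?case using step2[of "W2 - {j}" i j] fin by auto
  next
    case (insert k K)
    have kk: "k \<in> D" "k \<noteq> i" "k \<noteq> j" "i \<noteq> j" "i \<noteq> k" using insert.prems W(2) sub by auto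
    have u: "unb (flip_at (flip_at \<alpha> i) j) (V \<union> (W2 - {j}) \<union> K)" "unb (flip_at (flip_at \<alpha> k) j) (V \<union> (W2 - {j}) \<union> K)"
      using insert.IH insert.prems insert.hyps by auto
    obtain \<beta> where b: "supp \<beta> = E" "\<forall>l. l \<noteq> k \<longrightarrow> flip_at (flip_at \<alpha> i) j l = flip_at (flip_at \<alpha> k) j l \<longrightarrow> \<beta> l = flip_at (flip_at \<alpha> i) j l"
      "\<beta> k = \<alpha> k" "unb \<beta> (insert k (V \<union> (W2 - {j}) \<union> K))"
    proof -
      have "k \<in> E" using kk D(2) by blast
      moreover have "flip_at (flip_at \<alpha> i) j k \<noteq> flip_at (flip_at \<alpha> k) j k" using kk nz[of k] by (simp add: flip_at_apply)
      ultimately show ?thesis using unb_elim[OF ffS(1) ffS(1) u _ _ nz[OF kk(1)]] that by blast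
    qed
    have "\<beta> l = \<alpha> l" if "l \<noteq> i" "l \<noteq> j" for l using b(2,3) kk that by (cases "l = k") (auto simp: ff)
    then show ?case using cls2[OF _ _ b(1,4)] b(4) insert.prems by auto
  qed
  obtain i j where ij: "i \<in> W1" "j \<in> W2" using W(3,4) by blast
  have ine: "i \<noteq> j" using ij W(2) by blast
  have u: "unb (flip_at (flip_at \<alpha> i) j) (V \<union> (W2 - {j}) \<union> (W1 - {i}))"
    using step3[of "W1 - {i}" j i] fin ij by auto
  moreover have "\<gamma> l = flip_at (flip_at \<alpha> i) j l" if "l \<notin> V \<union> (W2 - {j}) \<union> (W1 - {i})" for l
  proof -
    have "l = i \<or> l = j \<or> l \<notin> D" using that by (auto simp: V_def)
    moreover have "i \<in> D" "j \<in> D" using ij sub by auto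
    ultimately show ?thesis
      using full_signs_cases[OF aS B_supp[OF a(2)], of l] ine by (auto simp: ff D_def)
  qed
  ultimately have "unb \<gamma> (V \<union> (W2 - {j}) \<union> (W1 - {i}))" using unb_cong by blast
  then show False using unb_not_B a by blast
qed

subsection \<open>Common faces\<close>

lemma common_faces_iff:
  "X \<in> common_faces P \<A> \<longleftrightarrow> X \<in> orth_space (N_of P) \<and> X g = Pos \<and> (\<forall>\<alpha> \<in> \<A>. \<forall>i. X i = Zero \<or> X i = (\<alpha>(g := Pos)) i)"
  by (auto simp: common_faces_def N.covectors_eq is_face_iff)

lemma z_common_faces_iff:
  "S \<in> z_common_faces P \<A> \<longleftrightarrow> S \<subseteq> E \<and> (\<exists>X \<in> common_faces P \<A>. \<forall>i \<in> S. X i = Zero)"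
proof -
  have "S \<subseteq> zeros (ground (N_of P)) X \<longleftrightarrow> (\<forall>i \<in> S. X i = Zero)" if "S \<subseteq> E" for X
    using that E_eq(1) by (auto simp: zeros_def in_supp)
  then show ?thesis unfolding z_common_faces_def by blast
qed

lemma z_antimono: "S \<in> z_common_faces P \<A> \<Longrightarrow> T \<subseteq> S \<Longrightarrow> \<B> \<subseteq> \<A> \<Longrightarrow> T \<in> z_common_faces P \<B>"
proof -
  assume S: "S \<in> z_common_faces P \<A>" "T \<subseteq> S" "\<B> \<subseteq> \<A>"
  then obtain X where X: "X \<in> common_faces P \<A>" "\<forall>i \<in> S. X i = Zero" "S \<subseteq> E" unfolding z_common_faces_iff by blast
  have "X \<in> common_faces P \<B>" using X(1) S(3) by (auto simp: common_faces_def)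
  then show ?thesis using X(2,3) S(2) unfolding z_common_faces_iff by blast
qed

lemma orth_N_in_E: "X \<in> orth_space (N_of P) \<Longrightarrow> X i \<noteq> Zero \<Longrightarrow> i \<noteq> g \<Longrightarrow> i \<in> E"
  using in_supp[of i X] unfolding orth_N by blast

lemma detour_iff: "i \<in> detour P \<alpha> \<beta> \<gamma> \<longleftrightarrow> i \<in> E \<and> \<alpha> i = \<gamma> i \<and> \<alpha> i \<noteq> \<beta> i"
  by (auto simp: detour_def)

lemma detour_subset: "detour P \<alpha> \<beta> \<gamma> \<subseteq> E"
  by (auto simp: detour_def)

text \<open>A common face of \<alpha> and \<gamma> vanishes wherever these two differ. If it also
  vanishes on the detour, all three sign vectors agree on its support in \<open>E\<close>, and it is
  a face of \<beta> as well.\<close>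

lemma z_detour:
  assumes s: "supp \<alpha> = E" "supp \<beta> = E" "supp \<gamma> = E"
    and S: "S \<in> z_common_faces P {\<alpha>, \<gamma>}" "detour P \<alpha> \<beta> \<gamma> \<subseteq> S"
  shows "S \<in> z_common_faces P {\<alpha>, \<beta>, \<gamma>}"
proof -
  obtain X where X: "X \<in> common_faces P {\<alpha>, \<gamma>}" "\<forall>i \<in> S. X i = Zero" and SE: "S \<subseteq> E"
    using S(1) unfolding z_common_faces_iff by blast
  have XN: "X \<in> orth_space (N_of P)" "X g = Pos" "\<And>i. X i = Zero \<or> X i = (\<alpha>(g := Pos)) i" "\<And>i. X i = Zero \<or> X i = (\<gamma>(g := Pos)) i"
    using X(1) unfolding common_faces_iff by auto
  have "X i = Zero \<or> X i = (\<beta>(g := Pos)) i" for i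
  proof (cases "i = g")
    case False
    show ?thesis
    proof (cases "X i = Zero")
      case nz: False
      then have "i \<in> E" using XN(1) False by (auto simp: orth_N in_supp)
      moreover have "X i = \<alpha> i" "X i = \<gamma> i" using XN(3,4)[of i] nz False by auto
      moreover have "i \<notin> detour P \<alpha> \<beta> \<gamma>" using nz X(2) S(2) by blast
      ultimately show ?thesis using False by (auto simp: detour_iff)
    qed simp
  qed (use XN in simp)
  then have "X \<in> common_faces P {\<alpha>, \<beta>, \<gamma>}" using XN unfolding common_faces_iff by auto
  then show ?thesis using X(2) SE unfolding z_common_faces_iff by blast
qed

text \<open>The circuit of infeasibility and a face of \<beta> both follow \<beta> on
  \<open>E\<close> and are positive at \<open>g\<close>, so they could not be orthogonal.\<close>

lemma z_infeasible:
  assumes "\<beta> \<in> B" "\<beta> \<notin> feasible_topes P" "\<beta> \<in> \<A>"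
  shows "S \<notin> z_common_faces P \<A>"
proof
  assume "S \<in> z_common_faces P \<A>"
  then obtain X where "X \<in> common_faces P \<A>" unfolding z_common_faces_iff by blast
  then have X: "X \<in> orth_space (N_of P)" "X g = Pos" "\<And>i. X i = Zero \<or> X i = (\<beta>(g := Pos)) i"
    using assms(3) common_faces_iff by auto
  have "infeasible \<beta>" using assms B_supp feasible_topes_eq by auto
  then obtain C where C: "C \<in> circuits M" "C f = Zero" "C g = Pos" "\<And>i. i \<in> E \<Longrightarrow> C i = Zero \<or> C i = \<beta> i"
    unfolding infeasible_def by blast
  have o: "orthogonal C X" using X C orth_N by blast
  have "X i = C i" if "C i \<noteq> Zero" "X i \<noteq> Zero" for i
  proof (cases "i = g")
    case False
    then have "i \<in> E" using that X(1) by (auto simp: orth_N in_supp)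
    then show ?thesis using C(4)[of i] X(3)[of i] that False by auto
  qed (use X C in simp)
  then have "C g = Zero \<or> X g = Zero" using orthogonal_agree[OF o] by blast
  then show False using X C by auto
qed

text \<open>Farkas' lemma produces a circuit that witnesses infeasibility; \<open>\<beta>\<close> is its composition
  with \<open>\<alpha>\<close>.\<close>

lemma z_blocked:
  assumes a: "\<alpha> \<in> B" and c: "supp \<gamma> = E" and S: "S \<subseteq> E" "S \<notin> z_common_faces P {\<alpha>, \<gamma>}"
  shows "\<exists>\<beta> \<in> B. \<beta> \<notin> feasible_topes P \<and> detour P \<alpha> \<beta> \<gamma> \<subseteq> S"
proof -
  have aS: "supp \<alpha> = E" using B_supp[OF a] .
  \<comment> \<open>Circuits get free signs on \<open>S\<close> and wherever \<alpha> and \<gamma>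
    differ. If no suitable circuit through \<open>g\<close> existed, the vector given by Farkas'
    lemma would vanish on \<open>R\<close> and be a common face with \<open>S\<close> among its
    zeros.\<close>
  define R where "R = S \<union> {i \<in> E. \<alpha> i \<noteq> \<gamma> i}"
  have RE: "R \<subseteq> E" using S by (auto simp: R_def)
  have "\<exists>C \<in> circuits (N_of P). C g = (\<alpha>(g := Pos)) g \<and> (\<forall>i \<in> ground (N_of P) - R. C i = Zero \<or> C i = (\<alpha>(g := Pos)) i)"
  proof (rule ccontr)
    assume no: "\<not> ?thesis"
    have "\<exists>Y \<in> orth_space (N_of P). Y g = (\<alpha>(g := Pos)) g \<and> (\<forall>i. Y i = Zero \<or> Y i = (\<alpha>(g := Pos)) i) \<and> (\<forall>i \<in> R. Y i = Zero)"
    proof (rule N.farkas_contract[OF _ _ no])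
      show "(\<alpha>(g := Pos)) i \<noteq> Zero" if "i \<in> ground (N_of P)" for i
        using that E_eq(1) aS by (cases "i = g") (auto simp: in_supp)
      show "g \<in> ground (N_of P) - R" using g_not_loop_N RE E_eq by auto
    qed
    then obtain Y where Y: "Y \<in> orth_space (N_of P)" "Y g = Pos" "\<And>i. Y i = Zero \<or> Y i = (\<alpha>(g := Pos)) i" "\<And>i. i \<in> R \<Longrightarrow> Y i = Zero"
      by auto
    have "Y i = Zero \<or> Y i = (\<gamma>(g := Pos)) i" for i
    proof (cases "i = g \<or> Y i = Zero")
      case False
      then have "i \<in> E" "i \<notin> R" using orth_N_in_E[OF Y(1)] Y(4) by blast+
      then have "\<alpha> i = \<gamma> i" by (simp add: R_def)
      then show ?thesis using Y(3)[of i] False by simp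
    qed (use Y(2) in auto)
    then have "Y \<in> common_faces P {\<alpha>, \<gamma>}" using Y unfolding common_faces_iff by auto
    then show False using S Y(4) unfolding z_common_faces_iff R_def by auto
  qed
  then obtain C where C0: "C \<in> circuits (N_of P)" "C g = Pos" "\<And>i. i \<in> ground (N_of P) - R \<Longrightarrow> C i = Zero \<or> C i = (\<alpha>(g := Pos)) i"
    by auto
  have C: "C \<in> circuits M" "C f = Zero" "C g = Pos" using C0 by (auto simp: circuits_N)
  have C4: "C i = Zero \<or> C i = \<alpha> i" if "i \<in> E - R" for i
  proof -
    have "i \<in> ground (N_of P) - R" "i \<noteq> g" using that E_eq(1) by blast+
    then show ?thesis using C0(3)[of i] by simp
  qed
  define \<beta> where "\<beta> = (\<lambda>i. if i \<in> E then (if C i \<noteq> Zero then C i else \<alpha> i) else Zero)"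
  have bS: "supp \<beta> = E" using aS by (auto simp: \<beta>_def supp_def split: if_splits)
  have "\<forall>i \<in> E. C i = Zero \<or> C i = \<beta> i" by (simp add: \<beta>_def)
  then have "infeasible \<beta>" using C by (auto simp: infeasible_def)
  then have nf: "\<beta> \<notin> feasible_topes P" by (simp add: feasible_topes_eq)
  \<comment> \<open>An unbounded direction of \<beta> never disagrees with \<open>C\<close>, so the
    two supports are disjoint. Away from \<open>C\<close>, \<beta> is \<alpha>, and the direction
    would make \<alpha> unbounded.\<close>
  have "\<beta> \<in> B"
  proof (rule ccontr)
    assume "\<beta> \<notin> B"
    then have "unb \<beta> {}" using bS not_B_unb by blast
    then obtain Z where Z: "Z \<in> orth_space M" "Z g = Zero" "Z f = Pos" "\<And>i. i \<in> E \<Longrightarrow> Z i = Zero \<or> Z i = \<beta> i"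
      unfolding unb_def by blast
    have o: "orthogonal C Z" using Z C by (auto simp: orth_space_def)
    have CE: "i \<in> E" if "C i \<noteq> Zero" "i \<noteq> g" for i
      using that circuit_svec[OF C(1)] C(2) E_eq by (auto simp: in_supp)
    have "Z i = C i" if "C i \<noteq> Zero" "Z i \<noteq> Zero" for i
    proof -
      have "i \<noteq> g" using that Z by auto
      then show ?thesis using CE[OF that(1)] Z(4)[of i] that by (auto simp: \<beta>_def)
    qed
    then have disj: "C i = Zero \<or> Z i = Zero" for i using orthogonal_agree[OF o] by blast
    have "Z i = Zero \<or> Z i = \<alpha> i" if "i \<in> E" for i using Z(4)[OF that] disj[of i] that by (auto simp: \<beta>_def)
    then have "unb \<alpha> {}" using Z unfolding unb_def by auto
    then show False using a unb_not_B by blast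
  qed
  moreover have "detour P \<alpha> \<beta> \<gamma> \<subseteq> S"
  proof
    fix i assume i: "i \<in> detour P \<alpha> \<beta> \<gamma>"
    then have "i \<in> E" "\<alpha> i = \<gamma> i" "C i \<noteq> Zero" "C i \<noteq> \<alpha> i" by (auto simp: detour_iff \<beta>_def split: if_splits)
    then show "i \<in> S" using C4[of i] by (auto simp: R_def)
  qed
  ultimately show ?thesis using nf by blast
qed

end

section \<open>Rings on additive types\<close>

text \<open>Rings whose addition is the addition of the underlying type, so that congruences modulo an
  ideal can be computed with the ordinary difference.\<close>

locale add_ring = ring R for R :: "'a::ab_group_add ring" (structure) +
  assumes plus: "add R = (+)" and zero_eq: "zero R = 0"
begin

lemma a_inv_eq: "x \<in> carrier R \<Longrightarrow> \<ominus> x = - x"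
proof -
  assume "x \<in> carrier R"
  then have "x \<oplus> \<ominus> x = \<zero>" by (rule r_neg)
  then have "x + \<ominus> x = 0" by (simp add: plus zero_eq)
  then show ?thesis by (simp add: add_eq_0_iff)
qed

lemma minus_eq': "x \<in> carrier R \<Longrightarrow> y \<in> carrier R \<Longrightarrow> x \<ominus> y = x - y"
  by (simp add: minus_eq a_inv_eq plus)

lemma plus_closed: "x \<in> carrier R \<Longrightarrow> y \<in> carrier R \<Longrightarrow> x + y \<in> carrier R"
  using a_closed plus by simp

lemma uminus_closed: "x \<in> carrier R \<Longrightarrow> - x \<in> carrier R"
  using a_inv_closed a_inv_eq by metis

lemma diff_closed: "x \<in> carrier R \<Longrightarrow> y \<in> carrier R \<Longrightarrow> x - y \<in> carrier R"
  using plus_closed[OF _ uminus_closed] by fastforce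

lemma zero_in: "0 \<in> carrier R" using zero_closed zero_eq by simp

lemma sum_in: "(\<And>i. i \<in> A \<Longrightarrow> x i \<in> carrier R) \<Longrightarrow> sum x A \<in> carrier R"
  by (induction A rule: infinite_finite_induct) (auto simp: zero_in plus_closed)

lemma l_distr': "x \<in> carrier R \<Longrightarrow> y \<in> carrier R \<Longrightarrow> z \<in> carrier R \<Longrightarrow> (x + y) \<otimes> z = x \<otimes> z + y \<otimes> z"
  using l_distr plus by simp

lemma r_distr': "x \<in> carrier R \<Longrightarrow> y \<in> carrier R \<Longrightarrow> z \<in> carrier R \<Longrightarrow> z \<otimes> (x + y) = z \<otimes> x + z \<otimes> y"
  using r_distr plus by simp

lemma diff_mult: "x \<in> carrier R \<Longrightarrow> y \<in> carrier R \<Longrightarrow> z \<in> carrier R \<Longrightarrow> (x - y) \<otimes> z = x \<otimes> z - y \<otimes> z"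
  using l_distr'[of "x - y" y z] diff_closed by (simp add: algebra_simps)

lemma mult_diff: "x \<in> carrier R \<Longrightarrow> y \<in> carrier R \<Longrightarrow> z \<in> carrier R \<Longrightarrow> z \<otimes> (x - y) = z \<otimes> x - z \<otimes> y"
  using r_distr'[of "x - y" y z] diff_closed by (simp add: algebra_simps)

context
  fixes I assumes I: "ideal I R"
begin

lemma ideal_carrier: "x \<in> I \<Longrightarrow> x \<in> carrier R"
  using ideal.Icarr[OF I] .

lemma ideal_zero: "0 \<in> I"
  using additive_subgroup.zero_closed[OF ideal.axioms(1)[OF I]] zero_eq by simp

lemma ideal_add: "x \<in> I \<Longrightarrow> y \<in> I \<Longrightarrow> x + y \<in> I"
  using additive_subgroup.a_closed[OF ideal.axioms(1)[OF I]] plus by simp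

lemma ideal_uminus: "x \<in> I \<Longrightarrow> - x \<in> I"
  using additive_subgroup.a_inv_closed[OF ideal.axioms(1)[OF I]] a_inv_eq ideal_carrier by metis

lemma ideal_diff: "x \<in> I \<Longrightarrow> y \<in> I \<Longrightarrow> x - y \<in> I"
  using ideal_add[OF _ ideal_uminus] by fastforce

lemma ideal_sum: "(\<And>i. i \<in> A \<Longrightarrow> x i \<in> I) \<Longrightarrow> sum x A \<in> I"
  by (induction A rule: infinite_finite_induct) (auto simp: ideal_zero ideal_add)

lemma ideal_mult_l: "x \<in> I \<Longrightarrow> a \<in> carrier R \<Longrightarrow> a \<otimes> x \<in> I"
  using ideal.I_l_closed[OF I] .

lemma ideal_mult_r: "x \<in> I \<Longrightarrow> a \<in> carrier R \<Longrightarrow> x \<otimes> a \<in> I"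
  using ideal.I_r_closed[OF I] .

lemma ideal_cong_trans: "x - y \<in> I \<Longrightarrow> y - z \<in> I \<Longrightarrow> x - z \<in> I"
  using ideal_add[of "x - y" "y - z"] by simp

lemma ideal_cong_sym: "x - y \<in> I \<Longrightarrow> y - x \<in> I"
  using ideal_uminus[of "x - y"] by simp

lemma rcos_eq_iff: "x \<in> carrier R \<Longrightarrow> y \<in> carrier R \<Longrightarrow> I +> x = I +> y \<longleftrightarrow> x - y \<in> I"
  using quotient_eq_iff_same_a_r_cos[OF I] minus_eq' by metis

lemma rcos_eq_self_iff: "x \<in> carrier R \<Longrightarrow> I +> x = I \<longleftrightarrow> x \<in> I"
proof -
  assume x: "x \<in> carrier R"
  have "I +> 0 = I" by (simp add: a_r_coset_def r_coset_def plus)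
  then show ?thesis using rcos_eq_iff[OF x zero_in] by simp
qed

lemma quot_hom: "ring_hom_ring R (R Quot I) ((+>) I)"
  using ideal.rcos_ring_hom_ring[OF I] .

lemma quot_surj: "carrier (R Quot I) = (+>) I ` carrier R"
  by (auto simp: FactRing_def A_RCOSETS_def RCOSETS_def a_r_coset_def)

end

lemma idealI':
  assumes "I \<subseteq> carrier R" "0 \<in> I" "\<And>x y. x \<in> I \<Longrightarrow> y \<in> I \<Longrightarrow> x - y \<in> I"
    "\<And>x a. x \<in> I \<Longrightarrow> a \<in> carrier R \<Longrightarrow> a \<otimes> x \<in> I" "\<And>x a. x \<in> I \<Longrightarrow> a \<in> carrier R \<Longrightarrow> x \<otimes> a \<in> I"
  shows "ideal I R"
proof (rule idealI[OF ring_axioms])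
  have um: "- x \<in> I" if "x \<in> I" for x using assms(3)[OF assms(2) that] by simp
  have "x + y \<in> I" if "x \<in> I" "y \<in> I" for x y using assms(3)[OF that(1) um[OF that(2)]] by simp
  moreover have "inv\<^bsub>add_monoid R\<^esub> x \<in> I" if "x \<in> I" for x
    using um[OF that] a_inv_eq[of x] assms(1) that unfolding a_inv_def by auto
  ultimately show "subgroup I (add_monoid R)"
    using assms by (intro subgroup.intro) (auto simp: plus zero_eq)
qed (use assms in auto)

lemma quot_ideal:
  assumes I: "ideal I R" and K: "ideal K R" "I \<subseteq> K"
  shows "ideal ((+>) I ` K) (R Quot I)" "\<And>x. x \<in> carrier R \<Longrightarrow> I +> x \<in> (+>) I ` K \<Longrightarrow> x \<in> K"
proof -
  interpret h: ring_hom_ring R "R Quot I" "(+>) I" by (rule quot_hom[OF I])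
  show "ideal ((+>) I ` K) (R Quot I)"
  proof (rule idealI[OF h.S.ring_axioms])
    show "subgroup ((+>) I ` K) (add_monoid (R Quot I))"
      using h.img_is_add_subgroup additive_subgroup.a_subgroup[OF ideal.axioms(1)[OF K(1)]] .
    fix C D assume "C \<in> (+>) I ` K" "D \<in> carrier (R Quot I)"
    then obtain x y where xy: "x \<in> K" "y \<in> carrier R" "C = I +> x" "D = I +> y" using quot_surj[OF I] by blast
    then have "x \<in> carrier R" using ideal_carrier[OF K(1)] by blast
    then show "D \<otimes>\<^bsub>R Quot I\<^esub> C \<in> (+>) I ` K" "C \<otimes>\<^bsub>R Quot I\<^esub> D \<in> (+>) I ` K"
      using xy ideal_mult_l[OF K(1)] ideal_mult_r[OF K(1)] h.hom_mult by (metis imageI)+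
  qed
  fix x assume x: "x \<in> carrier R" "I +> x \<in> (+>) I ` K"
  then obtain y where y: "y \<in> K" "I +> x = I +> y" by blast
  then have "x - y \<in> I" using rcos_eq_iff[OF I x(1)] ideal_carrier[OF K(1)] by blast
  then show "x \<in> K" using ideal_add[OF K(1), of "x - y" y] y(1) K(2) by auto
qed

end

text \<open>With equal kernels the value of \<open>h'\<close> depends only on that of
  \<open>h\<close>. Both isomorphisms of the theorem are obtained in this way, from two surjections
  out of a common ring.\<close>

lemma iso_of_kernels:
  assumes "ring_hom_ring R S h" "ring_hom_ring R S' h'"
    and surj: "carrier S = h ` carrier R" "carrier S' = h' ` carrier R"
    and ker: "\<And>x. x \<in> carrier R \<Longrightarrow> h x = \<zero>\<^bsub>S\<^esub> \<longleftrightarrow> h' x = \<zero>\<^bsub>S'\<^esub>"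
  shows "\<exists>\<phi> \<in> ring_iso S S'. \<forall>x \<in> carrier R. \<phi> (h x) = h' x"
proof -
  interpret h: ring_hom_ring R S h by fact
  interpret h': ring_hom_ring R S' h' by fact
  have eq: "h x = h y \<longleftrightarrow> h' x = h' y" if xy: "x \<in> carrier R" "y \<in> carrier R" for x y
  proof -
    have c: "x \<ominus>\<^bsub>R\<^esub> y \<in> carrier R" using xy by simp
    have "h x = h y \<longleftrightarrow> h (x \<ominus>\<^bsub>R\<^esub> y) = \<zero>\<^bsub>S\<^esub>"
      using xy by (simp add: h.R.minus_eq) (metis h.S.minus_eq h.S.r_right_minus_eq h.hom_closed)
    moreover have "h' x = h' y \<longleftrightarrow> h' (x \<ominus>\<^bsub>R\<^esub> y) = \<zero>\<^bsub>S'\<^esub>"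
      using xy by (simp add: h.R.minus_eq) (metis h'.S.minus_eq h'.S.r_right_minus_eq h'.hom_closed)
    ultimately show ?thesis using ker[OF c] by simp
  qed
  define \<phi> where "\<phi> s = h' (SOME x. x \<in> carrier R \<and> h x = s)" for s
  have \<phi>: "\<phi> (h x) = h' x" if x: "x \<in> carrier R" for x
  proof -
    have "(SOME y. y \<in> carrier R \<and> h y = h x) \<in> carrier R \<and> h (SOME y. y \<in> carrier R \<and> h y = h x) = h x"
      by (rule someI[of _ x]) (use x in simp)
    then show ?thesis unfolding \<phi>_def using eq x by blast
  qed
  have "\<phi> \<in> ring_hom S S'"
  proof (rule ring_hom_memI)
    fix s assume "s \<in> carrier S"
    then obtain x where x: "x \<in> carrier R" "s = h x" using surj by blast
    then show "\<phi> s \<in> carrier S'" using \<phi> by simp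
    fix t assume "t \<in> carrier S"
    then obtain y where y: "y \<in> carrier R" "t = h y" using surj by blast
    show "\<phi> (s \<otimes>\<^bsub>S\<^esub> t) = \<phi> s \<otimes>\<^bsub>S'\<^esub> \<phi> t" using x y \<phi>[of "x \<otimes>\<^bsub>R\<^esub> y"] \<phi>[of x] \<phi>[of y] by simp
    show "\<phi> (s \<oplus>\<^bsub>S\<^esub> t) = \<phi> s \<oplus>\<^bsub>S'\<^esub> \<phi> t" using x y \<phi>[of "x \<oplus>\<^bsub>R\<^esub> y"] \<phi>[of x] \<phi>[of y] by simp
  next
    show "\<phi> \<one>\<^bsub>S\<^esub> = \<one>\<^bsub>S'\<^esub>" using \<phi>[of "\<one>\<^bsub>R\<^esub>"] by simp
  qed
  moreover have "bij_betw \<phi> (carrier S) (carrier S')"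
    unfolding bij_betw_def
  proof
    show "inj_on \<phi> (carrier S)" unfolding surj(1) using \<phi> eq by (auto intro!: inj_onI)
    show "\<phi> ` carrier S = carrier S'" unfolding surj image_image using \<phi> by auto
  qed
  ultimately show ?thesis using \<phi> by (auto simp: ring_iso_def)
qed

section \<open>Convolution algebras\<close>

text \<open>Additive extension from generators. \<open>G u\<close> need only be additive in the
  coefficient (\<open>biadd\<close>), which covers integers and field elements alike.\<close>

definition lin :: "('a \<Rightarrow> 'c::zero \<Rightarrow> 'b::ab_group_add) \<Rightarrow> ('a \<Rightarrow>\<^sub>0 'c) \<Rightarrow> 'b" where
  "lin G x = (\<Sum>u \<in> Poly_Mapping.keys x. G u (Poly_Mapping.lookup x u))"

definition biadd :: "('a \<Rightarrow> 'c::ab_group_add \<Rightarrow> 'b::ab_group_add) \<Rightarrow> bool" where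
  "biadd G \<longleftrightarrow> (\<forall>u a b. G u (a + b) = G u a + G u b)"

lemma biadd_zero: "biadd G \<Longrightarrow> G u 0 = 0"
  unfolding biadd_def by (metis add_cancel_right_right add_0)

lemma lin_superset:
  assumes "biadd G" "finite A" "Poly_Mapping.keys x \<subseteq> A"
  shows "lin G x = (\<Sum>u \<in> A. G u (Poly_Mapping.lookup x u))"
  unfolding lin_def using assms
  by (intro sum.mono_neutral_left) (auto simp: in_keys_iff biadd_zero)

lemma lin_add: "biadd G \<Longrightarrow> lin G (x + y) = lin G x + lin G y"
proof -
  assume G: "biadd G"
  define A where "A = Poly_Mapping.keys x \<union> Poly_Mapping.keys y"
  have "lin G (x + y) = (\<Sum>u \<in> A. G u (Poly_Mapping.lookup (x + y) u))"
    using keys_add[of x y] by (intro lin_superset[OF G]) (auto simp: A_def)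
  also have "\<dots> = (\<Sum>u \<in> A. G u (Poly_Mapping.lookup x u)) + (\<Sum>u \<in> A. G u (Poly_Mapping.lookup y u))"
    using G by (simp add: lookup_add biadd_def sum.distrib)
  also have "\<dots> = lin G x + lin G y"
    using lin_superset[OF G, of A x] lin_superset[OF G, of A y] by (simp add: A_def)
  finally show ?thesis .
qed

lemma lin_zero [simp]: "lin G 0 = 0" by (simp add: lin_def)

lemma lin_diff: "biadd G \<Longrightarrow> lin G (x - y) = lin G x - lin G y"
  using lin_add[of G "x - y" y] by simp

lemma lin_single: "biadd G \<Longrightarrow> lin G (Poly_Mapping.single u a) = G u a"
  by (cases "a = 0") (auto simp: lin_def biadd_zero)

lemma pm_expand: "x = (\<Sum>u \<in> Poly_Mapping.keys x. Poly_Mapping.single u (Poly_Mapping.lookup x u))"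
proof (rule poly_mapping_eqI)
  fix k
  show "Poly_Mapping.lookup x k = Poly_Mapping.lookup (\<Sum>u \<in> Poly_Mapping.keys x. Poly_Mapping.single u (Poly_Mapping.lookup x u)) k"
    by (simp add: lookup_sum lookup_single when_def in_keys_iff)
qed

lemma pm_induct [consumes 1, case_names zero single add]:
  fixes x :: "'a \<Rightarrow>\<^sub>0 'c::ab_group_add"
  assumes "Poly_Mapping.keys x \<subseteq> S" and z: "Q 0" and s: "\<And>u c. u \<in> S \<Longrightarrow> Q (Poly_Mapping.single u c)"
    and a: "\<And>x y. Poly_Mapping.keys x \<subseteq> S \<Longrightarrow> Poly_Mapping.keys y \<subseteq> S \<Longrightarrow> Q x \<Longrightarrow> Q y \<Longrightarrow> Q (x + y)"
  shows "Q x"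
proof -
  have "Q (\<Sum>u \<in> A. Poly_Mapping.single u (Poly_Mapping.lookup x u)) \<and>
      Poly_Mapping.keys (\<Sum>u \<in> A. Poly_Mapping.single u (Poly_Mapping.lookup x u)) \<subseteq> S" if "A \<subseteq> S" "finite A" for A
    using that(2,1)
  proof (induction A rule: finite_induct)
    case (insert u A)
    have "Poly_Mapping.keys (Poly_Mapping.single u (Poly_Mapping.lookup x u)) \<subseteq> S" using insert.prems by simp
    then show ?case using insert a s keys_add by (auto dest!: subsetD[OF keys_add])
  qed (use z in simp)
  from this[OF assms(1)] show ?thesis using pm_expand[of x] by simp
qed

text \<open>The common pattern of the multiplications in \<open>free_pairs\<close> and
  \<open>path_algebra\<close>: generators are multiplied by a partial operation, and
  \<open>None\<close> stands for the product zero.\<close>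

definition conv :: "('a \<Rightarrow> 'a \<Rightarrow> 'a option) \<Rightarrow> ('a \<Rightarrow>\<^sub>0 'c::comm_ring_1) \<Rightarrow> ('a \<Rightarrow>\<^sub>0 'c) \<Rightarrow> ('a \<Rightarrow>\<^sub>0 'c)" where
  "conv op x y = (\<Sum>u \<in> Poly_Mapping.keys x. \<Sum>v \<in> Poly_Mapping.keys y.
     case op u v of None \<Rightarrow> 0 | Some w \<Rightarrow> Poly_Mapping.single w (Poly_Mapping.lookup x u * Poly_Mapping.lookup y v))"

lemma conv_lin:
  "conv op x y = lin (\<lambda>u a. lin (\<lambda>v b. case op u v of None \<Rightarrow> 0 | Some w \<Rightarrow> Poly_Mapping.single w (a * b)) y) x"
  by (simp add: conv_def lin_def)

lemma biadd_conv1: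
  "biadd (\<lambda>v (b :: 'c::comm_ring_1). case op u v of None \<Rightarrow> 0 | Some w \<Rightarrow> Poly_Mapping.single w (a * b))"
  by (auto simp: biadd_def distrib_left single_add split: option.splits)

lemma biadd_conv2:
  fixes y :: "'b \<Rightarrow>\<^sub>0 'c::comm_ring_1"
  shows "biadd (\<lambda>u a. lin (\<lambda>v b. case op u v of None \<Rightarrow> 0 | Some w \<Rightarrow> Poly_Mapping.single w (a * b)) y)"
proof -
  have "(case op u v of None \<Rightarrow> 0 | Some w \<Rightarrow> Poly_Mapping.single w ((a + a') * b)) =
      (case op u v of None \<Rightarrow> 0 | Some w \<Rightarrow> Poly_Mapping.single w (a * b)) +
      (case op u v of None \<Rightarrow> 0 | Some w \<Rightarrow> Poly_Mapping.single w (a' * b))" for u v a a' and b :: 'c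
    by (auto simp: distrib_right single_add split: option.splits)
  then show ?thesis by (simp add: biadd_def lin_def sum.distrib)
qed

lemma conv_add_left: "conv op (x + x') y = conv op x y + conv op x' y"
  unfolding conv_lin by (rule lin_add[OF biadd_conv2])

lemma conv_add_right: "conv op x (y + y') = conv op x y + conv op x y'"
  unfolding conv_lin by (simp add: lin_add[OF biadd_conv1] lin_def[of _ x] sum.distrib)

lemma conv_zero [simp]: "conv op 0 y = 0" "conv op x 0 = 0"
  by (simp_all add: conv_def)

lemma conv_single:
  "conv op (Poly_Mapping.single u a) (Poly_Mapping.single v b) =
     (case op u v of None \<Rightarrow> 0 | Some w \<Rightarrow> Poly_Mapping.single w (a * b))"
proof -
  have "conv op (Poly_Mapping.single u a) (Poly_Mapping.single v b) =
      lin (\<lambda>v b. case op u v of None \<Rightarrow> 0 | Some w \<Rightarrow> Poly_Mapping.single w (a * b)) (Poly_Mapping.single v b)"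
    unfolding conv_lin by (rule lin_single[OF biadd_conv2])
  also have "\<dots> = (case op u v of None \<Rightarrow> 0 | Some w \<Rightarrow> Poly_Mapping.single w (a * b))"
    by (rule lin_single[OF biadd_conv1])
  finally show ?thesis .
qed

lemma conv_sum_left: "conv op (sum f A) y = (\<Sum>i \<in> A. conv op (f i) y)"
  by (induction A rule: infinite_finite_induct) (auto simp: conv_add_left)

lemma conv_sum_right: "conv op y (sum f A) = (\<Sum>i \<in> A. conv op y (f i))"
  by (induction A rule: infinite_finite_induct) (auto simp: conv_add_right)

text \<open>\<open>conv\<close> is additive in each argument, so associativity and the unit laws
  have to be checked on single generators only.\<close>

lemma conv_ring:
  fixes e :: "'a \<Rightarrow>\<^sub>0 'c::comm_ring_1"
  assumes closed: "\<And>u v w. u \<in> S \<Longrightarrow> v \<in> S \<Longrightarrow> op u v = Some w \<Longrightarrow> w \<in> S"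
    and assoc: "\<And>u v t. u \<in> S \<Longrightarrow> v \<in> S \<Longrightarrow> t \<in> S \<Longrightarrow>
      Option.bind (op u v) (\<lambda>w. op w t) = Option.bind (op v t) (\<lambda>w. op u w)"
    and e: "Poly_Mapping.keys e \<subseteq> S"
    and unit: "\<And>u c. u \<in> S \<Longrightarrow> conv op e (Poly_Mapping.single u c) = Poly_Mapping.single u c"
      "\<And>u c. u \<in> S \<Longrightarrow> conv op (Poly_Mapping.single u c) e = Poly_Mapping.single u c"
  shows "add_ring \<lparr>carrier = {x. Poly_Mapping.keys x \<subseteq> S}, monoid.mult = conv op, one = e, zero = 0, add = (+)\<rparr>"
proof -
  have kadd: "Poly_Mapping.keys (x + y) \<subseteq> S" if "Poly_Mapping.keys x \<subseteq> S" "Poly_Mapping.keys y \<subseteq> S" for x y :: "'a \<Rightarrow>\<^sub>0 'c"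
    using keys_add[of x y] that by blast
  have kconv: "Poly_Mapping.keys (conv op x y) \<subseteq> S" if "Poly_Mapping.keys x \<subseteq> S" "Poly_Mapping.keys y \<subseteq> S" for x y :: "'a \<Rightarrow>\<^sub>0 'c"
    using that
  proof (induction x rule: pm_induct)
    case (single u c)
    from single.prems show ?case
    proof (induction y rule: pm_induct)
      case (single v b)
      then show ?case using closed[OF \<open>u \<in> S\<close>] by (auto simp: conv_single split: option.splits if_splits)
    qed (auto simp: conv_add_right kadd)
  qed (auto simp: conv_add_left kadd)
  have casc: "conv op (conv op x y) z = conv op x (conv op y z)"
    if "Poly_Mapping.keys x \<subseteq> S" "Poly_Mapping.keys y \<subseteq> S" "Poly_Mapping.keys z \<subseteq> S" for x y z :: "'a \<Rightarrow>\<^sub>0 'c"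
    using that
  proof (induction x rule: pm_induct)
    case (single u a)
    from single(2,3) show ?case
    proof (induction y rule: pm_induct)
      case (single v b)
      from single(2) show ?case
      proof (induction z rule: pm_induct)
        case (single t c)
        show ?case using assoc[OF \<open>u \<in> S\<close> \<open>v \<in> S\<close> \<open>t \<in> S\<close>]
          by (auto simp: conv_single mult.assoc split: option.splits)
      qed (auto simp: conv_add_right)
    qed (auto simp: conv_add_right conv_add_left)
  qed (auto simp: conv_add_left)
  have l1: "conv op e x = x" if "Poly_Mapping.keys x \<subseteq> S" for x :: "'a \<Rightarrow>\<^sub>0 'c"
    using that by (induction x rule: pm_induct) (auto simp: unit conv_add_right)
  have r1: "conv op x e = x" if "Poly_Mapping.keys x \<subseteq> S" for x :: "'a \<Rightarrow>\<^sub>0 'c"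
    using that by (induction x rule: pm_induct) (auto simp: unit conv_add_left)
  have "ring \<lparr>carrier = {x. Poly_Mapping.keys x \<subseteq> S}, monoid.mult = conv op, one = e, zero = 0, add = (+)\<rparr>"
  proof (rule ringI)
    show "abelian_group \<lparr>carrier = {x. Poly_Mapping.keys x \<subseteq> S}, monoid.mult = conv op, one = e, zero = 0, add = (+)\<rparr>"
    proof (rule abelian_groupI)
      fix x :: "'a \<Rightarrow>\<^sub>0 'c" assume "x \<in> carrier \<lparr>carrier = {x. Poly_Mapping.keys x \<subseteq> S}, monoid.mult = conv op, one = e, zero = 0, add = (+)\<rparr>"
      then show "\<exists>y \<in> carrier \<lparr>carrier = {x. Poly_Mapping.keys x \<subseteq> S}, monoid.mult = conv op, one = e, zero = 0, add = (+)\<rparr>.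
        y \<oplus>\<^bsub>\<lparr>carrier = {x. Poly_Mapping.keys x \<subseteq> S}, monoid.mult = conv op, one = e, zero = 0, add = (+)\<rparr>\<^esub> x =
        \<zero>\<^bsub>\<lparr>carrier = {x. Poly_Mapping.keys x \<subseteq> S}, monoid.mult = conv op, one = e, zero = 0, add = (+)\<rparr>\<^esub>"
        by (intro bexI[of _ "- x"]) (auto simp: in_keys_iff subset_iff)
    qed (auto simp: add_ac kadd)
    show "Group.monoid \<lparr>carrier = {x. Poly_Mapping.keys x \<subseteq> S}, monoid.mult = conv op, one = e, zero = 0, add = (+)\<rparr>"
      by (rule monoidI) (auto simp: kconv casc e l1 r1)
  qed (auto simp: conv_add_left conv_add_right)
  then show ?thesis by (simp add: add_ring_def add_ring_axioms_def)
qed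

section \<open>Free pairs, path algebras and polynomial rings\<close>

definition pair_op :: "'b ring \<Rightarrow> 'c ring \<Rightarrow> 'b \<times> 'c \<Rightarrow> 'b \<times> 'c \<Rightarrow> ('b \<times> 'c) option" where
  "pair_op B C u v = Some (fst u \<otimes>\<^bsub>B\<^esub> fst v, snd u \<otimes>\<^bsub>C\<^esub> snd v)"

lemma free_pairs_eq:
  "free_pairs B C = \<lparr>carrier = {x. Poly_Mapping.keys x \<subseteq> carrier B \<times> carrier C},
     monoid.mult = conv (pair_op B C), one = frag_of (\<one>\<^bsub>B\<^esub>, \<one>\<^bsub>C\<^esub>), zero = 0, add = (+)\<rparr>"
  by (auto simp: free_pairs_def conv_def pair_op_def fun_eq_iff)

lemma free_pairs_add_ring:
  assumes "ring B" "ring C"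
  shows "add_ring (free_pairs B C)"
proof -
  interpret B: ring B by fact
  interpret C: ring C by fact
  show ?thesis unfolding free_pairs_eq
    by (rule conv_ring) (auto simp: pair_op_def B.m_assoc C.m_assoc conv_single)
qed

lemma free_pairs_mult:
  "pair_gen a p \<otimes>\<^bsub>free_pairs B C\<^esub> pair_gen b q = pair_gen (a \<otimes>\<^bsub>B\<^esub> b) (p \<otimes>\<^bsub>C\<^esub> q)"
  by (simp add: free_pairs_eq conv_single pair_op_def)

definition path_op :: "'e svec list \<Rightarrow> 'e svec list \<Rightarrow> 'e svec list option" where
  "path_op p q = (if last p = hd q then Some (p @ tl q) else None)"

lemma path_algebra_eq:
  "path_algebra V = \<lparr>carrier = {x. Poly_Mapping.keys x \<subseteq> paths V}, monoid.mult = conv path_op,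
      one = (\<Sum>\<alpha> \<in> V. Poly_Mapping.single [\<alpha>] 1), zero = 0, add = (+)\<rparr>"
proof -
  have "(if c then a else 0) = (case if c then Some w else None of None \<Rightarrow> 0 | Some w \<Rightarrow> Poly_Mapping.single w b)"
    if "a = Poly_Mapping.single w b" for c a b and w :: "'e svec list" using that by simp
  then show ?thesis unfolding path_algebra_def conv_def path_op_def by (simp add: if_distrib cong: if_cong)
qed

lemma path_append: "p \<in> paths V \<Longrightarrow> q \<in> paths V \<Longrightarrow> last p = hd q \<Longrightarrow> p @ tl q \<in> paths V"
proof -
  assume p: "p \<in> paths V" and q: "q \<in> paths V" and l: "last p = hd q"
  obtain a q' where q': "q = a # q'" using q by (cases q) (auto simp: paths_def)
  then show ?thesis using p q l by (cases q') (auto simp: paths_def successively_append_iff)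
qed

lemma last_append_tl: "q \<noteq> [] \<Longrightarrow> last p = hd q \<Longrightarrow> last (p @ tl q) = last q"
  by (cases q) auto

lemma conv_unit_left:
  assumes "finite V" "u \<in> paths V"
  shows "conv path_op (\<Sum>\<alpha> \<in> V. Poly_Mapping.single [\<alpha>] a) (Poly_Mapping.single u c) = Poly_Mapping.single u (a * c)"
proof -
  have u: "u \<noteq> []" "hd u \<in> V" "hd u # tl u = u" using assms(2) by (auto simp: paths_def)
  have "conv path_op (\<Sum>\<alpha> \<in> V. Poly_Mapping.single [\<alpha>] a) (Poly_Mapping.single u c) =
      (\<Sum>\<alpha> \<in> V. if \<alpha> = hd u then Poly_Mapping.single u (a * c) else 0)"
    unfolding conv_sum_left by (rule sum.cong) (auto simp: conv_single path_op_def u)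
  then show ?thesis using u assms(1) by simp
qed

lemma conv_unit_right:
  assumes "finite V" "u \<in> paths V"
  shows "conv path_op (Poly_Mapping.single u c) (\<Sum>\<alpha> \<in> V. Poly_Mapping.single [\<alpha>] a) = Poly_Mapping.single u (c * a)"
proof -
  have u: "last u \<in> V" using assms(2) by (auto simp: paths_def)
  have "conv path_op (Poly_Mapping.single u c) (\<Sum>\<alpha> \<in> V. Poly_Mapping.single [\<alpha>] a) =
      (\<Sum>\<alpha> \<in> V. if \<alpha> = last u then Poly_Mapping.single u (c * a) else 0)"
    unfolding conv_sum_right by (rule sum.cong) (auto simp: conv_single path_op_def)
  then show ?thesis using u assms(1) by simp
qed

lemma keys_unit: "Poly_Mapping.keys (\<Sum>\<alpha> \<in> V. Poly_Mapping.single [\<alpha>] c) \<subseteq> paths V"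
proof (induction V rule: infinite_finite_induct)
  case (insert \<alpha> V)
  have "paths V \<subseteq> paths (insert \<alpha> V)" by (auto simp: paths_def)
  show ?case
  proof -
    have "[\<alpha>] \<in> paths (insert \<alpha> V)" by (simp add: paths_def)
    moreover have "Poly_Mapping.keys (Poly_Mapping.single [\<alpha>] c) \<subseteq> {[\<alpha>]}" by simp
    moreover have "Poly_Mapping.keys (\<Sum>\<alpha> \<in> V. Poly_Mapping.single [\<alpha>] c) \<subseteq> paths (insert \<alpha> V)"
      using insert.IH \<open>paths V \<subseteq> paths (insert \<alpha> V)\<close> by (rule order_trans)
    ultimately show ?thesis
      using keys_add[of "Poly_Mapping.single [\<alpha>] c" "\<Sum>\<alpha> \<in> V. Poly_Mapping.single [\<alpha>] c"] insert.hyps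
      by (simp del: keys_single) blast
  qed
qed auto

lemma path_algebra_add_ring:
  assumes "finite V"
  shows "add_ring (path_algebra V :: ('e, 'k::field) pathalg ring)"
  unfolding path_algebra_eq
proof (rule conv_ring)
  fix u v w :: "'e svec list" assume "u \<in> paths V" "v \<in> paths V" "path_op u v = Some w"
  then show "w \<in> paths V" using path_append by (auto simp: path_op_def split: if_splits)
next
  fix u v t :: "'e svec list" assume "u \<in> paths V" "v \<in> paths V" "t \<in> paths V"
  then have ne: "u \<noteq> []" "v \<noteq> []" "t \<noteq> []" by (auto simp: paths_def)
  then have "hd (v @ tl t) = hd v" "tl (v @ tl t) = tl v @ tl t" by auto
  then show "Option.bind (path_op u v) (\<lambda>w. path_op w t) = Option.bind (path_op v t) (\<lambda>w. path_op u w)"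
    using last_append_tl[OF ne(2), of u] by (auto simp: path_op_def)
qed (simp_all add: keys_unit conv_unit_left[OF assms] conv_unit_right[OF assms])

lemma sym_carrier: "p \<in> carrier (sym_ring E) \<longleftrightarrow> (\<forall>m \<in> Poly_Mapping.keys p. Poly_Mapping.keys m \<subseteq> E)"
  by (simp add: sym_ring_def)

lemma sym_simps [simp]: "\<one>\<^bsub>sym_ring E\<^esub> = 1" "\<zero>\<^bsub>sym_ring E\<^esub> = 0" "p \<otimes>\<^bsub>sym_ring E\<^esub> q = p * q" "p \<oplus>\<^bsub>sym_ring E\<^esub> q = p + q"
  by (simp_all add: sym_ring_def ring_of_type_algebra_def)

lemma sym_add: "p \<in> carrier (sym_ring E) \<Longrightarrow> q \<in> carrier (sym_ring E) \<Longrightarrow> p + q \<in> carrier (sym_ring E)"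
  unfolding sym_carrier using keys_add[of p q] by blast

lemma sym_mult: 
  assumes "p \<in> carrier (sym_ring E)" "q \<in> carrier (sym_ring E)"
  shows "p * q \<in> carrier (sym_ring E)"
  unfolding sym_carrier
proof
  fix m assume "m \<in> Poly_Mapping.keys (p * q)"
  then obtain a b where "m = a + b" "a \<in> Poly_Mapping.keys p" "b \<in> Poly_Mapping.keys q"
    using keys_mult[of p q] by blast
  then show "Poly_Mapping.keys m \<subseteq> E" using assms keys_add[of a b] unfolding sym_carrier by blast
qed

lemma sym_uminus: "p \<in> carrier (sym_ring E) \<Longrightarrow> - p \<in> carrier (sym_ring E)"
  by (simp add: sym_carrier in_keys_iff)

lemma sym_zero: "0 \<in> carrier (sym_ring E)" and sym_one: "1 \<in> carrier (sym_ring E)"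
  and sym_const: "poly_const c \<in> carrier (sym_ring E)"
  by (auto simp: sym_carrier poly_const_def split: if_splits)

lemma sym_var: "i \<in> E \<Longrightarrow> poly_var i \<in> carrier (sym_ring E)"
  by (auto simp: sym_carrier poly_var_def split: if_splits)

lemma sym_prod: "(\<And>i. i \<in> A \<Longrightarrow> x i \<in> carrier (sym_ring E)) \<Longrightarrow> prod x A \<in> carrier (sym_ring E)"
  by (induction A rule: infinite_finite_induct) (auto simp: sym_one sym_mult)

lemma sym_sum: "(\<And>i. i \<in> A \<Longrightarrow> x i \<in> carrier (sym_ring E)) \<Longrightarrow> sum x A \<in> carrier (sym_ring E)"
  by (induction A rule: infinite_finite_induct) (auto simp: sym_zero sym_add)

lemma sym_squarefree: "S \<subseteq> E \<Longrightarrow> squarefree_mon S \<in> carrier (sym_ring E)"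
  unfolding squarefree_mon_def by (rule sym_prod) (auto intro: sym_var)

lemma sym_add_ring: "add_ring (sym_ring E :: ('e, 'k::field) mpoly ring)"
proof -
  have "ring (sym_ring E :: ('e, 'k::field) mpoly ring)"
  proof (rule ringI)
    show "abelian_group (sym_ring E :: ('e, 'k::field) mpoly ring)"
    proof (rule abelian_groupI)
      fix x :: "('e, 'k) mpoly" assume "x \<in> carrier (sym_ring E)"
      then show "\<exists>y \<in> carrier (sym_ring E). y \<oplus>\<^bsub>sym_ring E\<^esub> x = \<zero>\<^bsub>sym_ring E\<^esub>"
        by (intro bexI[of _ "- x"]) (auto intro: sym_uminus)
    qed (auto simp: sym_add sym_zero add_ac)
    show "Group.monoid (sym_ring E :: ('e, 'k::field) mpoly ring)"
      by (rule monoidI) (auto simp: sym_mult sym_one mult_ac)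
  qed (auto simp: distrib_left distrib_right)
  then show ?thesis by (auto simp: add_ring_def add_ring_axioms_def fun_eq_iff)
qed

lemma poly_const_simps [simp]: "poly_const (a + b) = poly_const a + poly_const b"
  "poly_const (a * b) = poly_const a * poly_const b" "poly_const 0 = 0" "poly_const 1 = 1"
  by (simp_all add: poly_const_def single_add mult_single)

context add_ring
begin

text \<open>Congruent representatives have the same image coset, so the union in
  \<open>coset_map\<close> is a single coset.\<close>

lemma coset_map_eq:
  assumes I: "ideal I R" and J: "ideal J R" and p: "p \<in> carrier R"
    and h: "\<And>c. c \<in> carrier R \<Longrightarrow> h c \<in> carrier R" "\<And>c. c \<in> carrier R \<Longrightarrow> c - p \<in> I \<Longrightarrow> h c - h p \<in> J"
  shows "coset_map R J h (I +> p) = J +> h p"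
proof -
  have c: "c \<in> carrier R" "c - p \<in> I" if "c \<in> I +> p" for c
  proof -
    obtain i where i: "i \<in> I" "c = i + p" using \<open>c \<in> I +> p\<close> by (auto simp: a_r_coset_def r_coset_def plus)
    then show "c \<in> carrier R" "c - p \<in> I" using ideal_carrier[OF I i(1)] p plus_closed by auto
  qed
  then have "J +> h c = J +> h p" if "c \<in> I +> p" for c
    using rcos_eq_iff[OF J] h p that by blast
  moreover have "p \<in> I +> p"
    using ideal_zero[OF I] by (auto simp: a_r_coset_def r_coset_def plus)
  ultimately show ?thesis unfolding coset_map_def by blast
qed

lemma quot_finsum:
  assumes I: "ideal I R" and "finite A" "\<And>i. i \<in> A \<Longrightarrow> x i \<in> carrier R"
  shows "finsum (R Quot I) (\<lambda>i. I +> x i) A = I +> sum x A"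
proof -
  interpret h: ring_hom_ring R "R Quot I" "(+>) I" by (rule quot_hom[OF I])
  show ?thesis using assms(2,3)
  proof (induction A rule: finite_induct)
    case empty
    then show ?case using h.hom_zero zero_eq by simp
  next
    case (insert a A)
    have "finsum (R Quot I) (\<lambda>i. I +> x i) (insert a A) = (I +> x a) \<oplus>\<^bsub>R Quot I\<^esub> finsum (R Quot I) (\<lambda>i. I +> x i) A"
      using insert by (intro h.S.finsum_insert) auto
    also have "\<dots> = I +> (x a \<oplus> sum x A)"
      using insert by (subst h.hom_add) (auto intro: sum_in)
    finally show ?case using insert by (simp add: plus)
  qed
qed

end

context generic_program
begin

section \<open>Taut paths\<close>

lemma B_nonzero: "\<alpha> \<in> B \<Longrightarrow> \<alpha> i \<noteq> Zero \<longleftrightarrow> i \<in> E"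
  using B_supp[of \<alpha>] in_supp[of i \<alpha>] by simp

lemma finite_B: "finite B"
proof -
  have "(UNIV :: sign set) = {Zero, Pos, Neg}" using sign.exhaust by auto
  then have "finite (UNIV :: sign set)" by (metis finite.emptyI finite.insertI)
  then have "finite {h. \<forall>x. (x \<in> E \<longrightarrow> h x \<in> (UNIV :: sign set)) \<and> (x \<notin> E \<longrightarrow> h x = Zero)}"
    using finite_E by (intro finite_set_of_finite_funs)
  moreover have "B \<subseteq> {h. \<forall>x. (x \<in> E \<longrightarrow> h x \<in> (UNIV :: sign set)) \<and> (x \<notin> E \<longrightarrow> h x = Zero)}"
    using B_nonzero by blast
  ultimately show ?thesis using finite_subset by blast
qed

lemma sdist_flip:
  assumes "\<alpha> \<in> B" "\<gamma> \<in> B" "\<alpha> i \<noteq> \<gamma> i"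
  shows "sdist P \<alpha> \<gamma> = Suc (sdist P (flip_at \<alpha> i) \<gamma>)"
proof -
  have iE: "i \<in> E" using assms B_nonzero by metis
  have fi: "flip_at \<alpha> i i = \<gamma> i"
    using full_signs_cases[OF B_supp[OF assms(1)] B_supp[OF assms(2)], of i] assms(3) by (auto simp: flip_at_apply)
  have "{j \<in> E. \<alpha> j \<noteq> \<gamma> j} = insert i {j \<in> E. flip_at \<alpha> i j \<noteq> \<gamma> j}"
    using iE assms(3) fi by (auto simp: flip_at_apply split: if_splits)
  moreover have "i \<notin> {j \<in> E. flip_at \<alpha> i j \<noteq> \<gamma> j}" using fi by simp
  ultimately show ?thesis using finite_E by (simp add: sdist_def)
qed

lemma sdist_zero: "\<alpha> \<in> B \<Longrightarrow> sdist P \<alpha> \<alpha> = 0"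
  by (simp add: sdist_def)

lemma adjacent_flip: "i \<in> E \<Longrightarrow> \<alpha> \<in> B \<Longrightarrow> adjacent \<alpha> (flip_at \<alpha> i)"
  using B_nonzero by (auto simp: adjacent_def flip_at_apply split: if_splits)

lemma adjacent_flipD:
  assumes "\<alpha> \<in> B" "\<beta> \<in> B" "adjacent \<alpha> \<beta>"
  shows "\<exists>i \<in> E. \<beta> = flip_at \<alpha> i"
proof -
  obtain i where i: "\<alpha> i \<noteq> \<beta> i" "\<And>j. \<alpha> j \<noteq> \<beta> j \<Longrightarrow> j = i" using assms(3) unfolding adjacent_def by blast
  have "\<beta> = flip_at \<alpha> i"
    using full_eq_or_flip[OF B_supp[OF assms(1)] B_supp[OF assms(2)], of i] i by metis
  moreover have "i \<in> E" using i(1) B_nonzero assms by metis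
  ultimately show ?thesis by blast
qed

text \<open>Each step flips a sign in which the path still differs from its end. This forces the
  shortest possible length (\<open>taut_length\<close>) and, unlike a condition on repeated flips,
  suits recursion from the front.\<close>

fun taut :: "'e svec list \<Rightarrow> bool" where
  "taut [] = False"
| "taut [\<alpha>] = (\<alpha> \<in> B)"
| "taut (\<alpha> # \<beta> # \<pi>) = (\<alpha> \<in> B \<and> (\<exists>i. \<alpha> i \<noteq> last (\<beta> # \<pi>) i \<and> \<beta> = flip_at \<alpha> i) \<and> taut (\<beta> # \<pi>))"

lemma taut_paths: "taut \<pi> \<Longrightarrow> \<pi> \<in> paths B"
proof (induction \<pi> rule: taut.induct)
  case (3 \<alpha> \<beta> \<pi>)
  then obtain i where i: "\<alpha> i \<noteq> last (\<beta> # \<pi>) i" "\<beta> = flip_at \<alpha> i" and p: "\<alpha> \<in> B" "\<beta> # \<pi> \<in> paths B" by auto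
  have "last (\<beta> # \<pi>) \<in> B" using p(2) by (auto simp: paths_def)
  then have "i \<in> E" using i(1) p(1) B_nonzero by metis
  then have "adjacent \<alpha> \<beta>" using adjacent_flip p(1) i(2) by blast
  then show ?case using p by (auto simp: paths_def)
qed (auto simp: paths_def)

lemma paths_ends: "\<pi> \<in> paths B \<Longrightarrow> \<pi> \<noteq> [] \<and> hd \<pi> \<in> B \<and> last \<pi> \<in> B"
  by (auto simp: paths_def)

lemma paths_Cons: "\<alpha> # \<beta> # \<pi> \<in> paths B \<longleftrightarrow> \<alpha> \<in> B \<and> adjacent \<alpha> \<beta> \<and> \<beta> # \<pi> \<in> paths B"
  by (auto simp: paths_def)

lemma taut_length: "taut \<pi> \<Longrightarrow> length \<pi> = Suc (sdist P (hd \<pi>) (last \<pi>))"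
proof (induction \<pi> rule: taut.induct)
  case (3 \<alpha> \<beta> \<pi>)
  then obtain i where i: "\<alpha> i \<noteq> last (\<beta> # \<pi>) i" "\<beta> = flip_at \<alpha> i" and p: "\<alpha> \<in> B" "taut (\<beta> # \<pi>)" by auto
  have l: "last (\<beta> # \<pi>) \<in> B" using taut_paths[OF p(2)] by (auto simp: paths_def)
  have "length (\<beta> # \<pi>) = Suc (sdist P \<beta> (last (\<beta> # \<pi>)))" using 3 p(2) by simp
  then show ?case using sdist_flip[OF p(1) l i(1)] i(2) by simp
qed (auto simp: sdist_zero)

lemma taut_Cons: "\<alpha> \<in> B \<Longrightarrow> taut \<pi> \<Longrightarrow> hd \<pi> = flip_at \<alpha> i \<Longrightarrow> \<alpha> i \<noteq> last \<pi> i \<Longrightarrow> taut (\<alpha> # \<pi>)"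
  by (cases \<pi>) auto

lemma taut_exists: "\<alpha> \<in> B \<Longrightarrow> \<gamma> \<in> B \<Longrightarrow> \<exists>\<pi>. taut \<pi> \<and> hd \<pi> = \<alpha> \<and> last \<pi> = \<gamma>"
proof (induction "sdist P \<alpha> \<gamma>" arbitrary: \<alpha>)
  case 0
  have "\<alpha> = \<gamma>"
  proof (rule ccontr)
    assume "\<alpha> \<noteq> \<gamma>"
    then obtain i where "\<alpha> i \<noteq> \<gamma> i" by (auto simp: fun_eq_iff)
    then show False using sdist_flip[OF 0(2,3)] 0(1) by simp
  qed
  then show ?case using 0 by (intro exI[of _ "[\<alpha>]"]) auto
next
  case (Suc n)
  have "\<alpha> \<noteq> \<gamma>" using Suc sdist_zero by auto
  then obtain i where i: "\<alpha> i \<noteq> \<gamma> i" "flip_at \<alpha> i \<in> B" using bounded_step Suc by blast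
  then have "n = sdist P (flip_at \<alpha> i) \<gamma>" using sdist_flip[OF Suc(3,4) i(1)] Suc(2) by simp
  then obtain \<pi> where \<pi>: "taut \<pi>" "hd \<pi> = flip_at \<alpha> i" "last \<pi> = \<gamma>" using Suc(1) i(2) Suc(4) by blast
  then have "taut (\<alpha> # \<pi>)" using taut_Cons[OF Suc(3) \<pi>(1,2)] i(1) by simp
  then show ?case using \<pi> by (intro exI[of _ "\<alpha> # \<pi>"]) (cases \<pi>; auto)
qed

text \<open>An arbitrary choice; \<open>taut_unique\<close> shows that every other taut path with
  the same ends is congruent to it.\<close>

definition tau :: "'e svec \<Rightarrow> 'e svec \<Rightarrow> 'e svec list" where
  "tau \<alpha> \<gamma> = (SOME \<pi>. taut \<pi> \<and> hd \<pi> = \<alpha> \<and> last \<pi> = \<gamma>)"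

lemma tau: "\<alpha> \<in> B \<Longrightarrow> \<gamma> \<in> B \<Longrightarrow> taut (tau \<alpha> \<gamma>) \<and> hd (tau \<alpha> \<gamma>) = \<alpha> \<and> last (tau \<alpha> \<gamma>) = \<gamma>"
  unfolding tau_def by (rule someI_ex) (rule taut_exists)

end

section \<open>The weight of a path\<close>

text \<open>\<open>scalars\<close> names the coefficient field \<open>'k\<close>, so that the
  definitions of this locale can mention it.\<close>

locale program_algebra = generic_program P for P :: "'e program" +
  fixes scalars :: "'k::field itself"
begin

definition dmon :: "'e svec \<Rightarrow> 'e svec \<Rightarrow> 'e svec \<Rightarrow> ('e, 'k) mpoly" where
  "dmon \<alpha> \<beta> \<gamma> = squarefree_mon (detour P \<alpha> \<beta> \<gamma>)"

lemma squarefree_empty [simp]: "squarefree_mon {} = (1 :: ('e, 'k) mpoly)" by (simp add: squarefree_mon_def)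

lemma dmon_trivial [simp]: "dmon \<alpha> \<alpha> \<gamma> = 1" "dmon \<alpha> \<gamma> \<gamma> = 1"
  by (auto simp: dmon_def detour_def)

lemma dmon_sym: "dmon \<alpha> \<beta> \<gamma> \<in> carrier (sym_ring E)"
  unfolding dmon_def by (rule sym_squarefree[OF detour_subset])

lemma squarefree_prod: "S \<subseteq> E \<Longrightarrow> squarefree_mon S = (\<Prod>i \<in> E. if i \<in> S then poly_var i else 1)"
  unfolding squarefree_mon_def using finite_E by (intro prod.mono_neutral_cong_left) auto

text \<open>This identity is what makes the product of \<open>B_tilde\<close> associative.\<close>

lemma dmon_cocycle:
  assumes "\<alpha> \<in> B" "\<beta> \<in> B" "\<gamma> \<in> B" "\<delta> \<in> B"
  shows "dmon \<alpha> \<beta> \<delta> * dmon \<beta> \<gamma> \<delta> = dmon \<alpha> \<gamma> \<delta> * (dmon \<alpha> \<beta> \<gamma> :: ('e, 'k) mpoly)"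
proof -
  \<comment> \<open>Coordinatewise: every entry is one of two opposite signs, and in each sign
    pattern both sides contain \<open>poly_var i\<close> equally often.\<close>
  have "(if i \<in> detour P \<alpha> \<beta> \<delta> then poly_var i else 1) * (if i \<in> detour P \<beta> \<gamma> \<delta> then poly_var i else 1) =
      (if i \<in> detour P \<alpha> \<gamma> \<delta> then poly_var i else 1) * (if i \<in> detour P \<alpha> \<beta> \<gamma> then poly_var i else (1 :: ('e, 'k) mpoly))"
    if "i \<in> E" for i
  proof -
    have "\<alpha> i \<noteq> Zero" "\<beta> i \<noteq> Zero" "\<gamma> i \<noteq> Zero" "\<delta> i \<noteq> Zero" using that assms B_nonzero by auto
    then show ?thesis unfolding detour_iff
      by (cases "\<alpha> i"; cases "\<beta> i"; cases "\<gamma> i"; cases "\<delta> i") (auto simp: that)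
  qed
  then show ?thesis
    unfolding dmon_def squarefree_prod[OF detour_subset] prod.distrib[symmetric] by (intro prod.cong) auto
qed

text \<open>The factor by which a path differs from the taut paths with the same ends.\<close>

fun wt :: "'e svec list \<Rightarrow> ('e, 'k) mpoly" where
  "wt [] = 1"
| "wt [\<alpha>] = 1"
| "wt (\<alpha> # \<beta> # \<pi>) = dmon \<alpha> \<beta> (last (\<beta> # \<pi>)) * wt (\<beta> # \<pi>)"

lemma wt_sym: "wt \<pi> \<in> carrier (sym_ring E)"
  by (induction \<pi> rule: wt.induct) (auto simp: sym_one intro: sym_mult dmon_sym)

text \<open>The cocycle identity moves the correction factor of a concatenation past one step at a
  time. This multiplicativity makes \<open>L\<close> a homomorphism for the twisted matrix product
  (\<open>L_mult\<close>).\<close>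

lemma wt_append:
  assumes "p \<noteq> []" "q \<noteq> []" "set p \<subseteq> B" "set q \<subseteq> B" "last p = hd q"
  shows "wt (p @ tl q) = wt p * wt q * dmon (hd p) (last p) (last q)"
  using assms
proof (induction p rule: wt.induct)
  case (2 \<alpha>)
  then have "[\<alpha>] @ tl q = q" by (cases q) auto
  then show ?case by simp
next
  case (3 \<alpha> \<beta> \<pi>)
  define \<gamma> where "\<gamma> = last (\<beta> # \<pi>)"
  define \<delta> where "\<delta> = last q"
  have l: "last ((\<beta> # \<pi>) @ tl q) = \<delta>" using 3 last_append_tl[of q "\<beta> # \<pi>"] by (simp add: \<delta>_def)
  have B: "\<alpha> \<in> B" "\<beta> \<in> B" "\<gamma> \<in> B" "\<delta> \<in> B" using 3 last_in_set[of "\<beta> # \<pi>"] last_in_set[of q] by (auto simp: \<gamma>_def \<delta>_def)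
  have IH: "(wt ((\<beta> # \<pi>) @ tl q) :: ('e, 'k) mpoly) = wt (\<beta> # \<pi>) * wt q * dmon \<beta> \<gamma> \<delta>"
    using 3 by (simp add: \<gamma>_def \<delta>_def)
  have "(wt ((\<alpha> # \<beta> # \<pi>) @ tl q) :: ('e, 'k) mpoly) = dmon \<alpha> \<beta> \<delta> * wt ((\<beta> # \<pi>) @ tl q)" using l by simp
  also have "\<dots> = (dmon \<alpha> \<beta> \<delta> * dmon \<beta> \<gamma> \<delta>) * (wt (\<beta> # \<pi>) * wt q)" unfolding IH by (simp add: mult_ac)
  also have "\<dots> = (dmon \<alpha> \<gamma> \<delta> * dmon \<alpha> \<beta> \<gamma>) * (wt (\<beta> # \<pi>) * wt q)" by (simp only: dmon_cocycle[OF B])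
  also have "\<dots> = wt (\<alpha> # \<beta> # \<pi>) * wt q * dmon \<alpha> \<gamma> \<delta>" by (simp add: mult_ac \<gamma>_def)
  finally show ?case by (simp add: \<gamma>_def \<delta>_def)
qed auto

lemma detour_flip:
  assumes "\<alpha> \<in> B" "\<gamma> \<in> B" "i \<in> E"
  shows "detour P \<alpha> (flip_at \<alpha> i) \<gamma> = (if \<alpha> i = \<gamma> i then {i} else {})"
  using assms B_nonzero by (auto simp: detour_iff flip_at_apply split: if_splits)

lemma taut_wt: "taut \<pi> \<Longrightarrow> wt \<pi> = 1"
proof (induction \<pi> rule: taut.induct)
  case (3 \<alpha> \<beta> \<pi>)
  then obtain i where i: "\<alpha> i \<noteq> last (\<beta> # \<pi>) i" "\<beta> = flip_at \<alpha> i" and p: "\<alpha> \<in> B" "taut (\<beta> # \<pi>)" by auto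
  have l: "last (\<beta> # \<pi>) \<in> B" using taut_paths[OF p(2)] by (auto simp: paths_def)
  then have "i \<in> E" using i(1) p(1) B_nonzero by metis
  then show ?case using detour_flip[OF p(1) l] i 3 p(2) by (simp add: dmon_def)
qed auto

section \<open>The matrix of an element\<close>

abbreviation "PA \<equiv> path_algebra B :: ('e, 'k) pathalg ring"
abbreviation "Sym \<equiv> sym_ring E :: ('e, 'k) mpoly ring"
abbreviation "FP \<equiv> free_pairs PA Sym"

text \<open>Entries are polynomials, and the indices run through all bounded sign vectors; the
  passage to the rings \<open>R_tilde\<close> and to bounded feasible indices happens only in
  \<open>Phi\<close>.\<close>

definition L :: "('e, 'k) pathalg \<Rightarrow> 'e svec \<Rightarrow> 'e svec \<Rightarrow> ('e, 'k) mpoly" where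
  "L a \<alpha> \<gamma> = lin (\<lambda>\<pi> c. if hd \<pi> = \<alpha> \<and> last \<pi> = \<gamma> then poly_const c * wt \<pi> else 0) a"

lemma biadd_L: "biadd (\<lambda>\<pi> c. if hd \<pi> = \<alpha> \<and> last \<pi> = \<gamma> then poly_const c * wt \<pi> else 0)"
  by (auto simp: biadd_def distrib_right)

lemma L_add: "L (a + b) \<alpha> \<gamma> = L a \<alpha> \<gamma> + L b \<alpha> \<gamma>"
  and L_zero [simp]: "L 0 \<alpha> \<gamma> = 0"
  and L_single: "L (Poly_Mapping.single \<pi> c) \<alpha> \<gamma> = (if hd \<pi> = \<alpha> \<and> last \<pi> = \<gamma> then poly_const c * wt \<pi> else 0)"
  unfolding L_def by (simp_all add: lin_add[OF biadd_L] lin_single[OF biadd_L])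

lemma L_sum: "L (sum h A) \<alpha> \<gamma> = (\<Sum>i \<in> A. L (h i) \<alpha> \<gamma>)"
  by (induction A rule: infinite_finite_induct) (auto simp: L_add)

lemma L_sym: "L a \<alpha> \<gamma> \<in> carrier Sym"
  unfolding L_def lin_def by (intro sym_sum) (auto intro: sym_mult sym_const wt_sym sym_zero)

lemma PA_carrier: "a \<in> carrier PA \<longleftrightarrow> Poly_Mapping.keys a \<subseteq> paths B"
  by (simp add: path_algebra_def)

lemma PA_mult: "a \<otimes>\<^bsub>PA\<^esub> b = conv path_op a b"
  by (simp add: path_algebra_eq)

lemma L_mult_single:
  assumes u: "u \<in> paths B" and v: "v \<in> paths B" and "\<alpha> \<in> B" "\<gamma> \<in> B"
  shows "L (conv path_op (Poly_Mapping.single u c) (Poly_Mapping.single v c')) \<alpha> \<gamma> =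
    (\<Sum>\<beta> \<in> B. dmon \<alpha> \<beta> \<gamma> * (L (Poly_Mapping.single u c) \<alpha> \<beta> * L (Poly_Mapping.single v c') \<beta> \<gamma>))"
proof -
  have uv: "u \<noteq> []" "v \<noteq> []" "set u \<subseteq> B" "set v \<subseteq> B" "last u \<in> B" using u v by (auto simp: paths_def)
  have "dmon \<alpha> \<beta> \<gamma> * (L (Poly_Mapping.single u c) \<alpha> \<beta> * L (Poly_Mapping.single v c') \<beta> \<gamma>) =
      (if \<beta> = last u then if last u = hd v \<and> hd u = \<alpha> \<and> last v = \<gamma> then
         dmon \<alpha> (last u) \<gamma> * (poly_const c * wt u * (poly_const c' * wt v)) else 0 else 0)" for \<beta>
    unfolding L_single by auto
  then have R: "(\<Sum>\<beta> \<in> B. dmon \<alpha> \<beta> \<gamma> * (L (Poly_Mapping.single u c) \<alpha> \<beta> * L (Poly_Mapping.single v c') \<beta> \<gamma>)) =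
      (if last u = hd v \<and> hd u = \<alpha> \<and> last v = \<gamma> then
         dmon \<alpha> (last u) \<gamma> * (poly_const c * wt u * (poly_const c' * wt v)) else 0)"
    using uv(5) finite_B by simp
  show ?thesis
  proof (cases "last u = hd v")
    case True
    have "hd (u @ tl v) = hd u" "last (u @ tl v) = last v" using uv last_append_tl True by auto
    then show ?thesis unfolding R using True wt_append[OF uv(1-4) True]
      by (auto simp: conv_single path_op_def L_single mult_ac)
  qed (simp add: R conv_single path_op_def)
qed

lemma L_mult:
  assumes a: "a \<in> carrier PA" and b: "b \<in> carrier PA" and ag: "\<alpha> \<in> B" "\<gamma> \<in> B"
  shows "L (a \<otimes>\<^bsub>PA\<^esub> b) \<alpha> \<gamma> = (\<Sum>\<beta> \<in> B. dmon \<alpha> \<beta> \<gamma> * (L a \<alpha> \<beta> * L b \<beta> \<gamma>))"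
  unfolding PA_mult using a[unfolded PA_carrier]
proof (induction a rule: pm_induct)
  case (single u c)
  show ?case using b[unfolded PA_carrier]
  proof (induction b rule: pm_induct)
    case (single v c')
    then show ?case using L_mult_single[OF \<open>u \<in> paths B\<close> _ ag] by blast
  next
    case (add b b')
    then show ?case by (simp add: conv_add_right L_add distrib_left sum.distrib)
  qed simp
next
  case (add a a')
  then show ?case by (simp add: conv_add_left L_add distrib_right distrib_left sum.distrib)
qed simp

lemma L_const: "L (path_algebra_const B s) \<alpha> \<gamma> = (if \<alpha> = \<gamma> \<and> \<alpha> \<in> B then poly_const s else 0)"
proof -
  have "L (path_algebra_const B s) \<alpha> \<gamma> = (\<Sum>\<beta> \<in> B. if \<beta> = \<alpha> then if \<alpha> = \<gamma> then poly_const s else 0 else 0)"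
    unfolding path_algebra_const_def L_sum L_single by (intro sum.cong) auto
  then show ?thesis using finite_B by simp
qed

lemma PA_one: "\<one>\<^bsub>PA\<^esub> = path_algebra_const B 1"
  by (simp add: path_algebra_def path_algebra_const_def)

lemma PA_const: "path_algebra_const B s \<in> carrier PA"
  unfolding PA_carrier path_algebra_const_def by (rule keys_unit)

sublocale PA: add_ring "path_algebra (bounded_signs P) :: ('e, 'k) pathalg ring"
  by (rule path_algebra_add_ring[OF finite_B])

sublocale Sym: add_ring "sym_ring (elts P) :: ('e, 'k) mpoly ring"
  by (rule sym_add_ring)

sublocale FP: add_ring "free_pairs (path_algebra (bounded_signs P)) (sym_ring (elts P)) :: (('e, 'k) pathalg \<times> ('e, 'k) mpoly \<Rightarrow>\<^sub>0 int) ring"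
  by (rule free_pairs_add_ring) (rule PA.ring_axioms Sym.ring_axioms)+

lemma FP_carrier: "x \<in> carrier FP \<longleftrightarrow> Poly_Mapping.keys x \<subseteq> carrier PA \<times> carrier Sym"
  by (simp add: free_pairs_def)

lemma pair_in_FP: "a \<in> carrier PA \<Longrightarrow> p \<in> carrier Sym \<Longrightarrow> pair_gen a p \<in> carrier FP"
  by (simp add: FP_carrier)

definition Psi :: "(('e, 'k) pathalg \<times> ('e, 'k) mpoly \<Rightarrow>\<^sub>0 int) \<Rightarrow> 'e svec \<Rightarrow> 'e svec \<Rightarrow> ('e, 'k) mpoly" where
  "Psi x \<alpha> \<gamma> = lin (\<lambda>u n. of_int n * (L (fst u) \<alpha> \<gamma> * snd u)) x"

lemma biadd_Psi: "biadd (\<lambda>u n. of_int n * (L (fst u) \<alpha> \<gamma> * snd u))"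
  by (auto simp: biadd_def distrib_right)

lemma Psi_add: "Psi (x + y) \<alpha> \<gamma> = Psi x \<alpha> \<gamma> + Psi y \<alpha> \<gamma>"
  and Psi_diff: "Psi (x - y) \<alpha> \<gamma> = Psi x \<alpha> \<gamma> - Psi y \<alpha> \<gamma>"
  and Psi_zero [simp]: "Psi 0 \<alpha> \<gamma> = 0"
  and Psi_pair: "Psi (pair_gen a p) \<alpha> \<gamma> = L a \<alpha> \<gamma> * p"
  unfolding Psi_def by (simp_all add: lin_add[OF biadd_Psi] lin_diff[OF biadd_Psi] lin_single[OF biadd_Psi])

lemma Psi_sum: "Psi (sum h A) \<alpha> \<gamma> = (\<Sum>i \<in> A. Psi (h i) \<alpha> \<gamma>)"
  by (induction A rule: infinite_finite_induct) (auto simp: Psi_add)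

lemma Psi_sym: "x \<in> carrier FP \<Longrightarrow> Psi x \<alpha> \<gamma> \<in> carrier Sym"
  unfolding FP_carrier
proof (induction x rule: frag_induction)
  case (one u)
  then show ?case by (cases u) (auto simp: Psi_pair intro: sym_mult L_sym)
qed (auto simp: sym_zero Psi_diff intro: Sym.diff_closed)

lemma Psi_mult:
  assumes x: "x \<in> carrier FP" and y: "y \<in> carrier FP" and ag: "\<alpha> \<in> B" "\<gamma> \<in> B"
  shows "Psi (x \<otimes>\<^bsub>FP\<^esub> y) \<alpha> \<gamma> = (\<Sum>\<beta> \<in> B. dmon \<alpha> \<beta> \<gamma> * (Psi x \<alpha> \<beta> * Psi y \<beta> \<gamma>))"
proof -
  have "x \<in> carrier FP \<and> Psi (x \<otimes>\<^bsub>FP\<^esub> y) \<alpha> \<gamma> = (\<Sum>\<beta> \<in> B. dmon \<alpha> \<beta> \<gamma> * (Psi x \<alpha> \<beta> * Psi y \<beta> \<gamma>))"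
    using x[unfolded FP_carrier]
  proof (induction x rule: frag_induction)
    case zero
    then show ?case using FP.zero_in by (simp add: free_pairs_eq)
  next
    case (one u)
    obtain a p where u: "u = (a, p)" "a \<in> carrier PA" "p \<in> carrier Sym" using one by (cases u) auto
    have uF: "pair_gen a p \<in> carrier FP" using u pair_in_FP by blast
    have "y \<in> carrier FP \<and> Psi (pair_gen a p \<otimes>\<^bsub>FP\<^esub> y) \<alpha> \<gamma> = (\<Sum>\<beta> \<in> B. dmon \<alpha> \<beta> \<gamma> * (Psi (pair_gen a p) \<alpha> \<beta> * Psi y \<beta> \<gamma>))"
      using y[unfolded FP_carrier]
    proof (induction y rule: frag_induction)
      case zero
      then show ?case using FP.zero_in by (simp add: free_pairs_eq)
    next
      case (one v)
      obtain b q where v: "v = (b, q)" "b \<in> carrier PA" "q \<in> carrier Sym" using one by (cases v) auto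
      have "Psi (pair_gen a p \<otimes>\<^bsub>FP\<^esub> pair_gen b q) \<alpha> \<gamma> = L (a \<otimes>\<^bsub>PA\<^esub> b) \<alpha> \<gamma> * (p * q)"
        unfolding free_pairs_mult Psi_pair by simp
      also have "\<dots> = (\<Sum>\<beta> \<in> B. dmon \<alpha> \<beta> \<gamma> * (Psi (pair_gen a p) \<alpha> \<beta> * Psi (pair_gen b q) \<beta> \<gamma>))"
        unfolding L_mult[OF u(2) v(2) ag] sum_distrib_right Psi_pair by (simp add: mult_ac)
      finally show ?case using v pair_in_FP by blast
    next
      case (diff y y')
      then show ?case using uF FP.diff_closed
        by (simp add: FP.mult_diff Psi_diff right_diff_distrib sum_subtractf)
    qed
    then show ?case using u uF by simp
  next
    case (diff x x')
    then show ?case using y FP.diff_closed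
      by (simp add: FP.diff_mult Psi_diff left_diff_distrib right_diff_distrib sum_subtractf)
  qed
  then show ?thesis by blast
qed

text \<open>A right inverse of \<open>Psi\<close> (\<open>Psi_theta\<close>), since taut paths have
  weight one. It respects differences only modulo \<open>K\<close>
  (\<open>theta_diff_K\<close>).\<close>

definition theta :: "('e svec \<Rightarrow> 'e svec \<Rightarrow> ('e, 'k) mpoly) \<Rightarrow> (('e, 'k) pathalg \<times> ('e, 'k) mpoly \<Rightarrow>\<^sub>0 int)" where
  "theta m = (\<Sum>u \<in> B \<times> B. pair_gen (Poly_Mapping.single (tau (fst u) (snd u)) 1) (m (fst u) (snd u)))"

lemma path_in_PA: "\<pi> \<in> paths B \<Longrightarrow> Poly_Mapping.single \<pi> c \<in> carrier PA"
  by (simp add: PA_carrier)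

lemma tau_path: "\<alpha> \<in> B \<Longrightarrow> \<gamma> \<in> B \<Longrightarrow> tau \<alpha> \<gamma> \<in> paths B"
  using tau taut_paths by blast

lemma theta_in_FP: "(\<And>\<alpha> \<beta>. m \<alpha> \<beta> \<in> carrier Sym) \<Longrightarrow> theta m \<in> carrier FP"
  unfolding theta_def by (intro FP.sum_in pair_in_FP path_in_PA tau_path) auto

lemma Psi_theta: "\<alpha> \<in> B \<Longrightarrow> \<gamma> \<in> B \<Longrightarrow> Psi (theta m) \<alpha> \<gamma> = m \<alpha> \<gamma>"
proof -
  assume ag: "\<alpha> \<in> B" "\<gamma> \<in> B"
  have "Psi (theta m) \<alpha> \<gamma> = (\<Sum>u \<in> B \<times> B. if u = (\<alpha>, \<gamma>) then m \<alpha> \<gamma> else 0)"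
    unfolding theta_def Psi_sum Psi_pair L_single
    by (rule sum.cong) (auto simp: tau taut_wt)
  then show ?thesis using ag finite_B by simp
qed

end

section \<open>Degrees\<close>

definition tdeg :: "('e \<Rightarrow>\<^sub>0 nat) \<Rightarrow> nat" where
  "tdeg m = (\<Sum>i \<in> Poly_Mapping.keys m. Poly_Mapping.lookup m i)"

lemma tdeg_superset: "finite A \<Longrightarrow> Poly_Mapping.keys m \<subseteq> A \<Longrightarrow> tdeg m = (\<Sum>i \<in> A. Poly_Mapping.lookup m i)"
  unfolding tdeg_def by (intro sum.mono_neutral_left) (auto simp: in_keys_iff)

lemma tdeg_add: "tdeg (a + b) = tdeg a + tdeg b"
proof -
  define A where "A = Poly_Mapping.keys a \<union> Poly_Mapping.keys b"
  have "finite A" "Poly_Mapping.keys (a + b) \<subseteq> A" using keys_add[of a b] by (auto simp: A_def)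
  then show ?thesis
    by (simp add: tdeg_superset[of A] A_def lookup_add sum.distrib)
qed

lemma sym_deg_iff: "p \<in> sym_deg E d \<longleftrightarrow> p \<in> carrier (sym_ring E) \<and> (\<forall>m \<in> Poly_Mapping.keys p. 2 * int (tdeg m) = d)"
  by (simp add: sym_deg_def tdeg_def)

lemma sym_deg_carrier: "p \<in> sym_deg E d \<Longrightarrow> p \<in> carrier (sym_ring E)"
  by (simp add: sym_deg_iff)

lemma sym_deg_zero: "0 \<in> sym_deg E d"
  by (simp add: sym_deg_iff sym_zero)

lemma sym_deg_add: "p \<in> sym_deg E d \<Longrightarrow> q \<in> sym_deg E d \<Longrightarrow> p + q \<in> sym_deg E d"
  unfolding sym_deg_iff using keys_add[of p q] sym_add by blast

lemma sym_deg_uminus: "p \<in> sym_deg E d \<Longrightarrow> - p \<in> sym_deg E d"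
  by (simp add: sym_deg_iff sym_uminus)

lemma sym_deg_diff: "p \<in> sym_deg E d \<Longrightarrow> q \<in> sym_deg E d \<Longrightarrow> p - q \<in> sym_deg E d"
  using sym_deg_add[of p E d "- q"] sym_deg_uminus by fastforce

lemma sym_deg_sum: "(\<And>i. i \<in> A \<Longrightarrow> x i \<in> sym_deg E d) \<Longrightarrow> sum x A \<in> sym_deg E d"
  by (induction A rule: infinite_finite_induct) (auto simp: sym_deg_zero sym_deg_add)

lemma sym_deg_mult:
  assumes "p \<in> sym_deg E d" "q \<in> sym_deg E d'"
  shows "p * q \<in> sym_deg E (d + d')"
  unfolding sym_deg_iff
proof
  show "p * q \<in> carrier (sym_ring E)" using assms sym_mult sym_deg_carrier by blast
  show "\<forall>m \<in> Poly_Mapping.keys (p * q). 2 * int (tdeg m) = d + d'"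
  proof
    fix m assume "m \<in> Poly_Mapping.keys (p * q)"
    then obtain a b where "m = a + b" "a \<in> Poly_Mapping.keys p" "b \<in> Poly_Mapping.keys q"
      using keys_mult[of p q] by blast
    then show "2 * int (tdeg m) = d + d'" using assms by (auto simp: sym_deg_iff tdeg_add)
  qed
qed

lemma sym_deg_const: "poly_const c \<in> sym_deg E 0"
  by (auto simp: sym_deg_iff sym_const) (auto simp: poly_const_def tdeg_def split: if_splits)

lemma sym_deg_one: "1 \<in> sym_deg E 0"
  using sym_deg_const[of 1] by simp

lemma sym_deg_var: "i \<in> E \<Longrightarrow> poly_var i \<in> sym_deg E 2"
  by (auto simp: sym_deg_iff sym_var) (auto simp: poly_var_def tdeg_def split: if_splits)

lemma sym_deg_squarefree:
  "finite S \<Longrightarrow> S \<subseteq> E \<Longrightarrow> (squarefree_mon S :: ('e, 'k::field) mpoly) \<in> sym_deg E (2 * int (card S))"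
proof (induction S rule: finite_induct)
  case (insert i S)
  then have "poly_var i * (squarefree_mon S :: ('e, 'k) mpoly) \<in> sym_deg E (2 + 2 * int (card S))"
    by (intro sym_deg_mult sym_deg_var) auto
  then show ?case using insert by (simp add: squarefree_mon_def)
qed (simp add: squarefree_mon_def sym_deg_one)

context program_algebra
begin

text \<open>A step either lowers the distance to the end by one, with factor one, or raises it by
  one, with a factor \<open>poly_var i\<close> of degree two. So the degree of the weight is the
  excess of the length over the distance of the ends, which explains the shift by
  \<open>sdist\<close> in \<open>B_tilde_deg\<close>.\<close>

lemma wt_deg: "\<pi> \<in> paths B \<Longrightarrow> wt \<pi> \<in> sym_deg E (int (length \<pi>) - 1 - int (sdist P (hd \<pi>) (last \<pi>)))"
proof (induction \<pi> rule: wt.induct)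
  case 1 then show ?case by (simp add: paths_def)
next
  case (2 \<alpha>) then show ?case using sym_deg_one by (simp add: paths_def sdist_zero)
next
  case (3 \<alpha> \<beta> \<pi>)
  define \<gamma> where "\<gamma> = last (\<beta> # \<pi>)"
  have p: "\<alpha> \<in> B" "adjacent \<alpha> \<beta>" "\<beta> # \<pi> \<in> paths B" using 3(2) paths_Cons by auto
  have bg: "\<beta> \<in> B" "\<gamma> \<in> B" using paths_ends[OF p(3)] by (auto simp: \<gamma>_def)
  obtain i where i: "i \<in> E" "\<beta> = flip_at \<alpha> i" using adjacent_flipD p bg by blast
  have sd: "2 * int (card (detour P \<alpha> \<beta> \<gamma>)) + int (sdist P \<alpha> \<gamma>) = 1 + int (sdist P \<beta> \<gamma>)"
  proof (cases "\<alpha> i = \<gamma> i")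
    case True
    have "\<alpha> i \<noteq> Zero" using i B_nonzero p by auto
    then have "\<beta> i \<noteq> \<gamma> i" using True by (simp add: i flip_at_apply)
    then have "sdist P \<beta> \<gamma> = Suc (sdist P \<alpha> \<gamma>)" using sdist_flip[OF bg] i by simp
    then show ?thesis using detour_flip[OF p(1) bg(2) i(1)] True i(2) by simp
  next
    case False
    then show ?thesis using sdist_flip[OF p(1) bg(2) False] detour_flip[OF p(1) bg(2) i(1)] i(2) by simp
  qed
  have "dmon \<alpha> \<beta> \<gamma> \<in> sym_deg E (2 * int (card (detour P \<alpha> \<beta> \<gamma>)))"
    unfolding dmon_def
    by (intro sym_deg_squarefree detour_subset finite_subset[OF detour_subset finite_E])
  then have "dmon \<alpha> \<beta> \<gamma> * wt (\<beta> # \<pi>) \<in> sym_deg E (2 * int (card (detour P \<alpha> \<beta> \<gamma>)) + (int (length (\<beta> # \<pi>)) - 1 - int (sdist P \<beta> \<gamma>)))"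
    using 3(1)[OF p(3)] by (intro sym_deg_mult) (auto simp: \<gamma>_def)
  moreover have "2 * int (card (detour P \<alpha> \<beta> \<gamma>)) + (int (length (\<beta> # \<pi>)) - 1 - int (sdist P \<beta> \<gamma>)) =
      int (length (\<alpha> # \<beta> # \<pi>)) - 1 - int (sdist P \<alpha> \<gamma>)" using sd by simp
  ultimately have "dmon \<alpha> \<beta> \<gamma> * wt (\<beta> # \<pi>) \<in> sym_deg E (int (length (\<alpha> # \<beta> # \<pi>)) - 1 - int (sdist P \<alpha> \<gamma>))"
    by (simp only:)
  moreover have "last (\<alpha> # \<beta> # \<pi>) = \<gamma>" "wt (\<alpha> # \<beta> # \<pi>) = dmon \<alpha> \<beta> \<gamma> * wt (\<beta> # \<pi>)" by (simp_all add: \<gamma>_def)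
  ultimately show ?case by (simp only: list.sel)
qed

lemma L_deg:
  assumes "a \<in> path_algebra_deg B i"
  shows "L a \<alpha> \<gamma> \<in> sym_deg E (i - int (sdist P \<alpha> \<gamma>))"
  unfolding L_def lin_def
proof (rule sym_deg_sum)
  fix \<pi> assume \<pi>: "\<pi> \<in> Poly_Mapping.keys a"
  then have p: "\<pi> \<in> paths B" "int (length \<pi>) - 1 = i" using assms by (auto simp: path_algebra_deg_def path_algebra_def)
  show "(if hd \<pi> = \<alpha> \<and> last \<pi> = \<gamma> then poly_const (Poly_Mapping.lookup a \<pi>) * wt \<pi> else 0) \<in> sym_deg E (i - int (sdist P \<alpha> \<gamma>))"
    using sym_deg_mult[OF sym_deg_const wt_deg[OF p(1)]] p(2) by (auto simp: sym_deg_zero)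
qed

definition FP_deg :: "int \<Rightarrow> (('e, 'k) pathalg \<times> ('e, 'k) mpoly \<Rightarrow>\<^sub>0 int) set" where
  "FP_deg m = {x. Poly_Mapping.keys x \<subseteq> (\<Union>i. path_algebra_deg B i \<times> sym_deg E (m - i))}"

lemma FP_deg_carrier: "x \<in> FP_deg m \<Longrightarrow> x \<in> carrier FP"
  unfolding FP_deg_def FP_carrier by (auto simp: path_algebra_deg_def dest: sym_deg_carrier)

lemma Psi_deg: "x \<in> FP_deg m \<Longrightarrow> Psi x \<alpha> \<gamma> \<in> sym_deg E (m - int (sdist P \<alpha> \<gamma>))"
  unfolding FP_deg_def mem_Collect_eq
proof (induction x rule: frag_induction)
  case (one u)
  then obtain i a p where u: "u = (a, p)" "a \<in> path_algebra_deg B i" "p \<in> sym_deg E (m - i)" by blast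
  have "L a \<alpha> \<gamma> * p \<in> sym_deg E ((i - int (sdist P \<alpha> \<gamma>)) + (m - i))"
    using L_deg[OF u(2)] u(3) by (rule sym_deg_mult)
  then show ?case using u(1) by (simp add: Psi_pair)
qed (auto simp: sym_deg_zero Psi_diff intro: sym_deg_diff)

text \<open>The length of a taut path is the distance of its ends, which makes up for the shift in
  the degree of the entries.\<close>

lemma theta_deg:
  assumes "\<And>\<alpha> \<beta>. m \<alpha> \<beta> \<in> sym_deg E (n - int (sdist P \<alpha> \<beta>))"
  shows "theta m \<in> FP_deg n"
proof -
  have "Poly_Mapping.keys (pair_gen (Poly_Mapping.single (tau \<alpha> \<beta>) 1 :: ('e, 'k) pathalg) (m \<alpha> \<beta>)) \<subseteq> (\<Union>i. path_algebra_deg B i \<times> sym_deg E (n - i))"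
    if "\<alpha> \<in> B" "\<beta> \<in> B" for \<alpha> \<beta>
  proof -
    have "length (tau \<alpha> \<beta>) = Suc (sdist P \<alpha> \<beta>)" using tau[OF that] taut_length by metis
    then have "(Poly_Mapping.single (tau \<alpha> \<beta>) 1 :: ('e, 'k) pathalg) \<in> path_algebra_deg B (int (sdist P \<alpha> \<beta>))"
      using path_in_PA[OF tau_path[OF that]] by (auto simp: path_algebra_deg_def)
    then show ?thesis using assms[of \<alpha> \<beta>] by auto
  qed
  moreover have "Poly_Mapping.keys (sum h A) \<subseteq> (\<Union>i \<in> A. Poly_Mapping.keys (h i))" for h :: "'e svec \<times> 'e svec \<Rightarrow> ('e, 'k) pathalg \<times> ('e, 'k) mpoly \<Rightarrow>\<^sub>0 int" and A
    by (rule Poly_Mapping.keys_sum)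
  ultimately show ?thesis unfolding FP_deg_def theta_def by fastforce
qed

section \<open>The ideals of the rings \<open>R_tilde\<close>\<close>

abbreviation "RI \<A> \<equiv> R_ideal P \<A> :: ('e, 'k) mpoly set"
abbreviation "Pp \<equiv> bounded_feasible P"

lemma Pp_iff: "\<alpha> \<in> Pp \<longleftrightarrow> \<alpha> \<in> B \<and> \<alpha> \<in> feasible_topes P"
  by (auto simp: bounded_feasible_def)

lemma finite_Pp: "finite Pp" using finite_B by (rule rev_finite_subset) (auto simp: Pp_iff)

lemma RI_gens: "{squarefree_mon S | S. S \<subseteq> E \<and> S \<notin> z_common_faces P \<A>} \<subseteq> carrier Sym"
  using sym_squarefree by blast

lemma RI_ideal: "ideal (RI \<A>) Sym"
  unfolding R_ideal_def by (rule Sym.genideal_ideal[OF RI_gens])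

lemma RI_gen: "S \<subseteq> E \<Longrightarrow> S \<notin> z_common_faces P \<A> \<Longrightarrow> squarefree_mon S \<in> RI \<A>"
  unfolding R_ideal_def using Sym.genideal_self[OF RI_gens] by blast

lemma RI_minimal: "ideal J Sym \<Longrightarrow> (\<And>S. S \<subseteq> E \<Longrightarrow> S \<notin> z_common_faces P \<A> \<Longrightarrow> squarefree_mon S \<in> J) \<Longrightarrow> RI \<A> \<subseteq> J"
  unfolding R_ideal_def by (rule Sym.genideal_minimal) auto

lemma RI_mult: "p \<in> RI \<A> \<Longrightarrow> q \<in> carrier Sym \<Longrightarrow> q * p \<in> RI \<A>"
  using Sym.ideal_mult_l[OF RI_ideal] by simp

lemma RI_mono: "\<A> \<subseteq> \<B> \<Longrightarrow> RI \<A> \<subseteq> RI \<B>"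
  by (rule RI_minimal[OF RI_ideal]) (use RI_gen z_antimono in blast)

lemma RI_infeasible: "\<beta> \<in> B \<Longrightarrow> \<beta> \<notin> feasible_topes P \<Longrightarrow> \<beta> \<in> \<A> \<Longrightarrow> p \<in> carrier Sym \<Longrightarrow> p \<in> RI \<A>"
proof -
  assume b: "\<beta> \<in> B" "\<beta> \<notin> feasible_topes P" "\<beta> \<in> \<A>" "p \<in> carrier Sym"
  then have "1 \<in> RI \<A>" using RI_gen[of "{}" \<A>] z_infeasible by simp
  then show ?thesis using RI_mult[of 1 \<A> p] b by simp
qed

text \<open>This allows multiplication by a fixed polynomial to be tested on the generators of an
  ideal.\<close>

lemma colon_ideal: "ideal I Sym \<Longrightarrow> t \<in> carrier Sym \<Longrightarrow> ideal {p \<in> carrier Sym. t * p \<in> I} Sym"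
proof (rule Sym.idealI')
  assume I: "ideal I Sym" and t: "t \<in> carrier Sym"
  show "0 \<in> {p \<in> carrier Sym. t * p \<in> I}" using sym_zero Sym.ideal_zero[OF I] by simp
  fix x assume x: "x \<in> {p \<in> carrier Sym. t * p \<in> I}"
  show "x - y \<in> {p \<in> carrier Sym. t * p \<in> I}" if "y \<in> {p \<in> carrier Sym. t * p \<in> I}" for y
    using x that Sym.diff_closed Sym.ideal_diff[OF I] by (simp add: right_diff_distrib)
  fix a assume a: "a \<in> carrier Sym"
  have "a * (t * x) \<in> I" using Sym.ideal_mult_l[OF I _ a, of "t * x"] x by simp
  then show "a \<otimes>\<^bsub>Sym\<^esub> x \<in> {p \<in> carrier Sym. t * p \<in> I}" "x \<otimes>\<^bsub>Sym\<^esub> a \<in> {p \<in> carrier Sym. t * p \<in> I}"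
    using x a sym_mult by (auto simp: mult_ac)
qed auto

lemma squarefree_union: "S \<subseteq> E \<Longrightarrow> T \<subseteq> E \<Longrightarrow> squarefree_mon S * squarefree_mon T = squarefree_mon (S \<union> T) * (squarefree_mon (S \<inter> T) :: ('e, 'k) mpoly)"
  unfolding squarefree_mon_def using finite_E finite_subset by (metis prod.union_inter)

text \<open>This makes the last map in the definition of \<open>star\<close> well defined. For a
  generator given by \<open>S\<close>, the union of \<open>S\<close> with the detour is not in
  \<open>z_common_faces P {\<alpha>, \<gamma>}\<close> by \<open>z_detour\<close>, and the product
  of the two monomials is divisible by the monomial of the union.\<close>

lemma dmon_RI:
  assumes "\<alpha> \<in> B" "\<beta> \<in> B" "\<gamma> \<in> B" "p \<in> RI {\<alpha>, \<beta>, \<gamma>}"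
  shows "dmon \<alpha> \<beta> \<gamma> * p \<in> RI {\<alpha>, \<gamma>}"
proof -
  have "RI {\<alpha>, \<beta>, \<gamma>} \<subseteq> {p \<in> carrier Sym. dmon \<alpha> \<beta> \<gamma> * p \<in> RI {\<alpha>, \<gamma>}}"
  proof (rule RI_minimal[OF colon_ideal[OF RI_ideal dmon_sym]])
    fix S assume S: "S \<subseteq> E" "S \<notin> z_common_faces P {\<alpha>, \<beta>, \<gamma>}"
    define D where "D = detour P \<alpha> \<beta> \<gamma>"
    have D: "D \<subseteq> E" unfolding D_def by (rule detour_subset)
    have "D \<union> S \<notin> z_common_faces P {\<alpha>, \<gamma>}"
    proof
      assume "D \<union> S \<in> z_common_faces P {\<alpha>, \<gamma>}"
      then have "D \<union> S \<in> z_common_faces P {\<alpha>, \<beta>, \<gamma>}"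
        using z_detour[OF B_supp[OF assms(1)] B_supp[OF assms(2)] B_supp[OF assms(3)]] by (simp add: D_def)
      then show False using z_antimono S(2) by blast
    qed
    then have "squarefree_mon (D \<union> S) \<in> RI {\<alpha>, \<gamma>}" using RI_gen D S by blast
    moreover have "squarefree_mon (D \<inter> S) \<in> carrier Sym" by (rule sym_squarefree) (use D in blast)
    ultimately have "squarefree_mon (D \<inter> S) * squarefree_mon (D \<union> S) \<in> RI {\<alpha>, \<gamma>}" by (rule RI_mult)
    then show "squarefree_mon S \<in> {p \<in> carrier Sym. dmon \<alpha> \<beta> \<gamma> * p \<in> RI {\<alpha>, \<gamma>}}"
      using sym_squarefree[OF S(1)] squarefree_union[OF D S(1)] by (simp add: dmon_def D_def mult_ac)
  qed
  then show ?thesis using assms(4) by blast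
qed

text \<open>Summands through an infeasible vertex vanish in the quotient, so the sum over
  \<open>B\<close> in \<open>Psi_mult\<close> agrees there with the sum over
  \<open>bounded_feasible P\<close> in the product of \<open>B_tilde\<close>.\<close>

lemma dmon_RI_infeasible: "\<alpha> \<in> B \<Longrightarrow> \<beta> \<in> B \<Longrightarrow> \<gamma> \<in> B \<Longrightarrow> \<beta> \<notin> feasible_topes P \<Longrightarrow> p \<in> carrier Sym \<Longrightarrow> dmon \<alpha> \<beta> \<gamma> * p \<in> RI {\<alpha>, \<gamma>}"
  by (intro dmon_RI RI_infeasible[of \<beta>]) auto

section \<open>The homomorphism to \<open>B_tilde\<close>\<close>

abbreviation "BT \<equiv> B_tilde P :: ('e, 'k) matalg ring"
abbreviation rc :: "'e svec \<Rightarrow> 'e svec \<Rightarrow> ('e, 'k) mpoly \<Rightarrow> ('e, 'k) mpoly set" where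
  "rc \<alpha> \<beta> p \<equiv> RI {\<alpha>, \<beta>} +>\<^bsub>Sym\<^esub> p"

definition Phi :: "(('e, 'k) pathalg \<times> ('e, 'k) mpoly \<Rightarrow>\<^sub>0 int) \<Rightarrow> ('e, 'k) matalg" where
  "Phi x = B_family P (\<lambda>\<alpha> \<beta>. rc \<alpha> \<beta> (Psi x \<alpha> \<beta>))"

lemma B_family_cong: "(\<And>\<alpha> \<beta>. \<alpha> \<in> Pp \<Longrightarrow> \<beta> \<in> Pp \<Longrightarrow> h \<alpha> \<beta> = h' \<alpha> \<beta>) \<Longrightarrow> B_family P h = B_family P h'"
  unfolding B_family_def by (rule restrict_ext) auto

lemma B_family_apply: "\<alpha> \<in> Pp \<Longrightarrow> \<beta> \<in> Pp \<Longrightarrow> B_family P h (\<alpha>, \<beta>) = h \<alpha> \<beta>"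
  by (simp add: B_family_def)

lemma B_family_eq_iff: "B_family P h = B_family P h' \<longleftrightarrow> (\<forall>\<alpha> \<in> Pp. \<forall>\<beta> \<in> Pp. h \<alpha> \<beta> = h' \<alpha> \<beta>)"
  using B_family_cong B_family_apply by metis

lemma R_tilde_simps: "\<zero>\<^bsub>R_tilde P \<A>\<^esub> = RI \<A>" "\<one>\<^bsub>R_tilde P \<A>\<^esub> = RI \<A> +>\<^bsub>Sym\<^esub> 1"
  by (simp_all add: R_tilde_def FactRing_def)

lemma rc_zero: "RI \<A> +>\<^bsub>Sym\<^esub> 0 = RI \<A>"
  using Sym.rcos_eq_self_iff[OF RI_ideal sym_zero] Sym.ideal_zero[OF RI_ideal] by simp

lemma R_tilde_carrier: "carrier (R_tilde P \<A>) = (\<lambda>p. RI \<A> +>\<^bsub>Sym\<^esub> p) ` carrier Sym"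
  unfolding R_tilde_def by (rule Sym.quot_surj[OF RI_ideal])

lemma R_tilde_add: "p \<in> carrier Sym \<Longrightarrow> q \<in> carrier Sym \<Longrightarrow>
    (RI \<A> +>\<^bsub>Sym\<^esub> p) \<oplus>\<^bsub>R_tilde P \<A>\<^esub> (RI \<A> +>\<^bsub>Sym\<^esub> q) = RI \<A> +>\<^bsub>Sym\<^esub> (p + q)"
proof -
  interpret h: ring_hom_ring Sym "Sym Quot RI \<A>" "(+>\<^bsub>Sym\<^esub>) (RI \<A>)" by (rule Sym.quot_hom[OF RI_ideal])
  assume "p \<in> carrier Sym" "q \<in> carrier Sym"
  then show ?thesis using h.hom_add[of p q] by (simp add: R_tilde_def)
qed

lemma R_tilde_mult: "p \<in> carrier Sym \<Longrightarrow> q \<in> carrier Sym \<Longrightarrow>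
    (RI \<A> +>\<^bsub>Sym\<^esub> p) \<otimes>\<^bsub>R_tilde P \<A>\<^esub> (RI \<A> +>\<^bsub>Sym\<^esub> q) = RI \<A> +>\<^bsub>Sym\<^esub> (p * q)"
proof -
  interpret h: ring_hom_ring Sym "Sym Quot RI \<A>" "(+>\<^bsub>Sym\<^esub>) (RI \<A>)" by (rule Sym.quot_hom[OF RI_ideal])
  assume "p \<in> carrier Sym" "q \<in> carrier Sym"
  then show ?thesis using h.hom_mult[of p q] by (simp add: R_tilde_def)
qed

text \<open>On representatives the maps that make up \<open>star\<close> compose to multiplication
  twisted by the detour monomial; \<open>dmon_RI\<close> makes the last of them independent of the
  representative.\<close>

lemma star_eq:
  assumes B: "\<alpha> \<in> B" "\<beta> \<in> B" "\<gamma> \<in> B" and p: "p \<in> carrier Sym" and q: "q \<in> carrier Sym"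
  shows "star P \<alpha> \<beta> \<gamma> (rc \<alpha> \<beta> p) (rc \<beta> \<gamma> q) = rc \<alpha> \<gamma> (dmon \<alpha> \<beta> \<gamma> * (p * q))"
proof -
  define J where "J = RI {\<alpha>, \<beta>, \<gamma>}"
  have J: "ideal J Sym" unfolding J_def by (rule RI_ideal)
  have sub: "RI {\<alpha>, \<beta>} \<subseteq> J" "RI {\<beta>, \<gamma>} \<subseteq> J" unfolding J_def by (intro RI_mono; blast)+
  have "coset_map Sym J (\<lambda>p. p) (rc \<alpha> \<beta> p) = J +>\<^bsub>Sym\<^esub> p"
    by (rule Sym.coset_map_eq[OF RI_ideal J p]) (use sub in auto)
  moreover have "coset_map Sym J (\<lambda>p. p) (rc \<beta> \<gamma> q) = J +>\<^bsub>Sym\<^esub> q"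
    by (rule Sym.coset_map_eq[OF RI_ideal J q]) (use sub in auto)
  moreover have "(J +>\<^bsub>Sym\<^esub> p) \<otimes>\<^bsub>R_tilde P {\<alpha>, \<beta>, \<gamma>}\<^esub> (J +>\<^bsub>Sym\<^esub> q) = J +>\<^bsub>Sym\<^esub> (p * q)"
    unfolding J_def by (rule R_tilde_mult[OF p q])
  moreover have "coset_map Sym (RI {\<alpha>, \<gamma>}) (\<lambda>p. squarefree_mon (detour P \<alpha> \<beta> \<gamma>) * p) (J +>\<^bsub>Sym\<^esub> (p * q)) =
      rc \<alpha> \<gamma> (squarefree_mon (detour P \<alpha> \<beta> \<gamma>) * (p * q))"
  proof (rule Sym.coset_map_eq[OF J RI_ideal sym_mult[OF p q]])
    fix c assume c: "c \<in> carrier Sym"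
    show "squarefree_mon (detour P \<alpha> \<beta> \<gamma>) * c \<in> carrier Sym"
      using c by (intro sym_mult sym_squarefree detour_subset)
    assume "c - p * q \<in> J"
    then have "dmon \<alpha> \<beta> \<gamma> * (c - p * q) \<in> RI {\<alpha>, \<gamma>}" unfolding J_def by (rule dmon_RI[OF B])
    then show "squarefree_mon (detour P \<alpha> \<beta> \<gamma>) * c - squarefree_mon (detour P \<alpha> \<beta> \<gamma>) * (p * q) \<in> RI {\<alpha>, \<gamma>}"
      by (simp add: dmon_def right_diff_distrib)
  qed
  ultimately show ?thesis unfolding star_def Let_def J_def dmon_def by simp
qed

lemma Phi_hom: "Phi \<in> ring_hom FP BT"
proof (rule ring_hom_memI)
  fix x assume x: "x \<in> carrier FP"
  show "Phi x \<in> carrier BT"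
    using Psi_sym[OF x] by (auto simp: Phi_def B_family_def B_tilde_def R_tilde_carrier)
  fix y assume y: "y \<in> carrier FP"
  show "Phi (x \<oplus>\<^bsub>FP\<^esub> y) = Phi x \<oplus>\<^bsub>BT\<^esub> Phi y"
    unfolding FP.plus Phi_def B_tilde_def ring_record_simps
    by (rule B_family_cong) (simp add: B_family_apply R_tilde_add[OF Psi_sym[OF x] Psi_sym[OF y]] Psi_add)
  show "Phi (x \<otimes>\<^bsub>FP\<^esub> y) = Phi x \<otimes>\<^bsub>BT\<^esub> Phi y"
    unfolding B_tilde_def monoid.simps Phi_def
  proof (rule B_family_cong)
    fix \<alpha> \<gamma> assume ag: "\<alpha> \<in> Pp" "\<gamma> \<in> Pp"
    then have agB: "\<alpha> \<in> B" "\<gamma> \<in> B" by (auto simp: Pp_iff)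
    define t where "t \<beta> = dmon \<alpha> \<beta> \<gamma> * (Psi x \<alpha> \<beta> * Psi y \<beta> \<gamma>)" for \<beta>
    have tS: "t \<beta> \<in> carrier Sym" for \<beta> unfolding t_def by (intro sym_mult dmon_sym Psi_sym x y)
    have "(\<Sum>\<beta> \<in> B. t \<beta>) - (\<Sum>\<beta> \<in> Pp. t \<beta>) = (\<Sum>\<beta> \<in> B - Pp. t \<beta>)"
      using finite_B by (subst sum_diff) (auto simp: Pp_iff)
    moreover have "(\<Sum>\<beta> \<in> B - Pp. t \<beta>) \<in> RI {\<alpha>, \<gamma>}"
    proof (rule Sym.ideal_sum[OF RI_ideal])
      fix \<beta> assume "\<beta> \<in> B - Pp"
      then show "t \<beta> \<in> RI {\<alpha>, \<gamma>}" unfolding t_def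
        by (intro dmon_RI_infeasible agB sym_mult Psi_sym x y) (auto simp: Pp_iff)
    qed
    ultimately have "rc \<alpha> \<gamma> (\<Sum>\<beta> \<in> B. t \<beta>) = rc \<alpha> \<gamma> (\<Sum>\<beta> \<in> Pp. t \<beta>)"
      using Sym.rcos_eq_iff[OF RI_ideal, of "\<Sum>\<beta> \<in> B. t \<beta>" "\<Sum>\<beta> \<in> Pp. t \<beta>"] sym_sum[of _ t] tS by simp
    moreover have "finsum (R_tilde P {\<alpha>, \<gamma>}) (\<lambda>\<beta>. star P \<alpha> \<beta> \<gamma> (B_family P (\<lambda>\<alpha> \<beta>. rc \<alpha> \<beta> (Psi x \<alpha> \<beta>)) (\<alpha>, \<beta>))
          (B_family P (\<lambda>\<alpha> \<beta>. rc \<alpha> \<beta> (Psi y \<alpha> \<beta>)) (\<beta>, \<gamma>))) Pp = finsum (R_tilde P {\<alpha>, \<gamma>}) (\<lambda>\<beta>. rc \<alpha> \<gamma> (t \<beta>)) Pp"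
    proof -
      interpret h: ring_hom_ring Sym "Sym Quot RI {\<alpha>, \<gamma>}" "(+>\<^bsub>Sym\<^esub>) (RI {\<alpha>, \<gamma>})" by (rule Sym.quot_hom[OF RI_ideal])
      show ?thesis unfolding R_tilde_def
      proof (rule h.S.finsum_cong')
        fix \<beta> assume b: "\<beta> \<in> Pp"
        then have bB: "\<beta> \<in> B" by (simp add: Pp_iff)
        show "star P \<alpha> \<beta> \<gamma> (B_family P (\<lambda>\<alpha> \<beta>. rc \<alpha> \<beta> (Psi x \<alpha> \<beta>)) (\<alpha>, \<beta>))
          (B_family P (\<lambda>\<alpha> \<beta>. rc \<alpha> \<beta> (Psi y \<alpha> \<beta>)) (\<beta>, \<gamma>)) = rc \<alpha> \<gamma> (t \<beta>)"
          unfolding B_family_apply[OF ag(1) b] B_family_apply[OF b ag(2)] t_def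
          by (rule star_eq[OF agB(1) bB agB(2) Psi_sym[OF x] Psi_sym[OF y]])
      qed (use tS in auto)
    qed
    moreover have "finsum (R_tilde P {\<alpha>, \<gamma>}) (\<lambda>\<beta>. rc \<alpha> \<gamma> (t \<beta>)) Pp = rc \<alpha> \<gamma> (\<Sum>\<beta> \<in> Pp. t \<beta>)"
      unfolding R_tilde_def by (rule Sym.quot_finsum[OF RI_ideal finite_Pp tS])
    ultimately show "rc \<alpha> \<gamma> (Psi (x \<otimes>\<^bsub>FP\<^esub> y) \<alpha> \<gamma>) = finsum (R_tilde P {\<alpha>, \<gamma>}) (\<lambda>\<beta>. star P \<alpha> \<beta> \<gamma> (B_family P (\<lambda>\<alpha> \<beta>. rc \<alpha> \<beta> (Psi x \<alpha> \<beta>)) (\<alpha>, \<beta>))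
          (B_family P (\<lambda>\<alpha> \<beta>. rc \<alpha> \<beta> (Psi y \<alpha> \<beta>)) (\<beta>, \<gamma>))) Pp"
      unfolding Psi_mult[OF x y agB] t_def by simp
  qed
next
  show "Phi \<one>\<^bsub>FP\<^esub> = \<one>\<^bsub>BT\<^esub>"
    unfolding B_tilde_def monoid.simps Phi_def B_tilde_sym_def
  proof (rule B_family_cong)
    fix \<alpha> \<beta> assume "\<alpha> \<in> Pp" "\<beta> \<in> Pp"
    then show "rc \<alpha> \<beta> (Psi \<one>\<^bsub>FP\<^esub> \<alpha> \<beta>) = (if \<alpha> = \<beta> then rc \<alpha> \<beta> 1 else \<zero>\<^bsub>R_tilde P {\<alpha>, \<beta>}\<^esub>)"
      by (simp add: free_pairs_eq Psi_pair PA_one L_const Pp_iff R_tilde_simps rc_zero)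
  qed
qed

lemma Phi_zero: "\<zero>\<^bsub>BT\<^esub> = Phi 0"
  unfolding Phi_def B_tilde_def ring_record_simps by (rule B_family_cong) (simp add: R_tilde_simps rc_zero)

lemma B_tilde_elt:
  assumes C: "C \<in> extensional (Pp \<times> Pp)" and m: "\<And>\<alpha> \<beta>. \<alpha> \<in> Pp \<Longrightarrow> \<beta> \<in> Pp \<Longrightarrow> C (\<alpha>, \<beta>) = rc \<alpha> \<beta> (m \<alpha> \<beta>)"
  shows "C = Phi (theta m)"
proof -
  have "Phi (theta m) = B_family P (\<lambda>\<alpha> \<beta>. C (\<alpha>, \<beta>))"
    unfolding Phi_def by (rule B_family_cong) (simp add: Psi_theta Pp_iff m)
  also have "\<dots> = C" using C by (auto simp: B_family_def extensional_def fun_eq_iff)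
  finally show ?thesis by simp
qed

lemma Phi_surj: "carrier BT = Phi ` carrier FP"
proof
  show "Phi ` carrier FP \<subseteq> carrier BT" using Phi_hom by (auto simp: ring_hom_def)
  show "carrier BT \<subseteq> Phi ` carrier FP"
  proof
    fix C assume C: "C \<in> carrier BT"
    have "\<exists>p. p \<in> carrier Sym \<and> (\<alpha> \<in> Pp \<longrightarrow> \<beta> \<in> Pp \<longrightarrow> C (\<alpha>, \<beta>) = rc \<alpha> \<beta> p)" for \<alpha> \<beta>
    proof (cases "\<alpha> \<in> Pp \<and> \<beta> \<in> Pp")
      case True
      then have "C (\<alpha>, \<beta>) \<in> carrier (R_tilde P {\<alpha>, \<beta>})" using C by (auto simp: B_tilde_def PiE_iff)
      then show ?thesis by (auto simp: R_tilde_carrier)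
    qed (use sym_zero in blast)
    then obtain m where m: "\<And>\<alpha> \<beta>. m \<alpha> \<beta> \<in> carrier Sym" "\<And>\<alpha> \<beta>. \<alpha> \<in> Pp \<Longrightarrow> \<beta> \<in> Pp \<Longrightarrow> C (\<alpha>, \<beta>) = rc \<alpha> \<beta> (m \<alpha> \<beta>)"
      by metis
    have "C \<in> extensional (Pp \<times> Pp)" using C by (auto simp: B_tilde_def PiE_iff)
    then have "C = Phi (theta m)" using m(2) by (rule B_tilde_elt)
    then show "C \<in> Phi ` carrier FP" using theta_in_FP[OF m(1)] by (rule image_eqI)
  qed
qed

lemma Phi_deg: "Phi ` FP_deg n = B_tilde_deg P n"
proof
  show "Phi ` FP_deg n \<subseteq> B_tilde_deg P n"
  proof (rule image_subsetI)
    fix x assume x: "x \<in> FP_deg n"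
    show "Phi x \<in> B_tilde_deg P n" unfolding B_tilde_deg_def Phi_def B_family_def
      using Psi_deg[OF x] by (auto simp: quot_deg_def)
  qed
  show "B_tilde_deg P n \<subseteq> Phi ` FP_deg n"
  proof
    fix C :: "('e, 'k) matalg" assume C: "C \<in> B_tilde_deg P n"
    have "\<exists>p. p \<in> sym_deg E (n - int (sdist P \<alpha> \<beta>)) \<and> (\<alpha> \<in> Pp \<longrightarrow> \<beta> \<in> Pp \<longrightarrow> C (\<alpha>, \<beta>) = rc \<alpha> \<beta> p)" for \<alpha> \<beta>
    proof (cases "\<alpha> \<in> Pp \<and> \<beta> \<in> Pp")
      case True
      then have "C (\<alpha>, \<beta>) \<in> quot_deg Sym (RI {\<alpha>, \<beta>}) (sym_deg E) (n - int (sdist P \<alpha> \<beta>))"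
        using C by (auto simp: B_tilde_deg_def PiE_iff)
      then show ?thesis by (auto simp: quot_deg_def)
    qed (use sym_deg_zero in blast)
    then obtain m where m: "\<And>\<alpha> \<beta>. m \<alpha> \<beta> \<in> sym_deg E (n - int (sdist P \<alpha> \<beta>))" "\<And>\<alpha> \<beta>. \<alpha> \<in> Pp \<Longrightarrow> \<beta> \<in> Pp \<Longrightarrow> C (\<alpha>, \<beta>) = rc \<alpha> \<beta> (m \<alpha> \<beta>)"
      by metis
    have "C \<in> extensional (Pp \<times> Pp)" using C by (auto simp: B_tilde_deg_def PiE_iff)
    then have "C = Phi (theta m)" using m(2) by (rule B_tilde_elt)
    then show "C \<in> Phi ` FP_deg n" using theta_deg[OF m(1)] by (rule image_eqI)
  qed
qed

text \<open>\<open>B_tilde\<close> is the image of the ring \<open>FP\<close> under a map that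
  respects sums, products and the unit, and so inherits the ring axioms.\<close>

lemma BT_ring: "ring BT"
proof -
  have "ring (BT \<lparr>carrier := Phi ` carrier FP, zero := Phi \<zero>\<^bsub>FP\<^esub>\<rparr>)"
    by (rule FP.ring_hom_imp_img_ring[OF Phi_hom])
  moreover have "BT \<lparr>carrier := Phi ` carrier FP, zero := Phi \<zero>\<^bsub>FP\<^esub>\<rparr> = BT"
    unfolding Phi_surj[symmetric] FP.zero_eq Phi_zero[symmetric] by (rule ring.equality) simp_all
  ultimately show ?thesis by simp
qed

lemma Phi_ring_hom: "ring_hom_ring FP BT Phi"
  by (rule ring_hom_ringI2[OF FP.ring_axioms BT_ring Phi_hom])

text \<open>For an infeasible index the ideal is the whole polynomial ring, so the condition can be
  stated for all bounded indices, which are the ones over which \<open>theta\<close> sums.\<close>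

lemma Phi_kernel: 
  assumes x: "x \<in> carrier FP"
  shows "Phi x = \<zero>\<^bsub>BT\<^esub> \<longleftrightarrow> (\<forall>\<alpha> \<in> B. \<forall>\<beta> \<in> B. Psi x \<alpha> \<beta> \<in> RI {\<alpha>, \<beta>})"
proof -
  have "Phi x = \<zero>\<^bsub>BT\<^esub> \<longleftrightarrow> (\<forall>\<alpha> \<in> Pp. \<forall>\<beta> \<in> Pp. Psi x \<alpha> \<beta> \<in> RI {\<alpha>, \<beta>})"
    unfolding Phi_zero Phi_def B_family_eq_iff
    using Sym.rcos_eq_self_iff[OF RI_ideal Psi_sym[OF x]] by (simp add: rc_zero)
  also have "\<dots> \<longleftrightarrow> (\<forall>\<alpha> \<in> B. \<forall>\<beta> \<in> B. Psi x \<alpha> \<beta> \<in> RI {\<alpha>, \<beta>})"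
  proof -
    have "Psi x \<alpha> \<beta> \<in> RI {\<alpha>, \<beta>}" if "\<alpha> \<in> B" "\<beta> \<in> B" "\<alpha> \<notin> Pp \<or> \<beta> \<notin> Pp" for \<alpha> \<beta>
      using that RI_infeasible[OF _ _ _ Psi_sym[OF x], of \<alpha> "{\<alpha>, \<beta>}"]
        RI_infeasible[OF _ _ _ Psi_sym[OF x], of \<beta> "{\<alpha>, \<beta>}"] unfolding Pp_iff by blast
    moreover have "Pp \<subseteq> B" by (auto simp: Pp_iff)
    ultimately show ?thesis by blast
  qed
  finally show ?thesis .
qed

end

section \<open>Tensor products\<close>

lemma Quot_zero: "\<zero>\<^bsub>R Quot I\<^esub> = I"
  by (simp add: FactRing_def)

lemma Quot_carrier: "carrier (R Quot I) = (+>\<^bsub>R\<^esub>) I ` carrier R"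
  by (auto simp: FactRing_def A_RCOSETS_def RCOSETS_def a_r_coset_def)

lemma tensor_rels_subset:
  assumes "ring B" "ring C" and \<sigma>: "\<And>s. s \<in> carrier S \<Longrightarrow> \<sigma> s \<in> carrier B" and \<tau>: "\<And>s. s \<in> carrier S \<Longrightarrow> \<tau> s \<in> carrier C"
  shows "tensor_rels S \<sigma> \<tau> B C \<subseteq> carrier (free_pairs B C)"
proof -
  interpret B: ring B by fact
  interpret C: ring C by fact
  interpret F: add_ring "free_pairs B C" by (rule free_pairs_add_ring) fact+
  have pair: "pair_gen b c \<in> carrier (free_pairs B C)" if "b \<in> carrier B" "c \<in> carrier C" for b c
    using that by (simp add: free_pairs_def)
  show ?thesis unfolding tensor_rels_def
    using \<sigma> \<tau> by (auto intro!: F.diff_closed pair)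
qed

lemma tensor_ideal_ideal:
  assumes "ring B" "ring C" and \<sigma>: "\<And>s. s \<in> carrier S \<Longrightarrow> \<sigma> s \<in> carrier B" and \<tau>: "\<And>s. s \<in> carrier S \<Longrightarrow> \<tau> s \<in> carrier C"
  shows "ideal (tensor_ideal S \<sigma> \<tau> B C) (free_pairs B C)" "tensor_rels S \<sigma> \<tau> B C \<subseteq> tensor_ideal S \<sigma> \<tau> B C"
    "\<And>K. ideal K (free_pairs B C) \<Longrightarrow> tensor_rels S \<sigma> \<tau> B C \<subseteq> K \<Longrightarrow> tensor_ideal S \<sigma> \<tau> B C \<subseteq> K"
proof -
  interpret F: add_ring "free_pairs B C" by (rule free_pairs_add_ring) fact+
  note sub = tensor_rels_subset[OF assms]
  show "ideal (tensor_ideal S \<sigma> \<tau> B C) (free_pairs B C)"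
    unfolding tensor_ideal_def by (rule F.genideal_ideal[OF sub])
  show "tensor_rels S \<sigma> \<tau> B C \<subseteq> tensor_ideal S \<sigma> \<tau> B C"
    unfolding tensor_ideal_def by (rule F.genideal_self[OF sub])
  show "tensor_ideal S \<sigma> \<tau> B C \<subseteq> K" if "ideal K (free_pairs B C)" "tensor_rels S \<sigma> \<tau> B C \<subseteq> K" for K
    unfolding tensor_ideal_def using F.genideal_minimal that .
qed

context program_algebra
begin

section \<open>The kernel of the presentation of \<open>A_tilde\<close>\<close>

abbreviation "D \<equiv> dual_program P"
abbreviation "PP \<equiv> path_poly D :: ('e, 'k) pathpoly ring"
abbreviation "At \<equiv> A_tilde D :: ('e, 'k) pathpoly set ring"
abbreviation "AI \<equiv> A_ideal D :: ('e, 'k) pathpoly set"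

definition T :: "(('e, 'k) pathalg \<times> ('e, 'k) mpoly \<Rightarrow>\<^sub>0 int) set" where
  "T = tensor_ideal base_field (path_algebra_const B) poly_const PA Sym"

lemma T_facts: "ideal T FP" "tensor_rels base_field (path_algebra_const B) poly_const PA Sym \<subseteq> T"
  "\<And>K. ideal K FP \<Longrightarrow> tensor_rels base_field (path_algebra_const B) poly_const PA Sym \<subseteq> K \<Longrightarrow> T \<subseteq> K"
  unfolding T_def
  by (rule tensor_ideal_ideal[OF PA.ring_axioms Sym.ring_axioms]; (rule PA_const sym_const | assumption))+

lemma PP_eq: "PP = FP Quot T"
  by (simp add: path_poly_def feasible_topes_dual tensor_def T_def)

lemma path_tensor_eq: "path_tensor D a p = T +>\<^bsub>FP\<^esub> pair_gen a p"
  by (simp add: path_tensor_def feasible_topes_dual pure_tensor_def T_def)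

interpretation PP: ring_hom_ring FP PP "(+>\<^bsub>FP\<^esub>) T"
  unfolding PP_eq by (rule FP.quot_hom[OF T_facts(1)])

lemma T_diff: "x \<in> carrier FP \<Longrightarrow> y \<in> carrier FP \<Longrightarrow> (T +>\<^bsub>FP\<^esub> x) \<ominus>\<^bsub>PP\<^esub> (T +>\<^bsub>FP\<^esub> y) = T +>\<^bsub>FP\<^esub> (x - y)"
proof -
  assume xy: "x \<in> carrier FP" "y \<in> carrier FP"
  then have "T +>\<^bsub>FP\<^esub> (x \<ominus>\<^bsub>FP\<^esub> y) = (T +>\<^bsub>FP\<^esub> x) \<ominus>\<^bsub>PP\<^esub> (T +>\<^bsub>FP\<^esub> y)"
    unfolding FP.minus_eq PP.S.minus_eq by simp
  then show ?thesis using FP.minus_eq'[OF xy] by simp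
qed

abbreviation gp :: "'e svec list \<Rightarrow> ('e, 'k) mpoly \<Rightarrow> (('e, 'k) pathalg \<times> ('e, 'k) mpoly \<Rightarrow>\<^sub>0 int)" where
  "gp \<pi> p \<equiv> pair_gen (Poly_Mapping.single \<pi> 1) p"

lemma gp_in_FP: "\<pi> \<in> paths B \<Longrightarrow> p \<in> carrier Sym \<Longrightarrow> gp \<pi> p \<in> carrier FP"
  by (intro pair_in_FP path_in_PA)

definition square :: "'e svec \<Rightarrow> 'e svec \<Rightarrow> 'e svec \<Rightarrow> 'e svec \<Rightarrow> bool" where
  "square \<alpha> \<beta> \<gamma> \<delta> \<longleftrightarrow> {\<alpha>, \<beta>, \<gamma>, \<delta>} \<subseteq> B \<and> distinct [\<alpha>, \<beta>, \<gamma>, \<delta>] \<and>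
     adjacent \<alpha> \<gamma> \<and> adjacent \<alpha> \<delta> \<and> adjacent \<beta> \<gamma> \<and> adjacent \<beta> \<delta>"

text \<open>Lifts of \<open>A_rels\<close> to \<open>FP\<close> (\<open>A_rels_eq\<close>), so that
  congruences can be computed before the two quotients are formed.\<close>

definition A_gens :: "(('e, 'k) pathalg \<times> ('e, 'k) mpoly \<Rightarrow>\<^sub>0 int) set" where
  "A_gens =
     {gp [\<alpha>] 1 | \<alpha>. \<alpha> \<in> B - Pp} \<union>
     {gp [\<alpha>, \<gamma>, \<beta>] 1 - gp [\<alpha>, \<delta>, \<beta>] 1 | \<alpha> \<beta> \<gamma> \<delta>. square \<alpha> \<beta> \<gamma> \<delta>} \<union>
     {gp [\<alpha>, flip_at \<alpha> i, \<alpha>] 1 - gp [\<alpha>] (poly_var i) | \<alpha> i.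
        i \<in> E \<and> \<alpha> \<in> B \<and> flip_at \<alpha> i \<in> B}"

lemma adjacent_commute: "adjacent \<alpha> \<beta> \<longleftrightarrow> adjacent \<beta> \<alpha>"
  unfolding adjacent_def by metis

lemma path3: "\<alpha> \<in> B \<Longrightarrow> \<gamma> \<in> B \<Longrightarrow> \<beta> \<in> B \<Longrightarrow> adjacent \<alpha> \<gamma> \<Longrightarrow> adjacent \<beta> \<gamma> \<Longrightarrow> [\<alpha>, \<gamma>, \<beta>] \<in> paths B"
  using adjacent_commute[of \<beta> \<gamma>] by (auto simp: paths_def)

lemma path1: "\<alpha> \<in> B \<Longrightarrow> [\<alpha>] \<in> paths B" by (simp add: paths_def)

lemma loop_path: "i \<in> E \<Longrightarrow> \<alpha> \<in> B \<Longrightarrow> flip_at \<alpha> i \<in> B \<Longrightarrow> [\<alpha>, flip_at \<alpha> i, \<alpha>] \<in> paths B"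
  using path3[of \<alpha> "flip_at \<alpha> i" \<alpha>] adjacent_flip by blast

lemma A_gens_FP: "A_gens \<subseteq> carrier FP"
  unfolding A_gens_def
  by (auto simp: square_def intro!: FP.diff_closed gp_in_FP path1 path3 loop_path sym_one sym_var)

lemma A_rels_eq: "A_rels D = (+>\<^bsub>FP\<^esub>) T ` A_gens"
proof -
  have "{path_elt D [\<alpha>, \<gamma>, \<beta>] \<ominus>\<^bsub>PP\<^esub> path_elt D [\<alpha>, \<delta>, \<beta>] | \<alpha> \<beta> \<gamma> \<delta>. square \<alpha> \<beta> \<gamma> \<delta>} =
      (+>\<^bsub>FP\<^esub>) T ` {gp [\<alpha>, \<gamma>, \<beta>] 1 - gp [\<alpha>, \<delta>, \<beta>] 1 | \<alpha> \<beta> \<gamma> \<delta>. square \<alpha> \<beta> \<gamma> \<delta>}"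
  proof -
    have "path_elt D [\<alpha>, \<gamma>, \<beta>] \<ominus>\<^bsub>PP\<^esub> path_elt D [\<alpha>, \<delta>, \<beta>] = T +>\<^bsub>FP\<^esub> (gp [\<alpha>, \<gamma>, \<beta>] 1 - gp [\<alpha>, \<delta>, \<beta>] 1)"
      if "square \<alpha> \<beta> \<gamma> \<delta>" for \<alpha> \<beta> \<gamma> \<delta>
      unfolding path_elt_def path_tensor_eq
      by (intro T_diff gp_in_FP path3 sym_one) (use that in \<open>auto simp: square_def\<close>)
    then show ?thesis unfolding set_eq_iff image_iff Bex_def mem_Collect_eq by metis
  qed
  moreover have "{path_elt D [\<alpha>, flip_at \<alpha> i, \<alpha>] \<ominus>\<^bsub>PP\<^esub> path_tensor D (Poly_Mapping.single [\<alpha>] 1) (poly_var i) | \<alpha> i.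
        i \<in> E \<and> \<alpha> \<in> B \<and> flip_at \<alpha> i \<in> B} =
      (+>\<^bsub>FP\<^esub>) T ` {gp [\<alpha>, flip_at \<alpha> i, \<alpha>] 1 - gp [\<alpha>] (poly_var i) | \<alpha> i. i \<in> E \<and> \<alpha> \<in> B \<and> flip_at \<alpha> i \<in> B}"
  proof -
    have "path_elt D [\<alpha>, flip_at \<alpha> i, \<alpha>] \<ominus>\<^bsub>PP\<^esub> path_tensor D (Poly_Mapping.single [\<alpha>] 1) (poly_var i) =
        T +>\<^bsub>FP\<^esub> (gp [\<alpha>, flip_at \<alpha> i, \<alpha>] 1 - gp [\<alpha>] (poly_var i))"
      if "i \<in> E" "\<alpha> \<in> B" "flip_at \<alpha> i \<in> B" for \<alpha> i
      unfolding path_elt_def path_tensor_eq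
      by (intro T_diff gp_in_FP loop_path path1 sym_one sym_var) (use that in auto)
    then show ?thesis unfolding set_eq_iff image_iff Bex_def mem_Collect_eq by metis
  qed
  moreover have "{path_elt D [\<alpha>] | \<alpha>. \<alpha> \<in> B - Pp} = (+>\<^bsub>FP\<^esub>) T ` {gp [\<alpha>] 1 | \<alpha>. \<alpha> \<in> B - Pp}"
    unfolding path_elt_def path_tensor_eq by auto
  ultimately show ?thesis
    unfolding A_rels_def A_gens_def image_Un feasible_topes_dual bounded_feasible_dual elts_dual square_def by simp
qed

lemma AI_ideal: "ideal AI PP" and A_rels_AI: "A_rels D \<subseteq> AI"
  and AI_minimal: "\<And>J. ideal J PP \<Longrightarrow> A_rels D \<subseteq> J \<Longrightarrow> AI \<subseteq> J"
proof -
  have "A_rels D \<subseteq> carrier PP" unfolding A_rels_eq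
    by (rule image_subsetI, rule PP.hom_closed, rule subsetD[OF A_gens_FP])
  then show "ideal AI PP" "A_rels D \<subseteq> AI" unfolding A_ideal_def
    by (rule PP.S.genideal_ideal PP.S.genideal_self; assumption)+
  show "\<And>J. ideal J PP \<Longrightarrow> A_rels D \<subseteq> J \<Longrightarrow> AI \<subseteq> J" unfolding A_ideal_def by (rule PP.S.genideal_minimal)
qed

text \<open>The kernel of the composite map \<open>cls\<close> onto \<open>A_tilde\<close>
  (\<open>cls_kernel\<close>); it is the smallest ideal that contains the tensor relations and
  \<open>A_gens\<close> (\<open>K_minimal\<close>).\<close>

definition K :: "(('e, 'k) pathalg \<times> ('e, 'k) mpoly \<Rightarrow>\<^sub>0 int) set" where
  "K = {x \<in> carrier FP. T +>\<^bsub>FP\<^esub> x \<in> AI}"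

lemma K_ideal: "ideal K FP"
  unfolding K_def using PP.ideal_vimage[OF AI_ideal] .

lemma T_K: "T \<subseteq> K"
proof
  fix x assume x: "x \<in> T"
  then have xF: "x \<in> carrier FP" using FP.ideal_carrier[OF T_facts(1)] by blast
  have "\<zero>\<^bsub>PP\<^esub> = T" unfolding PP_eq by (rule Quot_zero)
  then have "T +>\<^bsub>FP\<^esub> x = \<zero>\<^bsub>PP\<^esub>" using iffD2[OF FP.rcos_eq_self_iff[OF T_facts(1) xF] x] by (rule trans[OF _ sym, rotated])
  then have "T +>\<^bsub>FP\<^esub> x \<in> AI"
    using additive_subgroup.zero_closed[OF ideal.axioms(1)[OF AI_ideal]] by (rule ssubst)
  then show "x \<in> K" using xF by (simp only: K_def mem_Collect_eq)
qed

lemma A_gens_K: "A_gens \<subseteq> K"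
  using A_gens_FP A_rels_AI unfolding A_rels_eq K_def by blast

lemma K_minimal:
  assumes J: "ideal J FP" "tensor_rels base_field (path_algebra_const B) poly_const PA Sym \<subseteq> J" "A_gens \<subseteq> J"
  shows "K \<subseteq> J"
proof
  fix x assume x: "x \<in> K"
  have TJ: "T \<subseteq> J" using T_facts(3) J by blast
  note q = FP.quot_ideal[OF T_facts(1) J(1) TJ, folded PP_eq]
  have "AI \<subseteq> (+>\<^bsub>FP\<^esub>) T ` J" by (rule AI_minimal[OF q(1)]) (use J(3) in \<open>auto simp: A_rels_eq\<close>)
  then show "x \<in> J" using q(2) x unfolding K_def by blast
qed

definition cls :: "(('e, 'k) pathalg \<times> ('e, 'k) mpoly \<Rightarrow>\<^sub>0 int) \<Rightarrow> ('e, 'k) pathpoly set" where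
  "cls x = AI +>\<^bsub>PP\<^esub> (T +>\<^bsub>FP\<^esub> x)"

lemma At_hom: "ring_hom_ring PP At ((+>\<^bsub>PP\<^esub>) AI)"
  unfolding A_tilde_def using ideal.rcos_ring_hom_ring[OF AI_ideal] .

interpretation At: ring_hom_ring PP At "(+>\<^bsub>PP\<^esub>) AI" by (rule At_hom)

lemma cls_hom: "ring_hom_ring FP At cls"
proof (rule ring_hom_ringI2[OF FP.ring_axioms At.S.ring_axioms])
  have "(+>\<^bsub>PP\<^esub>) AI \<circ> (+>\<^bsub>FP\<^esub>) T \<in> ring_hom FP At"
    by (rule ring_hom_trans[OF PP.homh At.homh])
  moreover have "(+>\<^bsub>PP\<^esub>) AI \<circ> (+>\<^bsub>FP\<^esub>) T = cls" by (auto simp: cls_def)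
  ultimately show "cls \<in> ring_hom FP At" by simp
qed

lemma cls_surj: "carrier At = cls ` carrier FP"
proof -
  have "carrier PP = (+>\<^bsub>FP\<^esub>) T ` carrier FP" unfolding PP_eq by (rule FP.quot_surj[OF T_facts(1)])
  moreover have "carrier At = (+>\<^bsub>PP\<^esub>) AI ` carrier PP"
    unfolding A_tilde_def by (rule Quot_carrier)
  moreover have "cls = (\<lambda>x. AI +>\<^bsub>PP\<^esub> (T +>\<^bsub>FP\<^esub> x))" by (rule ext) (rule cls_def)
  ultimately show ?thesis by (simp only: image_image)
qed

lemma cls_kernel: "x \<in> carrier FP \<Longrightarrow> cls x = \<zero>\<^bsub>At\<^esub> \<longleftrightarrow> x \<in> K"
proof -
  assume x: "x \<in> carrier FP"
  interpret AI: ideal AI PP by (rule AI_ideal)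
  have c: "T +>\<^bsub>FP\<^esub> x \<in> carrier PP" using PP.hom_closed[OF x] .
  have z: "\<zero>\<^bsub>At\<^esub> = AI" unfolding A_tilde_def by (rule Quot_zero)
  have "AI +>\<^bsub>PP\<^esub> (T +>\<^bsub>FP\<^esub> x) = AI \<longleftrightarrow> T +>\<^bsub>FP\<^esub> x \<in> AI"
    using AI.a_rcos_const[of "T +>\<^bsub>FP\<^esub> x"] AI.a_rcos_self[OF c] by metis
  then show ?thesis using x unfolding cls_def K_def z by blast
qed

text \<open>By \<open>K_minimal\<close> only generators have to be tested. Tensor relations, squares
  and loops already vanish under \<open>Psi\<close>; the idempotents of infeasible vertices need the
  ideals of \<open>R_tilde\<close>.\<close>

lemma K_Phi:
  assumes "x \<in> K" shows "Phi x = \<zero>\<^bsub>BT\<^esub>"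
proof -
  interpret Ph: ring_hom_ring FP BT Phi by (rule Phi_ring_hom)
  define J where "J = {x \<in> carrier FP. Phi x = \<zero>\<^bsub>BT\<^esub>}"
  have J: "ideal J FP" using Ph.kernel_is_ideal unfolding J_def a_kernel_def kernel_def by simp
  have inJ: "x \<in> J \<longleftrightarrow> (\<forall>\<alpha> \<in> B. \<forall>\<beta> \<in> B. Psi x \<alpha> \<beta> \<in> RI {\<alpha>, \<beta>})" if "x \<in> carrier FP" for x
    using Phi_kernel that by (simp add: J_def)
  have zero: "x \<in> J" if "x \<in> carrier FP" "\<And>\<alpha> \<beta>. \<alpha> \<in> B \<Longrightarrow> \<beta> \<in> B \<Longrightarrow> Psi x \<alpha> \<beta> = 0" for x
    using inJ[OF that(1)] that(2) Sym.ideal_zero[OF RI_ideal] by simp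
  have "K \<subseteq> J"
  proof (rule K_minimal[OF J])
    have sub: "tensor_rels base_field (path_algebra_const B) poly_const PA Sym \<subseteq> carrier FP"
      using T_facts(1,2) FP.ideal_carrier by blast
    show "tensor_rels base_field (path_algebra_const B) poly_const PA Sym \<subseteq> J"
    proof
      fix x assume x: "x \<in> tensor_rels base_field (path_algebra_const B) poly_const PA Sym"
      then have xF: "x \<in> carrier FP" using sub by blast
      have "Psi x \<alpha> \<beta> = 0" if ab: "\<alpha> \<in> B" "\<beta> \<in> B" for \<alpha> \<beta>
      proof -
        have bal: "L (b \<otimes>\<^bsub>PA\<^esub> path_algebra_const B s) \<alpha> \<beta> = L b \<alpha> \<beta> * poly_const s" if "b \<in> carrier PA" for b s
        proof -
          have "L (b \<otimes>\<^bsub>PA\<^esub> path_algebra_const B s) \<alpha> \<beta> = (\<Sum>\<gamma> \<in> B. if \<gamma> = \<beta> then L b \<alpha> \<beta> * poly_const s else 0)"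
            unfolding L_mult[OF that PA_const ab] L_const by (rule sum.cong) auto
          then show ?thesis using ab finite_B by simp
        qed
        show ?thesis using x unfolding tensor_rels_def
          by (auto simp: Psi_diff Psi_pair L_add PA.plus bal distrib_left distrib_right mult_ac)
      qed
      then show "x \<in> J" using zero xF by blast
    qed
    show "A_gens \<subseteq> J"
    proof
      fix y assume y: "y \<in> A_gens"
      then have yF: "y \<in> carrier FP" using A_gens_FP by blast
      from y consider (1) \<alpha> where "y = gp [\<alpha>] 1" "\<alpha> \<in> B - Pp"
        | (2) \<alpha> \<beta> \<gamma> \<delta> where "y = gp [\<alpha>, \<gamma>, \<beta>] 1 - gp [\<alpha>, \<delta>, \<beta>] 1" "{\<alpha>, \<beta>, \<gamma>, \<delta>} \<subseteq> B" "distinct [\<alpha>, \<beta>, \<gamma>, \<delta>]"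
            "adjacent \<alpha> \<gamma>" "adjacent \<alpha> \<delta>" "adjacent \<beta> \<gamma>" "adjacent \<beta> \<delta>"
        | (3) \<alpha> i where "y = gp [\<alpha>, flip_at \<alpha> i, \<alpha>] 1 - gp [\<alpha>] (poly_var i)" "i \<in> E" "\<alpha> \<in> B" "flip_at \<alpha> i \<in> B"
        unfolding A_gens_def square_def by blast
      then show "y \<in> J"
      proof cases
        case 1
        have "Psi y \<beta> \<gamma> \<in> RI {\<beta>, \<gamma>}" if "\<beta> \<in> B" "\<gamma> \<in> B" for \<beta> \<gamma>
        proof (cases "\<beta> = \<alpha>")
          case True
          then show ?thesis using RI_infeasible[of \<alpha> "{\<beta>, \<gamma>}" "Psi y \<beta> \<gamma>"] 1(2) Psi_sym[OF yF] by (auto simp: Pp_iff)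
        next
          case False
          then show ?thesis unfolding 1(1) Psi_pair L_single using Sym.ideal_zero[OF RI_ideal] by simp
        qed
        then show ?thesis using inJ[OF yF] by blast
      next
        case 2
        have B: "\<alpha> \<in> B" "\<beta> \<in> B" "\<gamma> \<in> B" "\<delta> \<in> B" using 2 by auto
        \<comment> \<open>The flips that lead from \<alpha> and from \<beta> to \<epsilon> are in
          different coordinates, so the first of them moves towards \<beta>.\<close>
        have det: "detour P \<alpha> \<epsilon> \<beta> = {}" if e: "\<epsilon> \<in> B" "adjacent \<alpha> \<epsilon>" "adjacent \<beta> \<epsilon>" for \<epsilon>
        proof -
          obtain i where i: "i \<in> E" "\<epsilon> = flip_at \<alpha> i" using adjacent_flipD B(1) e by blast
          obtain j where j: "j \<in> E" "\<epsilon> = flip_at \<beta> j" using adjacent_flipD B(2) e by blast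
          have ne: "\<alpha> \<noteq> \<beta>" using 2(3) by simp
          have "i \<noteq> j" using i j ne flip_flip by metis
          then have "\<beta> i = \<epsilon> i" using j by (simp add: flip_at_apply)
          moreover have "\<alpha> i \<noteq> Zero" using i B_nonzero B by auto
          ultimately have "\<alpha> i \<noteq> \<beta> i" using i by (simp add: flip_at_apply)
          then show ?thesis using detour_flip[OF B(1,2) i(1)] i(2) by simp
        qed
        have w: "wt [\<alpha>, \<gamma>, \<beta>] = 1" "wt [\<alpha>, \<delta>, \<beta>] = 1"
          using det[of \<gamma>] det[of \<delta>] 2 B by (simp_all add: dmon_def)
        then show ?thesis by (intro zero[OF yF], unfold 2(1) Psi_diff Psi_pair L_single w) simp
      next
        case 3
        have w: "wt [\<alpha>, flip_at \<alpha> i, \<alpha>] = poly_var i"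
          using detour_flip[OF 3(3,3,2)] by (simp add: dmon_def squarefree_mon_def)
        then show ?thesis by (intro zero[OF yF], unfold 3(1) Psi_diff Psi_pair L_single w) auto
      qed
    qed
  qed
  then show ?thesis using assms J_def by blast
qed

end

context program_algebra
begin

section \<open>Reduction of paths to taut paths\<close>

lemma K_rels:
  "b \<in> carrier PA \<Longrightarrow> b' \<in> carrier PA \<Longrightarrow> c \<in> carrier Sym \<Longrightarrow> pair_gen (b + b') c - pair_gen b c - pair_gen b' c \<in> K"
  "b \<in> carrier PA \<Longrightarrow> c \<in> carrier Sym \<Longrightarrow> c' \<in> carrier Sym \<Longrightarrow> pair_gen b (c + c') - pair_gen b c - pair_gen b c' \<in> K"
  "b \<in> carrier PA \<Longrightarrow> c \<in> carrier Sym \<Longrightarrow> pair_gen (b \<otimes>\<^bsub>PA\<^esub> path_algebra_const B s) c - pair_gen b (poly_const s * c) \<in> K"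
proof -
  have sub: "tensor_rels base_field (path_algebra_const B) poly_const PA Sym \<subseteq> K" using T_facts(2) T_K by blast
  show "b \<in> carrier PA \<Longrightarrow> b' \<in> carrier PA \<Longrightarrow> c \<in> carrier Sym \<Longrightarrow> pair_gen (b + b') c - pair_gen b c - pair_gen b' c \<in> K"
    by (rule subsetD[OF sub]) (auto simp: tensor_rels_def PA.plus)
  show "b \<in> carrier PA \<Longrightarrow> c \<in> carrier Sym \<Longrightarrow> c' \<in> carrier Sym \<Longrightarrow> pair_gen b (c + c') - pair_gen b c - pair_gen b c' \<in> K"
    by (rule subsetD[OF sub]) (auto simp: tensor_rels_def)
  show "b \<in> carrier PA \<Longrightarrow> c \<in> carrier Sym \<Longrightarrow> pair_gen (b \<otimes>\<^bsub>PA\<^esub> path_algebra_const B s) c - pair_gen b (poly_const s * c) \<in> K"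
    by (rule subsetD[OF sub]) (auto simp: tensor_rels_def ring_of_type_algebra_def)
qed

lemma K_pair_zero: "b \<in> carrier PA \<Longrightarrow> pair_gen b 0 \<in> K"
  using FP.ideal_uminus[OF K_ideal K_rels(2)[of b 0 0]] by (simp add: sym_zero)

lemma K_zero_pair: "c \<in> carrier Sym \<Longrightarrow> pair_gen 0 c \<in> K"
  using FP.ideal_uminus[OF K_ideal K_rels(1)[of 0 0 c]] PA.zero_in by simp

lemma K_pair_diff:
  assumes "b \<in> carrier PA" "c \<in> carrier Sym" "c' \<in> carrier Sym"
  shows "pair_gen b (c - c') - (pair_gen b c - pair_gen b c') \<in> K"
  using FP.ideal_uminus[OF K_ideal K_rels(2)[of b "c - c'" c']] assms Sym.diff_closed by (simp add: algebra_simps)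

lemma K_single_const:
  assumes "\<pi> \<in> paths B" "p \<in> carrier Sym"
  shows "pair_gen (Poly_Mapping.single \<pi> c) p - gp \<pi> (poly_const c * p) \<in> K"
proof -
  have "(Poly_Mapping.single \<pi> 1 :: ('e, 'k) pathalg) \<otimes>\<^bsub>PA\<^esub> path_algebra_const B c = Poly_Mapping.single \<pi> c"
    unfolding PA_mult path_algebra_const_def conv_unit_right[OF finite_B assms(1)] by simp
  then show ?thesis using K_rels(3)[OF path_in_PA[OF assms(1), of 1] assms(2), of c] by simp
qed

lemma gp_mult:
  assumes "last \<pi> = hd \<rho>"
  shows "gp \<pi> p \<otimes>\<^bsub>FP\<^esub> gp \<rho> q = gp (\<pi> @ tl \<rho>) (p * q)"
  unfolding free_pairs_mult PA_mult conv_single using assms by (simp add: path_op_def)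

text \<open>In \<open>A_tilde\<close> this says that \<pi> equals \<open>t\<close> times \<rho>. The
  coefficient \<open>p\<close> is quantified so that such relations can be chained without
  multiplying through by polynomials.\<close>

definition eqv :: "'e svec list \<Rightarrow> 'e svec list \<Rightarrow> ('e, 'k) mpoly \<Rightarrow> bool" where
  "eqv \<pi> \<rho> t \<longleftrightarrow> (\<forall>p \<in> carrier Sym. gp \<pi> p - gp \<rho> (t * p) \<in> K)"

lemma eqv_refl: "eqv \<pi> \<pi> 1"
  by (simp add: eqv_def FP.ideal_zero[OF K_ideal])

lemma eqv_sym: "eqv \<pi> \<rho> 1 \<Longrightarrow> eqv \<rho> \<pi> 1"
  by (auto simp: eqv_def intro: FP.ideal_cong_sym[OF K_ideal])

lemma eqv_trans:
  assumes "eqv \<pi> \<rho> t" "eqv \<rho> \<sigma> s" "t \<in> carrier Sym"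
  shows "eqv \<pi> \<sigma> (s * t)"
  unfolding eqv_def
proof
  fix p assume p: "p \<in> carrier Sym"
  have "gp \<pi> p - gp \<rho> (t * p) \<in> K" using assms(1) p by (simp add: eqv_def)
  moreover have "gp \<rho> (t * p) - gp \<sigma> (s * (t * p)) \<in> K" using assms(2) sym_mult[OF assms(3) p] by (simp add: eqv_def)
  ultimately have "gp \<pi> p - gp \<sigma> (s * (t * p)) \<in> K" by (rule FP.ideal_cong_trans[OF K_ideal])
  then show "gp \<pi> p - gp \<sigma> (s * t * p) \<in> K" by (simp add: mult.assoc)
qed

lemma eqv_trans1: "eqv \<pi> \<rho> 1 \<Longrightarrow> eqv \<rho> \<sigma> 1 \<Longrightarrow> eqv \<pi> \<sigma> 1"
  using eqv_trans[of \<pi> \<rho> 1 \<sigma> 1] by (simp add: sym_one)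

lemma eqv_prefix:
  assumes e: "eqv \<pi> \<rho> t" and t: "t \<in> carrier Sym" and P: "\<sigma> \<in> paths B" "\<pi> \<in> paths B" "\<rho> \<in> paths B" "last \<sigma> = hd \<pi>" "last \<sigma> = hd \<rho>"
  shows "eqv (\<sigma> @ tl \<pi>) (\<sigma> @ tl \<rho>) t"
  unfolding eqv_def
proof
  fix p assume p: "p \<in> carrier Sym"
  have tp: "t * p \<in> carrier Sym" using sym_mult[OF t p] .
  have "gp \<sigma> 1 \<otimes>\<^bsub>FP\<^esub> (gp \<pi> p - gp \<rho> (t * p)) \<in> K"
    using e p gp_in_FP[OF P(1) sym_one] by (intro FP.ideal_mult_l[OF K_ideal]) (auto simp: eqv_def)
  moreover have "gp \<sigma> 1 \<otimes>\<^bsub>FP\<^esub> (gp \<pi> p - gp \<rho> (t * p)) = gp (\<sigma> @ tl \<pi>) p - gp (\<sigma> @ tl \<rho>) (t * p)"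
    unfolding FP.mult_diff[OF gp_in_FP[OF P(2) p] gp_in_FP[OF P(3) tp] gp_in_FP[OF P(1) sym_one]]
      gp_mult[OF P(4)] gp_mult[OF P(5)] by simp
  ultimately show "gp (\<sigma> @ tl \<pi>) p - gp (\<sigma> @ tl \<rho>) (t * p) \<in> K" by simp
qed

text \<open>The defining relations come without a free coefficient; the arbitrary \<open>p\<close>
  is supplied by the suffix, which may be a trivial path.\<close>

lemma eqv_suffix_gen:
  assumes e: "gp \<pi> 1 - gp \<rho> t \<in> K" and t: "t \<in> carrier Sym" and P: "\<sigma> \<in> paths B" "\<pi> \<in> paths B" "\<rho> \<in> paths B" "last \<pi> = hd \<sigma>" "last \<rho> = hd \<sigma>"
  shows "eqv (\<pi> @ tl \<sigma>) (\<rho> @ tl \<sigma>) t"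
  unfolding eqv_def
proof
  fix p assume p: "p \<in> carrier Sym"
  have "(gp \<pi> 1 - gp \<rho> t) \<otimes>\<^bsub>FP\<^esub> gp \<sigma> p \<in> K"
    using e gp_in_FP[OF P(1) p] by (rule FP.ideal_mult_r[OF K_ideal])
  moreover have "(gp \<pi> 1 - gp \<rho> t) \<otimes>\<^bsub>FP\<^esub> gp \<sigma> p = gp (\<pi> @ tl \<sigma>) p - gp (\<rho> @ tl \<sigma>) (t * p)"
    unfolding FP.diff_mult[OF gp_in_FP[OF P(2) sym_one] gp_in_FP[OF P(3) t] gp_in_FP[OF P(1) p]]
      gp_mult[OF P(4)] gp_mult[OF P(5)] by simp
  ultimately show "gp (\<pi> @ tl \<sigma>) p - gp (\<rho> @ tl \<sigma>) (t * p) \<in> K" by simp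
qed

lemma square_K: "square \<alpha> \<beta> \<gamma> \<delta> \<Longrightarrow> gp [\<alpha>, \<gamma>, \<beta>] 1 - gp [\<alpha>, \<delta>, \<beta>] 1 \<in> K"
  by (rule subsetD[OF A_gens_K]) (auto simp: A_gens_def)

lemma loop_K: "i \<in> E \<Longrightarrow> \<alpha> \<in> B \<Longrightarrow> flip_at \<alpha> i \<in> B \<Longrightarrow> gp [\<alpha>, flip_at \<alpha> i, \<alpha>] 1 - gp [\<alpha>] (poly_var i) \<in> K"
  by (rule subsetD[OF A_gens_K]) (auto simp: A_gens_def)

lemma dead_K: "\<alpha> \<in> B \<Longrightarrow> \<alpha> \<notin> feasible_topes P \<Longrightarrow> gp [\<alpha>] 1 \<in> K"
  by (rule subsetD[OF A_gens_K]) (auto simp: A_gens_def Pp_iff)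

lemma path2: "\<alpha> \<in> B \<Longrightarrow> \<beta> \<in> B \<Longrightarrow> adjacent \<alpha> \<beta> \<Longrightarrow> [\<alpha>, \<beta>] \<in> paths B"
  by (simp add: paths_def)

lemma paths_hd_tl: "\<pi> \<in> paths B \<Longrightarrow> \<pi> = hd \<pi> # tl \<pi>"
  by (cases \<pi>) (auto simp: paths_def)

lemma eqv_Cons:
  assumes "eqv \<pi> \<rho> t" "t \<in> carrier Sym" "\<pi> \<in> paths B" "\<rho> \<in> paths B" "hd \<pi> = hd \<rho>" "\<alpha> \<in> B" "adjacent \<alpha> (hd \<pi>)"
  shows "eqv (\<alpha> # \<pi>) (\<alpha> # \<rho>) t"
proof -
  have "hd \<pi> \<in> B" using paths_ends assms(3) by blast
  then have "eqv ([\<alpha>, hd \<pi>] @ tl \<pi>) ([\<alpha>, hd \<pi>] @ tl \<rho>) t"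
    using assms by (intro eqv_prefix path2) auto
  moreover have "[\<alpha>, hd \<pi>] @ tl \<pi> = \<alpha> # \<pi>" "[\<alpha>, hd \<pi>] @ tl \<rho> = \<alpha> # \<rho>"
    using paths_hd_tl[OF assms(3)] paths_hd_tl[OF assms(4)] assms(5) by auto
  ultimately show ?thesis by simp
qed

lemma flip_commute: "k \<noteq> l \<Longrightarrow> flip_at (flip_at \<alpha> k) l = flip_at (flip_at \<alpha> l) k"
  by (auto simp: flip_at_def)

lemma flip_neq: "\<alpha> \<in> B \<Longrightarrow> i \<in> E \<Longrightarrow> flip_at \<alpha> i i \<noteq> \<alpha> i"
  using B_nonzero[of \<alpha> i] by (simp add: flip_at_apply)

lemma diff_in_E: "\<alpha> \<in> B \<Longrightarrow> \<gamma> \<in> B \<Longrightarrow> \<alpha> i \<noteq> \<gamma> i \<Longrightarrow> i \<in> E"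
  using B_nonzero by metis

text \<open>Taut paths that start with two different steps can be compared through squares, by
  \<open>bounded_steps_connected\<close>.\<close>

lemma taut_unique:
  "sdist P (hd \<pi>) (last \<pi>) = n \<Longrightarrow> taut \<pi> \<Longrightarrow> taut \<rho> \<Longrightarrow> hd \<pi> = hd \<rho> \<Longrightarrow> last \<pi> = last \<rho> \<Longrightarrow> eqv \<pi> \<rho> 1"
proof (induction n arbitrary: \<pi> \<rho> rule: less_induct)
  case (less n)
  define \<alpha> where "\<alpha> = hd \<pi>"
  define \<gamma> where "\<gamma> = last \<pi>"
  have ends: "\<alpha> \<in> B" "\<gamma> \<in> B" using paths_ends[OF taut_paths[OF less.prems(2)]] by (auto simp: \<alpha>_def \<gamma>_def)
  have IH: "eqv \<sigma> \<sigma>' 1" if "\<alpha> k \<noteq> \<gamma> k" "taut \<sigma>" "taut \<sigma>'" "hd \<sigma> = flip_at \<alpha> k" "hd \<sigma>' = flip_at \<alpha> k" "last \<sigma> = \<gamma>" "last \<sigma>' = \<gamma>" for \<sigma> \<sigma>' k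
  proof (rule less.IH[OF _ refl that(2,3)])
    show "sdist P (hd \<sigma>) (last \<sigma>) < n"
      using sdist_flip[OF ends that(1)] that less.prems(1) by (simp add: \<alpha>_def \<gamma>_def)
  qed (use that in simp_all)
  \<comment> \<open>A representative for each possible first step. By induction every taut path is
    equivalent to one of these (\<open>step\<close>), and it remains to compare them with each
    other.\<close>
  define c where "c k = \<alpha> # tau (flip_at \<alpha> k) \<gamma>" for k
  have step: "\<exists>k. \<alpha> k \<noteq> \<gamma> k \<and> flip_at \<alpha> k \<in> B \<and> eqv \<sigma> (c k) 1"
    if s: "taut \<sigma>" "hd \<sigma> = \<alpha>" "last \<sigma> = \<gamma>" "\<alpha> \<noteq> \<gamma>" for \<sigma>
  proof -
    obtain \<sigma>' where \<sigma>': "\<sigma> = \<alpha> # \<sigma>'" using s by (cases \<sigma>) auto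
    then obtain \<beta> \<sigma>'' where \<sigma>'': "\<sigma>' = \<beta> # \<sigma>''" using s by (cases \<sigma>') auto
    have "taut (\<alpha> # \<beta> # \<sigma>'')" using s(1) \<sigma>' \<sigma>'' by simp
    then obtain k where k: "\<alpha> k \<noteq> last (\<beta> # \<sigma>'') k" "\<beta> = flip_at \<alpha> k" and t: "taut (\<beta> # \<sigma>'')" by auto
    have l: "last (\<beta> # \<sigma>'') = \<gamma>" using s(3) \<sigma>' \<sigma>'' by simp
    have bB: "flip_at \<alpha> k \<in> B" using paths_ends[OF taut_paths[OF t]] k by simp
    have kE: "k \<in> E" using diff_in_E[OF ends] k l by simp
    have tt: "taut (tau \<beta> \<gamma>)" "hd (tau \<beta> \<gamma>) = \<beta>" "last (tau \<beta> \<gamma>) = \<gamma>" using tau[OF bB ends(2)] k by auto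
    have "eqv (\<beta> # \<sigma>'') (tau \<beta> \<gamma>) 1"
      by (rule IH[of k]) (use t tt k l in auto)
    then have "eqv (\<alpha> # \<beta> # \<sigma>'') (\<alpha> # tau \<beta> \<gamma>) 1"
      using taut_paths t tt ends adjacent_flip[OF kE ends(1)] k by (intro eqv_Cons sym_one) auto
    then show ?thesis using k l bB \<sigma>' \<sigma>'' unfolding c_def by auto
  qed
  show ?case
  proof (cases "\<alpha> = \<gamma>")
    case True
    have "\<sigma> = [\<alpha>]" if "taut \<sigma>" "hd \<sigma> = \<alpha>" "last \<sigma> = \<alpha>" for \<sigma>
      using taut_length[OF that(1)] that(2,3) sdist_zero[OF ends(1)] by (cases \<sigma>) auto
    then have "\<pi> = [\<alpha>]" "\<rho> = [\<alpha>]" using less.prems True by (auto simp: \<alpha>_def \<gamma>_def)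
    then show ?thesis using eqv_refl by simp
  next
    case False
    obtain i where i: "\<alpha> i \<noteq> \<gamma> i" "flip_at \<alpha> i \<in> B" "eqv \<pi> (c i) 1"
      using step[OF less.prems(2)] False \<alpha>_def \<gamma>_def by auto
    obtain j where j: "\<alpha> j \<noteq> \<gamma> j" "flip_at \<alpha> j \<in> B" "eqv \<rho> (c j) 1"
      using step[OF less.prems(3)] less.prems(4,5) False \<alpha>_def \<gamma>_def by auto
    \<comment> \<open>Two first steps that span a bounded square: both representatives can be
      continued through the opposite corner \<beta>, where the square relation applies.\<close>
    have nb: "eqv (c k) (c l) 1"
      if k: "\<alpha> k \<noteq> \<gamma> k" "flip_at \<alpha> k \<in> B" and l: "\<alpha> l \<noteq> \<gamma> l" "flip_at \<alpha> l \<in> B"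
        and kl: "k \<noteq> l" "flip_at (flip_at \<alpha> k) l \<in> B" for k l
    proof -
      define \<beta>1 \<beta>2 \<beta> where "\<beta>1 = flip_at \<alpha> k" and "\<beta>2 = flip_at \<alpha> l" and "\<beta> = flip_at (flip_at \<alpha> k) l"
      have bb: "\<beta>1 \<in> B" "\<beta>2 \<in> B" "\<beta> \<in> B" using k l kl by (auto simp: \<beta>1_def \<beta>2_def \<beta>_def)
      have kE: "k \<in> E" "l \<in> E" using diff_in_E[OF ends] k l by auto
      have b1: "\<beta> = flip_at \<beta>1 l" by (simp add: \<beta>_def \<beta>1_def)
      have b2: "\<beta> = flip_at \<beta>2 k" using flip_commute[OF kl(1)] by (simp add: \<beta>_def \<beta>2_def)
      define \<tau> where "\<tau> = tau \<beta> \<gamma>"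
      have t: "taut \<tau>" "hd \<tau> = \<beta>" "last \<tau> = \<gamma>" using tau[OF bb(3) ends(2)] by (auto simp: \<tau>_def)
      have tP: "\<tau> \<in> paths B" using taut_paths[OF t(1)] .
      have ne: "\<tau> \<noteq> []" using t(1) by auto
      have t1: "taut (\<beta>1 # \<tau>)"
        by (rule taut_Cons[OF bb(1) t(1), of l]) (use b1 t l kl in \<open>auto simp: \<beta>1_def flip_at_apply\<close>)
      have t2: "taut (\<beta>2 # \<tau>)"
        by (rule taut_Cons[OF bb(2) t(1), of k]) (use b2 t k kl in \<open>auto simp: \<beta>2_def flip_at_apply\<close>)
      have tt1: "taut (tau \<beta>1 \<gamma>)" "hd (tau \<beta>1 \<gamma>) = \<beta>1" "last (tau \<beta>1 \<gamma>) = \<gamma>" using tau[OF bb(1) ends(2)] by auto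
      have tt2: "taut (tau \<beta>2 \<gamma>)" "hd (tau \<beta>2 \<gamma>) = \<beta>2" "last (tau \<beta>2 \<gamma>) = \<gamma>" using tau[OF bb(2) ends(2)] by auto
      have a1: "adjacent \<alpha> \<beta>1" "adjacent \<alpha> \<beta>2" using adjacent_flip ends kE by (auto simp: \<beta>1_def \<beta>2_def)
      have a2: "adjacent \<beta> \<beta>1" "adjacent \<beta> \<beta>2"
        using adjacent_flip[OF kE(2) bb(1)] adjacent_flip[OF kE(1) bb(2)] b1 b2 adjacent_commute by auto
      have "eqv (tau \<beta>1 \<gamma>) (\<beta>1 # \<tau>) 1"
        by (rule IH[OF k(1)]) (use tt1 t1 t ne in \<open>auto simp: \<beta>1_def\<close>)
      then have e1: "eqv (c k) (\<alpha> # \<beta>1 # \<tau>) 1" unfolding c_def \<beta>1_def[symmetric]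
        using taut_paths tt1 t1 ends a1 by (intro eqv_Cons sym_one) auto
      have "eqv (tau \<beta>2 \<gamma>) (\<beta>2 # \<tau>) 1"
        by (rule IH[OF l(1)]) (use tt2 t2 t ne in \<open>auto simp: \<beta>2_def\<close>)
      then have e2: "eqv (c l) (\<alpha> # \<beta>2 # \<tau>) 1" unfolding c_def \<beta>2_def[symmetric]
        using taut_paths tt2 t2 ends a1 by (intro eqv_Cons sym_one) auto
      have "\<beta>1 l = \<alpha> l" "\<beta>2 l \<noteq> \<alpha> l" "\<beta>1 k \<noteq> \<alpha> k" "\<beta> k \<noteq> \<alpha> k" "\<beta> l \<noteq> \<alpha> l" "\<beta> k \<noteq> \<beta>2 k"
        using flip_neq[OF ends(1) kE(1)] flip_neq[OF ends(1) kE(2)] kl(1) by (auto simp: \<beta>1_def \<beta>2_def \<beta>_def flip_at_apply)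
      then have "distinct [\<alpha>, \<beta>, \<beta>1, \<beta>2]" by auto
      then have sq: "square \<alpha> \<beta> \<beta>1 \<beta>2" using ends bb a1 a2 by (simp add: square_def)
      have "eqv ([\<alpha>, \<beta>1, \<beta>] @ tl \<tau>) ([\<alpha>, \<beta>2, \<beta>] @ tl \<tau>) 1"
        by (rule eqv_suffix_gen[OF square_K[OF sq] sym_one tP]) (use t ends bb a1 a2 path3 in auto)
      moreover have "[\<alpha>, \<beta>1, \<beta>] @ tl \<tau> = \<alpha> # \<beta>1 # \<tau>" "[\<alpha>, \<beta>2, \<beta>] @ tl \<tau> = \<alpha> # \<beta>2 # \<tau>"
        using paths_hd_tl[OF tP] t(2) by auto
      ultimately have "eqv (\<alpha> # \<beta>1 # \<tau>) (\<alpha> # \<beta>2 # \<tau>) 1" by simp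
      then show ?thesis using e1 e2 eqv_trans1 eqv_sym by blast
    qed
    \<comment> \<open>\<open>W1\<close> collects the first steps whose representatives are
      equivalent to that of \<open>i\<close>. If \<open>j\<close> were not among them, no bounded
      square would link \<open>W1\<close> to the remaining first steps, against
      \<open>bounded_steps_connected\<close>.\<close>
    define W where "W = {k. \<alpha> k \<noteq> \<gamma> k \<and> flip_at \<alpha> k \<in> B}"
    define W1 where "W1 = {k \<in> W. eqv (c i) (c k) 1}"
    have "j \<in> W1"
    proof (rule ccontr)
      assume "j \<notin> W1"
      then have "j \<in> W - W1" using j by (simp add: W_def)
      moreover have "i \<in> W1" using i eqv_refl by (simp add: W_def W1_def)
      moreover have "flip_at (flip_at \<alpha> k) l \<notin> B" if "k \<in> W1" "l \<in> W - W1" for k l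
      proof
        assume "flip_at (flip_at \<alpha> k) l \<in> B"
        then have "eqv (c k) (c l) 1" using nb that by (auto simp: W_def W1_def)
        then have "eqv (c i) (c l) 1" using eqv_trans1 that by (auto simp: W1_def)
        then show False using that by (auto simp: W1_def)
      qed
      ultimately show False
        using bounded_steps_connected[OF ends, of W1 "W - W1"] by (auto simp: W_def W1_def)
    qed
    then have "eqv (c i) (c j) 1" by (simp add: W1_def)
    then show ?thesis using i j eqv_trans1 eqv_sym by blast
  qed
qed

text \<open>By induction the tail may be replaced by a taut path. If the first step leads away from
  the end, this taut path can be chosen to return to \<alpha> at once, and the loop relation turns
  the excursion into the factor \<open>poly_var i\<close>.\<close>

lemma path_reduce:
  "\<pi> \<in> paths B \<Longrightarrow> taut \<rho> \<Longrightarrow> hd \<rho> = hd \<pi> \<Longrightarrow> last \<rho> = last \<pi> \<Longrightarrow> eqv \<pi> \<rho> (wt \<pi>)"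
proof (induction \<pi> arbitrary: \<rho> rule: wt.induct)
  case 1 then show ?case by (simp add: paths_def)
next
  case (2 \<alpha>)
  then have "taut [\<alpha>]" by (auto simp: paths_def)
  then show ?case using taut_unique[OF refl, of "[\<alpha>]" \<rho>] 2 by simp
next
  case (3 \<alpha> \<beta> \<pi>)
  define \<gamma> where "\<gamma> = last (\<beta> # \<pi>)"
  have p: "\<alpha> \<in> B" "adjacent \<alpha> \<beta>" "\<beta> # \<pi> \<in> paths B" using 3(2) paths_Cons by auto
  have bg: "\<beta> \<in> B" "\<gamma> \<in> B" using paths_ends[OF p(3)] by (auto simp: \<gamma>_def)
  have r: "taut \<rho>" "hd \<rho> = \<alpha>" "last \<rho> = \<gamma>" "\<rho> \<in> paths B" using 3 taut_paths by (auto simp: \<gamma>_def)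
  obtain i where i: "i \<in> E" "\<beta> = flip_at \<alpha> i" using adjacent_flipD p bg by blast
  define \<sigma> where "\<sigma> = tau \<beta> \<gamma>"
  have s: "taut \<sigma>" "hd \<sigma> = \<beta>" "last \<sigma> = \<gamma>" "\<sigma> \<in> paths B" using tau[OF bg] taut_paths by (auto simp: \<sigma>_def)
  have "eqv (\<beta> # \<pi>) \<sigma> (wt (\<beta> # \<pi>))" using 3(1)[OF p(3) s(1)] s by (simp add: \<gamma>_def)
  then have e: "eqv (\<alpha> # \<beta> # \<pi>) (\<alpha> # \<sigma>) (wt (\<beta> # \<pi>))"
    using p s by (intro eqv_Cons wt_sym) auto
  have "eqv (\<alpha> # \<sigma>) \<rho> (dmon \<alpha> \<beta> \<gamma>)"
  proof (cases "\<alpha> i = \<gamma> i")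
    case False
    then have "taut (\<alpha> # \<sigma>)" using s i by (intro taut_Cons[OF p(1) s(1)]) auto
    moreover have "\<sigma> \<noteq> []" using s(1) by auto
    ultimately have "eqv (\<alpha> # \<sigma>) \<rho> 1" using taut_unique[OF refl, of "\<alpha> # \<sigma>" \<rho>] r s by auto
    then show ?thesis using detour_flip[OF p(1) bg(2) i(1)] False i(2) by (simp add: dmon_def)
  next
    case True
    have bi: "\<beta> i \<noteq> \<gamma> i" using flip_neq[OF p(1) i(1)] True i(2) by simp
    have t: "taut (\<beta> # \<rho>)" by (rule taut_Cons[OF bg(1) r(1), of i]) (use r i bi in auto)
    have ne: "\<rho> \<noteq> []" using r(1) by auto
    have "eqv \<sigma> (\<beta> # \<rho>) 1" using taut_unique[OF refl s(1) t] s r ne by auto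
    then have e1: "eqv (\<alpha> # \<sigma>) (\<alpha> # \<beta> # \<rho>) 1"
      using p s t taut_paths by (intro eqv_Cons sym_one) auto
    have "eqv ([\<alpha>, flip_at \<alpha> i, \<alpha>] @ tl \<rho>) ([\<alpha>] @ tl \<rho>) (poly_var i)"
      by (rule eqv_suffix_gen[OF loop_K]) (use i p bg r path1 loop_path sym_var in auto)
    moreover have "[\<alpha>, flip_at \<alpha> i, \<alpha>] @ tl \<rho> = \<alpha> # \<beta> # \<rho>" "[\<alpha>] @ tl \<rho> = \<rho>"
      using paths_hd_tl[OF r(4)] r(2) i(2) by auto
    ultimately have "eqv (\<alpha> # \<beta> # \<rho>) \<rho> (poly_var i)" by simp
    from eqv_trans[OF e1 this sym_one] have "eqv (\<alpha> # \<sigma>) \<rho> (poly_var i)" by simp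
    then show ?thesis using detour_flip[OF p(1) bg(2) i(1)] True i(2) by (simp add: dmon_def squarefree_mon_def)
  qed
  from eqv_trans[OF e this wt_sym] show ?case by (simp add: \<gamma>_def)
qed

lemma theta_diff_K:
  assumes "\<And>\<alpha> \<beta>. m \<alpha> \<beta> \<in> carrier Sym" "\<And>\<alpha> \<beta>. m' \<alpha> \<beta> \<in> carrier Sym"
  shows "theta (\<lambda>\<alpha> \<beta>. m \<alpha> \<beta> - m' \<alpha> \<beta>) - (theta m - theta m') \<in> K"
  unfolding theta_def sum_subtractf[symmetric]
  by (rule FP.ideal_sum[OF K_ideal], rule K_pair_diff) (use assms path_in_PA tau_path in auto)

lemma theta_zero_K:
  assumes "\<And>\<alpha> \<beta>. \<alpha> \<in> B \<Longrightarrow> \<beta> \<in> B \<Longrightarrow> gp (tau \<alpha> \<beta>) (m \<alpha> \<beta>) \<in> K"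
  shows "theta m \<in> K"
  unfolding theta_def by (rule FP.ideal_sum[OF K_ideal]) (use assms in auto)

lemma theta_Psi_single:
  assumes \<pi>: "\<pi> \<in> paths B" and p: "p \<in> carrier Sym"
  shows "pair_gen (Poly_Mapping.single \<pi> c) p - theta (Psi (pair_gen (Poly_Mapping.single \<pi> c) p)) \<in> K"
proof -
  define \<alpha> \<gamma> where "\<alpha> = hd \<pi>" and "\<gamma> = last \<pi>"
  have ag: "\<alpha> \<in> B" "\<gamma> \<in> B" using paths_ends[OF \<pi>] by (auto simp: \<alpha>_def \<gamma>_def)
  define q where "q = poly_const c * wt \<pi> * p"
  have Ps: "Psi (pair_gen (Poly_Mapping.single \<pi> c) p) \<beta> \<delta> = (if (\<beta>, \<delta>) = (\<alpha>, \<gamma>) then q else 0)" for \<beta> \<delta>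
    by (auto simp: Psi_pair L_single \<alpha>_def \<gamma>_def q_def)
  have cp: "poly_const c * p \<in> carrier Sym" using sym_mult[OF sym_const p] .
  have t: "taut (tau \<alpha> \<gamma>)" "hd (tau \<alpha> \<gamma>) = \<alpha>" "last (tau \<alpha> \<gamma>) = \<gamma>" using tau[OF ag] by auto
  have "eqv \<pi> (tau \<alpha> \<gamma>) (wt \<pi>)" using path_reduce[OF \<pi> t(1)] t by (simp add: \<alpha>_def \<gamma>_def)
  then have "gp \<pi> (poly_const c * p) - gp (tau \<alpha> \<gamma>) (wt \<pi> * (poly_const c * p)) \<in> K" using cp by (simp add: eqv_def)
  then have 1: "pair_gen (Poly_Mapping.single \<pi> c) p - gp (tau \<alpha> \<gamma>) q \<in> K"
    using FP.ideal_cong_trans[OF K_ideal K_single_const[OF \<pi> p]] by (simp add: q_def mult_ac)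
  have th: "theta (Psi (pair_gen (Poly_Mapping.single \<pi> c) p)) =
      gp (tau \<alpha> \<gamma>) q + (\<Sum>u \<in> B \<times> B - {(\<alpha>, \<gamma>)}. gp (tau (fst u) (snd u)) 0)"
  proof -
    have "(\<Sum>u \<in> B \<times> B - {(\<alpha>, \<gamma>)}. gp (tau (fst u) (snd u)) (Psi (pair_gen (Poly_Mapping.single \<pi> c) p) (fst u) (snd u))) =
        (\<Sum>u \<in> B \<times> B - {(\<alpha>, \<gamma>)}. gp (tau (fst u) (snd u)) 0)"
      by (rule sum.cong) (auto simp: Ps)
    then show ?thesis unfolding theta_def
      using ag finite_B by (subst sum.remove[of _ "(\<alpha>, \<gamma>)"]) (auto simp: Ps)
  qed
  have "(\<Sum>u \<in> B \<times> B - {(\<alpha>, \<gamma>)}. gp (tau (fst u) (snd u)) 0) \<in> K"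
    by (rule FP.ideal_sum[OF K_ideal], rule K_pair_zero) (use path_in_PA tau_path in auto)
  from FP.ideal_diff[OF K_ideal 1 this] show ?thesis by (simp only: th diff_diff_eq)
qed

text \<open>A normal form: modulo \<open>K\<close> every element is determined by its matrix. On a
  single path this is \<open>path_reduce\<close>; the rest is additivity modulo
  \<open>K\<close>.\<close>

lemma theta_Psi:
  assumes x: "x \<in> carrier FP"
  shows "x - theta (Psi x) \<in> K"
proof -
  have comb: "(x - y) - theta (Psi (x - y)) \<in> K"
    if x: "x \<in> carrier FP" "x - theta (Psi x) \<in> K" and y: "y \<in> carrier FP" "y - theta (Psi y) \<in> K" for x y
  proof -
    have "theta (Psi (x - y)) - (theta (Psi x) - theta (Psi y)) \<in> K"
    proof -
      have "Psi (x - y) = (\<lambda>\<alpha> \<beta>. Psi x \<alpha> \<beta> - Psi y \<alpha> \<beta>)" by (intro ext) (rule Psi_diff)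
      then show ?thesis using theta_diff_K[OF Psi_sym[OF x(1)] Psi_sym[OF y(1)]] by (simp only:)
    qed
    then have "((x - theta (Psi x)) - (y - theta (Psi y))) - (theta (Psi (x - y)) - (theta (Psi x) - theta (Psi y))) \<in> K"
      by (rule FP.ideal_diff[OF K_ideal FP.ideal_diff[OF K_ideal x(2) y(2)]])
    then show ?thesis by (simp add: algebra_simps)
  qed
  have th0: "theta (\<lambda>\<alpha> \<beta>. 0) \<in> K"
    by (rule theta_zero_K, rule K_pair_zero) (use path_in_PA tau_path in auto)
  have z0: "0 - theta (Psi 0) \<in> K"
  proof -
    have "Psi 0 = (\<lambda>\<alpha> \<beta>. 0)" by (intro ext) simp
    then show ?thesis using FP.ideal_uminus[OF K_ideal th0] by simp
  qed
  have cong: "x - theta (Psi x) \<in> K" if "y - x \<in> K" "y - theta (Psi y) \<in> K" "x \<in> carrier FP" "y \<in> carrier FP" "Psi y = Psi x" for x y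
    using FP.ideal_diff[OF K_ideal that(2,1)] that(5) by simp
  have "x \<in> carrier FP \<and> x - theta (Psi x) \<in> K"
    using x[unfolded FP_carrier]
  proof (induction x rule: frag_induction)
    case zero
    then show ?case using FP.zero_in z0 by blast
  next
    case (one u)
    obtain a p where u: "u = (a, p)" "a \<in> carrier PA" "p \<in> carrier Sym" using one by (cases u) auto
    have "pair_gen a p \<in> carrier FP \<and> pair_gen a p - theta (Psi (pair_gen a p)) \<in> K"
      using u(2)[unfolded PA_carrier]
    proof (induction a rule: pm_induct)
      case zero
      have "Psi (pair_gen 0 p) = (\<lambda>\<alpha> \<beta>. 0)" by (intro ext) (simp add: Psi_pair)
      then show ?case using FP.ideal_diff[OF K_ideal K_zero_pair[OF u(3)] th0] pair_in_FP[OF PA.zero_in u(3)] by simp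
    next
      case (single \<pi> c)
      then show ?case using theta_Psi_single u(3) pair_in_FP path_in_PA by blast
    next
      case (add a b)
      have ab: "a \<in> carrier PA" "b \<in> carrier PA" using add by (auto simp: PA_carrier)
      have F: "pair_gen a p \<in> carrier FP" "pair_gen b p \<in> carrier FP" "pair_gen (a + b) p \<in> carrier FP"
        using ab u(3) pair_in_FP PA.plus_closed by auto
      \<comment> \<open>The closure under differences also yields sums, with the second summand
        negated.\<close>
      have m: "- pair_gen b p - theta (Psi (- pair_gen b p)) \<in> K"
        using comb[OF FP.zero_in z0 F(2)] add by simp
      have s: "(pair_gen a p + pair_gen b p) - theta (Psi (pair_gen a p + pair_gen b p)) \<in> K"
        using comb[OF F(1) _ FP.uminus_closed[OF F(2)] m] add by simp
      have "Psi (pair_gen a p + pair_gen b p) = Psi (pair_gen (a + b) p)"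
        by (intro ext) (simp add: Psi_add Psi_pair L_add distrib_right)
      moreover have "(pair_gen a p + pair_gen b p) - pair_gen (a + b) p \<in> K"
        using FP.ideal_uminus[OF K_ideal K_rels(1)[OF ab u(3)]] by (simp add: algebra_simps)
      ultimately show ?case using cong[OF _ s F(3) FP.plus_closed[OF F(1,2)]] F(3) by blast
    qed
    then show ?case using u by simp
  next
    case (diff x y)
    then show ?case using comb FP.diff_closed by blast
  qed
  then show ?thesis by blast
qed

text \<open>For a generator given by \<open>S\<close>, \<open>z_blocked\<close> supplies a bounded
  infeasible \<delta> whose detour lies in \<open>S\<close>. The concatenation of taut paths through
  \<delta> contains a vanishing idempotent and has weight
  \<open>dmon \<alpha> \<delta> \<beta>\<close>; multiplied by the remaining variables of
  \<open>S\<close> it becomes the monomial of \<open>S\<close> times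
  \<open>tau \<alpha> \<beta>\<close>.\<close>

lemma tau_kills:
  assumes ab: "\<alpha> \<in> B" "\<beta> \<in> B" and q: "q \<in> RI {\<alpha>, \<beta>}"
  shows "gp (tau \<alpha> \<beta>) q \<in> K"
proof -
  have tP: "tau \<alpha> \<beta> \<in> paths B" using tau_path[OF ab] .
  have t: "taut (tau \<alpha> \<beta>)" "hd (tau \<alpha> \<beta>) = \<alpha>" "last (tau \<alpha> \<beta>) = \<beta>" using tau[OF ab] by auto
  have qS: "q \<in> carrier Sym" using Sym.ideal_carrier[OF RI_ideal q] .
  \<comment> \<open>A polynomial acts on the second component through the trivial path at \<beta>,
    multiplied from the right; hence the annihilator is an ideal.\<close>
  have J: "ideal {p \<in> carrier Sym. gp (tau \<alpha> \<beta>) p \<in> K} Sym"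
  proof (rule Sym.idealI')
    show "0 \<in> {p \<in> carrier Sym. gp (tau \<alpha> \<beta>) p \<in> K}" using sym_zero K_pair_zero path_in_PA[OF tP] by simp
    fix x assume x: "x \<in> {p \<in> carrier Sym. gp (tau \<alpha> \<beta>) p \<in> K}"
    show "x - y \<in> {p \<in> carrier Sym. gp (tau \<alpha> \<beta>) p \<in> K}" if y: "y \<in> {p \<in> carrier Sym. gp (tau \<alpha> \<beta>) p \<in> K}" for y
    proof -
      have "gp (tau \<alpha> \<beta>) x - gp (tau \<alpha> \<beta>) y \<in> K" using x y FP.ideal_diff[OF K_ideal] by blast
      moreover have "gp (tau \<alpha> \<beta>) (x - y) - (gp (tau \<alpha> \<beta>) x - gp (tau \<alpha> \<beta>) y) \<in> K"
        using x y K_pair_diff path_in_PA[OF tP] by blast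
      ultimately show ?thesis using FP.ideal_add[OF K_ideal] x y Sym.diff_closed by fastforce
    qed
    fix a assume a: "a \<in> carrier Sym"
    have "gp (tau \<alpha> \<beta>) x \<otimes>\<^bsub>FP\<^esub> gp [\<beta>] a \<in> K"
      using x gp_in_FP[OF path1[OF ab(2)] a] by (intro FP.ideal_mult_r[OF K_ideal]) auto
    then have "gp (tau \<alpha> \<beta>) (x * a) \<in> K" using gp_mult[of "tau \<alpha> \<beta>" "[\<beta>]" x a] t by simp
    then show "a \<otimes>\<^bsub>Sym\<^esub> x \<in> {p \<in> carrier Sym. gp (tau \<alpha> \<beta>) p \<in> K}" "x \<otimes>\<^bsub>Sym\<^esub> a \<in> {p \<in> carrier Sym. gp (tau \<alpha> \<beta>) p \<in> K}"
      using x a sym_mult by (auto simp: mult.commute)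
  qed auto
  have "squarefree_mon S \<in> {p \<in> carrier Sym. gp (tau \<alpha> \<beta>) p \<in> K}" if S: "S \<subseteq> E" "S \<notin> z_common_faces P {\<alpha>, \<beta>}" for S
  proof -
    obtain \<delta> where d: "\<delta> \<in> B" "\<delta> \<notin> feasible_topes P" "detour P \<alpha> \<delta> \<beta> \<subseteq> S"
      using z_blocked[OF ab(1) B_supp[OF ab(2)] S] by blast
    define r where "r = (squarefree_mon (S - detour P \<alpha> \<delta> \<beta>) :: ('e, 'k) mpoly)"
    have rS: "r \<in> carrier Sym" unfolding r_def by (rule sym_squarefree) (use S in blast)
    have fS: "finite S" using S(1) finite_E finite_subset by blast
    have sr: "squarefree_mon S = dmon \<alpha> \<delta> \<beta> * r"
      unfolding r_def dmon_def squarefree_mon_def using prod.subset_diff[OF d(3) fS] by (simp add: mult.commute)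
    define \<sigma> \<rho> where "\<sigma> = tau \<alpha> \<delta>" and "\<rho> = tau \<delta> \<beta>"
    have s: "taut \<sigma>" "hd \<sigma> = \<alpha>" "last \<sigma> = \<delta>" "\<sigma> \<in> paths B" using tau[OF ab(1) d(1)] taut_paths by (auto simp: \<sigma>_def)
    have r: "taut \<rho>" "hd \<rho> = \<delta>" "last \<rho> = \<beta>" "\<rho> \<in> paths B" using tau[OF d(1) ab(2)] taut_paths by (auto simp: \<rho>_def)
    have ne: "\<sigma> \<noteq> []" "\<rho> \<noteq> []" "set \<sigma> \<subseteq> B" "set \<rho> \<subseteq> B" using s r by (auto simp: paths_def)
    have "gp \<sigma> 1 \<otimes>\<^bsub>FP\<^esub> gp [\<delta>] 1 \<in> K"
      by (rule FP.ideal_mult_l[OF K_ideal dead_K[OF d(1,2)] gp_in_FP[OF s(4) sym_one]])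
    then have "gp \<sigma> 1 \<in> K" using gp_mult[of \<sigma> "[\<delta>]" 1 1] s by simp
    then have "gp \<sigma> 1 \<otimes>\<^bsub>FP\<^esub> gp \<rho> r \<in> K" by (rule FP.ideal_mult_r[OF K_ideal _ gp_in_FP[OF r(4) rS]])
    then have k: "gp (\<sigma> @ tl \<rho>) r \<in> K" using gp_mult[of \<sigma> \<rho> 1 r] s r by simp
    have "\<sigma> @ tl \<rho> \<in> paths B" using path_append s r by metis
    moreover have "hd (\<sigma> @ tl \<rho>) = \<alpha>" "last (\<sigma> @ tl \<rho>) = \<beta>" using last_append_tl[OF ne(2), of \<sigma>] ne s r by auto
    ultimately have "eqv (\<sigma> @ tl \<rho>) (tau \<alpha> \<beta>) (wt (\<sigma> @ tl \<rho>))" using path_reduce t by simp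
    moreover have "wt (\<sigma> @ tl \<rho>) = dmon \<alpha> \<delta> \<beta>"
      using wt_append[OF ne] s r taut_wt by simp
    ultimately have "gp (\<sigma> @ tl \<rho>) r - gp (tau \<alpha> \<beta>) (dmon \<alpha> \<delta> \<beta> * r) \<in> K" using rS by (simp add: eqv_def)
    from FP.ideal_diff[OF K_ideal k this] have "gp (tau \<alpha> \<beta>) (squarefree_mon S) \<in> K" by (simp add: sr)
    then show ?thesis using sym_squarefree[OF S(1)] by simp
  qed
  then have "RI {\<alpha>, \<beta>} \<subseteq> {p \<in> carrier Sym. gp (tau \<alpha> \<beta>) p \<in> K}" by (rule RI_minimal[OF J])
  then show ?thesis using q by blast
qed

text \<open>If \<open>Phi x\<close> vanishes, the coefficients of the normal form
  \<open>theta (Psi x)\<close> lie in the ideals of \<open>R_tilde\<close>, and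
  \<open>tau_kills\<close> removes its summands one by one.\<close>

theorem kernels_eq:
  assumes x: "x \<in> carrier FP"
  shows "cls x = \<zero>\<^bsub>At\<^esub> \<longleftrightarrow> Phi x = \<zero>\<^bsub>BT\<^esub>"
proof
  assume "cls x = \<zero>\<^bsub>At\<^esub>"
  then show "Phi x = \<zero>\<^bsub>BT\<^esub>" using cls_kernel[OF x] K_Phi by blast
next
  assume "Phi x = \<zero>\<^bsub>BT\<^esub>"
  then have P: "Psi x \<alpha> \<beta> \<in> RI {\<alpha>, \<beta>}" if "\<alpha> \<in> B" "\<beta> \<in> B" for \<alpha> \<beta> using Phi_kernel[OF x] that by blast
  have "theta (Psi x) \<in> K" by (rule theta_zero_K) (rule tau_kills[OF _ _ P])
  from FP.ideal_add[OF K_ideal theta_Psi[OF x] this] have "x \<in> K" by simp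
  then show "cls x = \<zero>\<^bsub>At\<^esub>" using cls_kernel[OF x] by blast
qed

theorem A_tilde_iso:
  "\<exists>\<phi> \<in> ring_iso At BT. \<forall>x \<in> carrier FP. \<phi> (cls x) = Phi x"
  using iso_of_kernels[OF cls_hom Phi_ring_hom cls_surj Phi_surj kernels_eq] .

end

section \<open>Constant terms of polynomials\<close>

lemma base_field_ring: "ring (base_field :: 'k::field ring)"
  by (rule ring_from_type_algebra)

lemma base_field_simps [simp]: "carrier (base_field :: 'k::field ring) = UNIV" "\<one>\<^bsub>base_field\<^esub> = (1 :: 'k)"
  "x \<otimes>\<^bsub>base_field\<^esub> y = x * (y :: 'k)" "x \<oplus>\<^bsub>base_field\<^esub> y = x + (y :: 'k)"
  by (simp_all add: ring_of_type_algebra_def)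

lemma const_term_add: "const_term (p + q) = const_term p + const_term q"
  by (simp add: const_term_def lookup_add)

lemma const_term_zero [simp]: "const_term 0 = 0"
  by (simp add: const_term_def)

lemma const_term_uminus: "const_term (- p) = - const_term p"
  by (simp add: const_term_def)

lemma const_term_const [simp]: "const_term (poly_const c) = c"
  by (simp add: const_term_def poly_const_def)

lemma const_term_mult: "const_term (p * q) = const_term p * (const_term q :: 'k::field)"
proof -
  have z: "a + b = 0 \<longleftrightarrow> a = 0 \<and> b = 0" for a b :: "'e \<Rightarrow>\<^sub>0 nat"
  proof
    assume "a + b = 0"
    then have "Poly_Mapping.lookup a i + Poly_Mapping.lookup b i = 0" for i by (metis lookup_add lookup_zero)
    then show "a = 0 \<and> b = 0" by (auto intro: poly_mapping_eqI)
  qed simp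
  have "Poly_Mapping.keys p \<subseteq> UNIV" "Poly_Mapping.keys q \<subseteq> UNIV" by auto
  then show ?thesis
  proof (induction p rule: pm_induct)
    case (single m a)
    from single(2) show ?case
    proof (induction q rule: pm_induct)
      case (single n b)
      then show ?case using z by (auto simp: const_term_def mult_single lookup_single when_def)
    qed (simp_all add: const_term_add distrib_left)
  qed (simp_all add: const_term_add distrib_right)
qed

lemma linear_form_sym: "linear_form E u \<in> carrier (sym_ring E)"
  unfolding linear_form_def by (intro sym_sum sym_mult sym_const sym_var)

lemma const_term_linear_form: "const_term (linear_form E (u :: 'a \<Rightarrow> 'b::field)) = 0"
proof -
  have "Poly_Mapping.single i (Suc 0) \<noteq> 0" for i :: 'a by (metis lookup_single_eq lookup_zero nat.distinct(1))
  then have "const_term (poly_var i :: ('a, 'b) mpoly) = 0" for i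
    by (simp add: const_term_def poly_var_def lookup_single when_def)
  then have "const_term (\<Sum>i \<in> A. poly_const (u i) * poly_var i) = 0" for A
    by (induction A rule: infinite_finite_induct) (simp_all add: const_term_add const_term_mult)
  then show ?thesis by (simp add: linear_form_def)
qed

context program_algebra
begin

section \<open>The central subring\<close>

abbreviation "bs \<equiv> B_tilde_sym P :: ('e, 'k) mpoly \<Rightarrow> ('e, 'k) matalg"

interpretation Phi: ring_hom_ring FP BT Phi by (rule Phi_ring_hom)

text \<open>A common lift to \<open>FP\<close> of \<open>A_tilde_sym\<close> and
  \<open>B_tilde_sym\<close> (\<open>A_tilde_sym_eq\<close>, \<open>Phi_jmap\<close>); through it
  the isomorphism is seen to be one of algebras.\<close>

definition jmap :: "('e, 'k) mpoly \<Rightarrow> (('e, 'k) pathalg \<times> ('e, 'k) mpoly \<Rightarrow>\<^sub>0 int)" where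
  "jmap p = pair_gen \<one>\<^bsub>PA\<^esub> p"

lemma jmap_FP: "p \<in> carrier Sym \<Longrightarrow> jmap p \<in> carrier FP"
  unfolding jmap_def by (rule pair_in_FP) simp

lemma Phi_cong: "(\<And>\<alpha> \<beta>. \<alpha> \<in> B \<Longrightarrow> \<beta> \<in> B \<Longrightarrow> Psi x \<alpha> \<beta> = Psi y \<alpha> \<beta>) \<Longrightarrow> Phi x = Phi y"
  unfolding Phi_def by (rule B_family_cong) (simp add: Pp_iff)

lemma Psi_jmap: "Psi (jmap p) \<alpha> \<beta> = (if \<alpha> = \<beta> \<and> \<alpha> \<in> B then p else 0)"
  by (auto simp: jmap_def Psi_pair PA_one L_const)

lemma Phi_jmap: "Phi (jmap p) = bs p"
  unfolding Phi_def B_tilde_sym_def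
  by (rule B_family_cong) (simp add: Psi_jmap R_tilde_simps rc_zero Pp_iff)

lemma bs_closed: "p \<in> carrier Sym \<Longrightarrow> bs p \<in> carrier BT"
  using Phi.hom_closed[OF jmap_FP] by (simp add: Phi_jmap)

lemma bs_add: 
  assumes "p \<in> carrier Sym" "q \<in> carrier Sym" shows "bs (p + q) = bs p \<oplus>\<^bsub>BT\<^esub> bs q"
proof -
  have "Phi (jmap (p + q)) = Phi (jmap p + jmap q)" by (rule Phi_cong) (simp add: Psi_jmap Psi_add)
  also have "\<dots> = Phi (jmap p) \<oplus>\<^bsub>BT\<^esub> Phi (jmap q)"
    using Phi.hom_add[OF jmap_FP[OF assms(1)] jmap_FP[OF assms(2)]] by (simp add: FP.plus)
  finally show ?thesis by (simp add: Phi_jmap)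
qed

lemma bs_mult:
  assumes "p \<in> carrier Sym" "q \<in> carrier Sym" shows "bs (p * q) = bs p \<otimes>\<^bsub>BT\<^esub> bs q"
proof -
  have "jmap (p * q) = jmap p \<otimes>\<^bsub>FP\<^esub> jmap q" unfolding jmap_def free_pairs_mult by simp
  then show ?thesis using Phi.hom_mult[OF jmap_FP[OF assms(1)] jmap_FP[OF assms(2)]] by (metis Phi_jmap)
qed

lemma bs_one: "bs 1 = \<one>\<^bsub>BT\<^esub>"
  by (simp add: B_tilde_def)

lemma bs_hom: "ring_hom_ring Sym BT bs"
  by (rule ring_hom_ringI[OF Sym.ring_axioms BT_ring]) (simp_all add: bs_closed bs_add bs_mult bs_one)

interpretation bs: ring_hom_ring Sym BT bs by (rule bs_hom)

lemma jmap_central: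
  assumes p: "p \<in> carrier Sym" and x: "x \<in> carrier FP"
  shows "jmap p \<otimes>\<^bsub>FP\<^esub> x = x \<otimes>\<^bsub>FP\<^esub> jmap p"
proof -
  have "x \<in> carrier FP \<and> jmap p \<otimes>\<^bsub>FP\<^esub> x = x \<otimes>\<^bsub>FP\<^esub> jmap p"
    using x[unfolded FP_carrier]
  proof (induction x rule: frag_induction)
    case zero
    then show ?case using FP.zero_in jmap_FP[OF p] FP.l_null FP.r_null by (simp add: FP.zero_eq)
  next
    case (one u)
    then show ?case unfolding jmap_def by (cases u) (auto simp: free_pairs_mult mult.commute intro: pair_in_FP)
  next
    case (diff x y)
    then show ?case using jmap_FP[OF p] FP.diff_closed by (simp add: FP.mult_diff FP.diff_mult)
  qed
  then show ?thesis by blast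
qed

text \<open>Inherited from \<open>FP\<close>, where the two components commute; it is needed for
  \<open>H\<close> to be multiplicative.\<close>

lemma bs_central: "p \<in> carrier Sym \<Longrightarrow> b \<in> carrier BT \<Longrightarrow> bs p \<otimes>\<^bsub>BT\<^esub> b = b \<otimes>\<^bsub>BT\<^esub> bs p"
proof -
  assume p: "p \<in> carrier Sym" and "b \<in> carrier BT"
  then obtain x where x: "x \<in> carrier FP" "b = Phi x" using Phi_surj by blast
  show ?thesis using jmap_central[OF p x(1)] Phi.hom_mult[OF jmap_FP[OF p] x(1)] Phi.hom_mult[OF x(1) jmap_FP[OF p]]
    by (simp add: x Phi_jmap)
qed

section \<open>Base change along the constant term\<close>

abbreviation "kf \<equiv> base_field :: 'k ring"
abbreviation "FB \<equiv> free_pairs BT kf"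

lemma FB_add_ring: "add_ring FB"
  by (rule free_pairs_add_ring[OF BT_ring base_field_ring])

interpretation FB: add_ring FB by (rule FB_add_ring)

lemma FB_carrier: "x \<in> carrier FB \<longleftrightarrow> Poly_Mapping.keys x \<subseteq> carrier BT \<times> UNIV"
  by (simp add: free_pairs_def)

lemma pair_in_FB: "b \<in> carrier BT \<Longrightarrow> pair_gen b c \<in> carrier FB"
  by (simp add: FB_carrier)

definition lift :: "('e, 'k) matalg \<Rightarrow> (('e, 'k) pathalg \<times> ('e, 'k) mpoly \<Rightarrow>\<^sub>0 int)" where
  "lift b = (SOME x. x \<in> carrier FP \<and> Phi x = b)"

lemma lift: "b \<in> carrier BT \<Longrightarrow> lift b \<in> carrier FP \<and> Phi (lift b) = b"
  unfolding lift_def by (rule someI_ex) (use Phi_surj in auto)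

text \<open>The multiplication map from \<open>B_tilde \<otimes> k\<close> to \<open>B_tilde\<close>, computed on preimages under \<open>Phi\<close>,
  where the addition is that of a type.\<close>

definition chi :: "(('e, 'k) matalg \<times> 'k \<Rightarrow>\<^sub>0 int) \<Rightarrow> (('e, 'k) pathalg \<times> ('e, 'k) mpoly \<Rightarrow>\<^sub>0 int)" where
  "chi x = lin (\<lambda>u n. frag_cmul n (lift (fst u) \<otimes>\<^bsub>FP\<^esub> jmap (poly_const (snd u)))) x"

text \<open>\<open>Phi\<close> removes the choice made in \<open>lift\<close>
  (\<open>H_pair\<close>). The map serves to bound the tensor relations from above: it sends
  \<open>TU\<close> into \<open>J\<close> (\<open>TU_H\<close>).\<close>

definition H :: "(('e, 'k) matalg \<times> 'k \<Rightarrow>\<^sub>0 int) \<Rightarrow> ('e, 'k) matalg" where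
  "H x = Phi (chi x)"

lemma biadd_chi: "biadd (\<lambda>u n. frag_cmul n (lift (fst u) \<otimes>\<^bsub>FP\<^esub> jmap (poly_const (snd u))))"
  by (auto simp: biadd_def frag_cmul_distrib)

lemma chi_pair: "chi (pair_gen b c) = lift b \<otimes>\<^bsub>FP\<^esub> jmap (poly_const c)"
  unfolding chi_def by (simp add: lin_single[OF biadd_chi])

lemma chi_diff: "chi (x - y) = chi x - chi y"
  unfolding chi_def by (rule lin_diff[OF biadd_chi])

lemma chi_add: "chi (x + y) = chi x + chi y"
  unfolding chi_def by (rule lin_add[OF biadd_chi])

lemma chi_zero: "chi 0 = 0"
  unfolding chi_def by simp

lemma chi_FP: "x \<in> carrier FB \<Longrightarrow> chi x \<in> carrier FP"
  unfolding FB_carrier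
proof (induction x rule: frag_induction)
  case (one u)
  then show ?case using lift jmap_FP[OF sym_const] by (cases u) (auto simp: chi_pair)
qed (auto simp: chi_zero chi_diff FP.zero_in FP.diff_closed)

lemma H_pair: "b \<in> carrier BT \<Longrightarrow> H (pair_gen b c) = b \<otimes>\<^bsub>BT\<^esub> bs (poly_const c)"
  unfolding H_def chi_pair using lift jmap_FP[OF sym_const] by (simp add: Phi_jmap)

lemma H_diff: "x \<in> carrier FB \<Longrightarrow> y \<in> carrier FB \<Longrightarrow> H (x - y) = H x \<ominus>\<^bsub>BT\<^esub> H y"
proof -
  assume xy: "x \<in> carrier FB" "y \<in> carrier FB"
  have "Phi (chi x \<ominus>\<^bsub>FP\<^esub> chi y) = Phi (chi x) \<ominus>\<^bsub>BT\<^esub> Phi (chi y)"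
    using xy chi_FP unfolding FP.minus_eq Phi.S.minus_eq by simp
  then show ?thesis unfolding H_def chi_diff using FP.minus_eq'[OF chi_FP[OF xy(1)] chi_FP[OF xy(2)]] by simp
qed

lemma H_zero: "H 0 = \<zero>\<^bsub>BT\<^esub>" by (simp add: H_def chi_zero Phi_zero)

lemma H_closed: "x \<in> carrier FB \<Longrightarrow> H x \<in> carrier BT"
  unfolding H_def using chi_FP by simp

lemma diff_mult_BT: "a \<in> carrier BT \<Longrightarrow> b \<in> carrier BT \<Longrightarrow> c \<in> carrier BT \<Longrightarrow> (a \<ominus>\<^bsub>BT\<^esub> b) \<otimes>\<^bsub>BT\<^esub> c = a \<otimes>\<^bsub>BT\<^esub> c \<ominus>\<^bsub>BT\<^esub> b \<otimes>\<^bsub>BT\<^esub> c"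
  by (simp add: Phi.S.minus_eq Phi.S.l_distr Phi.S.l_minus)

lemma mult_diff_BT: "a \<in> carrier BT \<Longrightarrow> b \<in> carrier BT \<Longrightarrow> c \<in> carrier BT \<Longrightarrow> c \<otimes>\<^bsub>BT\<^esub> (a \<ominus>\<^bsub>BT\<^esub> b) = c \<otimes>\<^bsub>BT\<^esub> a \<ominus>\<^bsub>BT\<^esub> c \<otimes>\<^bsub>BT\<^esub> b"
  by (simp add: Phi.S.minus_eq Phi.S.r_distr Phi.S.r_minus)

lemma H_mult:
  assumes x: "x \<in> carrier FB" and y: "y \<in> carrier FB"
  shows "H (x \<otimes>\<^bsub>FB\<^esub> y) = H x \<otimes>\<^bsub>BT\<^esub> H y"
proof -
  have "x \<in> carrier FB \<and> H (x \<otimes>\<^bsub>FB\<^esub> y) = H x \<otimes>\<^bsub>BT\<^esub> H y"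
    using x[unfolded FB_carrier]
  proof (induction x rule: frag_induction)
    case zero
    then show ?case using FB.zero_in FB.l_null[OF y] H_closed[OF y] by (simp add: FB.zero_eq H_zero)
  next
    case (one u)
    obtain b c where u: "u = (b, c)" "b \<in> carrier BT" using one by (cases u) auto
    have uF: "pair_gen b c \<in> carrier FB" using u pair_in_FB by blast
    have "y \<in> carrier FB \<and> H (pair_gen b c \<otimes>\<^bsub>FB\<^esub> y) = H (pair_gen b c) \<otimes>\<^bsub>BT\<^esub> H y"
      using y[unfolded FB_carrier]
    proof (induction y rule: frag_induction)
      case zero
      then show ?case using FB.zero_in FB.r_null[OF uF] H_closed[OF uF] by (simp add: FB.zero_eq H_zero)
    next
      case (one v)
      obtain b' c' where v: "v = (b', c')" "b' \<in> carrier BT" using one by (cases v) auto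
      have cc: "bs (poly_const c) \<in> carrier BT" "bs (poly_const c') \<in> carrier BT" by (rule bs_closed[OF sym_const])+
      have "H (pair_gen b c \<otimes>\<^bsub>FB\<^esub> pair_gen b' c') = (b \<otimes>\<^bsub>BT\<^esub> b') \<otimes>\<^bsub>BT\<^esub> (bs (poly_const c) \<otimes>\<^bsub>BT\<^esub> bs (poly_const c'))"
        unfolding free_pairs_mult using u v by (simp add: H_pair bs_mult[OF sym_const sym_const])
      also have "\<dots> = b \<otimes>\<^bsub>BT\<^esub> (b' \<otimes>\<^bsub>BT\<^esub> bs (poly_const c)) \<otimes>\<^bsub>BT\<^esub> bs (poly_const c')"
        using u v cc by (simp add: Phi.S.m_assoc)
      also have "\<dots> = b \<otimes>\<^bsub>BT\<^esub> (bs (poly_const c) \<otimes>\<^bsub>BT\<^esub> b') \<otimes>\<^bsub>BT\<^esub> bs (poly_const c')"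
        using bs_central[OF sym_const v(2), of c] by simp
      also have "\<dots> = H (pair_gen b c) \<otimes>\<^bsub>BT\<^esub> H (pair_gen b' c')"
        using u v cc by (simp add: H_pair Phi.S.m_assoc)
      finally show ?case using v pair_in_FB by blast
    next
      case (diff y y')
      then show ?case using uF FB.diff_closed H_closed
        by (simp add: FB.mult_diff H_diff mult_diff_BT)
    qed
    then show ?case using u uF by simp
  next
    case (diff x x')
    then show ?case using y FB.diff_closed H_closed
      by (simp add: FB.diff_mult H_diff diff_mult_BT)
  qed
  then show ?thesis by blast
qed

lemma H_hom: "ring_hom_ring FB BT H"
proof (rule ring_hom_ringI[OF FB.ring_axioms BT_ring])
  show "H (x \<oplus>\<^bsub>FB\<^esub> y) = H x \<oplus>\<^bsub>BT\<^esub> H y" if "x \<in> carrier FB" "y \<in> carrier FB" for x y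
    unfolding FB.plus H_def chi_add using Phi.hom_add[OF chi_FP chi_FP, OF that] by (simp add: FP.plus)
  have "\<one>\<^bsub>FB\<^esub> = pair_gen \<one>\<^bsub>BT\<^esub> 1" by (simp add: free_pairs_def)
  then show "H \<one>\<^bsub>FB\<^esub> = \<one>\<^bsub>BT\<^esub>" using H_pair[of "\<one>\<^bsub>BT\<^esub>" 1] by (simp add: bs_one)
qed (simp_all add: H_closed H_mult)

interpretation H: ring_hom_ring FB BT H by (rule H_hom)

section \<open>The tensor product as a quotient by linear forms\<close>

context
  fixes U :: "('e \<Rightarrow> 'k) set"
begin

abbreviation "SU \<equiv> sym_sub E U :: ('e, 'k) mpoly ring"

definition TU :: "(('e, 'k) matalg \<times> 'k \<Rightarrow>\<^sub>0 int) set" where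
  "TU = tensor_ideal SU bs const_term BT kf"

text \<open>This turns out to be the kernel of \<open>B_alg_proj P U\<close>
  (\<open>proj_kernel\<close>), so that the tensor product is the quotient of \<open>B_tilde\<close>
  by the linear forms in \<open>U\<close>.\<close>

definition J :: "('e, 'k) matalg set" where
  "J = Idl\<^bsub>BT\<^esub> ((\<lambda>u. bs (linear_form E u)) ` U)"

lemma SU_Sym: "s \<in> carrier SU \<Longrightarrow> s \<in> carrier Sym"
proof -
  assume "s \<in> carrier SU"
  then have "s \<in> generate_ring Sym (range poly_const \<union> linear_form E ` U)" by (simp add: sym_sub_def)
  then show ?thesis
  proof induction
    case one then show ?case by (simp add: sym_one)
  next
    case (incl h) then show ?case using sym_const linear_form_sym by blast
  qed (simp_all add: sym_add sym_mult sym_uminus Sym.a_inv_eq)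
qed

lemma SU_const: "poly_const c \<in> carrier SU" and SU_linear: "u \<in> U \<Longrightarrow> linear_form E u \<in> carrier SU"
  by (auto simp: sym_sub_def intro: generate_ring.incl)

lemma TU_facts: "ideal TU FB" "tensor_rels SU bs const_term BT kf \<subseteq> TU"
  "\<And>I. ideal I FB \<Longrightarrow> tensor_rels SU bs const_term BT kf \<subseteq> I \<Longrightarrow> TU \<subseteq> I"
  unfolding TU_def by (rule tensor_ideal_ideal[OF BT_ring base_field_ring]; (simp add: bs_closed SU_Sym)?)+

lemma B_alg_eq: "B_alg P U = FB Quot TU"
  by (simp add: B_alg_def tensor_def TU_def)

lemma B_alg_proj_eq: "B_alg_proj P U b = TU +>\<^bsub>FB\<^esub> pair_gen b 1"
  by (simp add: B_alg_proj_def pure_tensor_def TU_def)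

lemma TU_rels:
  "b \<in> carrier BT \<Longrightarrow> b' \<in> carrier BT \<Longrightarrow> pair_gen (b \<oplus>\<^bsub>BT\<^esub> b') c - pair_gen b c - pair_gen b' c \<in> TU"
  "b \<in> carrier BT \<Longrightarrow> pair_gen b (c + c') - pair_gen b c - pair_gen b c' \<in> TU"
  "b \<in> carrier BT \<Longrightarrow> s \<in> carrier SU \<Longrightarrow> pair_gen (b \<otimes>\<^bsub>BT\<^esub> bs s) c - pair_gen b (const_term s * c) \<in> TU"
proof -
  show "b \<in> carrier BT \<Longrightarrow> b' \<in> carrier BT \<Longrightarrow> pair_gen (b \<oplus>\<^bsub>BT\<^esub> b') c - pair_gen b c - pair_gen b' c \<in> TU"
    by (rule subsetD[OF TU_facts(2)]) (auto simp: tensor_rels_def)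
  show "b \<in> carrier BT \<Longrightarrow> pair_gen b (c + c') - pair_gen b c - pair_gen b c' \<in> TU"
    by (rule subsetD[OF TU_facts(2)]) (auto simp: tensor_rels_def)
  show "b \<in> carrier BT \<Longrightarrow> s \<in> carrier SU \<Longrightarrow> pair_gen (b \<otimes>\<^bsub>BT\<^esub> bs s) c - pair_gen b (const_term s * c) \<in> TU"
    by (rule subsetD[OF TU_facts(2)]) (auto simp: tensor_rels_def)
qed

lemma TU_pair_zero: "b \<in> carrier BT \<Longrightarrow> pair_gen b 0 \<in> TU"
  using FB.ideal_uminus[OF TU_facts(1) TU_rels(2)[of b 0 0]] by simp

lemma TU_pair: 
  assumes "b \<in> carrier BT"
  shows "TU +>\<^bsub>FB\<^esub> pair_gen b c = TU +>\<^bsub>FB\<^esub> pair_gen (b \<otimes>\<^bsub>BT\<^esub> bs (poly_const c)) 1"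
proof -
  have bc: "b \<otimes>\<^bsub>BT\<^esub> bs (poly_const c) \<in> carrier BT" using assms bs_closed[OF sym_const] by simp
  have "pair_gen (b \<otimes>\<^bsub>BT\<^esub> bs (poly_const c)) 1 - pair_gen b c \<in> TU"
    using TU_rels(3)[OF assms SU_const, of c 1] by simp
  then show ?thesis
    using FB.rcos_eq_iff[OF TU_facts(1) pair_in_FB[OF bc, of 1] pair_in_FB[OF assms, of c]] by simp
qed

lemma linear_forms_BT: "(\<lambda>u. bs (linear_form E u)) ` U \<subseteq> carrier BT"
  using bs_closed[OF linear_form_sym] by blast

lemma J_ideal: "ideal J BT" and J_gen: "u \<in> U \<Longrightarrow> bs (linear_form E u) \<in> J"
  and J_minimal: "ideal I BT \<Longrightarrow> (\<And>u. u \<in> U \<Longrightarrow> bs (linear_form E u) \<in> I) \<Longrightarrow> J \<subseteq> I"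
proof -
  show "ideal J BT" unfolding J_def by (rule Phi.S.genideal_ideal[OF linear_forms_BT])
  show "u \<in> U \<Longrightarrow> bs (linear_form E u) \<in> J"
    unfolding J_def using subsetD[OF Phi.S.genideal_self[OF linear_forms_BT]] by blast
  show "ideal I BT \<Longrightarrow> (\<And>u. u \<in> U \<Longrightarrow> bs (linear_form E u) \<in> I) \<Longrightarrow> J \<subseteq> I"
    unfolding J_def by (rule Phi.S.genideal_minimal) auto
qed

text \<open>Constants and the linear forms in \<open>U\<close> have this property, and the elements
  that are congruent to their constant term form a subring.\<close>

lemma SU_const_term:
  assumes "s \<in> carrier SU"
  shows "bs (s - poly_const (const_term s)) \<in> J"
proof -
  define I where "I = {p \<in> carrier Sym. bs p \<in> J}"
  have I: "ideal I Sym" unfolding I_def by (rule bs.ideal_vimage[OF J_ideal])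
  have "s \<in> generate_ring Sym (range poly_const \<union> linear_form E ` U)" using assms by (simp add: sym_sub_def)
  then have "s \<in> carrier Sym \<and> s - poly_const (const_term s) \<in> I"
  proof induction
    case one
    have "poly_const 1 = (1 :: ('e, 'k) mpoly)" by (simp add: poly_const_def)
    then have "(1 :: ('e, 'k) mpoly) - poly_const (const_term (1 :: ('e, 'k) mpoly)) = 0"
      by (metis const_term_const diff_self)
    then show ?case using Sym.ideal_zero[OF I] by (simp add: sym_one)
  next
    case (incl h)
    then consider c where "h = poly_const c" | u where "u \<in> U" "h = linear_form E u" by blast
    then show ?case
    proof cases
      case 1 then show ?thesis using Sym.ideal_zero[OF I] by (simp add: sym_const)
    next
      case 2 then show ?thesis using J_gen by (simp add: const_term_linear_form I_def linear_form_sym)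
    qed
  next
    case (a_inv h)
    have "- h - poly_const (const_term (- h)) = - (h - poly_const (const_term h))"
      by (simp add: const_term_uminus poly_const_def single_uminus)
    moreover have "- (h - poly_const (const_term h)) \<in> I" using a_inv Sym.ideal_uminus[OF I] by blast
    moreover have "- h \<in> carrier Sym" using a_inv by (intro sym_uminus) simp
    moreover have "\<ominus>\<^bsub>Sym\<^esub> h = - h" using a_inv by (intro Sym.a_inv_eq) simp
    ultimately show ?case by metis
  next
    case (eng_add p q)
    have "p + q - poly_const (const_term (p + q)) = (p - poly_const (const_term p)) + (q - poly_const (const_term q))"
      by (simp add: const_term_add)
    moreover have "p + q \<in> carrier Sym" using eng_add by (intro sym_add) simp_all
    moreover have "p \<oplus>\<^bsub>Sym\<^esub> q = p + q" by simp
    ultimately show ?case using eng_add Sym.ideal_add[OF I] by metis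
  next
    case (eng_mult p q)
    have "p * q - poly_const (const_term (p * q)) =
        q * (p - poly_const (const_term p)) + poly_const (const_term p) * (q - poly_const (const_term q))"
      by (simp add: const_term_mult algebra_simps)
    moreover have "q * (p - poly_const (const_term p)) \<in> I" "poly_const (const_term p) * (q - poly_const (const_term q)) \<in> I"
      using eng_mult Sym.ideal_mult_l[OF I] sym_const by fastforce+
    moreover have "p * q \<in> carrier Sym" using eng_mult by (intro sym_mult) simp_all
    moreover have "p \<otimes>\<^bsub>Sym\<^esub> q = p * q" by simp
    ultimately show ?case using eng_mult Sym.ideal_add[OF I] by metis
  qed
  then show ?thesis by (simp add: I_def)
qed

text \<open>The additive relations are sent to zero. Balancedness is sent to a multiple of
  \<open>s\<close> minus its constant term, which lies in \<open>J\<close> by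
  \<open>SU_const_term\<close>.\<close>

lemma TU_H: "x \<in> TU \<Longrightarrow> H x \<in> J"
proof -
  have I: "ideal {x \<in> carrier FB. H x \<in> J} FB" by (rule H.ideal_vimage[OF J_ideal])
  interpret J: ideal J BT by (rule J_ideal)
  have sub: "tensor_rels SU bs const_term BT kf \<subseteq> carrier FB"
    using TU_facts(1,2) FB.ideal_carrier by blast
  have "H x \<in> J" if x: "x \<in> tensor_rels SU bs const_term BT kf" for x
  proof -
    have cc: "bs (poly_const c) \<in> carrier BT" for c using bs_closed[OF sym_const] .
    from x consider
        (1) b b' c where "x = pair_gen (b \<oplus>\<^bsub>BT\<^esub> b') c - pair_gen b c - pair_gen b' c" "b \<in> carrier BT" "b' \<in> carrier BT"
      | (2) b c c' where "x = pair_gen b (c + c') - pair_gen b c - pair_gen b c'" "b \<in> carrier BT"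
      | (3) b s c where "x = pair_gen (b \<otimes>\<^bsub>BT\<^esub> bs s) c - pair_gen b (const_term s * c)" "b \<in> carrier BT" "s \<in> carrier SU"
      unfolding tensor_rels_def by auto
    then show ?thesis
    proof cases
      case 1
      have "H x = (b \<oplus>\<^bsub>BT\<^esub> b') \<otimes>\<^bsub>BT\<^esub> bs (poly_const c) \<ominus>\<^bsub>BT\<^esub> b \<otimes>\<^bsub>BT\<^esub> bs (poly_const c) \<ominus>\<^bsub>BT\<^esub> b' \<otimes>\<^bsub>BT\<^esub> bs (poly_const c)"
        using 1 by (simp add: H_diff FB.diff_closed pair_in_FB H_pair)
      also have "\<dots> = \<zero>\<^bsub>BT\<^esub>"
        using 1 cc[of c] by (simp add: Phi.S.l_distr Phi.S.minus_eq) (simp add: Phi.S.a_ac Phi.S.r_neg Phi.S.r_neg1 Phi.S.r_neg2)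
      finally show ?thesis by simp
    next
      case 2
      have "H x = b \<otimes>\<^bsub>BT\<^esub> (bs (poly_const c) \<oplus>\<^bsub>BT\<^esub> bs (poly_const c')) \<ominus>\<^bsub>BT\<^esub> b \<otimes>\<^bsub>BT\<^esub> bs (poly_const c) \<ominus>\<^bsub>BT\<^esub> b \<otimes>\<^bsub>BT\<^esub> bs (poly_const c')"
        using 2 by (simp add: H_diff FB.diff_closed pair_in_FB H_pair bs_add[OF sym_const sym_const])
      also have "\<dots> = \<zero>\<^bsub>BT\<^esub>"
        using 2 cc[of c] cc[of c'] by (simp add: Phi.S.r_distr Phi.S.minus_eq) (simp add: Phi.S.a_ac Phi.S.r_neg Phi.S.r_neg1 Phi.S.r_neg2)
      finally show ?thesis by simp
    next
      case 3
      define t where "t = const_term s"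
      have sS: "s \<in> carrier Sym" using SU_Sym[OF 3(3)] .
      have "H x = (b \<otimes>\<^bsub>BT\<^esub> bs s) \<otimes>\<^bsub>BT\<^esub> bs (poly_const c) \<ominus>\<^bsub>BT\<^esub> b \<otimes>\<^bsub>BT\<^esub> (bs (poly_const t) \<otimes>\<^bsub>BT\<^esub> bs (poly_const c))"
        using 3 bs_closed[OF sS] by (simp add: H_diff pair_in_FB H_pair bs_mult[OF sym_const sym_const] t_def)
      also have "\<dots> = b \<otimes>\<^bsub>BT\<^esub> (bs s \<ominus>\<^bsub>BT\<^esub> bs (poly_const t)) \<otimes>\<^bsub>BT\<^esub> bs (poly_const c)"
        using 3 bs_closed[OF sS] cc by (simp add: mult_diff_BT diff_mult_BT Phi.S.m_assoc)
      also have "bs s \<ominus>\<^bsub>BT\<^esub> bs (poly_const t) = bs (s - poly_const t)"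
      proof -
        have "bs (s \<ominus>\<^bsub>Sym\<^esub> poly_const t) = bs s \<ominus>\<^bsub>BT\<^esub> bs (poly_const t)"
          using sS sym_const unfolding Sym.minus_eq Phi.S.minus_eq by (metis Sym.a_inv_closed bs.hom_a_inv bs.hom_add)
        then show ?thesis using Sym.minus_eq'[OF sS sym_const] by simp
      qed
      finally show ?thesis using SU_const_term[OF 3(3)] 3(2) cc J.I_l_closed J.I_r_closed by (simp add: t_def)
    qed
  qed
  then have "tensor_rels SU bs const_term BT kf \<subseteq> {x \<in> carrier FB. H x \<in> J}" using sub by blast
  then have "TU \<subseteq> {x \<in> carrier FB. H x \<in> J}" by (rule TU_facts(3)[OF I])
  then show "x \<in> TU \<Longrightarrow> H x \<in> J" by blast
qed

lemma BU_hom: "ring_hom_ring FB (B_alg P U) ((+>\<^bsub>FB\<^esub>) TU)"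
  unfolding B_alg_eq by (rule FB.quot_hom[OF TU_facts(1)])

interpretation BU: ring_hom_ring FB "B_alg P U" "(+>\<^bsub>FB\<^esub>) TU" by (rule BU_hom)

lemma proj_hom: "ring_hom_ring BT (B_alg P U) (B_alg_proj P U)"
proof (rule ring_hom_ringI[OF BT_ring BU.S.ring_axioms])
  fix b assume b: "b \<in> carrier BT"
  show "B_alg_proj P U b \<in> carrier (B_alg P U)" unfolding B_alg_proj_eq by (rule BU.hom_closed[OF pair_in_FB[OF b]])
  fix b' assume b': "b' \<in> carrier BT"
  have "pair_gen (b \<otimes>\<^bsub>BT\<^esub> b') 1 = pair_gen b 1 \<otimes>\<^bsub>FB\<^esub> pair_gen b' 1" unfolding free_pairs_mult by simp
  then show "B_alg_proj P U (b \<otimes>\<^bsub>BT\<^esub> b') = B_alg_proj P U b \<otimes>\<^bsub>B_alg P U\<^esub> B_alg_proj P U b'"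
    unfolding B_alg_proj_eq using BU.hom_mult[OF pair_in_FB[OF b] pair_in_FB[OF b']] by simp
  have "pair_gen (b \<oplus>\<^bsub>BT\<^esub> b') 1 - (pair_gen b 1 + pair_gen b' 1) \<in> TU"
    using TU_rels(1)[OF b b', of 1] by (simp add: diff_diff_eq)
  then have "TU +>\<^bsub>FB\<^esub> pair_gen (b \<oplus>\<^bsub>BT\<^esub> b') 1 = TU +>\<^bsub>FB\<^esub> (pair_gen b 1 + pair_gen b' 1)"
    using FB.rcos_eq_iff[OF TU_facts(1)] pair_in_FB FB.plus_closed b b' Phi.S.a_closed by meson
  then show "B_alg_proj P U (b \<oplus>\<^bsub>BT\<^esub> b') = B_alg_proj P U b \<oplus>\<^bsub>B_alg P U\<^esub> B_alg_proj P U b'"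
    unfolding B_alg_proj_eq using BU.hom_add[OF pair_in_FB[OF b, of 1] pair_in_FB[OF b', of 1]] by (simp add: FB.plus)
next
  have "\<one>\<^bsub>FB\<^esub> = pair_gen \<one>\<^bsub>BT\<^esub> 1" by (simp add: free_pairs_def)
  then show "B_alg_proj P U \<one>\<^bsub>BT\<^esub> = \<one>\<^bsub>B_alg P U\<^esub>" unfolding B_alg_proj_eq using BU.hom_one by simp
qed

interpretation proj: ring_hom_ring BT "B_alg P U" "B_alg_proj P U" by (rule proj_hom)

lemma BT_deg_eq: "B_tilde_deg P n = Phi ` FP_deg n" using Phi_deg by simp

lemma BT_deg_carrier: "b \<in> B_tilde_deg P n \<Longrightarrow> b \<in> carrier BT"
  unfolding BT_deg_eq using FP_deg_carrier Phi.hom_closed by blast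

lemma BT_deg_zero: "\<zero>\<^bsub>BT\<^esub> \<in> B_tilde_deg P n"
  unfolding BT_deg_eq Phi_zero by (rule imageI) (simp add: FP_deg_def)

lemma BT_deg_diff:
  assumes "b \<in> B_tilde_deg P n" "b' \<in> B_tilde_deg P n" shows "b \<ominus>\<^bsub>BT\<^esub> b' \<in> B_tilde_deg P n"
proof -
  obtain x y where xy: "x \<in> FP_deg n" "y \<in> FP_deg n" "b = Phi x" "b' = Phi y" using assms unfolding BT_deg_eq by blast
  have F: "x \<in> carrier FP" "y \<in> carrier FP" using xy FP_deg_carrier by auto
  have "Phi (x \<ominus>\<^bsub>FP\<^esub> y) = b \<ominus>\<^bsub>BT\<^esub> b'" using F xy unfolding FP.minus_eq Phi.S.minus_eq by simp
  moreover have "x - y \<in> FP_deg n" using xy keys_diff[of x y] unfolding FP_deg_def by blast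
  ultimately show ?thesis unfolding BT_deg_eq using FP.minus_eq'[OF F] by (metis imageI)
qed

lemma BT_deg_const:
  assumes "b \<in> B_tilde_deg P n" shows "b \<otimes>\<^bsub>BT\<^esub> bs (poly_const c) \<in> B_tilde_deg P n"
proof -
  obtain x where x: "x \<in> FP_deg n" "b = Phi x" using assms unfolding BT_deg_eq by blast
  have F: "x \<in> carrier FP" using x FP_deg_carrier by auto
  define y where "y = theta (\<lambda>\<alpha> \<beta>. Psi x \<alpha> \<beta> * poly_const c)"
  have "y \<in> FP_deg n" unfolding y_def
    by (rule theta_deg) (use sym_deg_mult[OF Psi_deg[OF x(1)] sym_deg_const] in simp)
  moreover have "Phi y = Phi (x \<otimes>\<^bsub>FP\<^esub> jmap (poly_const c))"
  proof (rule Phi_cong)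
    fix \<alpha> \<gamma> assume ag: "\<alpha> \<in> B" "\<gamma> \<in> B"
    have "Psi (x \<otimes>\<^bsub>FP\<^esub> jmap (poly_const c)) \<alpha> \<gamma> = (\<Sum>\<beta> \<in> B. if \<beta> = \<gamma> then Psi x \<alpha> \<gamma> * poly_const c else 0)"
      unfolding Psi_mult[OF F jmap_FP[OF sym_const] ag] by (rule sum.cong) (auto simp: Psi_jmap)
    then show "Psi y \<alpha> \<gamma> = Psi (x \<otimes>\<^bsub>FP\<^esub> jmap (poly_const c)) \<alpha> \<gamma>"
      using ag finite_B by (simp add: y_def Psi_theta)
  qed
  moreover have "Phi (x \<otimes>\<^bsub>FP\<^esub> jmap (poly_const c)) = b \<otimes>\<^bsub>BT\<^esub> bs (poly_const c)"
    using F x jmap_FP[OF sym_const] by (simp add: Phi_jmap)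
  ultimately show ?thesis unfolding BT_deg_eq by (metis imageI)
qed

text \<open>The class of a pair is moved to scalar one by the second assumption, and
  \<open>X\<close> is closed under differences. \<open>X\<close> is a parameter in order to cover
  with one induction the whole ring (\<open>proj_surj\<close>) and each homogeneous component
  (\<open>proj_deg\<close>).\<close>

lemma FB_reduce:
  assumes "Poly_Mapping.keys x \<subseteq> S" "\<And>b c. (b, c) \<in> S \<Longrightarrow> b \<in> carrier BT \<and> (\<exists>b' \<in> X. TU +>\<^bsub>FB\<^esub> pair_gen b c = B_alg_proj P U b')"
    and X: "X \<subseteq> carrier BT" "\<zero>\<^bsub>BT\<^esub> \<in> X" "\<And>b b'. b \<in> X \<Longrightarrow> b' \<in> X \<Longrightarrow> b \<ominus>\<^bsub>BT\<^esub> b' \<in> X"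
  shows "\<exists>b \<in> X. TU +>\<^bsub>FB\<^esub> x = B_alg_proj P U b"
proof -
  have "x \<in> carrier FB \<and> (\<exists>b \<in> X. TU +>\<^bsub>FB\<^esub> x = B_alg_proj P U b)"
    using assms(1)
  proof (induction x rule: frag_induction)
    case zero
    have "TU +>\<^bsub>FB\<^esub> 0 = B_alg_proj P U \<zero>\<^bsub>BT\<^esub>" using BU.hom_zero proj.hom_zero by (simp add: FB.zero_eq)
    then show ?case using X(2) FB.zero_in by blast
  next
    case (one u)
    then show ?case using assms(2) pair_in_FB by (cases u) auto
  next
    case (diff x y)
    then obtain b b' where b: "b \<in> X" "TU +>\<^bsub>FB\<^esub> x = B_alg_proj P U b" "b' \<in> X" "TU +>\<^bsub>FB\<^esub> y = B_alg_proj P U b'"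
      and xy: "x \<in> carrier FB" "y \<in> carrier FB" by blast
    have bc: "b \<in> carrier BT" "b' \<in> carrier BT" using b X(1) by auto
    have "TU +>\<^bsub>FB\<^esub> (x \<ominus>\<^bsub>FB\<^esub> y) = (TU +>\<^bsub>FB\<^esub> x) \<ominus>\<^bsub>B_alg P U\<^esub> (TU +>\<^bsub>FB\<^esub> y)"
      using xy unfolding FB.minus_eq BU.S.minus_eq by simp
    also have "\<dots> = B_alg_proj P U (b \<ominus>\<^bsub>BT\<^esub> b')"
      using bc unfolding b(2,4) Phi.S.minus_eq BU.S.minus_eq by simp
    finally have "TU +>\<^bsub>FB\<^esub> (x - y) = B_alg_proj P U (b \<ominus>\<^bsub>BT\<^esub> b')" using FB.minus_eq'[OF xy] by simp
    then show ?case using X(3)[OF b(1,3)] FB.diff_closed[OF xy] by blast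
  qed
  then show ?thesis by blast
qed

lemma proj_surj: "carrier (B_alg P U) = B_alg_proj P U ` carrier BT"
proof
  show "B_alg_proj P U ` carrier BT \<subseteq> carrier (B_alg P U)" by auto
  show "carrier (B_alg P U) \<subseteq> B_alg_proj P U ` carrier BT"
  proof
    fix C assume "C \<in> carrier (B_alg P U)"
    then obtain x where x: "x \<in> carrier FB" "C = TU +>\<^bsub>FB\<^esub> x" using FB.quot_surj[OF TU_facts(1)] unfolding B_alg_eq by blast
    have "\<exists>b \<in> carrier BT. TU +>\<^bsub>FB\<^esub> x = B_alg_proj P U b"
    proof (rule FB_reduce[OF x(1)[unfolded FB_carrier]])
      fix b :: "('e, 'k) matalg" and c :: 'k assume "(b, c) \<in> carrier BT \<times> UNIV"
      then have b: "b \<in> carrier BT" by simp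
      then show "b \<in> carrier BT \<and> (\<exists>b' \<in> carrier BT. TU +>\<^bsub>FB\<^esub> pair_gen b c = B_alg_proj P U b')"
        using TU_pair[OF b, of c] bs_closed[OF sym_const] unfolding B_alg_proj_eq by blast
    qed auto
    then show "C \<in> B_alg_proj P U ` carrier BT" using x by blast
  qed
qed

lemma proj_deg: "B_alg_proj P U ` B_tilde_deg P n = B_alg_deg P U n"
proof
  have eq: "B_alg_deg P U n = (\<lambda>x. TU +>\<^bsub>FB\<^esub> x) ` {x. Poly_Mapping.keys x \<subseteq> (\<Union>i. B_tilde_deg P i \<times> field_deg (n - i))}"
    by (simp add: B_alg_deg_def tensor_deg_def TU_def)
  show "B_alg_proj P U ` B_tilde_deg P n \<subseteq> B_alg_deg P U n"
  proof (rule image_subsetI)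
    fix b :: "('e, 'k) matalg" assume "b \<in> B_tilde_deg P n"
    then have "(b, 1) \<in> (\<Union>i. B_tilde_deg P i \<times> (field_deg (n - i) :: 'k set))" by (auto simp: field_deg_def intro!: exI[of _ n])
    then show "B_alg_proj P U b \<in> B_alg_deg P U n" unfolding eq B_alg_proj_eq by auto
  qed
  show "B_alg_deg P U n \<subseteq> B_alg_proj P U ` B_tilde_deg P n"
    unfolding eq
  proof (rule image_subsetI)
    fix x :: "('e, 'k) matalg \<times> 'k \<Rightarrow>\<^sub>0 int" assume "x \<in> {x. Poly_Mapping.keys x \<subseteq> (\<Union>i. B_tilde_deg P i \<times> field_deg (n - i))}"
    then have x: "Poly_Mapping.keys x \<subseteq> (\<Union>i. B_tilde_deg P i \<times> field_deg (n - i))" by simp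
    have "\<exists>b \<in> B_tilde_deg P n. TU +>\<^bsub>FB\<^esub> x = B_alg_proj P U b"
    proof (rule FB_reduce[OF x])
      fix b :: "('e, 'k) matalg" and c :: 'k assume "(b, c) \<in> (\<Union>i. B_tilde_deg P i \<times> field_deg (n - i))"
      then obtain i where i: "b \<in> B_tilde_deg P i" "c \<in> field_deg (n - i)" by blast
      have b: "b \<in> carrier BT" using BT_deg_carrier[OF i(1)] .
      have "\<exists>b' \<in> B_tilde_deg P n. TU +>\<^bsub>FB\<^esub> pair_gen b c = B_alg_proj P U b'"
      \<comment> \<open>Scalars sit in degree zero: for \<open>i \<noteq> n\<close> the scalar is
        zero and the class vanishes.\<close>
      proof (cases "i = n")
        case True
        then show ?thesis using TU_pair[OF b, of c] BT_deg_const i(1) unfolding B_alg_proj_eq by blast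
      next
        case False
        then have "c = 0" using i(2) by (auto simp: field_deg_def)
        then have "TU +>\<^bsub>FB\<^esub> pair_gen b c = TU"
          using FB.rcos_eq_self_iff[OF TU_facts(1) pair_in_FB[OF b]] TU_pair_zero[OF b] by simp
        also have "\<dots> = B_alg_proj P U \<zero>\<^bsub>BT\<^esub>" unfolding proj.hom_zero B_alg_eq by (simp add: Quot_zero)
        finally show ?thesis using BT_deg_zero by blast
      qed
      then show "b \<in> carrier BT \<and> (\<exists>b' \<in> B_tilde_deg P n. TU +>\<^bsub>FB\<^esub> pair_gen b c = B_alg_proj P U b')" using b by blast
    qed (auto intro: BT_deg_carrier BT_deg_zero BT_deg_diff)
    then show "TU +>\<^bsub>FB\<^esub> x \<in> B_alg_proj P U ` B_tilde_deg P n" by blast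
  qed
qed

text \<open>\<open>H\<close> recovers \<open>b\<close> from the pair of \<open>b\<close> and one,
  and it maps \<open>TU\<close> into \<open>J\<close>, which gives one inclusion. For the other, a
  linear form in \<open>U\<close> moved to the second factor acts by its constant term, which is
  zero.\<close>

lemma proj_kernel:
  assumes b: "b \<in> carrier BT"
  shows "B_alg_proj P U b = \<zero>\<^bsub>B_alg P U\<^esub> \<longleftrightarrow> b \<in> J"
proof
  assume "B_alg_proj P U b = \<zero>\<^bsub>B_alg P U\<^esub>"
  then have "pair_gen b 1 \<in> TU"
    using FB.rcos_eq_self_iff[OF TU_facts(1) pair_in_FB[OF b]] unfolding B_alg_proj_eq B_alg_eq Quot_zero by blast
  then have "H (pair_gen b 1) \<in> J" by (rule TU_H)
  then show "b \<in> J" using b by (simp add: H_pair bs_one)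
next
  assume "b \<in> J"
  moreover have "J \<subseteq> {b \<in> carrier BT. B_alg_proj P U b = \<zero>\<^bsub>B_alg P U\<^esub>}"
  proof (rule J_minimal)
    show "ideal {b \<in> carrier BT. B_alg_proj P U b = \<zero>\<^bsub>B_alg P U\<^esub>} BT"
      using proj.kernel_is_ideal unfolding a_kernel_def kernel_def by simp
    fix u assume u: "u \<in> U"
    have l: "bs (linear_form E u) \<in> carrier BT" using bs_closed[OF linear_form_sym] .
    have o: "\<one>\<^bsub>BT\<^esub> \<in> carrier BT" by simp
    have "pair_gen (bs (linear_form E u)) 1 - pair_gen \<one>\<^bsub>BT\<^esub> 0 \<in> TU"
      using TU_rels(3)[OF o SU_linear[OF u], of 1] l by (simp add: const_term_linear_form)
    from FB.ideal_add[OF TU_facts(1) this TU_pair_zero[OF o]]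
    have "pair_gen (bs (linear_form E u)) 1 \<in> TU" by simp
    then have "TU +>\<^bsub>FB\<^esub> pair_gen (bs (linear_form E u)) 1 = TU"
      using FB.rcos_eq_self_iff[OF TU_facts(1) pair_in_FB[OF l]] by blast
    then have "B_alg_proj P U (bs (linear_form E u)) = \<zero>\<^bsub>B_alg P U\<^esub>" unfolding B_alg_proj_eq B_alg_eq Quot_zero .
    then show "bs (linear_form E u) \<in> {b \<in> carrier BT. B_alg_proj P U b = \<zero>\<^bsub>B_alg P U\<^esub>}" using l by blast
  qed
  ultimately show "B_alg_proj P U b = \<zero>\<^bsub>B_alg P U\<^esub>" by blast
qed

end

section \<open>The isomorphisms\<close>

lemma A_tilde_deg_eq: "A_tilde_deg D n = cls ` FP_deg n"
proof -
  have "path_poly_deg D n = (\<lambda>x. T +>\<^bsub>FP\<^esub> x) ` FP_deg n"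
    by (simp add: path_poly_deg_def tensor_deg_def feasible_topes_dual T_def FP_deg_def)
  then show ?thesis by (simp add: A_tilde_deg_def quot_deg_def image_image cls_def[abs_def])
qed

lemma A_tilde_sym_eq: "A_tilde_sym D p = cls (jmap p)"
  by (simp add: A_tilde_sym_def path_tensor_eq cls_def jmap_def feasible_topes_dual)

lemma A_tilde_path_eq: "A_tilde_path D \<pi> = cls (gp \<pi> 1)"
  by (simp add: A_tilde_path_def path_elt_def path_tensor_eq cls_def)

lemma Phi_path:
  assumes "\<pi> \<in> paths B" "wt \<pi> = 1"
  shows "Phi (gp \<pi> 1) = B_tilde_unit P (hd \<pi>) (last \<pi>)"
  unfolding Phi_def B_tilde_unit_def
  by (rule B_family_cong) (use assms in \<open>auto simp: Psi_pair L_single R_tilde_simps rc_zero\<close>)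

theorem A_tilde_B_tilde_isomorphisms:
  "\<exists>\<phi>. graded_ring_iso At (A_tilde_deg D) BT (B_tilde_deg P) \<phi> \<and>
    (\<forall>p \<in> carrier Sym. \<phi> (A_tilde_sym D p) = bs p) \<and>
    (\<forall>\<alpha> \<in> Pp. \<phi> (A_tilde_path D [\<alpha>]) = B_tilde_unit P \<alpha> \<alpha>) \<and>
    (\<forall>\<alpha> \<in> Pp. \<forall>\<beta> \<in> Pp. adjacent \<alpha> \<beta> \<longrightarrow> \<phi> (A_tilde_path D [\<alpha>, \<beta>]) = B_tilde_unit P \<alpha> \<beta>) \<and>
    (\<exists>\<psi>. graded_ring_iso (A_alg D U) (A_alg_deg D U) (B_alg P U) (B_alg_deg P U) \<psi> \<and>
       (\<forall>a \<in> carrier At. \<psi> (A_alg_proj D U a) = B_alg_proj P U (\<phi> a)))"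
proof -
  obtain \<phi> where \<phi>: "\<phi> \<in> ring_iso At BT" "\<And>x. x \<in> carrier FP \<Longrightarrow> \<phi> (cls x) = Phi x"
    using A_tilde_iso by blast
  interpret cls: ring_hom_ring FP At cls by (rule cls_hom)
  have deg: "\<phi> ` A_tilde_deg D n = B_tilde_deg P n" for n
  proof -
    have "\<phi> ` A_tilde_deg D n = (\<lambda>x. \<phi> (cls x)) ` FP_deg n" by (simp add: A_tilde_deg_eq image_image)
    also have "\<dots> = Phi ` FP_deg n" using \<phi>(2) FP_deg_carrier by (intro image_cong) auto
    finally show ?thesis by (simp add: Phi_deg)
  qed
  have sym: "\<phi> (A_tilde_sym D p) = bs p" if "p \<in> carrier Sym" for p
    using \<phi>(2)[OF jmap_FP[OF that]] by (simp add: A_tilde_sym_eq Phi_jmap)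
  have path: "\<phi> (A_tilde_path D \<pi>) = B_tilde_unit P (hd \<pi>) (last \<pi>)" if "\<pi> \<in> paths B" "wt \<pi> = 1" for \<pi>
    using \<phi>(2)[OF gp_in_FP[OF that(1) sym_one]] Phi_path[OF that] by (simp add: A_tilde_path_eq)
  have hom: "ring_hom_ring At BT \<phi>"
    using \<phi>(1) by (intro ring_hom_ringI2[OF cls.S.ring_axioms BT_ring]) (simp add: ring_iso_def)
  interpret ph: ring_hom_ring At BT \<phi> by (rule hom)
  define X where "X = (\<lambda>u. A_tilde_sym D (linear_form E u)) ` U"
  define AAI where "AAI = (A_alg_ideal D U :: ('e, 'k) pathpoly set set)"
  have AAI_eq: "AAI = Idl\<^bsub>At\<^esub> X" by (simp add: AAI_def A_alg_ideal_def X_def)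
  have XA: "X \<subseteq> carrier At" unfolding X_def A_tilde_sym_eq using cls.hom_closed[OF jmap_FP[OF linear_form_sym]] by blast
  have AAI: "ideal AAI At" "X \<subseteq> AAI" unfolding AAI_eq
    by (rule cls.S.genideal_ideal[OF XA], rule cls.S.genideal_self[OF XA])
  have phiX: "\<phi> (A_tilde_sym D (linear_form E u)) = bs (linear_form E u)" for u by (rule sym[OF linear_form_sym])
  define h where "h a = A_alg_proj D U a" for a
  have h_eq: "h = (+>\<^bsub>At\<^esub>) AAI" unfolding h_def A_alg_proj_def AAI_def ..
  have AU_eq: "A_alg D U = At Quot AAI" unfolding A_alg_def AAI_def ..
  have h_hom: "ring_hom_ring At (A_alg D U) h"
    unfolding AU_eq h_eq using ideal.rcos_ring_hom_ring[OF AAI(1)] .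
  have h_surj: "carrier (A_alg D U) = h ` carrier At"
    unfolding AU_eq h_eq by (rule Quot_carrier)
  interpret pr: ring_hom_ring BT "B_alg P U" "B_alg_proj P U" by (rule proj_hom)
  \<comment> \<open>The second isomorphism compares two surjections from \<open>A_tilde\<close>: the
    projection \<open>h\<close> to \<open>A_alg\<close>, and \<phi> followed by the projection to
    \<open>B_alg\<close>.\<close>
  define h' where "h' = B_alg_proj P U \<circ> \<phi>"
  have h'_hom: "ring_hom_ring At (B_alg P U) h'"
    unfolding h'_def by (rule ring_hom_ringI2[OF cls.S.ring_axioms pr.S.ring_axioms ring_hom_trans[OF ph.homh pr.homh]])
  have phi_surj: "\<phi> ` carrier At = carrier BT" using \<phi>(1) by (auto simp: ring_iso_def bij_betw_def)
  have h'_surj: "carrier (B_alg P U) = h' ` carrier At"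
    unfolding h'_def proj_surj image_comp[symmetric] phi_surj ..
  \<comment> \<open>\<phi> carries the generators of \<open>AAI\<close> to those of
    \<open>J U\<close>. One direction follows from the minimality of \<open>AAI\<close>, the other
    from that of \<open>J U\<close>, applied through the inverse isomorphism.\<close>
  have phiAAI: "a \<in> AAI \<longleftrightarrow> \<phi> a \<in> J U" if a: "a \<in> carrier At" for a
  proof
    have "AAI \<subseteq> {a \<in> carrier At. \<phi> a \<in> J U}" unfolding AAI_eq
      by (rule cls.S.genideal_minimal[OF ph.ideal_vimage[OF J_ideal]])
        (use XA J_gen phiX in \<open>auto simp: X_def\<close>)
    then show "a \<in> AAI \<Longrightarrow> \<phi> a \<in> J U" by blast
    define \<phi>' where "\<phi>' = inv_into (carrier At) \<phi>"
    have inj: "inj_on \<phi> (carrier At)" using \<phi>(1) by (auto simp: ring_iso_def bij_betw_def)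
    have "\<phi>' \<in> ring_iso BT At" unfolding \<phi>'_def by (rule ring_iso_set_sym[OF cls.S.ring_axioms \<phi>(1)])
    then interpret ip: ring_hom_ring BT At \<phi>'
      by (intro ring_hom_ringI2[OF BT_ring cls.S.ring_axioms]) (simp add: ring_iso_def)
    have ii: "\<phi>' (\<phi> a) = a" if "a \<in> carrier At" for a unfolding \<phi>'_def using inv_into_f_f[OF inj that] .
    have "J U \<subseteq> {b \<in> carrier BT. \<phi>' b \<in> AAI}"
    proof (rule J_minimal[OF ip.ideal_vimage[OF AAI(1)]])
      fix u assume u: "u \<in> U"
      have x: "A_tilde_sym D (linear_form E u) \<in> X" using u by (simp add: X_def)
      then have "\<phi>' (bs (linear_form E u)) = A_tilde_sym D (linear_form E u)" using ii XA phiX by (metis subsetD)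
      then show "bs (linear_form E u) \<in> {b \<in> carrier BT. \<phi>' b \<in> AAI}"
        using x AAI(2) bs_closed[OF linear_form_sym] by auto
    qed
    then show "\<phi> a \<in> J U \<Longrightarrow> a \<in> AAI" using ii[OF a] by auto
  qed
  have ker: "h a = \<zero>\<^bsub>A_alg D U\<^esub> \<longleftrightarrow> h' a = \<zero>\<^bsub>B_alg P U\<^esub>" if a: "a \<in> carrier At" for a
  proof -
    interpret AAI: ideal AAI At by (rule AAI(1))
    have "h a = \<zero>\<^bsub>A_alg D U\<^esub> \<longleftrightarrow> a \<in> AAI"
      unfolding h_eq AU_eq Quot_zero using AAI.a_rcos_const[of a] AAI.a_rcos_self[OF a] by metis
    moreover have "h' a = \<zero>\<^bsub>B_alg P U\<^esub> \<longleftrightarrow> \<phi> a \<in> J U"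
      unfolding h'_def o_apply using proj_kernel[OF ph.hom_closed[OF a]] .
    ultimately show ?thesis using phiAAI[OF a] by blast
  qed
  obtain \<psi> where \<psi>: "\<psi> \<in> ring_iso (A_alg D U) (B_alg P U)" "\<And>a. a \<in> carrier At \<Longrightarrow> \<psi> (h a) = h' a"
    using iso_of_kernels[OF h_hom h'_hom h_surj h'_surj ker] by blast
  have deg2: "\<psi> ` A_alg_deg D U n = B_alg_deg P U n" for n
  proof -
    have sub: "A_tilde_deg D n \<subseteq> carrier At" unfolding A_tilde_deg_eq using FP_deg_carrier cls.hom_closed by blast
    have "A_alg_deg D U n = h ` A_tilde_deg D n" by (simp add: A_alg_deg_def quot_deg_def h_def[abs_def] A_alg_proj_def)
    then have "\<psi> ` A_alg_deg D U n = (\<lambda>a. \<psi> (h a)) ` A_tilde_deg D n" by (simp add: image_image)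
    also have "\<dots> = h' ` A_tilde_deg D n" using \<psi>(2) sub by (intro image_cong) auto
    also have "\<dots> = B_alg_proj P U ` (\<phi> ` A_tilde_deg D n)" by (simp add: h'_def image_comp)
    finally show ?thesis by (simp add: deg proj_deg)
  qed
  \<comment> \<open>Paths with at most one step have weight one, so \<open>Phi\<close> sends them to
    the units of the summands.\<close>
  have p1: "[\<alpha>] \<in> paths B" "wt [\<alpha>] = 1" if "\<alpha> \<in> Pp" for \<alpha> using that path1 by (auto simp: Pp_iff)
  have p2: "[\<alpha>, \<beta>] \<in> paths B" "wt [\<alpha>, \<beta>] = 1" if "\<alpha> \<in> Pp" "\<beta> \<in> Pp" "adjacent \<alpha> \<beta>" for \<alpha> \<beta>
    using that path2 by (auto simp: Pp_iff)
  show ?thesis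
  proof (rule exI[of _ \<phi>], intro conjI ballI impI exI[of _ \<psi>])
    show "graded_ring_iso At (A_tilde_deg D) BT (B_tilde_deg P) \<phi>" using \<phi>(1) deg by (simp add: graded_ring_iso_def)
    show "\<phi> (A_tilde_sym D p) = bs p" if "p \<in> carrier Sym" for p using sym that .
    show "\<phi> (A_tilde_path D [\<alpha>]) = B_tilde_unit P \<alpha> \<alpha>" if "\<alpha> \<in> Pp" for \<alpha> using path[OF p1[OF that]] by simp
    show "\<phi> (A_tilde_path D [\<alpha>, \<beta>]) = B_tilde_unit P \<alpha> \<beta>" if "\<alpha> \<in> Pp" "\<beta> \<in> Pp" "adjacent \<alpha> \<beta>" for \<alpha> \<beta>
      using path[OF p2[OF that]] by simp
    show "graded_ring_iso (A_alg D U) (A_alg_deg D U) (B_alg P U) (B_alg_deg P U) \<psi>" using \<psi>(1) deg2 by (simp add: graded_ring_iso_def)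
    show "\<psi> (A_alg_proj D U a) = B_alg_proj P U (\<phi> a)" if "a \<in> carrier At" for a
      using \<psi>(2)[OF that] by (simp add: h_def h'_def)
  qed
qed

end

theorem theorem5p12:
  fixes P :: "'e program" and U :: "('e \<Rightarrow> 'k::field) set"
  assumes "program P" and "generic P" and "parameter_space (M_of P) U"
  shows "\<exists>\<phi> :: ('e, 'k) pathpoly set \<Rightarrow> ('e, 'k) matalg.
    graded_ring_iso
      (A_tilde (dual_program P)) (A_tilde_deg (dual_program P)) (B_tilde P) (B_tilde_deg P) \<phi> \<and>
    (\<forall>p \<in> carrier (sym_ring (elts P)).
       \<phi> (A_tilde_sym (dual_program P) p) = B_tilde_sym P p) \<and>
    (\<forall>\<alpha> \<in> bounded_feasible P.
       \<phi> (A_tilde_path (dual_program P) [\<alpha>]) = B_tilde_unit P \<alpha> \<alpha>) \<and>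
    (\<forall>\<alpha> \<in> bounded_feasible P. \<forall>\<beta> \<in> bounded_feasible P. adjacent \<alpha> \<beta> \<longrightarrow>
       \<phi> (A_tilde_path (dual_program P) [\<alpha>, \<beta>]) = B_tilde_unit P \<alpha> \<beta>) \<and>
    (\<exists>\<psi>. graded_ring_iso
           (A_alg (dual_program P) U) (A_alg_deg (dual_program P) U) (B_alg P U) (B_alg_deg P U) \<psi> \<and>
         (\<forall>a \<in> carrier (A_tilde (dual_program P)).
            \<psi> (A_alg_proj (dual_program P) U a) = B_alg_proj P U (\<phi> a)))"
proof -
  interpret program_algebra P "TYPE('k)" by unfold_locales (rule assms)+
  show ?thesis by (rule A_tilde_B_tilde_isomorphisms)
qed

end
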